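(* Let $N\ge 3$, $0<\gamma_2<\gamma_1<2$, $s\ge 1$ and $\psi_0\in H^s(\mathbb{R}^N)$. Let $\psi$ be the $H^s(\mathbb{R}^N)$-solution of the Cauchy problem $$\mathrm{i}\,\psi_t=\Delta\psi+\left(|x|^{-\gamma_1}\ast|\psi|^2\right)\psi-\left(|x|^{-\gamma_2}\ast|\psi|^2\right)\psi,\qquad \psi(\cdot,0)=\psi_0,$$ and let $T^*$ be its maximal existence time. Then $T^*=\infty$. In addition, $\|\psi(t)\|_{H^1}\le C_0$ for any $t\ge 0$, where $C_0>0$ depends on $E(\psi_0)$ and $\|\psi_0\|_2$.
   Context: Functions are complex-valued. The energy is $E(u):=\frac12\int_{\mathbb{R}^N}|\nabla u|^2\,dx+\frac14\int_{\mathbb{R}^N}\int_{\mathbb{R}^N}\frac{|u(x)|^2|u(y)|^2}{|x-y|^{\gamma_2}}\,dx\,dy-\frac14\int_{\mathbb{R}^N}\int_{\mathbb{R}^N}\frac{|u(x)|^2|u(y)|^2}{|x-y|^{\gamma_1}}\,dx\,dy$. Solutions are understood in the integral (Duhamel) sense $\psi(t)=U(t)\psi_0-\mathrm{i}\int_0^tU(t-t')F(\psi(t'))\,dt'$, where $U(t)=e^{-\mathrm{i}\Delta t}$ and $F(u)=(|x|^{-\gamma_1}\ast|u|^2)u-(|x|^{-\gamma_2}\ast|u|^2)u$. For $s\ge\max\{1,\gamma_1/2\}$ and $\psi_0\in H^s(\mathbb{R}^N)$ there is a unique local solution in $C([0,T],H^s(\mathbb{R}^N))$ for some $T>0$, conserving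 the $L^2$-norm and $E$; $T^*$ is the supremum of the times up to which this solution extends in $C([0,T],H^s(\mathbb{R}^N))$. *)

theory Defs
  imports "HOL-Analysis.Analysis"
begin

section \<open>The Hilbert space of square-integrable functions\<close>

definition square_integrable :: "('a::euclidean_space \<Rightarrow> complex) \<Rightarrow> bool" where
  "square_integrable f \<longleftrightarrow>
     f \<in> borel_measurable lborel \<and> integrable lborel (\<lambda>x. (cmod (f x))\<^sup>2)"

definition L2_rel :: "('a::euclidean_space \<Rightarrow> complex) \<Rightarrow> ('a \<Rightarrow> complex) \<Rightarrow> bool" where
  "L2_rel f g \<longleftrightarrow> square_integrable f \<and> square_integrable g \<and> (AE x in lborel. f x = g x)"

lemma square_integrable_zero [simp]: "square_integrable (\<lambda>x. 0)"
  by (simp add: square_integrable_def)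

lemma square_integrable_cmult:
  assumes "square_integrable f"
  shows "square_integrable (\<lambda>x. c * f x)"
  using assms by (auto simp: square_integrable_def norm_mult power_mult_distrib)

lemma square_integrable_scaleR:
  assumes "square_integrable f"
  shows "square_integrable (\<lambda>x. r *\<^sub>R f x)"
  using square_integrable_cmult[OF assms, of "of_real r"] by (simp add: scaleR_conv_of_real)

lemma square_integrable_add:
  assumes "square_integrable f" "square_integrable g"
  shows "square_integrable (\<lambda>x. f x + g x)"
proof -
  have [measurable]: "f \<in> borel_measurable lborel" "g \<in> borel_measurable lborel"
    and "integrable lborel (\<lambda>x. (cmod (f x))\<^sup>2)" "integrable lborel (\<lambda>x. (cmod (g x))\<^sup>2)"
    using assms by (auto simp: square_integrable_def)
  then have i: "integrable lborel (\<lambda>x. 2 * (cmod (f x))\<^sup>2 + 2 * (cmod (g x))\<^sup>2)"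
    by simp
  have b: "(cmod (a + b))\<^sup>2 \<le> 2 * (cmod a)\<^sup>2 + 2 * (cmod b)\<^sup>2" for a b
  proof -
    have "(cmod (a + b))\<^sup>2 \<le> (cmod a + cmod b)\<^sup>2"
      by (intro power_mono norm_triangle_ineq) simp
    also have "\<dots> \<le> 2 * (cmod a)\<^sup>2 + 2 * (cmod b)\<^sup>2"
      using sum_squares_bound[of "cmod a" "cmod b"] by (simp add: power2_sum)
    finally show ?thesis .
  qed
  have "integrable lborel (\<lambda>x. (cmod (f x + g x))\<^sup>2)"
    by (rule Bochner_Integration.integrable_bound[OF i]) (use b in \<open>auto intro!: AE_I2 simp: abs_of_nonneg\<close>)
  then show ?thesis by (simp add: square_integrable_def)
qed

lemma square_integrable_uminus:
  assumes "square_integrable f"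
  shows "square_integrable (\<lambda>x. - f x)"
  using square_integrable_cmult[OF assms, of "-1"] by simp

lemma square_integrable_diff:
  assumes "square_integrable f" "square_integrable g"
  shows "square_integrable (\<lambda>x. f x - g x)"
  using square_integrable_add[OF assms(1) square_integrable_uminus[OF assms(2)]] by simp

lemma square_integrable_inner:
  assumes "square_integrable f" "square_integrable g"
  shows "integrable lborel (\<lambda>x. f x \<bullet> g x)"
proof -
  have [measurable]: "f \<in> borel_measurable lborel" "g \<in> borel_measurable lborel"
    and "integrable lborel (\<lambda>x. (cmod (f x))\<^sup>2)" "integrable lborel (\<lambda>x. (cmod (g x))\<^sup>2)"
    using assms by (auto simp: square_integrable_def)
  then have i: "integrable lborel (\<lambda>x. (cmod (f x))\<^sup>2 + (cmod (g x))\<^sup>2)"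
    by simp
  have b: "\<bar>a \<bullet> b\<bar> \<le> (cmod a)\<^sup>2 + (cmod b)\<^sup>2" for a b
  proof -
    have "\<bar>a \<bullet> b\<bar> \<le> cmod a * cmod b"
      by (rule Cauchy_Schwarz_ineq2)
    also have "\<dots> \<le> 2 * cmod a * cmod b"
      by simp
    also have "\<dots> \<le> (cmod a)\<^sup>2 + (cmod b)\<^sup>2"
      by (rule sum_squares_bound)
    finally show ?thesis .
  qed
  show ?thesis
    by (rule Bochner_Integration.integrable_bound[OF i]) (use b in \<open>auto intro!: AE_I2\<close>)
qed

quotient_type (overloaded) 'a L2 = "'a::euclidean_space \<Rightarrow> complex" / partial: L2_rel
proof (rule part_equivpI)
  show "\<exists>f. L2_rel f f"
    by (rule exI[of _ "\<lambda>x. 0"]) (simp add: L2_rel_def)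
  show "symp L2_rel"
    by (auto simp: symp_def L2_rel_def)
  show "transp L2_rel"
    by (auto simp: transp_def L2_rel_def)
qed

instantiation L2 :: (euclidean_space) real_vector
begin

lift_definition zero_L2 :: "'a L2" is "\<lambda>x. 0"
  by (simp add: L2_rel_def)

lift_definition plus_L2 :: "'a L2 \<Rightarrow> 'a L2 \<Rightarrow> 'a L2" is "\<lambda>f g x. f x + g x"
  by (auto simp: L2_rel_def square_integrable_add)

lift_definition scaleR_L2 :: "real \<Rightarrow> 'a L2 \<Rightarrow> 'a L2" is "\<lambda>r f x. r *\<^sub>R f x"
  by (auto simp: L2_rel_def square_integrable_scaleR)

lift_definition uminus_L2 :: "'a L2 \<Rightarrow> 'a L2" is "\<lambda>f x. - f x"
  by (auto simp: L2_rel_def square_integrable_uminus)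

lift_definition minus_L2 :: "'a L2 \<Rightarrow> 'a L2 \<Rightarrow> 'a L2" is "\<lambda>f g x. f x - g x"
  by (auto simp: L2_rel_def square_integrable_diff)

instance
proof
  fix u v w :: "'a L2" and r q :: real
  show "u + v + w = u + (v + w)"
    by transfer (auto simp: L2_rel_def add.assoc intro!: square_integrable_add)
  show "u + v = v + u"
    by transfer (auto simp: L2_rel_def add.commute intro!: square_integrable_add)
  show "0 + u = u"
    by transfer (auto simp: L2_rel_def)
  show "- u + u = 0"
    by transfer (auto simp: L2_rel_def)
  show "u - v = u + - v"
    by transfer (auto simp: L2_rel_def intro!: square_integrable_diff)
  show "r *\<^sub>R (u + v) = r *\<^sub>R u + r *\<^sub>R v"
    by transfer
      (auto simp: L2_rel_def scaleR_add_right intro!: square_integrable_add square_integrable_scaleR)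
  show "(r + q) *\<^sub>R u = r *\<^sub>R u + q *\<^sub>R u"
    by transfer
      (auto simp: L2_rel_def scaleR_add_left intro!: square_integrable_add square_integrable_scaleR)
  show "r *\<^sub>R q *\<^sub>R u = (r * q) *\<^sub>R u"
    by transfer (auto simp: L2_rel_def intro!: square_integrable_scaleR)
  show "1 *\<^sub>R u = u"
    by transfer (auto simp: L2_rel_def)
qed

end

instantiation L2 :: (euclidean_space) real_inner
begin

lift_definition inner_L2 :: "'a L2 \<Rightarrow> 'a L2 \<Rightarrow> real" is "\<lambda>f g. LINT x|lborel. f x \<bullet> g x"
  by (intro integral_cong_AE) (auto simp: L2_rel_def square_integrable_def)

definition norm_L2 :: "'a L2 \<Rightarrow> real" where
  "norm_L2 u = sqrt (u \<bullet> u)"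

definition sgn_L2 :: "'a L2 \<Rightarrow> 'a L2" where
  "sgn_L2 u = u /\<^sub>R norm u"

definition dist_L2 :: "'a L2 \<Rightarrow> 'a L2 \<Rightarrow> real" where
  "dist_L2 u v = norm (u - v)"

definition uniformity_L2 :: "('a L2 \<times> 'a L2) filter" where
  "uniformity_L2 = (INF e\<in>{0 <..}. principal {(u, v). dist u v < e})"

definition open_L2 :: "'a L2 set \<Rightarrow> bool" where
  "open_L2 S \<longleftrightarrow> (\<forall>u\<in>S. \<forall>\<^sub>F (u', v) in uniformity. u' = u \<longrightarrow> v \<in> S)"

instance
proof
  fix u v w :: "'a L2" and r :: real
  show "u \<bullet> v = v \<bullet> u"
    by transfer (simp add: inner_commute)
  show "(u + v) \<bullet> w = u \<bullet> w + v \<bullet> w"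
    by transfer (auto simp: L2_rel_def inner_add_left square_integrable_inner)
  show "r *\<^sub>R u \<bullet> v = r * (u \<bullet> v)"
    by transfer simp
  show "0 \<le> u \<bullet> u"
    by transfer simp
  show "u \<bullet> u = 0 \<longleftrightarrow> u = 0"
  proof transfer
    fix f :: "'a \<Rightarrow> complex"
    assume f: "L2_rel f f"
    then have "integrable lborel (\<lambda>x. f x \<bullet> f x)"
      by (auto simp: L2_rel_def square_integrable_inner)
    then have "(LINT x|lborel. f x \<bullet> f x) = 0 \<longleftrightarrow> (AE x in lborel. f x \<bullet> f x = 0)"
      by (intro integral_nonneg_eq_0_iff_AE) auto
    then show "(LINT x|lborel. f x \<bullet> f x) = 0 \<longleftrightarrow> L2_rel f (\<lambda>x. 0)"
      using f by (simp add: L2_rel_def)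
  qed
qed (rule norm_L2_def sgn_L2_def dist_L2_def uniformity_L2_def open_L2_def)+

end

lift_definition cscale_L2 :: "complex \<Rightarrow> 'a::euclidean_space L2 \<Rightarrow> 'a L2" is "\<lambda>c f x. c * f x"
  by (auto simp: L2_rel_def square_integrable_cmult)


section \<open>Fourier transform, Sobolev spaces and the free propagator\<close>

definition fourier_integral :: "('a::euclidean_space \<Rightarrow> complex) \<Rightarrow> 'a \<Rightarrow> complex" where
  "fourier_integral f \<xi> =
     of_real ((2 * pi) powr (- real DIM('a) / 2)) * (LINT x|lborel. cis (- (x \<bullet> \<xi>)) * f x)"

text \<open>The Plancherel extension to square-integrable functions: the limit in mean of the Fourier
  integrals over balls. The truncations are integrable since the balls have finite measure.\<close>

definition fourier :: "'a::euclidean_space L2 \<Rightarrow> 'a L2" where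
  "fourier u = Lim at_top
     (\<lambda>R::real. abs_L2 (fourier_integral (\<lambda>x. indicator (cball 0 R) x * rep_L2 u x)))"

definition sobolev :: "real \<Rightarrow> 'a::euclidean_space L2 set" where
  "sobolev s = {u. integrable lborel (\<lambda>\<xi>. (1 + (norm \<xi>)\<^sup>2) powr s * (cmod (rep_L2 (fourier u) \<xi>))\<^sup>2)}"

definition sobolev_norm :: "real \<Rightarrow> 'a::euclidean_space L2 \<Rightarrow> real" where
  "sobolev_norm s u =
     sqrt (LINT \<xi>|lborel. (1 + (norm \<xi>)\<^sup>2) powr s * (cmod (rep_L2 (fourier u) \<xi>))\<^sup>2)"

text \<open>The group generated by \<open>- \<i> \<Delta>\<close>; the Laplacian has Fourier symbol \<open>- \<bar>\<xi>\<bar>\<^sup>2\<close>.\<close>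

definition propagator :: "real \<Rightarrow> 'a::euclidean_space L2 \<Rightarrow> 'a L2" where
  "propagator t u =
     (THE w. fourier w = abs_L2 (\<lambda>\<xi>. cis (t * (norm \<xi>)\<^sup>2) * rep_L2 (fourier u) \<xi>))"


section \<open>Weak derivatives\<close>

primrec Ck :: "nat \<Rightarrow> ('a::euclidean_space \<Rightarrow> real) \<Rightarrow> bool" where
  "Ck 0 \<phi> \<longleftrightarrow> continuous_on UNIV \<phi>"
| "Ck (Suc k) \<phi> \<longleftrightarrow>
     (\<forall>x. \<phi> differentiable (at x)) \<and>
     (\<forall>b\<in>Basis. Ck k (\<lambda>x. frechet_derivative \<phi> (at x) b))"

definition test_function :: "('a::euclidean_space \<Rightarrow> real) \<Rightarrow> bool" where
  "test_function \<phi> \<longleftrightarrow> (\<forall>k. Ck k \<phi>) \<and> compact (closure {x. \<phi> x \<noteq> 0})"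

text \<open>Specified only if the weak derivative exists and is square-integrable, as it does on
  \<open>sobolev 1\<close>.\<close>

definition weak_deriv :: "'a::euclidean_space \<Rightarrow> 'a L2 \<Rightarrow> 'a L2" where
  "weak_deriv b u = (THE v. \<forall>\<phi>. test_function \<phi> \<longrightarrow>
     (LINT x|lborel. frechet_derivative \<phi> (at x) b *\<^sub>R rep_L2 u x) =
     - (LINT x|lborel. \<phi> x *\<^sub>R rep_L2 v x))"


section \<open>The Hartree equation\<close>

definition hartree_potential :: "real \<Rightarrow> 'a::euclidean_space L2 \<Rightarrow> 'a \<Rightarrow> real" where
  "hartree_potential \<gamma> u x = (LINT y|lborel. norm (x - y) powr (- \<gamma>) * (cmod (rep_L2 u y))\<^sup>2)"

definition nonlinearity :: "real \<Rightarrow> real \<Rightarrow> 'a::euclidean_space L2 \<Rightarrow> 'a L2" where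
  "nonlinearity \<gamma>1 \<gamma>2 u = abs_L2 (\<lambda>x.
     of_real (hartree_potential \<gamma>1 u x) * rep_L2 u x
     - of_real (hartree_potential \<gamma>2 u x) * rep_L2 u x)"

definition energy :: "real \<Rightarrow> real \<Rightarrow> 'a::euclidean_space L2 \<Rightarrow> real" where
  "energy \<gamma>1 \<gamma>2 u =
     1/2 * (LINT x|lborel. (\<Sum>b\<in>Basis. (cmod (rep_L2 (weak_deriv b u) x))\<^sup>2))
     + 1/4 * (LINT x|lborel. LINT y|lborel.
         (cmod (rep_L2 u x))\<^sup>2 * (cmod (rep_L2 u y))\<^sup>2 / norm (x - y) powr \<gamma>2)
     - 1/4 * (LINT x|lborel. LINT y|lborel.
         (cmod (rep_L2 u x))\<^sup>2 * (cmod (rep_L2 u y))\<^sup>2 / norm (x - y) powr \<gamma>1)"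

text \<open>Solutions on a time interval \<open>J\<close> with left end point \<open>0\<close>: curves in \<open>C(J, H\<^sup>s)\<close> satisfying
  Duhamel's formula.\<close>

definition solution_on ::
    "real \<Rightarrow> real \<Rightarrow> real \<Rightarrow> 'a::euclidean_space L2 \<Rightarrow> real set \<Rightarrow> (real \<Rightarrow> 'a L2) \<Rightarrow> bool" where
  "solution_on s \<gamma>1 \<gamma>2 \<psi>0 J \<psi> \<longleftrightarrow>
     (\<forall>t\<in>J. \<psi> t \<in> sobolev s) \<and>
     (\<forall>t\<in>J. ((\<lambda>t'. sobolev_norm s (\<psi> t' - \<psi> t)) \<longlongrightarrow> 0) (at t within J)) \<and>
     (\<forall>t\<in>J. (\<lambda>t'. propagator (t - t') (nonlinearity \<gamma>1 \<gamma>2 (\<psi> t'))) integrable_on {0..t} \<and>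
        \<psi> t = propagator t \<psi>0
          - cscale_L2 \<i> (integral {0..t} (\<lambda>t'. propagator (t - t') (nonlinearity \<gamma>1 \<gamma>2 (\<psi> t')))))"

text \<open>As solutions are unique, this is the supremum of the times up to which the solution with
  initial value \<open>\<psi>0\<close> extends.\<close>

definition max_existence_time ::
    "real \<Rightarrow> real \<Rightarrow> real \<Rightarrow> 'a::euclidean_space L2 \<Rightarrow> ereal" where
  "max_existence_time s \<gamma>1 \<gamma>2 \<psi>0 = Sup {ereal T |T. 0 < T \<and> (\<exists>\<psi>. solution_on s \<gamma>1 \<gamma>2 \<psi>0 {0..T} \<psi>)}"

definition maximal_solution ::
    "real \<Rightarrow> real \<Rightarrow> real \<Rightarrow> 'a::euclidean_space L2 \<Rightarrow> (real \<Rightarrow> 'a L2) \<Rightarrow> bool" where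
  "maximal_solution s \<gamma>1 \<gamma>2 \<psi>0 \<psi> \<longleftrightarrow>
     solution_on s \<gamma>1 \<gamma>2 \<psi>0 {t. 0 \<le> t \<and> ereal t < max_existence_time s \<gamma>1 \<gamma>2 \<psi>0} \<psi>"

end

(* The Bessel potential J_s maps L^2 isometrically onto H^s, so the equation is read as an ordinary
   differential equation in L^2 for U(-t) J_s^{-1} psi(t).

   Hardy's inequality bounds |x|^{-gamma} * |u|^2 uniformly by
   4 rho^{2-gamma} ||grad u||^2 + rho^{-gamma} ||u||^2 for every rho > 0. With rho small in terms of the
   mass, the focusing part of the energy is absorbed by the kinetic part, and conservation of mass and
   energy bounds the H^1 norm of every solution.

   The kernel |x|^{-gamma} is a superposition of Gaussians and so has a positive Fourier transform. Hence
   the quartic form is dominated by a positive form in the moduli of the Fourier transforms, in which the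
   Sobolev weight can be distributed over the factors. This makes the nonlinearity locally Lipschitz in
   H^s with growth C_s ||u||_{H^1}^2 ||u||_{H^s}, so by Gronwall's argument the H^s norm cannot blow up
   while the H^1 norm is bounded. Global solutions are obtained by truncating the nonlinearity at
   a radius that this bound prevents the solution from reaching. *)
theory Submission
  imports Defs "HOL-Probability.Characteristic_Functions"
begin

section \<open>Square-integrable functions\<close>

text \<open>For psi = J_s f, \<open>norm f\<close> is the H^s norm of psi and
  \<open>norm (bessel (s - 1) f)\<close> its H^1 norm, so that only bounded operators on L^2 occur.
  Passing to U(-t) f removes the unbounded generator and makes a contraction argument possible, but
  f itself need not be differentiable in time. This is the obstacle for the energy in H^1: formally
  one pairs the variation of E with psi_t, which lies only in H^{-1}. The kinetic form is invariant
  under U(t) and is therefore differentiated along U(-t) f, while the increment of a quartic form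
  between two times is written exactly as a pairing with J_2 (f(t') - f(t)), whose quotients do
  converge. For noninteger s the weight (1 + |xi|^2)^{s/2} is not a differential operator to which a
  product rule applies; in frequency space the triangle inequality takes the place of that rule. To
  estimate the positive form, each transform is replaced by its modulus. This preserves all Sobolev
  norms and leads back to physical space, where Hardy's inequality applies.\<close>

lemma square_integrable_rep [simp]: "square_integrable (rep_L2 u)"
  using Quotient3_rel_rep[OF Quotient3_L2, of u u] by (auto simp: L2_rel_def)

lemma borel_measurable_rep_L2 [measurable]: "rep_L2 u \<in> borel_measurable borel"
  using square_integrable_rep[of u] by (simp add: square_integrable_def)

lemma abs_rep_L2 [simp]: "abs_L2 (rep_L2 u) = u"
  by (rule Quotient3_abs_rep[OF Quotient3_L2])

lemma L2_rel_refl: "L2_rel f f \<longleftrightarrow> square_integrable f"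
  by (auto simp: L2_rel_def)

lemma abs_L2_eq_iff:
  assumes "square_integrable f" "square_integrable g"
  shows "abs_L2 f = abs_L2 g \<longleftrightarrow> (AE x in lborel. f x = g x)"
  using Quotient3_rel[OF Quotient3_L2, of f g] assms by (auto simp: L2_rel_def)

lemma abs_L2_cong_AE:
  assumes "square_integrable f" "square_integrable g" "AE x in lborel. f x = g x"
  shows "abs_L2 f = abs_L2 g"
  using abs_L2_eq_iff assms by blast

lemma rep_abs_L2: "square_integrable f \<Longrightarrow> AE x in lborel. rep_L2 (abs_L2 f) x = f x"
  using abs_L2_eq_iff[of "rep_L2 (abs_L2 f)" f] by simp

lemma L2_eqI: "AE x in lborel. rep_L2 u x = rep_L2 v x \<Longrightarrow> u = v"
  using abs_L2_eq_iff[of "rep_L2 u" "rep_L2 v"] by simp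

lemma abs_L2_add: "square_integrable f \<Longrightarrow> square_integrable g \<Longrightarrow> abs_L2 f + abs_L2 g = abs_L2 (\<lambda>x. f x + g x)"
  by (simp add: plus_L2.abs_eq L2_rel_refl)

lemma abs_L2_diff: "square_integrable f \<Longrightarrow> square_integrable g \<Longrightarrow> abs_L2 f - abs_L2 g = abs_L2 (\<lambda>x. f x - g x)"
  by (simp add: minus_L2.abs_eq L2_rel_refl)

lemma abs_L2_scaleR: "square_integrable f \<Longrightarrow> r *\<^sub>R abs_L2 f = abs_L2 (\<lambda>x. r *\<^sub>R f x)"
  by (simp add: scaleR_L2.abs_eq L2_rel_refl)

lemma abs_L2_cscale: "square_integrable f \<Longrightarrow> cscale_L2 c (abs_L2 f) = abs_L2 (\<lambda>x. c * f x)"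
  by (simp add: cscale_L2.abs_eq L2_rel_refl)

lemma rep_L2_add: "AE x in lborel. rep_L2 (u + v) x = rep_L2 u x + rep_L2 v x"
  using rep_abs_L2[OF square_integrable_add[of "rep_L2 u" "rep_L2 v"]]
    abs_L2_add[of "rep_L2 u" "rep_L2 v"] by simp

lemma rep_L2_diff: "AE x in lborel. rep_L2 (u - v) x = rep_L2 u x - rep_L2 v x"
  using rep_abs_L2[OF square_integrable_diff[of "rep_L2 u" "rep_L2 v"]]
    abs_L2_diff[of "rep_L2 u" "rep_L2 v"] by simp

lemma rep_L2_scaleR: "AE x in lborel. rep_L2 (r *\<^sub>R u) x = r *\<^sub>R rep_L2 u x"
  using rep_abs_L2[OF square_integrable_scaleR[of "rep_L2 u" r]]
    abs_L2_scaleR[of "rep_L2 u" r] by simp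

lemma rep_L2_cscale: "AE x in lborel. rep_L2 (cscale_L2 c u) x = c * rep_L2 u x"
  using rep_abs_L2[OF square_integrable_cmult[of "rep_L2 u" c]]
    abs_L2_cscale[of "rep_L2 u" c] by simp

lemma inner_L2_eq: "u \<bullet> v = (LINT x|lborel. rep_L2 u x \<bullet> rep_L2 v x)"
  using inner_L2.abs_eq[of "rep_L2 u" "rep_L2 v"] by (simp add: L2_rel_refl)

lemma inner_abs_L2:
  "square_integrable f \<Longrightarrow> square_integrable g \<Longrightarrow> abs_L2 f \<bullet> abs_L2 g = (LINT x|lborel. f x \<bullet> g x)"
  by (simp add: inner_L2.abs_eq L2_rel_refl)

lemma square_integrableD:
  assumes "square_integrable f"
  shows "f \<in> borel_measurable borel" "integrable lborel (\<lambda>x. (cmod (f x))\<^sup>2)"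
  using assms by (auto simp: square_integrable_def)

lemma power2_norm_L2: "(norm u)\<^sup>2 = (LINT x|lborel. (cmod (rep_L2 u x))\<^sup>2)"
  by (simp add: power2_norm_eq_inner inner_L2_eq)

lemma power2_norm_abs_L2:
  "square_integrable f \<Longrightarrow> (norm (abs_L2 f))\<^sup>2 = (LINT x|lborel. (cmod (f x))\<^sup>2)"
  by (simp add: power2_norm_eq_inner inner_abs_L2)

lemma nn_integral_abs_L2:
  "square_integrable f \<Longrightarrow> (\<integral>\<^sup>+x. ennreal ((cmod (f x))\<^sup>2) \<partial>lborel) = ennreal ((norm (abs_L2 f))\<^sup>2)"
  by (simp add: power2_norm_abs_L2 nn_integral_eq_integral square_integrableD)

lemma nn_integral_rep_L2:
  "(\<integral>\<^sup>+x. ennreal ((cmod (rep_L2 u x))\<^sup>2) \<partial>lborel) = ennreal ((norm u)\<^sup>2)"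
  using nn_integral_abs_L2[of "rep_L2 u"] by simp

lemma square_integrableI:
  assumes "f \<in> borel_measurable borel" "(\<integral>\<^sup>+x. ennreal ((cmod (f x))\<^sup>2) \<partial>lborel) < \<infinity>"
  shows "square_integrable f"
  unfolding square_integrable_def using assms by (auto intro!: integrableI_bounded)

lemma square_integrable_bound:
  assumes "square_integrable g" "f \<in> borel_measurable borel" "AE x in lborel. cmod (f x) \<le> B * cmod (g x)"
  shows "square_integrable f"
proof -
  have "integrable lborel (\<lambda>x. (B * cmod (g x))\<^sup>2)"
    unfolding power_mult_distrib using square_integrableD(2)[OF assms(1)] by (rule integrable_mult_right)
  then have "integrable lborel (\<lambda>x. (cmod (f x))\<^sup>2)"
    by (rule Bochner_Integration.integrable_bound) (use assms(2,3) in \<open>auto elim!: eventually_mono intro!: power_mono\<close>)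
  then show ?thesis using assms(2) by (simp add: square_integrable_def)
qed

lemma norm_L2_le:
  assumes "square_integrable f" "square_integrable g" "0 \<le> B" "AE x in lborel. cmod (f x) \<le> B * cmod (g x)"
  shows "norm (abs_L2 f) \<le> B * norm (abs_L2 g)"
proof -
  have "(norm (abs_L2 f))\<^sup>2 \<le> (LINT x|lborel. (B * cmod (g x))\<^sup>2)"
    unfolding power2_norm_abs_L2[OF assms(1)]
  proof (rule integral_mono_AE)
    show "AE x in lborel. (cmod (f x))\<^sup>2 \<le> (B * cmod (g x))\<^sup>2"
      using assms(4) by eventually_elim (simp add: power_mono)
  qed (use assms(1,2) in \<open>auto simp: square_integrableD power_mult_distrib\<close>)
  also have "\<dots> = (B * norm (abs_L2 g))\<^sup>2"
    unfolding power_mult_distrib power2_norm_abs_L2[OF assms(2)] by (rule integral_mult_right_zero)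
  finally show ?thesis
    by (rule power2_le_imp_le) (use assms(3) in auto)
qed

lemma square_integrable_mult:
  assumes "square_integrable f" "square_integrable g"
  shows "integrable lborel (\<lambda>x. f x * g x)"
proof -
  have [measurable]: "f \<in> borel_measurable borel" "g \<in> borel_measurable borel"
    and "integrable lborel (\<lambda>x. (cmod (f x))\<^sup>2)" "integrable lborel (\<lambda>x. (cmod (g x))\<^sup>2)"
    using assms by (auto simp: square_integrable_def)
  then have i: "integrable lborel (\<lambda>x. (cmod (f x))\<^sup>2 + (cmod (g x))\<^sup>2)"
    by simp
  have b: "a * b \<le> a\<^sup>2 + b\<^sup>2" if "a \<ge> 0" "b \<ge> 0" for a b :: real
  proof -
    have "a * b \<le> 2 * a * b" using that by simp
    also have "\<dots> \<le> a\<^sup>2 + b\<^sup>2" by (rule sum_squares_bound)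
    finally show ?thesis .
  qed
  show ?thesis
    by (rule Bochner_Integration.integrable_bound[OF i]) (use b in \<open>auto intro!: AE_I2 simp: norm_mult\<close>)
qed

lemma square_integrable_cnj [simp]: "square_integrable (\<lambda>x. cnj (f x)) \<longleftrightarrow> square_integrable f"
proof -
  have "square_integrable (\<lambda>x. cnj (f x))" if "square_integrable f" for f :: "'a \<Rightarrow> complex"
    using that measurable_compose[of f lborel borel cnj borel]
    by (simp add: square_integrable_def borel_measurable_continuous_onI continuous_intros)
  from this[of f] this[of "\<lambda>x. cnj (f x)"] show ?thesis by auto
qed

text \<open>The instance of \<open>real_inner\<close> sees only the real part of the sesquilinear
  product. The complex product, linear in the first argument, serves Parseval's formula and the
  complex-valued pairings with test functions.\<close>

definition cinner :: "'a::euclidean_space L2 \<Rightarrow> 'a L2 \<Rightarrow> complex" where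
  "cinner u v = (LINT x|lborel. rep_L2 u x * cnj (rep_L2 v x))"

lemma integrable_cinner: "integrable lborel (\<lambda>x. rep_L2 u x * cnj (rep_L2 v x))"
  by (intro square_integrable_mult) auto

lemma Re_cinner: "Re (cinner u v) = u \<bullet> v"
  unfolding cinner_def inner_L2_eq
  by (subst integral_Re[symmetric, OF integrable_cinner]) (simp add: inner_complex_def)

text \<open>Rotating the second argument by i recovers the imaginary part, so that identities for
  \<open>cinner\<close> reduce to identities for the real inner product.\<close>

lemma cinner_eq: "cinner u v = Complex (u \<bullet> v) (u \<bullet> cscale_L2 \<i> v)"
proof -
  have "Im (cinner u v) = (LINT x|lborel. rep_L2 u x \<bullet> (\<i> * rep_L2 v x))"
    unfolding cinner_def by (subst integral_Im[symmetric, OF integrable_cinner]) (simp add: inner_complex_def)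
  also have "\<dots> = u \<bullet> cscale_L2 \<i> v"
    unfolding inner_L2_eq using rep_L2_cscale[of \<i> v]
    by (intro integral_cong_AE) (auto elim!: eventually_mono)
  finally show ?thesis by (simp add: complex_eq_iff Re_cinner)
qed

section \<open>Completeness of L^2\<close>

lemma ennreal_le_suminf: "f k \<le> (\<Sum>k. f k :: ennreal)"
  using sum_le_suminf[of f "{k}"] by auto

text \<open>Riesz-Fischer: a fast subsequence converges almost everywhere, and Fatou's lemma
  upgrades this to convergence in norm of the whole sequence.\<close>

lemma L2_Cauchy_convergent:
  fixes X :: "nat \<Rightarrow> 'a::euclidean_space L2"
  assumes "Cauchy X"
  shows "convergent X"
proof -
  define f where "f n = rep_L2 (X n)" for n
  have [measurable]: "f n \<in> borel_measurable borel" for n by (simp add: f_def)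
  have fnorm: "(\<integral>\<^sup>+x. ennreal ((cmod (f m x - f n x))\<^sup>2) \<partial>lborel) = ennreal ((norm (X m - X n))\<^sup>2)" for m n
    unfolding f_def using nn_integral_abs_L2[OF square_integrable_diff[of "rep_L2 (X m)" "rep_L2 (X n)"]]
    by (simp flip: abs_L2_diff)
  have "\<exists>N. \<forall>m\<ge>N. \<forall>n\<ge>N. norm (X m - X n) < (1/2)^k" for k
    using CauchyD[OF assms, of "(1/2)^k"] by auto
  then obtain N where N: "\<And>k m n. m \<ge> N k \<Longrightarrow> n \<ge> N k \<Longrightarrow> norm (X m - X n) < (1/2)^k" by metis
  define r where "r = rec_nat (N 0) (\<lambda>k rk. max (Suc rk) (N (Suc k)))"
  have r0: "r 0 = N 0" and rS: "r (Suc k) = max (Suc (r k)) (N (Suc k))" for k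
    by (auto simp: r_def)
  have rN: "r k \<ge> N k" for k by (cases k) (auto simp: r0 rS)
  have rmono: "strict_mono r" by (auto simp: strict_mono_Suc_iff rS)
  have rd: "norm (X (r (Suc k)) - X (r k)) < (1/2)^k" for k
    by (rule N) (use rN[of k] rmono in \<open>auto simp: strict_mono_def intro: order.trans[OF rN less_imp_le]\<close>)
  \<comment> \<open>The weight 2^k balances two demands: the squared increments integrate to at most
    4^(-k), so the weighted series is integrable, and where the series is finite the increments are
    at most a multiple of 2^(-k/2).\<close>
  define W where "W x = (\<Sum>k. ennreal (2^k * (cmod (f (r (Suc k)) x - f (r k) x))\<^sup>2))" for x
  have [measurable]: "W \<in> borel_measurable borel" unfolding W_def by measurable
  have "(\<integral>\<^sup>+x. W x \<partial>lborel) = (\<Sum>k. \<integral>\<^sup>+x. ennreal (2^k * (cmod (f (r (Suc k)) x - f (r k) x))\<^sup>2) \<partial>lborel)"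
    unfolding W_def by (rule nn_integral_suminf) measurable
  also have "\<dots> = (\<Sum>k. ennreal (2^k * (norm (X (r (Suc k)) - X (r k)))\<^sup>2))"
    by (simp add: ennreal_mult' nn_integral_cmult fnorm)
  also have "\<dots> \<le> (\<Sum>k. ennreal ((1/2)^k))"
  proof (rule suminf_le)
    fix k
    have "2^k * (norm (X (r (Suc k)) - X (r k)))\<^sup>2 \<le> 2^k * ((1/2)^k)\<^sup>2"
      by (intro mult_left_mono power_mono less_imp_le[OF rd]) auto
    also have "\<dots> = (1/2::real)^k" by (simp add: power2_eq_square power_divide)
    finally show "ennreal (2^k * (norm (X (r (Suc k)) - X (r k)))\<^sup>2) \<le> ennreal ((1/2)^k)"
      by (rule ennreal_leI)
  qed auto
  also have "\<dots> = ennreal (\<Sum>k. (1/2)^k)"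
    by (rule suminf_ennreal2) (auto intro: summable_geometric)
  also have "\<dots> < \<infinity>" by simp
  finally have "AE x in lborel. W x \<noteq> \<infinity>"
    by (intro nn_integral_noteq_infinite) auto
  moreover have "convergent (\<lambda>k. f (r k) x)" if "W x \<noteq> \<infinity>" for x
  proof -
    define w where "w = enn2real (W x)"
    have w: "W x = ennreal w" "w \<ge> 0" using that by (auto simp: w_def less_top)
    have le: "cmod (f (r (Suc k)) x - f (r k) x) \<le> sqrt w * (1 / sqrt 2)^k" for k
    proof -
      have "ennreal (2^k * (cmod (f (r (Suc k)) x - f (r k) x))\<^sup>2) \<le> W x"
        unfolding W_def by (rule ennreal_le_suminf)
      then have "2^k * (cmod (f (r (Suc k)) x - f (r k) x))\<^sup>2 \<le> w" using w by simp
      then have "sqrt (2^k * (cmod (f (r (Suc k)) x - f (r k) x))\<^sup>2) \<le> sqrt w" by simp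
      then have "sqrt 2^k * cmod (f (r (Suc k)) x - f (r k) x) \<le> sqrt w"
        by (simp add: real_sqrt_mult real_sqrt_power)
      then show ?thesis by (simp add: field_simps power_divide)
    qed
    have "summable (\<lambda>k. sqrt w * (1 / sqrt 2)^k)"
      by (intro summable_mult summable_geometric) auto
    then have "summable (\<lambda>k. f (r (Suc k)) x - f (r k) x)"
      by (rule summable_comparison_test'[OF _ le])
    then have "(\<lambda>n. (\<Sum>k<n. f (r (Suc k)) x - f (r k) x) + f (r 0) x) \<longlonglongrightarrow>
        (\<Sum>k. f (r (Suc k)) x - f (r k) x) + f (r 0) x"
      by (intro tendsto_intros summable_LIMSEQ)
    then show ?thesis
      unfolding sum_lessThan_telescope[of "\<lambda>k. f (r k) x"] by (auto simp: convergent_def)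
  qed
  ultimately have conv: "AE x in lborel. convergent (\<lambda>k. f (r k) x)" by (rule eventually_mono)
  define g where "g x = lim (\<lambda>k. f (r k) x)" for x
  have g[measurable]: "g \<in> borel_measurable borel" unfolding g_def by measurable
  have lim: "AE x in lborel. (\<lambda>k. f (r k) x) \<longlonglongrightarrow> g x"
    using conv by eventually_elim (simp add: g_def convergent_LIMSEQ_iff)
  \<comment> \<open>Fatou along the subsequence: a bound on all later distances from
    \<open>X n\<close> passes to the limit function.\<close>
  have bd: "(\<integral>\<^sup>+x. ennreal ((cmod (g x - f n x))\<^sup>2) \<partial>lborel) \<le> ennreal (e\<^sup>2)"
    if n: "\<And>k. k \<ge> n \<Longrightarrow> norm (X k - X n) \<le> e" for n e
  proof -
    have "(\<integral>\<^sup>+x. ennreal ((cmod (g x - f n x))\<^sup>2) \<partial>lborel)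
        = (\<integral>\<^sup>+x. liminf (\<lambda>k. ennreal ((cmod (f (r k) x - f n x))\<^sup>2)) \<partial>lborel)"
    proof (rule nn_integral_cong_AE, use lim in eventually_elim)
      fix x assume "(\<lambda>k. f (r k) x) \<longlonglongrightarrow> g x"
      then have "(\<lambda>k. ennreal ((cmod (f (r k) x - f n x))\<^sup>2)) \<longlonglongrightarrow> ennreal ((cmod (g x - f n x))\<^sup>2)"
        by (intro tendsto_intros)
      then show "ennreal ((cmod (g x - f n x))\<^sup>2) = liminf (\<lambda>k. ennreal ((cmod (f (r k) x - f n x))\<^sup>2))"
        by (intro lim_imp_Liminf[symmetric]) simp
    qed
    also have "\<dots> \<le> liminf (\<lambda>k. \<integral>\<^sup>+x. ennreal ((cmod (f (r k) x - f n x))\<^sup>2) \<partial>lborel)"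
      by (rule nn_integral_liminf) measurable
    also have "\<dots> = liminf (\<lambda>k. ennreal ((norm (X (r k) - X n))\<^sup>2))"
      by (simp add: fnorm)
    also have "\<dots> \<le> liminf (\<lambda>k. ennreal (e\<^sup>2))"
    proof (rule Liminf_mono)
      show "\<forall>\<^sub>F k in sequentially. ennreal ((norm (X (r k) - X n))\<^sup>2) \<le> ennreal (e\<^sup>2)"
        using eventually_ge_at_top[of n]
      proof eventually_elim
        case (elim k)
        then have "r k \<ge> n" using seq_suble[OF rmono, of k] by simp
        then show ?case by (intro ennreal_leI power_mono n) auto
      qed
    qed
    finally show ?thesis by (simp add: Liminf_const)
  qed
  have sqd: "square_integrable (\<lambda>x. g x - f (N 0) x)"
  proof (rule square_integrableI)
    have "(\<integral>\<^sup>+x. ennreal ((cmod (g x - f (N 0) x))\<^sup>2) \<partial>lborel) \<le> ennreal (1\<^sup>2)"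
      by (rule bd) (use N[of 0] in \<open>auto simp: less_imp_le\<close>)
    then show "(\<integral>\<^sup>+x. ennreal ((cmod (g x - f (N 0) x))\<^sup>2) \<partial>lborel) < \<infinity>"
      using order_le_less_trans by fastforce
  qed measurable
  have sqg: "square_integrable g"
    using square_integrable_add[OF sqd square_integrable_rep[of "X (N 0)"]] by (simp add: f_def)
  have "X \<longlonglongrightarrow> abs_L2 g"
  proof (rule LIMSEQ_I)
    fix e :: real assume "0 < e"
    then obtain k where k: "(1/2)^k < e" using real_arch_pow_inv[of e "1/2"] by auto
    have "norm (X n - abs_L2 g) < e" if "n \<ge> N k" for n
    proof -
      have "ennreal ((norm (abs_L2 g - X n))\<^sup>2) \<le> ennreal (((1/2)^k)\<^sup>2)"
        using bd[of n "(1/2)^k"] N[of k] that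
          nn_integral_abs_L2[OF square_integrable_diff[OF sqg square_integrable_rep[of "X n"]]]
        by (simp add: f_def less_imp_le flip: abs_L2_diff[OF sqg])
      then have "(norm (abs_L2 g - X n))\<^sup>2 \<le> ((1/2)^k)\<^sup>2" by simp
      then have "norm (abs_L2 g - X n) \<le> (1/2)^k" by (rule power2_le_imp_le) simp
      then show ?thesis using k by (simp add: norm_minus_commute)
    qed
    then show "\<exists>no. \<forall>n\<ge>no. norm (X n - abs_L2 g) < e" by blast
  qed
  then show ?thesis by (auto simp: convergent_def)
qed

instance L2 :: (euclidean_space) banach
  by standard (use L2_Cauchy_convergent in auto)

text \<open>Lebesgue's theorem for the squared distance, whose majorant is (2 B |w|)^2. It is stated
  for representatives because the truncations and symbols to which it is applied are given
  pointwise.\<close>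

lemma tendsto_L2_dominated:
  fixes f :: "nat \<Rightarrow> 'a::euclidean_space \<Rightarrow> complex"
  assumes [measurable]: "\<And>n. f n \<in> borel_measurable borel" "F \<in> borel_measurable borel"
    and w: "square_integrable w"
    and bound: "\<And>n. AE x in lborel. cmod (f n x) \<le> B * cmod (w x)"
    and lim: "AE x in lborel. (\<lambda>n. f n x) \<longlonglongrightarrow> F x"
  shows "square_integrable F" "\<And>n. square_integrable (f n)" "(\<lambda>n. abs_L2 (f n)) \<longlonglongrightarrow> abs_L2 F"
proof -
  show sf: "square_integrable (f n)" for n
    by (rule square_integrable_bound[OF w _ bound]) measurable
  have Fb: "AE x in lborel. cmod (F x) \<le> B * cmod (w x)"
  proof -
    have "AE x in lborel. \<forall>n. cmod (f n x) \<le> B * cmod (w x)"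
      using bound by (simp add: AE_all_countable)
    with lim show ?thesis
      by eventually_elim (auto intro: LIMSEQ_le_const2 tendsto_norm)
  qed
  show sF: "square_integrable F"
    by (rule square_integrable_bound[OF w _ Fb]) measurable
  have [measurable]: "w \<in> borel_measurable borel" using w by (simp add: square_integrableD)
  have iw: "integrable lborel (\<lambda>x. (2 * B)\<^sup>2 * (cmod (w x))\<^sup>2)"
    using w by (simp add: square_integrableD)
  have "(\<lambda>n. LINT x|lborel. (cmod (f n x - F x))\<^sup>2) \<longlonglongrightarrow> (LINT x|(lborel :: 'a measure). 0)"
  proof (rule integral_dominated_convergence[where w="\<lambda>x. (2 * B)\<^sup>2 * (cmod (w x))\<^sup>2"])
    show "AE x in lborel. (\<lambda>n. (cmod (f n x - F x))\<^sup>2) \<longlonglongrightarrow> 0"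
      using lim
    proof eventually_elim
      fix x assume "(\<lambda>n. f n x) \<longlonglongrightarrow> F x"
      then have "(\<lambda>n. (cmod (f n x - F x))\<^sup>2) \<longlonglongrightarrow> (cmod (F x - F x))\<^sup>2"
        by (intro tendsto_intros)
      then show "(\<lambda>n. (cmod (f n x - F x))\<^sup>2) \<longlonglongrightarrow> 0" by simp
    qed
    show "AE x in lborel. norm ((cmod (f n x - F x))\<^sup>2) \<le> (2 * B)\<^sup>2 * (cmod (w x))\<^sup>2" for n
      using bound[of n] Fb
    proof eventually_elim
      fix x assume "cmod (f n x) \<le> B * cmod (w x)" "cmod (F x) \<le> B * cmod (w x)"
      then have "cmod (f n x - F x) \<le> 2 * B * cmod (w x)"
        using norm_triangle_ineq4[of "f n x" "F x"] by simp
      then have "(cmod (f n x - F x))\<^sup>2 \<le> (2 * B * cmod (w x))\<^sup>2"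
        by (rule power_mono) simp
      then show "norm ((cmod (f n x - F x))\<^sup>2) \<le> (2 * B)\<^sup>2 * (cmod (w x))\<^sup>2"
        by (simp only: power_mult_distrib) simp
    qed
  qed (use iw in auto)
  then have "(\<lambda>n. (norm (abs_L2 (f n) - abs_L2 F))\<^sup>2) \<longlonglongrightarrow> 0"
    by (simp add: abs_L2_diff sf sF power2_norm_abs_L2 square_integrable_diff)
  then have "(\<lambda>n. norm (abs_L2 (f n) - abs_L2 F)) \<longlonglongrightarrow> 0"
    using tendsto_real_sqrt by fastforce
  then show "(\<lambda>n. abs_L2 (f n)) \<longlonglongrightarrow> abs_L2 F"
    by (simp add: tendsto_norm_zero_iff LIM_zero_iff)
qed

section \<open>Density of the indicators of boxes\<close>

lemma square_integrable_indicator: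
  assumes "A \<in> sets borel" "emeasure lborel A < \<infinity>"
  shows "square_integrable (indicator A)"
proof (rule square_integrableI)
  have "(\<integral>\<^sup>+x. ennreal ((cmod (indicator A x :: complex))\<^sup>2) \<partial>lborel) = (\<integral>\<^sup>+x. indicator A x \<partial>lborel)"
    by (intro nn_integral_cong) (auto split: split_indicator)
  then show "(\<integral>\<^sup>+x. ennreal ((cmod (indicator A x :: complex))\<^sup>2) \<partial>lborel) < \<infinity>"
    using assms by simp
qed (use assms in measurable)

text \<open>The boxes form an intersection-stable generator, so a Dynkin argument reaches all Borel
  sets. Every set is cut with a fixed box, which keeps the measure finite under complements; the box
  then exhausts the space.\<close>

lemma box_indicator_closure:
  fixes P :: "'a::euclidean_space L2 \<Rightarrow> bool"
  assumes add: "\<And>u v. P u \<Longrightarrow> P v \<Longrightarrow> P (u + v)"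
    and scale: "\<And>c u. P u \<Longrightarrow> P (cscale_L2 c u)"
    and box: "\<And>a b. P (abs_L2 (indicator (box a b)))"
    and lim: "\<And>X u. (\<And>n. P (X n)) \<Longrightarrow> X \<longlonglongrightarrow> u \<Longrightarrow> P u"
    and A: "A \<in> sets borel" and fin: "emeasure lborel A < \<infinity>"
  shows "P (abs_L2 (indicator A))"
proof -
  let ?G = "range (\<lambda>(a, b). box a b :: 'a set)"
  have zero: "P 0" using box[of 0 0] by (simp add: zero_L2_def box_def indicator_def[abs_def])
  have sqb: "square_integrable (indicator (A \<inter> box a b))" if "A \<in> sets borel" for A and a b :: 'a
  proof (rule square_integrable_indicator)
    have "emeasure lborel (A \<inter> box a b) \<le> emeasure lborel (box a b)"
      by (intro emeasure_mono) auto
    also have "\<dots> < \<infinity>" by (rule emeasure_lborel_box_finite)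
    finally show "emeasure lborel (A \<inter> box a b) < \<infinity>" .
  qed (use that in auto)
  have *: "P (abs_L2 (indicator (A \<inter> box a b)))" if "A \<in> sets borel" for A a b
  proof -
    have "Int_stable ?G" by (auto simp: Int_stable_def box_Int_box)
    moreover have "?G \<subseteq> Pow UNIV" by auto
    moreover have "A \<in> sigma_sets UNIV ?G" using that by (simp add: borel_eq_box)
    ultimately show ?thesis
    proof (induction rule: sigma_sets_induct_disjoint)
      case (basic A)
      then show ?case by (auto simp: box_Int_box intro!: box)
    next
      case empty
      then show ?case using zero by (simp add: zero_L2_def)
    next
      case (compl A)
      then have A: "A \<in> sets borel" by (simp add: borel_eq_box)
      have "abs_L2 (indicator ((UNIV - A) \<inter> box a b)) =
          abs_L2 (indicator (UNIV \<inter> box a b)) + cscale_L2 (- 1) (abs_L2 (indicator (A \<inter> box a b)))"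
        unfolding abs_L2_cscale[OF sqb[OF A]]
        by (subst abs_L2_add[OF sqb square_integrable_cmult[OF sqb]])
          (auto simp: A intro!: arg_cong[where f=abs_L2] split: split_indicator)
      then show ?case using add scale box compl by simp
    next
      case (union A)
      then have A: "A i \<in> sets borel" for i by (auto simp: borel_eq_box)
      have "P (abs_L2 (\<lambda>x. \<Sum>i<n. indicator (A i \<inter> box a b) x)) \<and>
        square_integrable (\<lambda>x. \<Sum>i<n. indicator (A i \<inter> box a b) x :: complex)" for n
      proof (induction n)
        case 0 then show ?case using zero by (simp add: zero_L2_def)
      next
        case (Suc n)
        then show ?case
          using add[OF conjunct1[OF Suc] union.IH[of n]]
          by (simp add: abs_L2_add sqb A square_integrable_add)
      qed
      \<comment> \<open>By disjointness the partial sums are indicators of finite unions, and the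
        indicator of the fixed box dominates all of them.\<close>
      moreover have "(\<lambda>n. abs_L2 (\<lambda>x. \<Sum>i<n. indicator (A i \<inter> box a b) x)) \<longlonglongrightarrow> abs_L2 (indicator (\<Union> (range A) \<inter> box a b))"
      proof (rule tendsto_L2_dominated(3)[where B=1 and w="indicator (UNIV \<inter> box a b)"])
        have eq: "(\<Sum>i<n. indicator (A i \<inter> box a b) x) = (indicator ((\<Union>i<n. A i) \<inter> box a b) x :: complex)" for n x
        proof (induction n)
          case (Suc n)
          have "A n \<inter> A i = {}" if "i < n" for i
            using union(1) that by (auto simp: disjoint_family_on_def)
          then show ?case unfolding sum.lessThan_Suc Suc
            by (auto split: split_indicator simp: less_Suc_eq)
        qed simp
        show "AE x in lborel. cmod (\<Sum>i<n. indicator (A i \<inter> box a b) x) \<le> 1 * cmod (indicator (UNIV \<inter> box a b) x)" for n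
          unfolding eq by (auto split: split_indicator)
        have "(\<lambda>n. indicator ((\<Union>i<n. A i) \<inter> box a b) x :: complex) \<longlonglongrightarrow> indicator (\<Union> (range A) \<inter> box a b) x" for x
        proof (cases "x \<in> \<Union> (range A) \<inter> box a b")
          case True
          then obtain i where i: "x \<in> A i" "x \<in> box a b" by auto
          have "\<forall>\<^sub>F n in sequentially. indicator ((\<Union>i<n. A i) \<inter> box a b) x = (1::complex)"
            using eventually_gt_at_top[of i] by eventually_elim (use i in \<open>auto simp: indicator_def\<close>)
          then show ?thesis using True by (simp add: tendsto_eventually)
        next
          case False
          then have "indicator ((\<Union>i<n. A i) \<inter> box a b) x = (0::complex)" for n by (auto split: split_indicator)
          then show ?thesis using False by simp
        qed
        then show "AE x in lborel. (\<lambda>n. \<Sum>i<n. indicator (A i \<inter> box a b) x :: complex) \<longlonglongrightarrow> indicator (\<Union> (range A) \<inter> box a b) x"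
          unfolding eq by auto
        show "square_integrable (indicator (UNIV \<inter> box a b))" by (rule sqb) simp
      qed (use A in measurable)
      ultimately show ?case by (intro lim[of _ "abs_L2 (indicator (\<Union> (range A) \<inter> box a b))"]) auto
    qed
  qed
  let ?B = "\<lambda>n::nat. box (- (real n *\<^sub>R One)) (real n *\<^sub>R One) :: 'a set"
  have "(\<lambda>n. abs_L2 (indicator (A \<inter> ?B n))) \<longlonglongrightarrow> abs_L2 (indicator A)"
  proof (rule tendsto_L2_dominated(3)[where B=1 and w="indicator A"])
    show "square_integrable (indicator A)" by (rule square_integrable_indicator[OF A fin])
    show "AE x in lborel. cmod (indicator (A \<inter> ?B n) x) \<le> 1 * cmod (indicator A x)" for n
      by (auto split: split_indicator)
    have "(\<lambda>n. indicator (A \<inter> ?B n) x :: complex) \<longlonglongrightarrow> indicator A x" for x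
    proof -
      obtain N where N: "x \<in> ?B N" using UN_box_eq_UNIV by blast
      have "\<forall>\<^sub>F n in sequentially. indicator (A \<inter> ?B n) x = (indicator A x :: complex)"
        using eventually_ge_at_top[of N]
      proof eventually_elim
        case (elim n)
        have "real N \<le> real n" using elim by simp
        then have "x \<in> ?B n" using N by (auto simp: box_def)
        then show ?case by (simp split: split_indicator)
      qed
      then show ?thesis by (rule tendsto_eventually)
    qed
    then show "AE x in lborel. (\<lambda>n. indicator (A \<inter> ?B n) x :: complex) \<longlonglongrightarrow> indicator A x" by auto
  qed (use A in measurable)
  then show ?thesis by (rule lim[rotated]) (rule *[OF A])
qed

text \<open>Simple functions are dense, and their nonzero level sets have finite measure. A closed
  linear property therefore has to be tested on boxes only; this carries the continuity of
  translations and the fundamental lemma for test functions.\<close>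

theorem L2_induct [case_names add scale box lim]:
  fixes P :: "'a::euclidean_space L2 \<Rightarrow> bool"
  assumes add: "\<And>u v. P u \<Longrightarrow> P v \<Longrightarrow> P (u + v)"
    and scale: "\<And>c u. P u \<Longrightarrow> P (cscale_L2 c u)"
    and box: "\<And>a b. P (abs_L2 (indicator (box a b)))"
    and lim: "\<And>X u. (\<And>n. P (X n)) \<Longrightarrow> X \<longlonglongrightarrow> u \<Longrightarrow> P u"
  shows "P u"
proof -
  have zero: "P 0" using box[of 0 0] by (simp add: zero_L2_def box_def indicator_def[abs_def])
  obtain F where F: "\<And>i. simple_function lborel (F i)" "\<And>x. (\<lambda>i. F i x) \<longlonglongrightarrow> rep_L2 u x"
      "\<And>i x. cmod (F i x) \<le> 2 * cmod (rep_L2 u x)"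
    using borel_measurable_implies_sequence_metric[of "rep_L2 u" lborel 0] by (auto simp: dist_norm)
  have Fm[measurable]: "F i \<in> borel_measurable borel" for i
    using borel_measurable_simple_function[OF F(1)[of i]] by simp
  have Fsq: "square_integrable (F i)" for i
    by (rule square_integrable_bound[OF square_integrable_rep[of u]]) (use F(3) in auto)
  have "P (abs_L2 (F i))" for i
  proof -
    have fin: "finite (range (F i))" using simple_functionD(1)[OF F(1)[of i]] by simp
    define A where "A c = {x. F i x = c}" for c
    have A: "A c \<in> sets borel" for c unfolding A_def by measurable
    \<comment> \<open>Chebyshev: the level set of a nonzero value c contributes |c|^2 times its
      measure to the squared norm.\<close>
    have Afin: "emeasure lborel (A c) < \<infinity>" if "c \<noteq> 0" for c
    proof -
      have "ennreal ((cmod c)\<^sup>2) * emeasure lborel (A c) = (\<integral>\<^sup>+x. ennreal ((cmod c)\<^sup>2) * indicator (A c) x \<partial>lborel)"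
        using A by (simp add: nn_integral_cmult_indicator)
      also have "\<dots> \<le> (\<integral>\<^sup>+x. ennreal ((cmod (F i x))\<^sup>2) \<partial>lborel)"
        by (intro nn_integral_mono) (auto simp: A_def split: split_indicator)
      also have "\<dots> < \<infinity>" by (simp add: nn_integral_abs_L2[OF Fsq])
      finally show ?thesis using that by (auto simp: ennreal_mult_less_top)
    qed
    have "P (abs_L2 (\<lambda>x. \<Sum>c\<in>S. c * indicator (A c) x)) \<and> square_integrable (\<lambda>x. \<Sum>c\<in>S. c * indicator (A c) x)"
      if "finite S" "0 \<notin> S" for S
      using that
    proof (induction S)
      case empty
      then show ?case using zero by (simp add: zero_L2_def)
    next
      case (insert c S)
      then have sq: "square_integrable (indicator (A c))"
        by (intro square_integrable_indicator A Afin) auto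
      have "P (abs_L2 (indicator (A c)))"
        using insert(4) by (intro box_indicator_closure[where P=P, OF add scale box lim A Afin]) auto
      from scale[OF this, of c] have Pc: "P (abs_L2 (\<lambda>x. c * indicator (A c) x))"
        by (simp add: abs_L2_cscale sq)
      have eq: "(\<lambda>x. \<Sum>c\<in>insert c S. c * indicator (A c) x) =
          (\<lambda>x. c * indicator (A c) x + (\<Sum>c\<in>S. c * indicator (A c) x))"
        using insert(1,2) by (intro ext sum.insert)
      have S: "P (abs_L2 (\<lambda>x. \<Sum>c\<in>S. c * indicator (A c) x))"
          "square_integrable (\<lambda>x. \<Sum>c\<in>S. c * indicator (A c) x)"
        using insert by auto
      show ?case
        unfolding eq abs_L2_add[OF square_integrable_cmult[OF sq] S(2), symmetric]
        using add[OF Pc S(1)] square_integrable_add[OF square_integrable_cmult[OF sq] S(2)] by blast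
    qed
    from this[of "range (F i) - {0}"] fin
    have "P (abs_L2 (\<lambda>x. \<Sum>c\<in>range (F i) - {0}. c * indicator (A c) x))" by auto
    also have "(\<lambda>x. \<Sum>c\<in>range (F i) - {0}. c * indicator (A c) x) = F i"
    proof
      fix x
      have "(\<Sum>c\<in>range (F i) - {0}. c * indicator (A c) x) = (\<Sum>c\<in>range (F i) - {0}. if c = F i x then c else 0)"
        by (intro sum.cong) (auto simp: A_def)
      also have "\<dots> = F i x" using fin by (simp add: sum.delta)
      finally show "(\<Sum>c\<in>range (F i) - {0}. c * indicator (A c) x) = F i x" .
    qed
    finally show ?thesis .
  qed
  moreover have "(\<lambda>i. abs_L2 (F i)) \<longlonglongrightarrow> abs_L2 (rep_L2 u)"
    by (rule tendsto_L2_dominated(3)[where B=2 and w="rep_L2 u"]) (use F in auto)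
  ultimately show ?thesis using lim[of "\<lambda>i. abs_L2 (F i)" "abs_L2 (rep_L2 u)"] by simp
qed

section \<open>Complex scalars on L^2\<close>

lemma cscale_L2_add: "cscale_L2 c (u + v) = cscale_L2 c u + cscale_L2 c v"
  by transfer (auto simp: L2_rel_def distrib_left intro!: square_integrable_add square_integrable_cmult)

lemma cscale_L2_diff: "cscale_L2 c (u - v) = cscale_L2 c u - cscale_L2 c v"
  by transfer (auto simp: L2_rel_def right_diff_distrib intro!: square_integrable_diff square_integrable_cmult)

lemma cscale_L2_cscale: "cscale_L2 c (cscale_L2 d u) = cscale_L2 (c * d) u"
  by transfer (auto simp: L2_rel_def mult.assoc intro!: square_integrable_cmult)

lemma cscale_L2_of_real: "cscale_L2 (of_real r) u = r *\<^sub>R u"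
  by transfer (auto simp: L2_rel_def scaleR_conv_of_real intro!: square_integrable_cmult)

lemma norm_cscale_L2 [simp]: "norm (cscale_L2 c u) = cmod c * norm u"
proof -
  have "(norm (cscale_L2 c u))\<^sup>2 = (LINT x|lborel. (cmod (c * rep_L2 u x))\<^sup>2)"
    using power2_norm_abs_L2[OF square_integrable_cmult[of "rep_L2 u" c]] abs_L2_cscale[of "rep_L2 u" c] by simp
  also have "\<dots> = (cmod c * norm u)\<^sup>2"
    by (simp only: norm_mult power_mult_distrib power2_norm_L2) simp
  finally show ?thesis by simp
qed

lemma bounded_linear_cscale_L2: "bounded_linear (cscale_L2 c)"
proof (rule bounded_linear_intro[where K="cmod c"])
  show "cscale_L2 c (r *\<^sub>R x) = r *\<^sub>R cscale_L2 c x" for r x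
    by (simp add: cscale_L2_cscale mult.commute flip: cscale_L2_of_real)
qed (auto simp: cscale_L2_add)

lemma inner_cscale_L2: "cscale_L2 c u \<bullet> v = u \<bullet> cscale_L2 (cnj c) v"
proof -
  have "cscale_L2 c u \<bullet> v = (LINT x|lborel. (c * rep_L2 u x) \<bullet> rep_L2 v x)"
    unfolding inner_L2_eq using rep_L2_cscale[of c u] by (intro integral_cong_AE) auto
  also have "\<dots> = (LINT x|lborel. rep_L2 u x \<bullet> (cnj c * rep_L2 v x))"
    by (intro Bochner_Integration.integral_cong) (auto simp: inner_complex_def algebra_simps)
  also have "\<dots> = u \<bullet> cscale_L2 (cnj c) v"
    unfolding inner_L2_eq using rep_L2_cscale[of "cnj c" v] by (intro integral_cong_AE) auto
  finally show ?thesis .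
qed

section \<open>Multiplication and translation operators\<close>

text \<open>The bound holds everywhere rather than essentially: all symbols in use are explicit
  functions, and products, conjugates and translates then stay bounded without exceptional
  sets.\<close>

definition bounded_multiplier :: "('a::euclidean_space \<Rightarrow> complex) \<Rightarrow> bool" where
  "bounded_multiplier m \<longleftrightarrow> m \<in> borel_measurable borel \<and> bounded (range m)"

definition pmult :: "('a::euclidean_space \<Rightarrow> complex) \<Rightarrow> 'a L2 \<Rightarrow> 'a L2" where
  "pmult m u = abs_L2 (\<lambda>x. m x * rep_L2 u x)"

lemma borel_measurable_cnj [measurable]:
  "f \<in> borel_measurable M \<Longrightarrow> (\<lambda>x. cnj (f x)) \<in> borel_measurable M"
  by (rule measurable_compose[of f M borel cnj borel])
    (auto intro!: borel_measurable_continuous_onI continuous_intros)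

lemma bounded_multiplier_measurable: "bounded_multiplier m \<Longrightarrow> m \<in> borel_measurable borel"
  by (simp add: bounded_multiplier_def)

lemma bounded_multiplierI:
  "m \<in> borel_measurable borel \<Longrightarrow> (\<And>x. cmod (m x) \<le> B) \<Longrightarrow> bounded_multiplier m"
  by (auto simp: bounded_multiplier_def bounded_iff)

lemma bounded_multiplier_mult:
  assumes "bounded_multiplier m" "bounded_multiplier n"
  shows "bounded_multiplier (\<lambda>x. m x * n x)"
proof -
  obtain A B where "\<And>x. cmod (m x) \<le> A" "\<And>x. cmod (n x) \<le> B"
    using assms by (auto simp: bounded_multiplier_def bounded_iff)
  then have "cmod (m x * n x) \<le> A * B" for x
    unfolding norm_mult by (intro mult_mono) (auto intro: order.trans[OF norm_ge_zero])
  then show ?thesis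
    using assms by (intro bounded_multiplierI) (auto simp: bounded_multiplier_def)
qed

lemma bounded_multiplier_cnj: "bounded_multiplier m \<Longrightarrow> bounded_multiplier (\<lambda>x. cnj (m x))"
  by (auto simp: bounded_multiplier_def bounded_iff)

lemma square_integrable_pmult:
  assumes "bounded_multiplier m" "square_integrable f"
  shows "square_integrable (\<lambda>x. m x * f x)"
proof -
  obtain B where B: "\<And>x. cmod (m x) \<le> B"
    using assms(1) by (auto simp: bounded_multiplier_def bounded_iff)
  have [measurable]: "m \<in> borel_measurable borel" "f \<in> borel_measurable borel"
    using assms by (auto simp: bounded_multiplier_def square_integrableD)
  show ?thesis
    by (rule square_integrable_bound[OF assms(2), of _ B])
      (use B in \<open>auto simp: norm_mult intro!: mult_right_mono\<close>)
qed

lemma pmult_abs_L2: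
  assumes "bounded_multiplier m" "square_integrable f"
  shows "pmult m (abs_L2 f) = abs_L2 (\<lambda>x. m x * f x)"
  unfolding pmult_def using rep_abs_L2[OF assms(2)]
  by (intro abs_L2_cong_AE square_integrable_pmult assms) auto

lemma rep_pmult:
  assumes "bounded_multiplier m"
  shows "AE x in lborel. rep_L2 (pmult m u) x = m x * rep_L2 u x"
  unfolding pmult_def using assms by (intro rep_abs_L2 square_integrable_pmult) auto

lemma norm_pmult_le:
  assumes "bounded_multiplier m" "\<And>x. cmod (m x) \<le> B"
  shows "norm (pmult m u) \<le> B * norm u"
proof -
  have "0 \<le> B" using assms(2)[of 0] norm_ge_zero order.trans by blast
  then have "norm (abs_L2 (\<lambda>x. m x * rep_L2 u x)) \<le> B * norm (abs_L2 (rep_L2 u))"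
    by (intro norm_L2_le square_integrable_pmult assms AE_I2) (auto simp: norm_mult assms intro!: mult_right_mono)
  then show ?thesis by (simp add: pmult_def)
qed

lemma bounded_linear_pmult:
  assumes m: "bounded_multiplier m"
  shows "bounded_linear (pmult m)"
proof -
  obtain B where B: "\<And>x. cmod (m x) \<le> B"
    using m by (auto simp: bounded_multiplier_def bounded_iff)
  show ?thesis
  proof (rule bounded_linear_intro[where K=B])
    fix u v :: "'a L2" and r :: real
    show "pmult m (u + v) = pmult m u + pmult m v"
      unfolding pmult_def using rep_L2_add[of u v]
      by (subst abs_L2_add) (auto simp: m square_integrable_pmult distrib_left
          intro!: abs_L2_cong_AE square_integrable_add)
    show "pmult m (r *\<^sub>R u) = r *\<^sub>R pmult m u"
      unfolding pmult_def using rep_L2_scaleR[of r u]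
      by (subst abs_L2_scaleR) (auto simp: m square_integrable_pmult
          intro!: abs_L2_cong_AE square_integrable_scaleR)
    show "norm (pmult m u) \<le> norm u * B"
      using norm_pmult_le[OF m B] by (simp add: mult.commute)
  qed
qed

lemma pmult_pmult:
  assumes "bounded_multiplier m" "bounded_multiplier n"
  shows "pmult m (pmult n u) = pmult (\<lambda>x. m x * n x) u"
  using assms pmult_abs_L2[OF assms(1), of "\<lambda>x. n x * rep_L2 u x"]
  by (simp add: pmult_def mult.assoc square_integrable_pmult)

lemma pmult_const: "pmult (\<lambda>x. c) u = cscale_L2 c u"
  using abs_L2_cscale[of "rep_L2 u" c] by (simp add: pmult_def)

lemma pmult_one: "pmult (\<lambda>x. 1) u = u"
  by (simp add: pmult_def)

lemma inner_pmult:
  assumes "bounded_multiplier m"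
  shows "pmult m u \<bullet> v = u \<bullet> pmult (\<lambda>x. cnj (m x)) v"
proof -
  have [measurable]: "m \<in> borel_measurable borel" "(\<lambda>x. cnj (m x)) \<in> borel_measurable borel"
    using assms bounded_multiplier_cnj[OF assms] by (auto simp: bounded_multiplier_def)
  have "pmult m u \<bullet> v = (LINT x|lborel. (m x * rep_L2 u x) \<bullet> rep_L2 v x)"
    unfolding inner_L2_eq using rep_pmult[OF assms, of u] by (intro integral_cong_AE) auto
  also have "\<dots> = (LINT x|lborel. rep_L2 u x \<bullet> (cnj (m x) * rep_L2 v x))"
    by (intro Bochner_Integration.integral_cong) (auto simp: inner_complex_def algebra_simps)
  also have "\<dots> = u \<bullet> pmult (\<lambda>x. cnj (m x)) v"
    unfolding inner_L2_eq using rep_pmult[OF bounded_multiplier_cnj[OF assms], of v]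
    by (intro integral_cong_AE) auto
  finally show ?thesis .
qed

lemma tendsto_pmult_sequentially:
  fixes m :: "nat \<Rightarrow> 'a::euclidean_space \<Rightarrow> complex"
  assumes "\<And>n. m n \<in> borel_measurable borel" "m' \<in> borel_measurable borel"
    and "\<And>n x. cmod (m n x) \<le> B" "\<And>x. (\<lambda>n. m n x) \<longlonglongrightarrow> m' x"
  shows "(\<lambda>n. pmult (m n) u) \<longlonglongrightarrow> pmult m' u"
  unfolding pmult_def
  by (rule tendsto_L2_dominated(3)[where w="rep_L2 u" and B=B])
    (use assms in \<open>auto simp: norm_mult intro!: mult_right_mono tendsto_mult\<close>)

text \<open>Strong convergence of multipliers by dominated convergence. The bound is asked for h
  different from t, since the symbols are often difference quotients whose value at t is an artefact
  of division by zero.\<close>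

lemma tendsto_pmult_at:
  fixes m :: "real \<Rightarrow> 'a::euclidean_space \<Rightarrow> complex"
  assumes "\<And>h. m h \<in> borel_measurable borel" "m' \<in> borel_measurable borel"
    and "\<And>h x. h \<noteq> t \<Longrightarrow> cmod (m h x) \<le> B" "\<And>x. ((\<lambda>h. m h x) \<longlongrightarrow> m' x) (at t within S)"
  shows "((\<lambda>h. pmult (m h) u) \<longlongrightarrow> pmult m' u) (at t within S)"
  unfolding tendsto_at_iff_sequentially comp_def
proof (intro allI impI)
  fix X :: "nat \<Rightarrow> real" assume X: "\<forall>i. X i \<in> S - {t}" "X \<longlonglongrightarrow> t"
  have "(\<lambda>n. m (X n) x) \<longlonglongrightarrow> m' x" for x
    using assms(4)[of x] X unfolding tendsto_at_iff_sequentially comp_def by blast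
  then show "(\<lambda>n. pmult (m (X n)) u) \<longlonglongrightarrow> pmult m' u"
    using X by (intro tendsto_pmult_sequentially[where B=B] assms) auto
qed

lemma tendsto_pmult_cball:
  "((\<lambda>R. pmult (indicator (cball 0 R)) u) \<longlongrightarrow> u) at_top"
proof (rule tendsto_at_topI_sequentially)
  fix X :: "nat \<Rightarrow> real" assume X: "filterlim X at_top sequentially"
  have "(\<lambda>n. pmult (indicator (cball 0 (X n))) u) \<longlonglongrightarrow> pmult (\<lambda>x. 1) u"
  proof (rule tendsto_pmult_sequentially[where B=1])
    fix x :: 'a
    have "\<forall>\<^sub>F n in sequentially. X n \<ge> norm x"
      using X by (simp add: filterlim_at_top)
    then have "\<forall>\<^sub>F n in sequentially. indicator (cball 0 (X n)) x = (1::complex)"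
      by eventually_elim simp
    then show "(\<lambda>n. indicator (cball 0 (X n)) x :: complex) \<longlonglongrightarrow> 1" by (rule tendsto_eventually)
  qed (auto split: split_indicator intro!: borel_measurable_indicator)
  then show "(\<lambda>n. pmult (indicator (cball 0 (X n))) u) \<longlonglongrightarrow> u" by (simp add: pmult_one)
qed

section \<open>Translations\<close>

definition shift :: "'a::euclidean_space \<Rightarrow> 'a L2 \<Rightarrow> 'a L2" where
  "shift h u = abs_L2 (\<lambda>x. rep_L2 u (x + h))"

lemma AE_lborel_translate:
  assumes "AE x in lborel. P x"
  shows "AE x in lborel. P (x + h :: 'a::euclidean_space)"
proof -
  have "AE x in distr lborel borel ((+) h). P x"
    unfolding lborel_distr_plus by (rule assms)
  then show ?thesis by (subst add.commute) (rule AE_distrD[rotated], auto)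
qed

lemma integral_lborel_translate:
  fixes f :: "'a::euclidean_space \<Rightarrow> 'b::{banach, second_countable_topology}"
  assumes [measurable]: "f \<in> borel_measurable borel"
  shows "(LINT x|lborel. f (x + h)) = (LINT x|lborel. f x)"
proof -
  have "(LINT x|lborel. f x) = (LINT x|distr lborel borel ((+) h). f x)"
    by (simp add: lborel_distr_plus)
  also have "\<dots> = (LINT x|lborel. f (x + h))"
    by (subst integral_distr) (auto simp: add.commute)
  finally show ?thesis by simp
qed

lemma nn_integral_lborel_translate:
  fixes f :: "'a::euclidean_space \<Rightarrow> ennreal"
  assumes [measurable]: "f \<in> borel_measurable borel"
  shows "(\<integral>\<^sup>+x. f (x + h) \<partial>lborel) = (\<integral>\<^sup>+x. f x \<partial>lborel)"
proof -
  have "(\<integral>\<^sup>+x. f x \<partial>lborel) = (\<integral>\<^sup>+x. f x \<partial>distr lborel borel ((+) h))"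
    by (simp add: lborel_distr_plus)
  also have "\<dots> = (\<integral>\<^sup>+x. f (x + h) \<partial>lborel)"
    by (subst nn_integral_distr) (auto simp: add.commute)
  finally show ?thesis by simp
qed

lemma square_integrable_shift:
  assumes "square_integrable f"
  shows "square_integrable (\<lambda>x. f (x + h))"
proof (rule square_integrableI)
  have [measurable]: "f \<in> borel_measurable borel" using assms by (simp add: square_integrableD)
  show "(\<lambda>x. f (x + h)) \<in> borel_measurable borel" by measurable
  have "(\<integral>\<^sup>+x. ennreal ((cmod (f (x + h)))\<^sup>2) \<partial>lborel) = (\<integral>\<^sup>+x. ennreal ((cmod (f x))\<^sup>2) \<partial>lborel)"
    by (rule nn_integral_lborel_translate[where f="\<lambda>x. ennreal ((cmod (f x))\<^sup>2)"]) measurable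
  then show "(\<integral>\<^sup>+x. ennreal ((cmod (f (x + h)))\<^sup>2) \<partial>lborel) < \<infinity>"
    by (simp add: nn_integral_abs_L2[OF assms])
qed

lemma shift_abs_L2: "square_integrable f \<Longrightarrow> shift h (abs_L2 f) = abs_L2 (\<lambda>x. f (x + h))"
  unfolding shift_def using AE_lborel_translate[OF rep_abs_L2]
  by (intro abs_L2_cong_AE square_integrable_shift) auto

lemma rep_shift: "AE x in lborel. rep_L2 (shift h u) x = rep_L2 u (x + h)"
  unfolding shift_def by (intro rep_abs_L2 square_integrable_shift) simp

lemma inner_shift: "shift h u \<bullet> v = u \<bullet> shift (- h) v"
proof -
  have "shift h u \<bullet> v = (LINT x|lborel. rep_L2 u (x + h) \<bullet> rep_L2 v x)"
    unfolding inner_L2_eq using rep_shift[of h u] by (intro integral_cong_AE) auto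
  also have "\<dots> = (LINT x|lborel. rep_L2 u x \<bullet> rep_L2 v (x - h))"
    by (subst integral_lborel_translate[where h=h, symmetric]) auto
  also have "\<dots> = u \<bullet> shift (- h) v"
    unfolding inner_L2_eq using rep_shift[of "- h" v] by (intro integral_cong_AE) auto
  finally show ?thesis .
qed

lemma shift_shift: "shift h (shift k u) = shift (h + k) u"
  using shift_abs_L2[of "\<lambda>x. rep_L2 u (x + k)" h]
  by (simp add: shift_def square_integrable_shift ac_simps)

lemma shift_0 [simp]: "shift 0 u = u"
  by (simp add: shift_def)

lemma norm_shift [simp]: "norm (shift h u) = norm u"
  by (simp add: norm_eq_sqrt_inner inner_shift shift_shift)

lemma shift_add: "shift h (u + v) = shift h u + shift h v"
  unfolding shift_def using AE_lborel_translate[OF rep_L2_add[of u v], of h]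
  by (subst abs_L2_add) (auto intro!: abs_L2_cong_AE square_integrable_add square_integrable_shift)

lemma shift_cscale: "shift h (cscale_L2 c u) = cscale_L2 c (shift h u)"
  unfolding shift_def using AE_lborel_translate[OF rep_L2_cscale[of c u], of h]
  by (subst abs_L2_cscale) (auto intro!: abs_L2_cong_AE square_integrable_cmult square_integrable_shift)

lemma bounded_linear_shift: "bounded_linear (shift h)"
  by (rule bounded_linear_intro[where K=1])
    (auto simp: shift_add shift_cscale simp flip: cscale_L2_of_real)

lemma shift_diff: "shift h (u - v) = shift h u - shift h v"
  using linear_diff[OF bounded_linear.linear[OF bounded_linear_shift]] .

text \<open>For a box the translated indicators converge off the frontier, a null set, under a
  common majorant. Translations are isometries, so the property survives limits and induction gives
  all of L^2.\<close>

lemma tendsto_shift: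
  fixes u :: "'a::euclidean_space L2" and X :: "nat \<Rightarrow> 'a"
  assumes X: "X \<longlonglongrightarrow> 0"
  shows "(\<lambda>n. shift (X n) u) \<longlonglongrightarrow> u"
proof (induction u rule: L2_induct)
  case (add u v)
  then show ?case by (simp add: shift_add tendsto_add)
next
  case (scale c u)
  then show ?case
    using bounded_linear.tendsto[OF bounded_linear_cscale_L2] by (simp add: shift_cscale)
next
  case (box a b)
  have sq: "square_integrable (indicator (box a b))"
    using square_integrable_indicator[OF _ emeasure_lborel_box_finite] by simp
  obtain M where M: "\<And>n. norm (X n) \<le> M"
    using convergent_imp_Bseq[of X] X by (auto simp: convergent_def Bseq_def)
  obtain D where D: "\<And>x. x \<in> box a b \<Longrightarrow> norm x \<le> D"
    using bounded_box[of a b] by (auto simp: bounded_iff)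
  have "(\<lambda>n. abs_L2 (\<lambda>x. indicator (box a b) (x + X n))) \<longlonglongrightarrow> abs_L2 (indicator (box a b))"
  \<comment> \<open>All shifts are bounded by M and the box by D, so one ball contains every
    translate of the box.\<close>
  proof (rule tendsto_L2_dominated(3)[where B=1 and w="indicator (cball 0 (D + M))"])
    show "square_integrable (indicator (cball (0::'a) (D + M)))"
      by (intro square_integrable_indicator emeasure_lborel_cball_finite) auto
    show "AE x in lborel. cmod (indicator (box a b) (x + X n)) \<le> 1 * cmod (indicator (cball 0 (D + M)) x)" for n
    proof (rule AE_I2)
      fix x
      have "norm x \<le> D + M" if "x + X n \<in> box a b"
        using D[OF that] M[of n] norm_triangle_ineq4[of "x + X n" "X n"] by simp
      then show "cmod (indicator (box a b) (x + X n)) \<le> 1 * cmod (indicator (cball 0 (D + M)) x)"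
        by (auto split: split_indicator)
    qed
    have "AE x in lborel. x \<notin> frontier (box a b)"
    proof (rule AE_not_in)
      show "frontier (box a b) \<in> null_sets lborel"
        using negligible_convex_frontier[OF convex_box(2)[of a b]]
        by (simp add: negligible_iff_null_sets null_sets_def frontier_def)
    qed
    then show "AE x in lborel. (\<lambda>n. indicator (box a b) (x + X n) :: complex) \<longlonglongrightarrow> indicator (box a b) x"
    proof eventually_elim
      fix x assume "x \<notin> frontier (box a b)"
      then consider "x \<in> box a b" | "x \<in> - closure (box a b)"
        by (auto simp: frontier_def interior_open[OF open_box])
      then obtain U where U: "open U" "x \<in> U" "U \<subseteq> box a b \<or> U \<inter> box a b = {}"
        by cases (use closure_subset[of "box a b"] in \<open>blast intro: open_box, metis open_Compl closed_closure ComplD disjoint_iff subsetD\<close>)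
      have "(\<lambda>n. x + X n) \<longlonglongrightarrow> x" using tendsto_add[OF tendsto_const X, of x] by simp
      then have "\<forall>\<^sub>F n in sequentially. x + X n \<in> U" using U topological_tendstoD by blast
      then have "\<forall>\<^sub>F n in sequentially. indicator (box a b) (x + X n) = (indicator (box a b) x :: complex)"
        by eventually_elim (use U in \<open>auto split: split_indicator\<close>)
      then show "(\<lambda>n. indicator (box a b) (x + X n) :: complex) \<longlonglongrightarrow> indicator (box a b) x"
        by (rule tendsto_eventually)
    qed
  qed measurable
  then show ?case by (simp add: shift_abs_L2 sq)
next
  case (lim U u)
  show ?case
  proof (rule LIMSEQ_I)
    fix e :: real assume e: "e > 0"
    obtain k where k: "norm (U k - u) < e / 3"
      using LIMSEQ_D[OF lim(2), of "e / 3"] e by auto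
    obtain N where N: "\<And>n. n \<ge> N \<Longrightarrow> norm (shift (X n) (U k) - U k) < e / 3"
      using LIMSEQ_D[OF lim(1)[of k], of "e / 3"] e by auto
    have "norm (shift (X n) u - u) < e" if "n \<ge> N" for n
    proof -
      have eq: "shift (X n) u - u = shift (X n) (u - U k) + (shift (X n) (U k) - U k) + (U k - u)"
        by (simp add: shift_diff)
      have "norm (shift (X n) u - u) \<le> norm (shift (X n) (u - U k)) + norm (shift (X n) (U k) - U k) + norm (U k - u)"
        unfolding eq by (rule norm_triangle_le[OF add_right_mono[OF norm_triangle_ineq]])
      then show ?thesis using k N[OF that] by (simp add: norm_minus_commute)
    qed
    then show "\<exists>no. \<forall>n\<ge>no. norm (shift (X n) u - u) < e" by blast
  qed
qed

section \<open>Plancherel's theorem\<close>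

lemma borel_measurable_cis [measurable]: "f \<in> borel_measurable M \<Longrightarrow> (\<lambda>x. cis (f x)) \<in> borel_measurable M"
  by (rule measurable_compose[of f M borel cis borel]) (auto intro!: borel_measurable_continuous_onI continuous_intros)

lemma borel_measurable_std_normal_density [measurable]:
  "f \<in> borel_measurable M \<Longrightarrow> (\<lambda>x. std_normal_density (f x)) \<in> borel_measurable M"
  by (rule measurable_compose[of f M borel]) auto

lemma power2_norm_Basis: "(norm z)\<^sup>2 = (\<Sum>b\<in>Basis. (z \<bullet> b)\<^sup>2)"
  unfolding power2_norm_eq_inner by (subst euclidean_inner) (simp add: power2_eq_square)

lemma sum_Basis_half: "(\<Sum>b\<in>Basis. - (z \<bullet> b)\<^sup>2 / 2) = - (norm z)\<^sup>2 / 2"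
  unfolding power2_norm_Basis by (simp add: sum_negf flip: sum_divide_distrib)

text \<open>Normalised as a probability density, so that its transform without any prefactor is
  exp(-|x|^2 / 2). The product form reduces integrals to one coordinate at a time.\<close>

definition gauss :: "'a::euclidean_space \<Rightarrow> real" where
  "gauss z = (\<Prod>b\<in>Basis. std_normal_density (z \<bullet> b))"

lemma gauss_eq: "gauss (z :: 'a::euclidean_space) = (2 * pi) powr (- real DIM('a) / 2) * exp (- (norm z)\<^sup>2 / 2)"
proof -
  have s: "1 / sqrt (2 * pi) = (2 * pi) powr (- 1 / 2)"
    by (simp add: powr_minus_divide powr_half_sqrt)
  have "gauss z = (\<Prod>b\<in>(Basis :: 'a set). (2 * pi) powr (- 1 / 2)) * (\<Prod>b\<in>Basis. exp (- (z \<bullet> b)\<^sup>2 / 2))"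
    unfolding gauss_def std_normal_density_def s by (rule prod.distrib)
  also have "(\<Prod>b\<in>(Basis :: 'a set). (2 * pi) powr (- 1 / 2)) = (2 * pi) powr (- real DIM('a) / 2)"
    by (simp add: powr_powr flip: powr_realpow)
  also have "(\<Prod>b\<in>Basis. exp (- (z \<bullet> b)\<^sup>2 / 2)) = exp (\<Sum>b\<in>Basis. - (z \<bullet> b)\<^sup>2 / 2)"
    by (simp add: exp_sum)
  finally show ?thesis unfolding sum_Basis_half .
qed

lemma borel_measurable_gauss [measurable]: "gauss \<in> borel_measurable borel"
  unfolding gauss_def by measurable

lemma gauss_nonneg [simp]: "0 \<le> gauss z"
  by (simp add: gauss_eq)

lemma integral_cis_std_normal:
  "integrable lborel (\<lambda>x. cis (t * x) * of_real (std_normal_density x))"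
  "(LINT x|lborel. cis (t * x) * of_real (std_normal_density x)) = of_real (exp (- t\<^sup>2 / 2))"
proof -
  show "integrable lborel (\<lambda>x. cis (t * x) * complex_of_real (std_normal_density x))"
    by (rule Bochner_Integration.integrable_bound[OF integrable_normal_density[of 1 0]]) (auto simp: norm_mult)
  have "(LINT x|lborel. cis (t * x) * complex_of_real (std_normal_density x)) = char std_normal_distribution t"
    unfolding char_def
    by (subst integral_density) (auto simp: cis_conv_exp scaleR_conv_of_real mult.commute)
  then show "(LINT x|lborel. cis (t * x) * complex_of_real (std_normal_density x)) = of_real (exp (- t\<^sup>2 / 2))"
    by (simp add: char_std_normal_distribution)
qed

text \<open>Lebesgue measure is the image of a product of one-dimensional ones, and in each
  coordinate the integral is the characteristic function of the normal distribution.\<close>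

lemma integral_cis_gauss:
  fixes x :: "'a::euclidean_space"
  shows "integrable lborel (\<lambda>z. cis (z \<bullet> x) * of_real (gauss z))"
    and "(LINT z|lborel. cis (z \<bullet> x) * of_real (gauss z)) = of_real (exp (- (norm x)\<^sup>2 / 2))"
proof -
  interpret product_sigma_finite "\<lambda>b::'a. lborel :: real measure" ..
  define k where "k b t = cis ((x \<bullet> b) * t) * complex_of_real (std_normal_density t)" for b :: 'a and t
  have k: "cis (z \<bullet> x) * of_real (gauss z) = (\<Prod>b\<in>Basis. k b (z \<bullet> b))" for z
  proof -
    have "cis (z \<bullet> x) = (\<Prod>b\<in>Basis. cis ((x \<bullet> b) * (z \<bullet> b)))"
      by (subst euclidean_inner) (simp add: cis_conv_exp sum_distrib_left exp_sum mult.commute)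
    then show ?thesis by (simp add: k_def prod.distrib gauss_def)
  qed
  have sb: "(\<Sum>b\<in>Basis. f b *\<^sub>R b) \<bullet> b = f b" if "b \<in> Basis" for f and b :: 'a
    using that by (simp add: inner_sum_left_Basis)
  have ki: "integrable lborel (k b)" "integral\<^sup>L lborel (k b) = of_real (exp (- (x \<bullet> b)\<^sup>2 / 2))" for b
    unfolding k_def[abs_def] by (auto simp: integral_cis_std_normal)
  have meas: "(\<lambda>f. \<Sum>b\<in>Basis. f b *\<^sub>R b) \<in> (\<Pi>\<^sub>M b\<in>(Basis::'a set). lborel) \<rightarrow>\<^sub>M (borel :: 'a measure)"
    by measurable
  have mk: "(\<lambda>z. \<Prod>b\<in>Basis. k b (z \<bullet> b)) \<in> borel_measurable (borel :: 'a measure)"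
    unfolding k_def by measurable
  have *: "integrable (\<Pi>\<^sub>M b\<in>Basis. lborel) (\<lambda>f. \<Prod>b\<in>Basis. k b (f b))"
    by (intro product_integrable_prod ki) auto
  show "integrable lborel (\<lambda>z. cis (z \<bullet> x) * of_real (gauss z))"
    unfolding k
    by (subst lborel_eq) (use * in \<open>simp add: integrable_distr_eq[OF meas mk] sb cong: prod.cong\<close>)
  have "(LINT z|lborel. cis (z \<bullet> x) * of_real (gauss z)) = integral\<^sup>L (\<Pi>\<^sub>M b\<in>Basis. lborel) (\<lambda>f. \<Prod>b\<in>Basis. k b (f b))"
    unfolding k by (subst lborel_eq) (simp add: integral_distr[OF meas mk] sb cong: prod.cong)
  also have "\<dots> = (\<Prod>b\<in>Basis. of_real (exp (- (x \<bullet> b)\<^sup>2 / 2)))"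
    by (subst product_integral_prod) (auto simp: ki)
  also have "\<dots> = of_real (exp (\<Sum>b\<in>Basis. - (x \<bullet> b)\<^sup>2 / 2))"
    by (simp add: exp_sum)
  finally show "(LINT z|lborel. cis (z \<bullet> x) * of_real (gauss z)) = of_real (exp (- (norm x)\<^sup>2 / 2))" unfolding sum_Basis_half .
qed

lemma integrable_gauss: "integrable lborel (gauss :: 'a::euclidean_space \<Rightarrow> real)"
  using integrable_Re[OF integral_cis_gauss(1)[of "0::'a"]] by simp

lemma integral_gauss: "(LINT z|lborel. gauss (z :: 'a::euclidean_space)) = 1"
proof -
  have "complex_of_real (LINT z|lborel. gauss (z :: 'a)) = 1"
    using integral_cis_gauss(2)[of "0::'a"] by simp
  then show ?thesis by (simp only: of_real_eq_1_iff)
qed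

lemma integral_lborel_scale:
  fixes f :: "'a::euclidean_space \<Rightarrow> 'b::{banach, second_countable_topology}"
  assumes [measurable]: "f \<in> borel_measurable borel" and c: "0 < c"
  shows "(LINT x|lborel. f x) = c ^ DIM('a) *\<^sub>R (LINT x|lborel. f (c *\<^sub>R x))"
proof -
  have "(LINT x|lborel. f x) = (LINT x|density (distr lborel borel (\<lambda>x. 0 + c *\<^sub>R x)) (\<lambda>_. ennreal (\<bar>c\<bar> ^ DIM('a))). f x)"
    using c by (subst lborel_affine[of c 0]) auto
  also have "\<dots> = (LINT x|distr lborel borel (\<lambda>x. 0 + c *\<^sub>R x). (\<bar>c\<bar> ^ DIM('a)) *\<^sub>R f x)"
    by (rule integral_density) auto
  also have "\<dots> = (LINT x|lborel. c ^ DIM('a) *\<^sub>R f (c *\<^sub>R x))"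
    using c by (subst integral_distr) auto
  finally show ?thesis by simp
qed

lemma integrable_lborel_scale:
  fixes f :: "'a::euclidean_space \<Rightarrow> 'b::{banach, second_countable_topology}"
  assumes "integrable lborel (\<lambda>x. f (c *\<^sub>R x))" and [measurable]: "f \<in> borel_measurable borel" and c: "0 < c"
  shows "integrable lborel f"
proof -
  have "integrable (density (distr lborel borel (\<lambda>x. 0 + c *\<^sub>R x)) (\<lambda>_. ennreal (\<bar>c\<bar> ^ DIM('a)))) f"
    using assms(1) by (subst integrable_density) (auto simp: integrable_distr_eq)
  then show ?thesis using c by (subst lborel_affine[of c 0]) auto
qed

lemma integrable_product_kernel:
  fixes f :: "'a::euclidean_space \<Rightarrow> complex" and g :: "'b::euclidean_space \<Rightarrow> complex"
  assumes f: "integrable lborel f" and g: "integrable lborel g"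
    and k [measurable]: "(\<lambda>(x, y). k x y) \<in> borel_measurable (borel \<Otimes>\<^sub>M borel)"
    and B: "\<And>x y. cmod (k x y) \<le> B"
  shows "integrable (lborel \<Otimes>\<^sub>M lborel) (\<lambda>(x, y). f x * g y * k x y)"
proof -
  have [measurable]: "f \<in> borel_measurable borel" "g \<in> borel_measurable borel"
    using f g by auto
  have "(\<integral>\<^sup>+ z. ennreal (norm (case z of (x, y) \<Rightarrow> f x * g y * k x y)) \<partial>(lborel \<Otimes>\<^sub>M lborel))
      \<le> (\<integral>\<^sup>+ z. ennreal (norm (f (fst z))) * ennreal (norm (g (snd z))) * ennreal B \<partial>(lborel \<Otimes>\<^sub>M lborel))"
  proof (rule nn_integral_mono)
    fix z :: "'a \<times> 'b"
    have "ennreal (norm (f (fst z) * g (snd z) * k (fst z) (snd z))) \<le> ennreal (norm (f (fst z)) * norm (g (snd z)) * B)"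
      unfolding norm_mult by (intro ennreal_leI mult_left_mono B) simp
    also have "\<dots> = ennreal (norm (f (fst z))) * ennreal (norm (g (snd z))) * ennreal B"
      using order.trans[OF norm_ge_zero B] by (simp add: ennreal_mult)
    finally show "ennreal (norm (case z of (x, y) \<Rightarrow> f x * g y * k x y))
        \<le> ennreal (norm (f (fst z))) * ennreal (norm (g (snd z))) * ennreal B"
      by (simp add: case_prod_beta)
  qed
  also have "\<dots> = (\<integral>\<^sup>+ x. \<integral>\<^sup>+ y. ennreal (norm (f x)) * ennreal (norm (g y)) * ennreal B \<partial>lborel \<partial>lborel)"
    by (subst lborel.nn_integral_fst[symmetric]) auto
  also have "\<dots> = (\<integral>\<^sup>+ x. ennreal (norm (f x)) \<partial>lborel) * (\<integral>\<^sup>+ y. ennreal (norm (g y)) \<partial>lborel) * ennreal B"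
    by (simp add: nn_integral_cmult nn_integral_multc)
  also have "\<dots> < \<infinity>"
    using f g by (auto simp: integrable_iff_bounded ennreal_mult_less_top)
  finally show ?thesis by (intro integrableI_bounded) auto
qed

lemma Fubini_product_kernel:
  fixes f :: "'a::euclidean_space \<Rightarrow> complex" and g :: "'b::euclidean_space \<Rightarrow> complex"
  assumes f: "integrable lborel f" and g: "integrable lborel g"
    and k [measurable]: "(\<lambda>(x, y). k x y) \<in> borel_measurable (borel \<Otimes>\<^sub>M borel)"
    and B: "\<And>x y. cmod (k x y) \<le> B"
  shows "(LINT x|lborel. f x * (LINT y|lborel. g y * k x y)) = (LINT y|lborel. g y * (LINT x|lborel. f x * k x y))"
proof -
  have "(LINT y|lborel. LINT x|lborel. f x * g y * k x y) = (LINT x|lborel. LINT y|lborel. f x * g y * k x y)"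
    by (rule lborel_pair.Fubini_integral) (rule integrable_product_kernel[OF assms])
  then show ?thesis by (simp add: mult.assoc mult.left_commute[of _ "g _"] flip: integral_mult_right_zero)
qed

section \<open>Isometry of the Fourier integral\<close>

lemma borel_measurable_fourier_integral:
  assumes [measurable]: "f \<in> borel_measurable borel"
  shows "fourier_integral f \<in> borel_measurable borel"
  unfolding fourier_integral_def[abs_def] by measurable

lemma integrable_cis_mult:
  fixes f :: "'a::euclidean_space \<Rightarrow> complex"
  assumes "integrable lborel f" and [measurable]: "g \<in> borel_measurable borel"
  shows "integrable lborel (\<lambda>x. cis (g x) * f x)"
  by (rule Bochner_Integration.integrable_bound[OF assms(1)])
    (use assms borel_measurable_integrable[OF assms(1)] in \<open>auto simp: norm_mult\<close>)

text \<open>Fubini turns the Gaussian regularisation of the Fourier side into a Gaussian average of translates.\<close>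

lemma gauss_regularized_plancherel:
  fixes f :: "'a::euclidean_space \<Rightarrow> complex"
  assumes f1: "integrable lborel f" and f2: "square_integrable f" and e: "0 < e"
  shows "integrable lborel (\<lambda>\<xi>. (cmod (fourier_integral f \<xi>))\<^sup>2 * exp (- (norm (e *\<^sub>R \<xi>))\<^sup>2 / 2))"
    and "(LINT \<xi>|lborel. (cmod (fourier_integral f \<xi>))\<^sup>2 * exp (- (norm (e *\<^sub>R \<xi>))\<^sup>2 / 2)) =
      (LINT z|lborel. gauss z * (shift (e *\<^sub>R z) (abs_L2 f) \<bullet> abs_L2 f))"
proof -
  define c where "c = (2 * pi) powr (- real DIM('a) / 2)"
  have c: "c > 0" by (simp add: c_def)
  have gauss_c: "gauss (z::'a) = c * exp (- (norm z)\<^sup>2 / 2)" for z by (simp add: gauss_eq c_def)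
  have [measurable]: "f \<in> borel_measurable borel" using f2 by (simp add: square_integrableD)
  have [measurable]: "fourier_integral f \<in> borel_measurable borel" by (rule borel_measurable_fourier_integral) measurable
  define G where "G \<xi> = exp (- (norm (e *\<^sub>R \<xi>))\<^sup>2 / 2)" for \<xi> :: 'a
  have [measurable]: "G \<in> borel_measurable borel" unfolding G_def by measurable
  have Gg: "G \<xi> = gauss (e *\<^sub>R \<xi>) / c" for \<xi> using c by (simp add: G_def gauss_c)
  have Gi: "integrable lborel G"
  proof (rule integrable_lborel_scale[where c="1 / e"])
    have "(\<lambda>x. G ((1 / e) *\<^sub>R x)) = (\<lambda>x. gauss x / c)" using e by (auto simp: Gg)
    then show "integrable lborel (\<lambda>x. G ((1 / e) *\<^sub>R x))" by (simp add: integrable_divide_zero integrable_gauss)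
  qed (use e in auto)
  have Gci: "integrable lborel (\<lambda>\<xi>. complex_of_real (G \<xi>))" using Gi by simp
  define A where "A \<xi> = (LINT x|lborel. cis (- (x \<bullet> \<xi>)) * f x)" for \<xi>
  have [measurable]: "A \<in> borel_measurable borel" unfolding A_def by measurable
  have FA: "fourier_integral f \<xi> = of_real c * A \<xi>" for \<xi> by (simp add: fourier_integral_def A_def c_def)
  have Abd: "cmod (A \<xi>) \<le> (LINT x|lborel. cmod (f x))" for \<xi>
    unfolding A_def using integral_norm_bound[of lborel "\<lambda>x. cis (- (x \<bullet> \<xi>)) * f x"] by (simp add: norm_mult)
  have GAi: "integrable lborel (\<lambda>\<xi>. complex_of_real (G \<xi>) * A \<xi>)"
    by (rule Bochner_Integration.integrable_bound[OF integrable_mult_right[OF Gci, of "of_real (LINT x|lborel. cmod (f x))"]])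
      (auto simp: norm_mult mult.commute[of "LINT x|lborel. cmod (f x)"] intro!: mult_left_mono order.trans[OF Abd])
  \<comment> \<open>The transform of the damping factor. At scale e it is again
    \<open>gauss\<close>, up to the factor 1 / (c^2 e^N); the power of e is cancelled by the
    substitution x = y + e z.\<close>
  define K where "K w = (LINT \<xi>|lborel. complex_of_real (G \<xi>) * cis (- (w \<bullet> \<xi>)))" for w :: 'a
  have Ke: "K (e *\<^sub>R z) = of_real (gauss z / (c\<^sup>2 * e ^ DIM('a)))" for z
  proof -
    have "K (e *\<^sub>R z) = (1 / e) ^ DIM('a) *\<^sub>R (LINT \<xi>|lborel. complex_of_real (G ((1 / e) *\<^sub>R \<xi>)) * cis (- ((e *\<^sub>R z) \<bullet> ((1 / e) *\<^sub>R \<xi>))))"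
      unfolding K_def using e by (intro integral_lborel_scale) auto
    also have "(LINT \<xi>|lborel. complex_of_real (G ((1 / e) *\<^sub>R \<xi>)) * cis (- ((e *\<^sub>R z) \<bullet> ((1 / e) *\<^sub>R \<xi>)))) =
       (LINT \<xi>|lborel. of_real (1 / c) * (cis (\<xi> \<bullet> (- z)) * of_real (gauss \<xi>)))"
      using e by (intro Bochner_Integration.integral_cong) (auto simp: Gg inner_commute)
    also have "\<dots> = of_real (1 / c) * of_real (exp (- (norm z)\<^sup>2 / 2))"
      by (subst integral_mult_right_zero) (simp only: integral_cis_gauss norm_minus_cancel)
    also have "(1 / e) ^ DIM('a) *\<^sub>R \<dots> = of_real (gauss z / (c\<^sup>2 * e ^ DIM('a)))"
      using e c by (simp add: gauss_c scaleR_conv_of_real power_divide power2_eq_square)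
    finally show ?thesis .
  qed
  have [measurable]: "K \<in> borel_measurable borel" unfolding K_def by measurable
  have Fi: "integrable lborel (\<lambda>\<xi>. (cmod (fourier_integral f \<xi>))\<^sup>2 * G \<xi>)"
  proof (rule Bochner_Integration.integrable_bound[OF integrable_mult_right[OF Gi, of "(c * (LINT x|lborel. cmod (f x)))\<^sup>2"]])
    have "cmod (fourier_integral f \<xi>) \<le> c * (LINT x|lborel. cmod (f x))" for \<xi>
      using c Abd[of \<xi>] by (simp add: FA norm_mult)
    then have "(cmod (fourier_integral f \<xi>))\<^sup>2 * G \<xi> \<le> (c * (LINT x|lborel. cmod (f x)))\<^sup>2 * G \<xi>" for \<xi>
      by (intro mult_right_mono power_mono) (auto simp: G_def)
    then show "AE \<xi> in lborel. norm ((cmod (fourier_integral f \<xi>))\<^sup>2 * G \<xi>) \<le> norm ((c * (LINT x|lborel. cmod (f x)))\<^sup>2 * G \<xi>)"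
      by (auto simp: G_def abs_mult)
  qed measurable
  then show "integrable lborel (\<lambda>\<xi>. (cmod (fourier_integral f \<xi>))\<^sup>2 * exp (- (norm (e *\<^sub>R \<xi>))\<^sup>2 / 2))"
    by (simp add: G_def)
  have fcnj: "integrable lborel (\<lambda>y. cnj (f y))" using f1 by simp
  have ab: "a * b \<le> a\<^sup>2 / 2 + b\<^sup>2 / 2" for a b :: real
    using sum_squares_bound[of a b] by simp
  \<comment> \<open>The modulus of f(y) f(y + e z) is at most the mean of the two squares, whose
    integral over y does not depend on z. This justifies the last interchange of integrals.\<close>
  have pairI: "integrable (lborel \<Otimes>\<^sub>M lborel) (\<lambda>(y, z). cnj (f y) * (f (y + e *\<^sub>R z) * complex_of_real (gauss z)))"
  proof (rule integrableI_bounded)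
    have "(\<integral>\<^sup>+ p. ennreal (norm (case p of (y, z) \<Rightarrow> cnj (f y) * (f (y + e *\<^sub>R z) * complex_of_real (gauss z)))) \<partial>(lborel \<Otimes>\<^sub>M lborel))
       = (\<integral>\<^sup>+ z. \<integral>\<^sup>+ y. ennreal (gauss z) * ennreal (cmod (f y) * cmod (f (y + e *\<^sub>R z))) \<partial>lborel \<partial>lborel)"
      by (subst lborel_pair.nn_integral_snd[symmetric])
        (auto simp: norm_mult mult_ac simp flip: ennreal_mult)
    also have "\<dots> \<le> (\<integral>\<^sup>+ z. ennreal (gauss (z::'a)) * ennreal ((norm (abs_L2 f))\<^sup>2) \<partial>lborel)"
    proof (rule nn_integral_mono)
      fix z :: 'a
      have I: "integrable lborel (\<lambda>y. (cmod (f y))\<^sup>2)" "integrable lborel (\<lambda>y. (cmod (f (y + e *\<^sub>R z)))\<^sup>2)"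
        using f2 square_integrable_shift[OF f2, of "e *\<^sub>R z"] by (auto simp: square_integrable_def)
      have "(\<integral>\<^sup>+ y. ennreal (cmod (f y) * cmod (f (y + e *\<^sub>R z))) \<partial>lborel)
          \<le> (\<integral>\<^sup>+ y. ennreal ((cmod (f y))\<^sup>2 / 2 + (cmod (f (y + e *\<^sub>R z)))\<^sup>2 / 2) \<partial>lborel)"
        by (intro nn_integral_mono ennreal_leI ab)
      also have "\<dots> = ennreal (LINT y|lborel. (cmod (f y))\<^sup>2 / 2 + (cmod (f (y + e *\<^sub>R z)))\<^sup>2 / 2)"
        using I by (intro nn_integral_eq_integral) auto
      also have "(LINT y|lborel. (cmod (f y))\<^sup>2 / 2 + (cmod (f (y + e *\<^sub>R z)))\<^sup>2 / 2) = (norm (abs_L2 f))\<^sup>2"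
        using I integral_lborel_translate[of "\<lambda>y. (cmod (f y))\<^sup>2" "e *\<^sub>R z"]
        by (simp add: power2_norm_abs_L2[OF f2])
      finally show "(\<integral>\<^sup>+ y. ennreal (gauss z) * ennreal (cmod (f y) * cmod (f (y + e *\<^sub>R z))) \<partial>lborel) \<le> ennreal (gauss z) * ennreal ((norm (abs_L2 f))\<^sup>2)"
        by (simp add: nn_integral_cmult mult_left_mono)
    qed
    also have "\<dots> < \<infinity>"
      using integrable_gauss[where 'a='a] by (simp add: nn_integral_multc integrable_iff_bounded ennreal_mult_less_top)
    finally show "(\<integral>\<^sup>+ p. ennreal (norm (case p of (y, z) \<Rightarrow> cnj (f y) * (f (y + e *\<^sub>R z) * complex_of_real (gauss z)))) \<partial>(lborel \<Otimes>\<^sub>M lborel)) < \<infinity>" .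
  qed measurable
  have "complex_of_real (LINT \<xi>|lborel. (cmod (fourier_integral f \<xi>))\<^sup>2 * G \<xi>)
      = (LINT \<xi>|lborel. of_real ((cmod (fourier_integral f \<xi>))\<^sup>2 * G \<xi>))"
    by (rule integral_complex_of_real[symmetric])
  also have "\<dots> = (LINT \<xi>|lborel. of_real (c\<^sup>2) * ((of_real (G \<xi>) * A \<xi>) * (LINT y|lborel. cnj (f y) * cis (y \<bullet> \<xi>))))"
  proof (intro Bochner_Integration.integral_cong refl)
    fix \<xi>
    have "(LINT y|lborel. cnj (f y) * cis (y \<bullet> \<xi>)) = cnj (A \<xi>)"
      unfolding A_def Bochner_Integration.integral_cnj[symmetric] by (simp add: cis_cnj mult.commute)
    then show "complex_of_real ((cmod (fourier_integral f \<xi>))\<^sup>2 * G \<xi>) = of_real (c\<^sup>2) * ((of_real (G \<xi>) * A \<xi>) * (LINT y|lborel. cnj (f y) * cis (y \<bullet> \<xi>)))"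
      by (simp add: FA norm_mult power_mult_distrib complex_norm_square[symmetric] mult_ac del: of_real_power)
  qed
  \<comment> \<open>So far the transform of f is merely known to be bounded; the integrable factor G
    is what makes this interchange legitimate.\<close>
  also have "\<dots> = of_real (c\<^sup>2) * (LINT y|lborel. cnj (f y) * (LINT \<xi>|lborel. (of_real (G \<xi>) * A \<xi>) * cis (y \<bullet> \<xi>)))"
    by (subst integral_mult_right_zero) (subst Fubini_product_kernel[OF GAi fcnj, of "\<lambda>\<xi> y. cis (y \<bullet> \<xi>)" 1], auto)
  also have "(\<lambda>y. LINT \<xi>|lborel. (of_real (G \<xi>) * A \<xi>) * cis (y \<bullet> \<xi>)) = (\<lambda>y. LINT x|lborel. f x * K (x - y))"
  proof
    fix y
    have "(LINT \<xi>|lborel. (of_real (G \<xi>) * A \<xi>) * cis (y \<bullet> \<xi>)) = (LINT \<xi>|lborel. of_real (G \<xi>) * (LINT x|lborel. f x * cis (- ((x - y) \<bullet> \<xi>))))"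
    proof (intro Bochner_Integration.integral_cong refl)
      fix \<xi>
      have "cis (- ((x - y) \<bullet> \<xi>)) = cis (y \<bullet> \<xi>) * cis (- (x \<bullet> \<xi>))" for x
        by (simp add: cis_mult inner_diff_left)
      then show "(of_real (G \<xi>) * A \<xi>) * cis (y \<bullet> \<xi>) = of_real (G \<xi>) * (LINT x|lborel. f x * cis (- ((x - y) \<bullet> \<xi>)))"
        by (simp add: A_def mult_ac flip: integral_mult_right_zero)
    qed
    also have "\<dots> = (LINT x|lborel. f x * (LINT \<xi>|lborel. of_real (G \<xi>) * cis (- ((x - y) \<bullet> \<xi>))))"
      by (rule Fubini_product_kernel[OF Gci f1, of _ 1]) auto
    finally show "(LINT \<xi>|lborel. (of_real (G \<xi>) * A \<xi>) * cis (y \<bullet> \<xi>)) = (LINT x|lborel. f x * K (x - y))" by (simp add: K_def)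
  qed
  also have "(\<lambda>y. LINT x|lborel. f x * K (x - y)) = (\<lambda>y. of_real (1 / c\<^sup>2) * (LINT z|lborel. f (y + e *\<^sub>R z) * of_real (gauss z)))"
  proof
    fix y
    have "(LINT x|lborel. f x * K (x - y)) = (LINT x|lborel. f (x + y) * K x)"
      by (subst integral_lborel_translate[where h=y, symmetric]) auto
    also have "\<dots> = e ^ DIM('a) *\<^sub>R (LINT z|lborel. f (e *\<^sub>R z + y) * K (e *\<^sub>R z))"
      by (rule integral_lborel_scale) (use e in auto)
    also have "\<dots> = of_real (1 / c\<^sup>2) * (LINT z|lborel. f (y + e *\<^sub>R z) * of_real (gauss z))"
      using e c by (simp add: Ke scaleR_conv_of_real add.commute field_simps flip: integral_mult_right_zero)
    finally show "(LINT x|lborel. f x * K (x - y)) = of_real (1 / c\<^sup>2) * (LINT z|lborel. f (y + e *\<^sub>R z) * of_real (gauss z))" .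
  qed
  also have "of_real (c\<^sup>2) * (LINT y|lborel. cnj (f y) * (of_real (1 / c\<^sup>2) * (LINT z|lborel. f (y + e *\<^sub>R z) * of_real (gauss z)))) =
      (LINT y|lborel. LINT z|lborel. cnj (f y) * (f (y + e *\<^sub>R z) * of_real (gauss z)))"
    using c by (simp add: mult.left_commute[of _ "1 / _"])
  also have "\<dots> = (LINT z|lborel. LINT y|lborel. cnj (f y) * (f (y + e *\<^sub>R z) * of_real (gauss z)))"
    by (rule lborel_pair.Fubini_integral[symmetric]) (rule pairI)
  also have lr: "(\<lambda>z. LINT y|lborel. cnj (f y) * (f (y + e *\<^sub>R z) * of_real (gauss z))) =
      (\<lambda>z. of_real (gauss z) * cinner (shift (e *\<^sub>R z) (abs_L2 f)) (abs_L2 f))" (is "?l = ?r")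
  proof
    fix z
    have "cinner (shift (e *\<^sub>R z) (abs_L2 f)) (abs_L2 f) = (LINT y|lborel. f (y + e *\<^sub>R z) * cnj (f y))"
      unfolding cinner_def using rep_abs_L2[OF f2] rep_abs_L2[OF square_integrable_shift[OF f2, of "e *\<^sub>R z"]]
      by (intro integral_cong_AE) (auto simp: shift_abs_L2[OF f2])
    then show "(LINT y|lborel. cnj (f y) * (f (y + e *\<^sub>R z) * of_real (gauss z))) = of_real (gauss z) * cinner (shift (e *\<^sub>R z) (abs_L2 f)) (abs_L2 f)"
      by (simp add: mult_ac flip: integral_mult_right_zero)
  qed
  finally have eq: "complex_of_real (LINT \<xi>|lborel. (cmod (fourier_integral f \<xi>))\<^sup>2 * G \<xi>) =
      (LINT z|lborel. of_real (gauss z) * cinner (shift (e *\<^sub>R z) (abs_L2 f)) (abs_L2 f))" .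
  show "(LINT \<xi>|lborel. (cmod (fourier_integral f \<xi>))\<^sup>2 * exp (- (norm (e *\<^sub>R \<xi>))\<^sup>2 / 2)) =
      (LINT z|lborel. gauss z * (shift (e *\<^sub>R z) (abs_L2 f) \<bullet> abs_L2 f))"
    unfolding G_def[symmetric]
  proof -
    have "integrable lborel ?r"
      unfolding lr[symmetric] using lborel_pair.integrable_snd[OF pairI] .
    from integral_Re[OF this] have "Re (integral\<^sup>L lborel ?r) = (LINT z|lborel. gauss z * (shift (e *\<^sub>R z) (abs_L2 f) \<bullet> abs_L2 f))"
      by (simp add: Re_cinner)
    then show "(LINT \<xi>|lborel. (cmod (fourier_integral f \<xi>))\<^sup>2 * G \<xi>) =
      (LINT z|lborel. gauss z * (shift (e *\<^sub>R z) (abs_L2 f) \<bullet> abs_L2 f))"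
      unfolding eq[symmetric] by simp
  qed
qed

text \<open>The Gaussian regularisation is removed on both sides: in frequency by monotone
  convergence, which also yields square-integrability, and in space by the continuity of
  translations in L^2.\<close>

lemma plancherel_integral:
  fixes f :: "'a::euclidean_space \<Rightarrow> complex"
  assumes f1: "integrable lborel f" and f2: "square_integrable f"
  shows "square_integrable (fourier_integral f)" "norm (abs_L2 (fourier_integral f)) = norm (abs_L2 f)"
proof -
  define u where "u = abs_L2 f"
  have [measurable]: "f \<in> borel_measurable borel" using f2 by (simp add: square_integrableD)
  have m[measurable]: "fourier_integral f \<in> borel_measurable borel" by (rule borel_measurable_fourier_integral) measurable
  define e where "e n = inverse (real (Suc n))" for n
  have e: "e n > 0" for n by (simp add: e_def)
  have e0: "e \<longlonglongrightarrow> 0" unfolding e_def by (rule LIMSEQ_inverse_real_of_nat)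
  define W where "W n \<xi> = (cmod (fourier_integral f \<xi>))\<^sup>2 * exp (- (norm (e n *\<^sub>R \<xi>))\<^sup>2 / 2)" for n \<xi>
  note reg = gauss_regularized_plancherel[OF f1 f2 e, folded W_def u_def]
  have "(\<lambda>n. LINT z|lborel. gauss z * (shift (e n *\<^sub>R z) u \<bullet> u)) \<longlonglongrightarrow> (LINT z|lborel. gauss (z::'a) * (u \<bullet> u))"
  proof (rule integral_dominated_convergence[where w="\<lambda>z. gauss z * (norm u * norm u)"])
    show "AE z in lborel. (\<lambda>n. gauss z * (shift (e n *\<^sub>R z) u \<bullet> u)) \<longlonglongrightarrow> gauss (z::'a) * (u \<bullet> u)"
    proof (rule AE_I2)
      fix z :: 'a
      have "(\<lambda>n. e n *\<^sub>R z) \<longlonglongrightarrow> 0" using tendsto_scaleR[OF e0 tendsto_const, of z] by simp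
      then show "(\<lambda>n. gauss z * (shift (e n *\<^sub>R z) u \<bullet> u)) \<longlonglongrightarrow> gauss z * (u \<bullet> u)"
        by (intro tendsto_intros tendsto_shift)
    qed
    show "AE z in lborel. norm (gauss z * (shift (e n *\<^sub>R z) u \<bullet> u)) \<le> gauss z * (norm u * norm u)" for n
      using Cauchy_Schwarz_ineq2[of "shift (e n *\<^sub>R _) u" u]
      by (auto simp: abs_mult intro!: mult_left_mono)
    show "(\<lambda>z. gauss z * (shift (e n *\<^sub>R z) u \<bullet> u)) \<in> borel_measurable lborel" for n
    proof -
      have "(\<lambda>z. shift (e n *\<^sub>R z) u \<bullet> u) = (\<lambda>z. LINT x|lborel. rep_L2 u (x + e n *\<^sub>R z) \<bullet> rep_L2 u x)"
      proof
        fix z show "shift (e n *\<^sub>R z) u \<bullet> u = (LINT x|lborel. rep_L2 u (x + e n *\<^sub>R z) \<bullet> rep_L2 u x)"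
          unfolding inner_L2_eq using rep_shift[of "e n *\<^sub>R z" u] by (intro integral_cong_AE) auto
      qed
      then have "(\<lambda>z. shift (e n *\<^sub>R z) u \<bullet> u) \<in> borel_measurable borel" by simp
      then show ?thesis by (intro borel_measurable_times) auto
    qed
  qed (auto intro: integrable_gauss)
  also have "(LINT z|lborel. gauss (z::'a) * (u \<bullet> u)) = (norm u)\<^sup>2"
    by (simp add: integral_gauss power2_norm_eq_inner)
  finally have lim: "(\<lambda>n. LINT \<xi>|lborel. W n \<xi>) \<longlonglongrightarrow> (norm u)\<^sup>2" using reg(2) by simp
  have Wmono: "mono (\<lambda>n. W n \<xi>)" for \<xi>
  proof (rule incseq_SucI)
    fix n
    have "norm (e (Suc n) *\<^sub>R \<xi>) \<le> norm (e n *\<^sub>R \<xi>)"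
      by (auto simp: e_def intro!: mult_right_mono)
    then have "(norm (e (Suc n) *\<^sub>R \<xi>))\<^sup>2 \<le> (norm (e n *\<^sub>R \<xi>))\<^sup>2" by (rule power_mono) simp
    then show "W n \<xi> \<le> W (Suc n) \<xi>" unfolding W_def by (intro mult_left_mono) auto
  qed
  have Wlim: "(\<lambda>n. W n \<xi>) \<longlonglongrightarrow> (cmod (fourier_integral f \<xi>))\<^sup>2" for \<xi>
  proof -
    have "(\<lambda>n. (cmod (fourier_integral f \<xi>))\<^sup>2 * exp (- (norm (e n *\<^sub>R \<xi>))\<^sup>2 / 2)) \<longlonglongrightarrow> (cmod (fourier_integral f \<xi>))\<^sup>2 * exp (- (norm (0 *\<^sub>R \<xi>))\<^sup>2 / 2)"
      by (intro tendsto_intros e0) simp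
    then show ?thesis by (simp add: W_def)
  qed
  have Wi: "integrable lborel (W n)" for n using reg(1) by (simp add: W_def[abs_def])
  have "integrable lborel (\<lambda>\<xi>. (cmod (fourier_integral f \<xi>))\<^sup>2)"
    by (rule integrable_monotone_convergence[OF Wi _ _ lim]) (auto simp: Wmono Wlim)
  then show sq: "square_integrable (fourier_integral f)" by (simp add: square_integrable_def)
  have "(LINT \<xi>|lborel. (cmod (fourier_integral f \<xi>))\<^sup>2) = (norm u)\<^sup>2"
    by (rule integral_monotone_convergence[OF Wi _ _ lim]) (auto simp: Wmono Wlim)
  then have "(norm (abs_L2 (fourier_integral f)))\<^sup>2 = (norm u)\<^sup>2"
    by (simp add: power2_norm_abs_L2[OF sq])
  then show "norm (abs_L2 (fourier_integral f)) = norm (abs_L2 f)" by (simp add: u_def)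
qed

section \<open>Extension of the Fourier transform to L^2\<close>

lemma fourier_integral_add:
  assumes "integrable lborel f" "integrable lborel g"
  shows "fourier_integral (\<lambda>x. f x + g x) = (\<lambda>\<xi>. fourier_integral f \<xi> + fourier_integral g \<xi>)"
  using assms by (simp add: fourier_integral_def fun_eq_iff distrib_left integrable_cis_mult)

lemma fourier_integral_cmult:
  "fourier_integral (\<lambda>x. c * f x) = (\<lambda>\<xi>. c * fourier_integral f \<xi>)"
  by (simp add: fourier_integral_def fun_eq_iff mult.left_commute[of _ c])

lemma fourier_integral_diff:
  assumes "integrable lborel f" "integrable lborel g"
  shows "fourier_integral (\<lambda>x. f x - g x) = (\<lambda>\<xi>. fourier_integral f \<xi> - fourier_integral g \<xi>)"
  using assms by (simp add: fourier_integral_def fun_eq_iff right_diff_distrib integrable_cis_mult)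

lemma fourier_integral_cong_AE:
  assumes [measurable]: "f \<in> borel_measurable borel" "g \<in> borel_measurable borel" and "AE x in lborel. f x = g x"
  shows "fourier_integral f = fourier_integral g"
  unfolding fourier_integral_def fun_eq_iff using assms(3)
  by (intro allI arg_cong[where f="\<lambda>x. _ * x"] integral_cong_AE) auto

lemma norm_fourier_integral_diff:
  assumes "integrable lborel f" "square_integrable f" "integrable lborel g" "square_integrable g"
  shows "norm (abs_L2 (fourier_integral f) - abs_L2 (fourier_integral g)) = norm (abs_L2 f - abs_L2 g)"
  using plancherel_integral[of "\<lambda>x. f x - g x"] assms
  by (simp add: abs_L2_diff plancherel_integral square_integrable_diff fourier_integral_diff)

definition trunc :: "real \<Rightarrow> 'a::euclidean_space L2 \<Rightarrow> 'a L2" where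
  "trunc R = pmult (indicator (cball 0 R))"

lemma bounded_multiplier_indicator: "A \<in> sets borel \<Longrightarrow> bounded_multiplier (indicator A)"
  by (rule bounded_multiplierI[where B=1]) (auto split: split_indicator)

lemma square_integrable_trunc:
  "square_integrable f \<Longrightarrow> square_integrable (\<lambda>x. indicator (cball 0 R) x * f x)"
  by (intro square_integrable_pmult bounded_multiplier_indicator) auto

lemma integrable_trunc:
  fixes f :: "'a::euclidean_space \<Rightarrow> complex"
  assumes "square_integrable f"
  shows "integrable lborel (\<lambda>x. indicator (cball 0 R) x * f x)"
  by (intro square_integrable_mult assms square_integrable_indicator emeasure_lborel_cball_finite) auto

lemma borel_measurable_trunc [measurable]:
  fixes f :: "'a::euclidean_space \<Rightarrow> complex"
  shows "f \<in> borel_measurable borel \<Longrightarrow> (\<lambda>x. indicator (cball 0 R) x * f x) \<in> borel_measurable borel"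
  by (intro borel_measurable_times borel_measurable_indicator) auto

lemma trunc_eq: "trunc R u = abs_L2 (\<lambda>x. indicator (cball 0 R) x * rep_L2 u x)"
  by (simp add: trunc_def pmult_def)

lemma tendsto_trunc: "((\<lambda>R. trunc R u) \<longlongrightarrow> u) at_top"
  unfolding trunc_def by (rule tendsto_pmult_cball)

text \<open>\<open>fourier\<close> is a \<open>Lim\<close>, so convergence has to be shown before
  its value can be used. By Plancherel the transforms of truncations are as far apart as the
  truncations themselves, hence Cauchy; the same identity passes from integer radii to all real
  ones.\<close>

lemma tendsto_fourier:
  "((\<lambda>R. abs_L2 (fourier_integral (\<lambda>x. indicator (cball 0 R) x * rep_L2 u x))) \<longlongrightarrow> fourier u) at_top"
proof -
  define X where "X R = abs_L2 (fourier_integral (\<lambda>x. indicator (cball 0 R) x * rep_L2 u x))" for R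
  have d: "norm (X R - X S) = norm (trunc R u - trunc S u)" for R S
    unfolding X_def trunc_eq by (intro norm_fourier_integral_diff integrable_trunc square_integrable_trunc) auto
  have tr: "(\<lambda>n. trunc (real n) u) \<longlonglongrightarrow> u"
    using tendsto_trunc filterlim_real_sequentially by (rule filterlim_compose)
  have "Cauchy (\<lambda>n. X (real n))"
    using LIMSEQ_imp_Cauchy[OF tr] by (simp add: Cauchy_def dist_norm d)
  then obtain L where L: "(\<lambda>n. X (real n)) \<longlonglongrightarrow> L"
    using Cauchy_convergent by (auto simp: convergent_def)
  have "norm (X R - L) = norm (trunc R u - u)" for R
  proof (rule LIMSEQ_unique)
    show "(\<lambda>n. norm (X R - X (real n))) \<longlonglongrightarrow> norm (X R - L)"
      by (intro tendsto_intros L)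
    show "(\<lambda>n. norm (X R - X (real n))) \<longlonglongrightarrow> norm (trunc R u - u)"
      unfolding d by (intro tendsto_intros tr)
  qed
  moreover have "((\<lambda>R. norm (trunc R u - u)) \<longlongrightarrow> 0) at_top"
    using tendsto_trunc[of u] by (simp add: LIM_zero tendsto_norm_zero)
  ultimately have "((\<lambda>R. norm (X R - L)) \<longlongrightarrow> 0) at_top" by simp
  then have "(X \<longlongrightarrow> L) at_top" by (simp add: tendsto_norm_zero_iff LIM_zero_iff)
  then have "(X \<longlongrightarrow> fourier u) at_top"
    unfolding fourier_def X_def[symmetric] by (simp add: tendsto_Lim)
  then show ?thesis by (simp add: X_def[abs_def])
qed

lemma fourier_abs_L2:
  assumes "integrable lborel f" "square_integrable f"
  shows "fourier (abs_L2 f) = abs_L2 (fourier_integral f)"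
proof (rule tendsto_unique[OF _ tendsto_fourier])
  let ?X = "\<lambda>R. abs_L2 (fourier_integral (\<lambda>x. indicator (cball 0 R) x * rep_L2 (abs_L2 f) x))"
  have "norm (?X R - abs_L2 (fourier_integral f)) = norm (trunc R (abs_L2 f) - abs_L2 f)" for R
    unfolding trunc_eq by (intro norm_fourier_integral_diff integrable_trunc square_integrable_trunc assms) auto
  moreover have "((\<lambda>R. norm (trunc R (abs_L2 f) - abs_L2 f)) \<longlongrightarrow> 0) at_top"
    using tendsto_trunc[of "abs_L2 f"] by (simp add: LIM_zero tendsto_norm_zero)
  ultimately have "((\<lambda>R. norm (?X R - abs_L2 (fourier_integral f))) \<longlongrightarrow> 0) at_top" by simp
  then show "(?X \<longlongrightarrow> abs_L2 (fourier_integral f)) at_top" by (simp add: tendsto_norm_zero_iff LIM_zero_iff)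
qed auto

text \<open>Truncations to balls are integrable and converge to u, so continuous maps that agree on
  integrable functions agree everywhere. This is how formulas for the Fourier integral pass to
  \<open>fourier\<close>.\<close>

lemma L2_eq_on_integrable:
  assumes A: "continuous_on UNIV A" and B: "continuous_on UNIV B"
    and eq: "\<And>f. integrable lborel f \<Longrightarrow> square_integrable f \<Longrightarrow> A (abs_L2 f) = (B (abs_L2 f) :: 'b::t2_space)"
  shows "A u = B u"
proof (rule tendsto_unique)
  have c: "(A \<longlongrightarrow> A u) (nhds u)" "(B \<longlongrightarrow> B u) (nhds u)"
    using A B by (auto simp: continuous_on_eq_continuous_at isCont_def tendsto_at_iff_tendsto_nhds)
  show "((\<lambda>R. A (trunc R u)) \<longlongrightarrow> A u) at_top"
    using c(1) tendsto_trunc by (rule filterlim_compose)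
  have "((\<lambda>R. B (trunc R u)) \<longlongrightarrow> B u) at_top"
    using c(2) tendsto_trunc by (rule filterlim_compose)
  moreover have "A (trunc R u) = B (trunc R u)" for R
    unfolding trunc_eq by (intro eq integrable_trunc square_integrable_trunc) auto
  ultimately show "((\<lambda>R. A (trunc R u)) \<longlongrightarrow> B u) at_top" by simp
qed simp

lemma fourier_add: "fourier (u + v) = fourier u + fourier v"
proof (rule tendsto_unique[OF _ tendsto_fourier])
  let ?X = "\<lambda>u R. abs_L2 (fourier_integral (\<lambda>x. indicator (cball 0 R) x * rep_L2 u x))"
  have "?X (u + v) R = ?X u R + ?X v R" for R
  proof -
    have "fourier_integral (\<lambda>x. indicator (cball 0 R) x * rep_L2 (u + v) x) =
        fourier_integral (\<lambda>x. indicator (cball 0 R) x * rep_L2 u x + indicator (cball 0 R) x * rep_L2 v x)"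
      using rep_L2_add[of u v] by (intro fourier_integral_cong_AE) (auto simp: distrib_left)
    then show ?thesis
      by (simp add: abs_L2_add plancherel_integral integrable_trunc square_integrable_trunc fourier_integral_add)
  qed
  then show "(?X (u + v) \<longlongrightarrow> fourier u + fourier v) at_top"
    by (simp add: tendsto_add tendsto_fourier)
qed auto

lemma fourier_cscale: "fourier (cscale_L2 c u) = cscale_L2 c (fourier u)"
proof (rule tendsto_unique[OF _ tendsto_fourier])
  let ?X = "\<lambda>u R. abs_L2 (fourier_integral (\<lambda>x. indicator (cball 0 R) x * rep_L2 u x))"
  have "?X (cscale_L2 c u) R = cscale_L2 c (?X u R)" for R
  proof -
    have "fourier_integral (\<lambda>x. indicator (cball 0 R) x * rep_L2 (cscale_L2 c u) x) =
        fourier_integral (\<lambda>x. c * (indicator (cball 0 R) x * rep_L2 u x))"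
      using rep_L2_cscale[of c u] by (intro fourier_integral_cong_AE) auto
    then show ?thesis
      by (simp add: abs_L2_cscale plancherel_integral integrable_trunc square_integrable_trunc fourier_integral_cmult)
  qed
  then show "(?X (cscale_L2 c u) \<longlongrightarrow> cscale_L2 c (fourier u)) at_top"
    by (simp add: bounded_linear.tendsto[OF bounded_linear_cscale_L2] tendsto_fourier)
qed auto

lemma norm_fourier [simp]: "norm (fourier u) = norm u"
proof (rule tendsto_unique[OF _ tendsto_norm[OF tendsto_fourier]])
  have "norm (abs_L2 (fourier_integral (\<lambda>x. indicator (cball 0 R) x * rep_L2 u x))) = norm (trunc R u)" for R
    unfolding trunc_eq by (intro plancherel_integral integrable_trunc square_integrable_trunc) auto
  then show "((\<lambda>R. norm (abs_L2 (fourier_integral (\<lambda>x. indicator (cball 0 R) x * rep_L2 u x)))) \<longlongrightarrow> norm u) at_top"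
    by (simp add: tendsto_norm tendsto_trunc)
qed auto

lemma fourier_scaleR: "fourier (r *\<^sub>R u) = r *\<^sub>R fourier u"
  by (simp add: fourier_cscale flip: cscale_L2_of_real)

lemma bounded_linear_fourier: "bounded_linear fourier"
  by (rule bounded_linear_intro[where K=1]) (auto simp: fourier_add fourier_scaleR)

lemma inner_fourier: "fourier u \<bullet> fourier v = u \<bullet> v"
proof -
  have "(norm (fourier u + fourier v))\<^sup>2 = (norm (u + v))\<^sup>2"
    by (simp flip: fourier_add)
  then show ?thesis by (simp only: dot_norm norm_fourier)
qed

section \<open>The inverse Fourier transform\<close>

definition conj_L2 :: "'a::euclidean_space L2 \<Rightarrow> 'a L2" where
  "conj_L2 u = abs_L2 (\<lambda>x. cnj (rep_L2 u x))"

lemma conj_abs_L2: "square_integrable f \<Longrightarrow> conj_L2 (abs_L2 f) = abs_L2 (\<lambda>x. cnj (f x))"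
  unfolding conj_L2_def using rep_abs_L2 by (intro abs_L2_cong_AE) auto

lemma conj_conj_L2 [simp]: "conj_L2 (conj_L2 u) = u"
  using conj_abs_L2[of "\<lambda>x. cnj (rep_L2 u x)"] by (simp add: conj_L2_def)

lemma conj_L2_add: "conj_L2 (u + v) = conj_L2 u + conj_L2 v"
  unfolding conj_L2_def using rep_L2_add[of u v]
  by (subst abs_L2_add) (auto intro!: abs_L2_cong_AE square_integrable_add)

lemma conj_L2_cscale: "conj_L2 (cscale_L2 c u) = cscale_L2 (cnj c) (conj_L2 u)"
  unfolding conj_L2_def using rep_L2_cscale[of c u]
  by (subst abs_L2_cscale) (auto intro!: abs_L2_cong_AE square_integrable_cmult)

lemma norm_conj_L2 [simp]: "norm (conj_L2 u) = norm u"
proof (rule power2_eq_imp_eq)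
  show "(norm (conj_L2 u))\<^sup>2 = (norm u)\<^sup>2"
    unfolding conj_L2_def power2_norm_L2[of u] by (subst power2_norm_abs_L2) auto
qed auto

lemma bounded_linear_conj_L2: "bounded_linear conj_L2"
  by (rule bounded_linear_intro[where K=1])
    (auto simp: conj_L2_add conj_L2_cscale simp flip: cscale_L2_of_real)

text \<open>Conjugating before and after the transform reverses the sign of the exponent.\<close>

definition ifourier :: "'a::euclidean_space L2 \<Rightarrow> 'a L2" where
  "ifourier u = conj_L2 (fourier (conj_L2 u))"

lemma bounded_linear_ifourier: "bounded_linear ifourier"
  unfolding ifourier_def[abs_def]
  by (intro bounded_linear_compose[OF bounded_linear_conj_L2] bounded_linear_compose[OF bounded_linear_fourier]
      bounded_linear_conj_L2)

text \<open>The multiplication formula, which moves the transform from one factor of an integral to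
  the other, is Fubini for integrable functions and extends by density in each argument
  separately.\<close>

lemma inner_fourier_left: "fourier u \<bullet> v = u \<bullet> ifourier v"
proof -
  have *: "fourier u \<bullet> conj_L2 w = u \<bullet> conj_L2 (fourier w)" for w
  proof (rule L2_eq_on_integrable[where u=u])
    fix f :: "'a \<Rightarrow> complex" assume f: "integrable lborel f" "square_integrable f"
    show "fourier (abs_L2 f) \<bullet> conj_L2 w = abs_L2 f \<bullet> conj_L2 (fourier w)"
    proof (rule L2_eq_on_integrable[where u=w])
      fix g :: "'a \<Rightarrow> complex" assume g: "integrable lborel g" "square_integrable g"
      let ?c = "complex_of_real ((2 * pi) powr (- real DIM('a) / 2))"
      have I: "integrable lborel (\<lambda>x. fourier_integral f x * g x)" "integrable lborel (\<lambda>x. f x * fourier_integral g x)"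
        by (intro square_integrable_mult plancherel_integral f g)+
      have "(LINT x|lborel. fourier_integral f x * g x) = ?c * (LINT \<xi>|lborel. g \<xi> * (LINT x|lborel. f x * cis (- (x \<bullet> \<xi>))))"
        by (subst integral_mult_right_zero[symmetric]) (simp add: fourier_integral_def mult_ac)
      also have "(LINT \<xi>|lborel. g \<xi> * (LINT x|lborel. f x * cis (- (x \<bullet> \<xi>)))) = (LINT x|lborel. f x * (LINT \<xi>|lborel. g \<xi> * cis (- (x \<bullet> \<xi>))))"
        by (rule Fubini_product_kernel[OF g(1) f(1), of _ 1]) auto
      also have "?c * \<dots> = (LINT x|lborel. f x * fourier_integral g x)"
        by (subst integral_mult_right_zero[symmetric]) (simp add: fourier_integral_def mult_ac inner_commute)
      finally have "Re (LINT x|lborel. fourier_integral f x * g x) = Re (LINT x|lborel. f x * fourier_integral g x)"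
        by simp
      moreover have "fourier (abs_L2 f) \<bullet> conj_L2 (abs_L2 g) = Re (LINT x|lborel. fourier_integral f x * g x)"
        by (subst integral_Re[OF I(1), symmetric])
          (simp add: f g fourier_abs_L2 conj_abs_L2 inner_abs_L2 plancherel_integral inner_complex_def)
      moreover have "abs_L2 f \<bullet> conj_L2 (fourier (abs_L2 g)) = Re (LINT x|lborel. f x * fourier_integral g x)"
        by (subst integral_Re[OF I(2), symmetric])
          (simp add: f g fourier_abs_L2 conj_abs_L2 inner_abs_L2 plancherel_integral inner_complex_def)
      ultimately show "fourier (abs_L2 f) \<bullet> conj_L2 (abs_L2 g) = abs_L2 f \<bullet> conj_L2 (fourier (abs_L2 g))"
        by simp
    qed (intro linear_continuous_on bounded_linear_compose[OF bounded_linear_inner_right]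
          bounded_linear_conj_L2 bounded_linear_compose[OF bounded_linear_conj_L2] bounded_linear_fourier)+
  qed (intro linear_continuous_on bounded_linear_compose[OF bounded_linear_inner_left] bounded_linear_inner_left bounded_linear_fourier)+
  show ?thesis using *[of "conj_L2 v"] by (simp add: ifourier_def)
qed

text \<open>The adjoint of an isometry is a left inverse.\<close>

lemma ifourier_fourier [simp]: "ifourier (fourier u) = u"
proof -
  have "w \<bullet> (ifourier (fourier u) - u) = 0" for w
    by (simp add: inner_diff_right inner_fourier flip: inner_fourier_left)
  from this[of "ifourier (fourier u) - u"] show ?thesis by simp
qed

text \<open>Conjugation exchanges the two compositions, so the left inverse is also a right inverse
  and the transform is onto.\<close>

lemma fourier_ifourier [simp]: "fourier (ifourier u) = u"
proof -
  have "conj_L2 (fourier (conj_L2 (fourier (conj_L2 u)))) = conj_L2 u"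
    using ifourier_fourier[of "conj_L2 u"] by (simp add: ifourier_def)
  then have "conj_L2 (conj_L2 (fourier (conj_L2 (fourier (conj_L2 u))))) = conj_L2 (conj_L2 u)" by simp
  then show ?thesis by (simp add: ifourier_def)
qed

lemma cinner_fourier: "cinner (fourier u) (fourier v) = cinner u v"
  by (simp add: cinner_eq inner_fourier flip: fourier_cscale)

section \<open>Translations and modulations in frequency\<close>

lemma bounded_multiplier_cis: "g \<in> borel_measurable borel \<Longrightarrow> bounded_multiplier (\<lambda>x. cis (g x))"
  by (rule bounded_multiplierI[where B=1]) auto

lemma fourier_shift: "fourier (shift h u) = pmult (\<lambda>\<xi>. cis (h \<bullet> \<xi>)) (fourier u)"
proof (rule L2_eq_on_integrable[where u=u,
      OF linear_continuous_on[OF bounded_linear_compose[OF bounded_linear_fourier bounded_linear_shift]]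
        linear_continuous_on[OF bounded_linear_compose[OF bounded_linear_pmult[OF bounded_multiplier_cis] bounded_linear_fourier]]])
  fix f :: "'a \<Rightarrow> complex" assume f: "integrable lborel f" "square_integrable f"
  then have [measurable]: "f \<in> borel_measurable borel" by auto
  have i: "integrable lborel (\<lambda>x. f (x + h))"
    using f(1) integrable_distr_eq[of "(+) h" lborel borel f] by (simp add: lborel_distr_plus add.commute)
  have "fourier_integral (\<lambda>x. f (x + h)) \<xi> = cis (h \<bullet> \<xi>) * fourier_integral f \<xi>" for \<xi>
  proof -
    have "(LINT x|lborel. cis (- (x \<bullet> \<xi>)) * f (x + h)) = (LINT x|lborel. cis (- ((x + h - h) \<bullet> \<xi>)) * f (x + h))"
      by simp
    also have "\<dots> = (LINT x|lborel. cis (- ((x - h) \<bullet> \<xi>)) * f x)"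
      by (rule integral_lborel_translate) measurable
    also have "\<dots> = (LINT x|lborel. cis (h \<bullet> \<xi>) * (cis (- (x \<bullet> \<xi>)) * f x))"
      by (intro Bochner_Integration.integral_cong refl) (simp add: inner_diff_left cis_mult flip: mult.assoc)
    finally show ?thesis by (simp add: fourier_integral_def)
  qed
  then have "fourier_integral (\<lambda>x. f (x + h)) = (\<lambda>\<xi>. cis (h \<bullet> \<xi>) * fourier_integral f \<xi>)" by blast
  then show "fourier (shift h (abs_L2 f)) = pmult (\<lambda>\<xi>. cis (h \<bullet> \<xi>)) (fourier (abs_L2 f))"
    using f i by (simp add: shift_abs_L2 fourier_abs_L2 square_integrable_shift pmult_abs_L2 plancherel_integral
        bounded_multiplier_cis)
qed auto

lemma fourier_modulation: "fourier (pmult (\<lambda>x. cis (k \<bullet> x)) u) = shift (- k) (fourier u)"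
proof (rule L2_eq_on_integrable[where u=u,
      OF linear_continuous_on[OF bounded_linear_compose[OF bounded_linear_fourier bounded_linear_pmult[OF bounded_multiplier_cis]]]
        linear_continuous_on[OF bounded_linear_compose[OF bounded_linear_shift bounded_linear_fourier]]])
  fix f :: "'a \<Rightarrow> complex" assume f: "integrable lborel f" "square_integrable f"
  have b: "bounded_multiplier (\<lambda>x. cis (k \<bullet> x))" by (rule bounded_multiplier_cis) measurable
  have i: "integrable lborel (\<lambda>x. cis (k \<bullet> x) * f x)" by (rule integrable_cis_mult[OF f(1)]) measurable
  have "fourier_integral (\<lambda>x. cis (k \<bullet> x) * f x) \<xi> = fourier_integral f (\<xi> - k)" for \<xi>
    by (simp add: fourier_integral_def inner_diff_right cis_mult inner_commute algebra_simps flip: mult.assoc)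
  then have "fourier_integral (\<lambda>x. cis (k \<bullet> x) * f x) = (\<lambda>\<xi>. fourier_integral f (\<xi> - k))" by blast
  then show "fourier (pmult (\<lambda>x. cis (k \<bullet> x)) (abs_L2 f)) = shift (- k) (fourier (abs_L2 f))"
    using f i b by (simp add: pmult_abs_L2 fourier_abs_L2 square_integrable_pmult shift_abs_L2 plancherel_integral)
qed auto

section \<open>Test functions\<close>

lemma Ck_SucI:
  assumes "\<And>x. (\<phi> has_derivative \<phi>' x) (at x)" "\<And>b. b \<in> Basis \<Longrightarrow> Ck k (\<lambda>x. \<phi>' x b)"
  shows "Ck (Suc k) \<phi>"
proof -
  have "frechet_derivative \<phi> (at x) = \<phi>' x" for x
    using frechet_derivative_at[OF assms(1)] by simp
  then show ?thesis using assms by (auto simp: differentiable_def)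
qed

lemma Ck_SucD:
  assumes "Ck (Suc k) \<phi>"
  shows "(\<phi> has_derivative frechet_derivative \<phi> (at x)) (at x)" "b \<in> Basis \<Longrightarrow> Ck k (\<lambda>x. frechet_derivative \<phi> (at x) b)"
  using assms by (auto simp: frechet_derivative_works)

lemma Ck_continuous: "Ck k \<phi> \<Longrightarrow> continuous_on UNIV \<phi>"
  by (cases k) (auto intro!: differentiable_imp_continuous_on simp: differentiable_on_def differentiable_at_withinI)

lemma Ck_Suc_imp: "Ck (Suc k) \<phi> \<Longrightarrow> Ck k \<phi>"
proof (induction k arbitrary: \<phi>)
  case 0
  then show ?case using Ck_continuous by fastforce
next
  case (Suc k)
  show ?case by (rule Ck_SucI[OF Ck_SucD(1)[OF Suc(2)]]) (rule Suc.IH[OF Ck_SucD(2)[OF Suc(2)]])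
qed

lemma Ck_const: "Ck k (\<lambda>x. c)"
proof (induction k arbitrary: c)
  case (Suc k)
  show ?case by (rule Ck_SucI[where \<phi>'="\<lambda>x y. 0"]) (auto intro: Suc)
qed simp

lemma Ck_inner: "Ck k (\<lambda>x. x \<bullet> a)"
proof (cases k)
  case (Suc k)
  show ?thesis unfolding Suc
    by (rule Ck_SucI[where \<phi>'="\<lambda>x y. y \<bullet> a"]) (auto intro!: Ck_const derivative_eq_intros)
qed (auto intro!: continuous_intros)

lemma Ck_add: "Ck k \<phi> \<Longrightarrow> Ck k \<psi> \<Longrightarrow> Ck k (\<lambda>x. \<phi> x + \<psi> x)"
proof (induction k arbitrary: \<phi> \<psi>)
  case (Suc k)
  show ?case
    by (rule Ck_SucI[OF has_derivative_add[OF Ck_SucD(1)[OF Suc(2)] Ck_SucD(1)[OF Suc(3)]]])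
      (intro Suc.IH Ck_SucD(2)[OF Suc(2)] Ck_SucD(2)[OF Suc(3)])
qed (auto intro: continuous_intros)

lemma Ck_mult: "Ck k \<phi> \<Longrightarrow> Ck k \<psi> \<Longrightarrow> Ck k (\<lambda>x. \<phi> x * \<psi> x)"
proof (induction k arbitrary: \<phi> \<psi>)
  case (Suc k)
  show ?case
    by (rule Ck_SucI[OF has_derivative_mult[OF Ck_SucD(1)[OF Suc(2)] Ck_SucD(1)[OF Suc(3)]]])
      (intro Ck_add Suc.IH Ck_SucD(2)[OF Suc(2)] Ck_SucD(2)[OF Suc(3)] Ck_Suc_imp[OF Suc(2)] Ck_Suc_imp[OF Suc(3)])
qed (auto intro: continuous_intros)

lemma Ck_prod:
  assumes "\<And>i. i \<in> I \<Longrightarrow> Ck k (\<phi> i)"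
  shows "Ck k (\<lambda>x. \<Prod>i\<in>I. \<phi> i x)"
  using assms by (induction I rule: infinite_finite_induct) (auto intro: Ck_const Ck_mult)

text \<open>The induction differentiates the outer function, so it runs over a whole family closed
  under derivatives instead of a single g.\<close>

lemma Ck_compose:
  assumes F: "\<And>g. g \<in> F \<Longrightarrow> \<exists>g'\<in>F. \<forall>t. (g has_real_derivative g' t) (at t)"
  shows "g \<in> F \<Longrightarrow> Ck k \<psi> \<Longrightarrow> Ck k (\<lambda>x. g (\<psi> x))"
proof (induction k arbitrary: g \<psi>)
  case 0
  obtain g' where "\<forall>t. (g has_real_derivative g' t) (at t)" using F[OF 0(1)] by blast
  then have "continuous_on UNIV g"
    using DERIV_isCont by (auto simp: continuous_on_eq_continuous_at)
  with 0 show ?case by (auto intro: continuous_on_compose2)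
next
  case (Suc k)
  obtain g' where g': "g' \<in> F" "\<And>t. (g has_real_derivative g' t) (at t)" using F[OF Suc(2)] by blast
  show ?case
  proof (rule Ck_SucI)
    show "((\<lambda>x. g (\<psi> x)) has_derivative (\<lambda>y. frechet_derivative \<psi> (at x) y * g' (\<psi> x))) (at x)" for x
      by (rule has_derivative_compose[OF Ck_SucD(1)[OF Suc(3)], of g "\<lambda>y. y * g' (\<psi> x)"])
        (use g'(2) in \<open>auto simp: has_field_derivative_def mult_commute_abs\<close>)
    show "Ck k (\<lambda>x. frechet_derivative \<psi> (at x) b * g' (\<psi> x))" if "b \<in> Basis" for b
      by (rule Ck_mult[OF Ck_SucD(2)[OF Suc(3) that] Suc.IH[OF g'(1) Ck_Suc_imp[OF Suc(3)]]])
  qed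
qed

text \<open>Closed under differentiation, which makes the functions \<open>flat p\<close> smooth.\<close>

definition flat :: "real poly \<Rightarrow> real \<Rightarrow> real" where
  "flat p t = (if 0 < t then poly p (1 / t) * exp (- 1 / t) else 0)"

lemma tendsto_poly_exp: "((\<lambda>x. poly p x / exp x) \<longlongrightarrow> 0) (at_top :: real filter)"
proof -
  have "((\<lambda>x. \<Sum>i\<le>degree p. coeff p i * (x ^ i / exp x)) \<longlongrightarrow> (\<Sum>i\<le>degree p. coeff p i * 0)) (at_top :: real filter)"
    by (intro tendsto_intros tendsto_power_div_exp_0)
  then show ?thesis by (simp add: poly_altdef sum_divide_distrib)
qed

text \<open>For t > 0 the chain rule turns p(x) into x^2 (p(x) - p'(x)) with x = 1/t, which explains
  the polynomial. At 0 the quotient from the right is a polynomial in 1/h divided by exp (1/h) and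
  tends to 0.\<close>

lemma flat_has_derivative: "(flat p has_real_derivative flat ([:0, 0, 1:] * (p - pderiv p)) t) (at t)"
proof -
  consider "t > 0" | "t < 0" | "t = 0" by linarith
  then show ?thesis
  proof cases
    case 1
    have "((\<lambda>t. poly p (1 / t) * exp (- 1 / t)) has_real_derivative flat ([:0, 0, 1:] * (p - pderiv p)) t) (at t)"
      using 1 by (auto intro!: derivative_eq_intros simp: flat_def field_simps power2_eq_square)
    then show ?thesis
      by (rule has_field_derivative_transform_within_open[of _ _ _ "{0<..}"]) (use 1 in \<open>auto simp: flat_def\<close>)
  next
    case 2
    have "((\<lambda>t. 0) has_real_derivative flat ([:0, 0, 1:] * (p - pderiv p)) t) (at t)"
      using 2 by (auto simp: flat_def)
    then show ?thesis
      by (rule has_field_derivative_transform_within_open[of _ _ _ "{..<0}"]) (use 2 in \<open>auto simp: flat_def\<close>)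
  next
    case 3
    have "((\<lambda>h. flat p h / h) \<longlongrightarrow> 0) (at 0)"
      unfolding filterlim_at_split
    proof
      show "((\<lambda>h. flat p h / h) \<longlongrightarrow> 0) (at_left 0)"
        by (rule tendsto_eventually) (auto simp: flat_def eventually_at_filter)
      have "((\<lambda>h. poly ([:0, 1:] * p) (inverse h) / exp (inverse h)) \<longlongrightarrow> 0) (at_right (0::real))"
        using tendsto_poly_exp filterlim_inverse_at_top_right by (rule filterlim_compose)
      moreover have "\<forall>\<^sub>F h in at_right 0. poly ([:0, 1:] * p) (inverse h) / exp (inverse h) = flat p h / (h::real)"
        by (auto simp: flat_def eventually_at_filter field_simps exp_minus)
      ultimately show "((\<lambda>h. flat p h / h) \<longlongrightarrow> 0) (at_right 0)"
        by (rule Lim_transform_eventually)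
    qed
    then show ?thesis using 3 by (simp add: DERIV_def flat_def)
  qed
qed

lemma Ck_flat: "Ck k \<psi> \<Longrightarrow> Ck k (\<lambda>x. flat p (\<psi> x))"
  by (rule Ck_compose[of "range flat"]) (use flat_has_derivative in blast)+

lemma Ck_exp: "Ck k \<psi> \<Longrightarrow> Ck k (\<lambda>x. exp (\<psi> x))"
  by (rule Ck_compose[of "{exp}"]) (use DERIV_exp in auto)

text \<open>A smooth function that is positive exactly on the open box, with one flat factor for
  each face. The arguments are spelled as sums so that \<open>Ck_add\<close> and
  \<open>Ck_inner\<close> apply literally.\<close>

definition box_bump :: "'a::euclidean_space \<Rightarrow> 'a \<Rightarrow> 'a \<Rightarrow> real" where
  "box_bump a c x = (\<Prod>b\<in>Basis. flat 1 (x \<bullet> b + - (a \<bullet> b)) * flat 1 (x \<bullet> (- b) + c \<bullet> b))"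

lemma Ck_box_bump: "Ck k (box_bump a c)"
  unfolding box_bump_def[abs_def] by (intro Ck_prod Ck_mult Ck_flat Ck_add Ck_inner Ck_const)

lemma box_bump_nonneg: "0 \<le> box_bump a c x"
  unfolding box_bump_def by (intro prod_nonneg mult_nonneg_nonneg) (auto simp: flat_def)

lemma box_bump_pos_iff: "0 < box_bump a c x \<longleftrightarrow> x \<in> box a c"
proof -
  have f: "flat 1 t = 0 \<longleftrightarrow> t \<le> 0" for t by (auto simp: flat_def)
  have "box_bump a c x \<noteq> 0 \<longleftrightarrow> x \<in> box a c"
    by (auto simp: box_bump_def f box_def not_le)
  then show ?thesis using box_bump_nonneg[of a c x] by linarith
qed

text \<open>Converges to the indicator of the box as n grows: exp (- n b) tends to 0 where the bump
  b is positive and equals 1 elsewhere.\<close>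

definition box_step :: "nat \<Rightarrow> 'a::euclidean_space \<Rightarrow> 'a \<Rightarrow> 'a \<Rightarrow> real" where
  "box_step n a c x = 1 + (- 1) * exp ((- real n) * box_bump a c x)"

lemma box_step_bounds: "0 \<le> box_step n a c x" "box_step n a c x \<le> indicator (box a c) x"
proof -
  show "0 \<le> box_step n a c x" using box_bump_nonneg[of a c x] by (simp add: box_step_def)
  show "box_step n a c x \<le> indicator (box a c) x"
    using box_bump_pos_iff[of a c x] box_bump_nonneg[of a c x]
    by (auto simp: box_step_def split: split_indicator)
qed

lemma test_function_box_step: "test_function (box_step n a c)"
  unfolding test_function_def
proof
  show "\<forall>k. Ck k (box_step n a c)"
    unfolding box_step_def[abs_def] by (intro allI Ck_add Ck_mult Ck_const Ck_exp Ck_box_bump)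
  have "{x. box_step n a c x \<noteq> 0} \<subseteq> box a c"
  proof
    fix x assume "x \<in> {x. box_step n a c x \<noteq> 0}"
    then show "x \<in> box a c"
      using box_step_bounds[of n a c x] by (cases "x \<in> box a c") auto
  qed
  then have "bounded {x. box_step n a c x \<noteq> 0}" using bounded_box bounded_subset by blast
  then show "compact (closure {x. box_step n a c x \<noteq> 0})" by (simp add: compact_closure)
qed

lemma box_step_LIMSEQ: "(\<lambda>n. box_step n a c x) \<longlonglongrightarrow> indicator (box a c) x"
proof (cases "x \<in> box a c")
  case True
  then have p: "box_bump a c x > 0" by (simp add: box_bump_pos_iff)
  have "(\<lambda>n. 1 + (- 1) * exp (- box_bump a c x) ^ n) \<longlonglongrightarrow> 1 + (- 1) * 0"
    using p by (intro tendsto_intros LIMSEQ_realpow_zero) auto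
  then show ?thesis using True by (simp add: box_step_def exp_of_nat_mult[symmetric] mult.commute)
next
  case False
  then have "box_bump a c x = 0" using box_bump_pos_iff[of a c x] box_bump_nonneg[of a c x] by simp
  then show ?thesis using False by (simp add: box_step_def)
qed

lemma test_function_bounded_support:
  assumes "test_function \<phi>"
  obtains R M where "\<And>x. \<phi> x \<noteq> 0 \<Longrightarrow> norm x \<le> R" "\<And>x. \<bar>\<phi> x\<bar> \<le> M" "0 \<le> R" "0 \<le> M"
proof -
  have c: "continuous_on UNIV \<phi>" using assms Ck_continuous[of 0 \<phi>] unfolding test_function_def by blast
  have K: "compact (closure {x. \<phi> x \<noteq> 0})" using assms by (simp add: test_function_def)
  obtain R where R: "R > 0" "\<And>x. x \<in> closure {x. \<phi> x \<noteq> 0} \<Longrightarrow> norm x \<le> R"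
    using compact_imp_bounded[OF K] by (auto simp: bounded_pos)
  have "compact (\<phi> ` closure {x. \<phi> x \<noteq> 0})"
    by (intro compact_continuous_image K continuous_on_subset[OF c]) simp
  then obtain M where M: "M > 0" "\<And>x. x \<in> closure {x. \<phi> x \<noteq> 0} \<Longrightarrow> norm (\<phi> x) \<le> M"
    using compact_imp_bounded[of "\<phi> ` closure {x. \<phi> x \<noteq> 0}"] by (auto simp: bounded_pos)
  have "\<bar>\<phi> x\<bar> \<le> M" for x
    using M(1) M(2)[of x] closure_subset[of "{x. \<phi> x \<noteq> 0}"] by (cases "\<phi> x = 0") auto
  moreover have "norm x \<le> R" if "\<phi> x \<noteq> 0" for x
    using R(2)[of x] closure_subset[of "{x. \<phi> x \<noteq> 0}"] that by blast
  ultimately show thesis using R(1) M(1) by (intro that[of R M]) auto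
qed

lemma square_integrable_bounded_support:
  fixes f :: "'a::euclidean_space \<Rightarrow> complex"
  assumes [measurable]: "f \<in> borel_measurable borel" and "\<And>x. f x \<noteq> 0 \<Longrightarrow> norm x \<le> R" "\<And>x. cmod (f x) \<le> M" "0 \<le> M"
  shows "square_integrable f"
proof (rule square_integrable_bound[OF square_integrable_indicator[OF _ emeasure_lborel_cball_finite[of 0 R]]])
  have "cmod (f x) \<le> M * cmod (indicator (cball 0 R) x)" for x
    using assms(2)[of x] assms(3)[of x] by (cases "f x = 0") (use assms(4) in \<open>auto split: split_indicator\<close>)
  then show "AE x in lborel. cmod (f x) \<le> M * cmod (indicator (cball 0 R) x)" by blast
qed auto

lemma test_function_measurable:
  assumes "test_function \<phi>"
  shows "(\<lambda>x. complex_of_real (\<phi> x)) \<in> borel_measurable borel"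
proof -
  have "Ck 0 \<phi>" using assms unfolding test_function_def by blast
  then show ?thesis by (auto intro!: borel_measurable_continuous_onI continuous_intros)
qed

lemma square_integrable_test_function:
  assumes "test_function \<phi>"
  shows "square_integrable (\<lambda>x. complex_of_real (\<phi> x))"
proof -
  obtain R M where "\<And>x. \<phi> x \<noteq> 0 \<Longrightarrow> norm x \<le> R" "\<And>x. \<bar>\<phi> x\<bar> \<le> M" "0 \<le> M"
    using test_function_bounded_support[OF assms] by metis
  then show ?thesis
    by (intro square_integrable_bounded_support[where R=R and M=M] test_function_measurable assms) auto
qed

text \<open>Off the closed support the function is locally zero, so its derivative vanishes there
  and the support does not grow.\<close>

lemma test_function_deriv:
  assumes "test_function \<phi>" "b \<in> Basis"
  shows "test_function (\<lambda>x. frechet_derivative \<phi> (at x) b)"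
  unfolding test_function_def
proof
  have C: "Ck (Suc k) \<phi>" for k using assms(1) unfolding test_function_def by blast
  show "\<forall>k. Ck k (\<lambda>x. frechet_derivative \<phi> (at x) b)" using Ck_SucD(2)[OF C assms(2)] by blast
  have "{x. frechet_derivative \<phi> (at x) b \<noteq> 0} \<subseteq> closure {x. \<phi> x \<noteq> 0}"
  proof
    fix x assume "x \<in> {x. frechet_derivative \<phi> (at x) b \<noteq> 0}"
    then have nz: "frechet_derivative \<phi> (at x) b \<noteq> 0" by simp
    show "x \<in> closure {x. \<phi> x \<noteq> 0}"
    proof (rule ccontr)
      assume x: "x \<notin> closure {x. \<phi> x \<noteq> 0}"
      have "(\<phi> has_derivative (\<lambda>y. 0)) (at x)"
        by (rule has_derivative_transform_within_open[of "\<lambda>x. 0" _ x UNIV "- closure {x. \<phi> x \<noteq> 0}"])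
          (use x closure_subset[of "{x. \<phi> x \<noteq> 0}"] in auto)
      then show False using nz frechet_derivative_at by (metis (no_types))
    qed
  qed
  then have "bounded {x. frechet_derivative \<phi> (at x) b \<noteq> 0}"
    using assms(1) bounded_subset compact_imp_bounded unfolding test_function_def by blast
  then show "compact (closure {x. frechet_derivative \<phi> (at x) b \<noteq> 0})" by (simp add: compact_closure)
qed

section \<open>The fundamental lemma for test functions\<close>

lemma cscale_L2_add_left: "cscale_L2 (c + d) u = cscale_L2 c u + cscale_L2 d u"
  by transfer (auto simp: L2_rel_def distrib_right intro!: square_integrable_add square_integrable_cmult)

lemma cscale_L2_Re_Im: "cscale_L2 k u = Re k *\<^sub>R u + Im k *\<^sub>R cscale_L2 \<i> u"
proof -
  have "cscale_L2 k u = cscale_L2 (of_real (Re k)) u + cscale_L2 (of_real (Im k) * \<i>) u"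
    unfolding cscale_L2_add_left[symmetric] by (intro arg_cong[where f="\<lambda>c. cscale_L2 c u"]) (simp add: complex_eq_iff)
  then show ?thesis by (simp add: cscale_L2_of_real flip: cscale_L2_cscale)
qed

text \<open>Test functions approximate the indicators of boxes in L^2. Orthogonality is carried
  along for all complex multiples, which makes the induction hypothesis stable under complex
  scaling.\<close>

lemma L2_eq_0_test_function:
  assumes "\<And>\<phi>. test_function \<phi> \<Longrightarrow> cinner w (abs_L2 (\<lambda>x. of_real (\<phi> x))) = 0"
  shows "w = 0"
proof -
  have "\<forall>c. w \<bullet> cscale_L2 c u = 0" for u
  proof (induction u rule: L2_induct)
    case (box a c)
    have "square_integrable (indicator (box a c))"
      by (intro square_integrable_indicator emeasure_lborel_box_finite) auto
    then have lim: "(\<lambda>n. abs_L2 (\<lambda>x. complex_of_real (box_step n a c x))) \<longlonglongrightarrow> abs_L2 (indicator (box a c))"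
    proof (rule tendsto_L2_dominated(3)[where B=1, rotated 2])
      show "AE x in lborel. cmod (complex_of_real (box_step n a c x)) \<le> 1 * cmod (indicator (box a c) x)" for n
      proof (rule AE_I2)
        fix x
        show "cmod (complex_of_real (box_step n a c x)) \<le> 1 * cmod (indicator (box a c) x)"
          using box_step_bounds[of n a c x] by (cases "x \<in> box a c") auto
      qed
      show "AE x in lborel. (\<lambda>n. complex_of_real (box_step n a c x)) \<longlonglongrightarrow> indicator (box a c) x"
      proof (rule AE_I2)
        fix x
        have "(\<lambda>n. complex_of_real (box_step n a c x)) \<longlonglongrightarrow> of_real (indicator (box a c) x)"
          by (intro tendsto_of_real box_step_LIMSEQ)
        then show "(\<lambda>n. complex_of_real (box_step n a c x)) \<longlonglongrightarrow> indicator (box a c) x"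
          by (cases "x \<in> box a c") auto
      qed
    qed (use test_function_measurable[OF test_function_box_step] in auto)
    have z: "w \<bullet> cscale_L2 k (abs_L2 (\<lambda>x. of_real (box_step n a c x))) = 0" for k n
    proof -
      let ?v = "abs_L2 (\<lambda>x. complex_of_real (box_step n a c x))"
      have "w \<bullet> ?v = 0" "w \<bullet> cscale_L2 \<i> ?v = 0"
        using assms[OF test_function_box_step[of n a c]] by (auto simp: cinner_eq complex_eq_iff)
      moreover have "cscale_L2 k ?v = Re k *\<^sub>R ?v + Im k *\<^sub>R cscale_L2 \<i> ?v"
        by (rule cscale_L2_Re_Im)
      ultimately show ?thesis by (simp add: inner_add_right)
    qed
    show ?case
    proof
      fix k
      have "(\<lambda>n. w \<bullet> cscale_L2 k (abs_L2 (\<lambda>x. of_real (box_step n a c x)))) \<longlonglongrightarrow> w \<bullet> cscale_L2 k (abs_L2 (indicator (box a c)))"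
        by (intro tendsto_intros bounded_linear.tendsto[OF bounded_linear_cscale_L2] lim)
      then show "w \<bullet> cscale_L2 k (abs_L2 (indicator (box a c))) = 0"
        by (simp add: z LIMSEQ_const_iff)
    qed
  next
    case (lim X u)
    show ?case
    proof
      fix k
      have "(\<lambda>n. w \<bullet> cscale_L2 k (X n)) \<longlonglongrightarrow> w \<bullet> cscale_L2 k u"
        by (intro tendsto_intros bounded_linear.tendsto[OF bounded_linear_cscale_L2] lim)
      then show "w \<bullet> cscale_L2 k u = 0"
        using lim(1) by (simp add: LIMSEQ_const_iff)
    qed
  qed (auto simp: cscale_L2_add inner_add_right cscale_L2_cscale)
  from this[of w] have "w \<bullet> cscale_L2 1 w = 0" by blast
  then show ?thesis by (simp add: cscale_L2_of_real[of 1, simplified])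
qed

section \<open>Bessel potentials and the free propagator\<close>

text \<open>The Fourier multiplier m(D).\<close>

definition fmult :: "('a::euclidean_space \<Rightarrow> complex) \<Rightarrow> 'a L2 \<Rightarrow> 'a L2" where
  "fmult m u = ifourier (pmult m (fourier u))"

lemma fourier_fmult [simp]: "fourier (fmult m u) = pmult m (fourier u)"
  by (simp add: fmult_def)

lemma fmult_eqI: "fourier w = pmult m (fourier u) \<Longrightarrow> w = fmult m u"
  by (metis fmult_def ifourier_fourier)

lemma norm_ifourier [simp]: "norm (ifourier u) = norm u"
  using norm_fourier[of "ifourier u"] by simp

lemma bounded_linear_fmult: "bounded_multiplier m \<Longrightarrow> bounded_linear (fmult m)"
  unfolding fmult_def[abs_def]
  by (intro bounded_linear_compose[OF bounded_linear_ifourier] bounded_linear_compose[OF bounded_linear_pmult]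
      bounded_linear_fourier)

lemma fmult_add: "bounded_multiplier m \<Longrightarrow> fmult m (u + v) = fmult m u + fmult m v"
  using linear_add[OF bounded_linear.linear[OF bounded_linear_fmult]] .

lemma fmult_diff: "bounded_multiplier m \<Longrightarrow> fmult m (u - v) = fmult m u - fmult m v"
  using linear_diff[OF bounded_linear.linear[OF bounded_linear_fmult]] .

lemma fmult_scaleR: "bounded_multiplier m \<Longrightarrow> fmult m (r *\<^sub>R u) = r *\<^sub>R fmult m u"
  using linear_cmul[OF bounded_linear.linear[OF bounded_linear_fmult]] .

lemma norm_fmult_le:
  "bounded_multiplier m \<Longrightarrow> (\<And>x. cmod (m x) \<le> B) \<Longrightarrow> norm (fmult m u) \<le> B * norm u"
  using norm_pmult_le[of m B "fourier u"] by (simp add: fmult_def)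

lemma fmult_fmult:
  "bounded_multiplier m \<Longrightarrow> bounded_multiplier n \<Longrightarrow> fmult m (fmult n u) = fmult (\<lambda>x. m x * n x) u"
  by (simp add: fmult_def pmult_pmult)

lemma fmult_one: "fmult (\<lambda>x. 1) u = u"
  by (simp add: fmult_def pmult_one)

lemma fmult_const: "fmult (\<lambda>x. c) u = cscale_L2 c u"
  by (simp add: fmult_def pmult_const flip: fourier_cscale)

lemma bounded_multiplier_const: "bounded_multiplier (\<lambda>x. c)"
  by (rule bounded_multiplierI[where B="cmod c"]) auto

lemma fmult_cscale: "bounded_multiplier m \<Longrightarrow> fmult m (cscale_L2 c u) = cscale_L2 c (fmult m u)"
  unfolding fmult_const[symmetric] by (simp add: fmult_fmult bounded_multiplier_const mult.commute)

lemma inner_fmult: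
  "bounded_multiplier m \<Longrightarrow> fmult m u \<bullet> v = u \<bullet> fmult (\<lambda>x. cnj (m x)) v"
  using inner_pmult[of m "fourier u" "fourier v"] inner_fourier[of "fmult m u" v]
    inner_fourier[of u "fmult (\<lambda>x. cnj (m x)) v"] by simp

lemma pmult_diff_mult:
  assumes "bounded_multiplier m" "bounded_multiplier n"
  shows "pmult (\<lambda>x. m x - n x) u = pmult m u - pmult n u"
  unfolding pmult_def
  by (subst abs_L2_diff) (auto simp: assms square_integrable_pmult left_diff_distrib)

lemma pmult_add_mult:
  assumes "bounded_multiplier m" "bounded_multiplier n"
  shows "pmult (\<lambda>x. m x + n x) u = pmult m u + pmult n u"
  unfolding pmult_def
  by (subst abs_L2_add) (auto simp: assms square_integrable_pmult distrib_right)

lemma bounded_multiplier_add: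
  "bounded_multiplier m \<Longrightarrow> bounded_multiplier n \<Longrightarrow> bounded_multiplier (\<lambda>x. m x + n x)"
  unfolding bounded_multiplier_def by (intro conjI borel_measurable_add bounded_plus_comp) auto

lemma bounded_multiplier_diff:
  "bounded_multiplier m \<Longrightarrow> bounded_multiplier n \<Longrightarrow> bounded_multiplier (\<lambda>x. m x - n x)"
  unfolding bounded_multiplier_def by (intro conjI borel_measurable_diff bounded_minus_comp) auto

lemma fmult_diff_mult:
  assumes "bounded_multiplier m" "bounded_multiplier n"
  shows "fmult (\<lambda>x. m x - n x) u = fmult m u - fmult n u"
  unfolding fmult_def pmult_diff_mult[OF assms]
  by (rule linear_diff[OF bounded_linear.linear[OF bounded_linear_ifourier]])

lemma fmult_add_mult:
  assumes "bounded_multiplier m" "bounded_multiplier n"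
  shows "fmult (\<lambda>x. m x + n x) u = fmult m u + fmult n u"
  unfolding fmult_def pmult_add_mult[OF assms]
  by (rule linear_add[OF bounded_linear.linear[OF bounded_linear_ifourier]])

lemma fmult_sum_mult:
  assumes "finite S" "\<And>i. i \<in> S \<Longrightarrow> bounded_multiplier (m i)"
  shows "fmult (\<lambda>x. \<Sum>i\<in>S. m i x) u = (\<Sum>i\<in>S. fmult (m i) u) \<and> bounded_multiplier (\<lambda>x. \<Sum>i\<in>S. m i x)"
  using assms
proof (induction S)
  case empty
  have "cscale_L2 0 u = 0" using cscale_L2_of_real[of 0 u] by simp
  then show ?case by (simp add: fmult_const bounded_multiplier_const)
next
  case (insert i S)
  then have "bounded_multiplier (\<lambda>x. m i x + (\<Sum>i\<in>S. m i x))"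
    by (intro bounded_multiplier_add) auto
  then show ?case using insert by (simp add: fmult_add_mult)
qed

lemma fmult_scaleR_mult:
  assumes "bounded_multiplier m"
  shows "r *\<^sub>R fmult m u = fmult (\<lambda>x. of_real r * m x) u"
  by (simp add: assms fmult_const fmult_fmult bounded_multiplier_const flip: cscale_L2_of_real fmult_const)

lemma tendsto_fmult_at:
  fixes m :: "real \<Rightarrow> 'a::euclidean_space \<Rightarrow> complex"
  assumes "\<And>h. m h \<in> borel_measurable borel" "m' \<in> borel_measurable borel"
    and "\<And>h x. h \<noteq> t \<Longrightarrow> cmod (m h x) \<le> B" "\<And>x. ((\<lambda>h. m h x) \<longlongrightarrow> m' x) (at t within S)"
  shows "((\<lambda>h. fmult (m h) u) \<longlongrightarrow> fmult m' u) (at t within S)"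
  unfolding fmult_def
  by (rule bounded_linear.tendsto[OF bounded_linear_ifourier]) (rule tendsto_pmult_at[OF assms])

lemma shift_eq_fmult: "shift h u = fmult (\<lambda>\<xi>. cis (h \<bullet> \<xi>)) u"
  by (rule fmult_eqI) (rule fourier_shift)

definition bessel_symbol :: "real \<Rightarrow> 'a::euclidean_space \<Rightarrow> complex" where
  "bessel_symbol s \<xi> = of_real ((1 + (norm \<xi>)\<^sup>2) powr (- s / 2))"

text \<open>\<open>bessel s\<close> is $J_s = (1 - \Delta)^{-s/2}$, an isometry of $L^2$ onto $H^s$.\<close>

abbreviation bessel :: "real \<Rightarrow> 'a::euclidean_space L2 \<Rightarrow> 'a L2" where
  "bessel s \<equiv> fmult (bessel_symbol s)"

lemma one_plus_norm_sq: "1 \<le> 1 + (norm \<xi>)\<^sup>2" "0 < 1 + (norm \<xi>)\<^sup>2"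
  by (auto simp: add_pos_nonneg)

lemma cmod_bessel_symbol: "cmod (bessel_symbol s \<xi>) = (1 + (norm \<xi>)\<^sup>2) powr (- s / 2)"
  by (simp add: bessel_symbol_def)

lemma cmod_bessel_symbol_le: "0 \<le> s \<Longrightarrow> cmod (bessel_symbol s \<xi>) \<le> 1"
  using powr_mono[of "- s / 2" 0 "1 + (norm \<xi>)\<^sup>2"] one_plus_norm_sq[of \<xi>]
  by (simp add: cmod_bessel_symbol split: if_splits)

lemma cnj_bessel_symbol [simp]: "cnj (bessel_symbol s \<xi>) = bessel_symbol s \<xi>"
  by (simp add: bessel_symbol_def)

lemma bessel_symbol_measurable [measurable]: "bessel_symbol s \<in> borel_measurable borel"
  unfolding bessel_symbol_def[abs_def] by measurable

lemma bounded_multiplier_bessel [simp]: "0 \<le> s \<Longrightarrow> bounded_multiplier (bessel_symbol s)"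
  by (rule bounded_multiplierI[where B=1]) (auto simp: cmod_bessel_symbol_le)

lemma bessel_symbol_mult: "bessel_symbol s \<xi> * bessel_symbol r \<xi> = bessel_symbol (s + r) \<xi>"
  by (simp add: bessel_symbol_def add_divide_distrib diff_divide_distrib flip: of_real_mult powr_add)

lemma bessel_bessel: "0 \<le> s \<Longrightarrow> 0 \<le> r \<Longrightarrow> bessel s (bessel r u) = bessel (s + r) u"
  by (simp add: fmult_fmult bessel_symbol_mult)

lemma bessel_0 [simp]: "bessel 0 u = u"
proof -
  have "bessel_symbol 0 = (\<lambda>\<xi>::'a. 1)"
  proof
    fix \<xi> :: 'a
    have "1 + (norm \<xi>)\<^sup>2 \<noteq> 0" using one_plus_norm_sq(2)[of \<xi>] by linarith
    then show "bessel_symbol 0 \<xi> = 1" by (simp add: bessel_symbol_def)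
  qed
  then show ?thesis by (simp add: fmult_one)
qed

lemma norm_bessel_le: "0 \<le> s \<Longrightarrow> norm (bessel s u) \<le> norm u"
  using norm_fmult_le[OF bounded_multiplier_bessel cmod_bessel_symbol_le, where u=u] by simp

lemma fmult_bessel_commute:
  "bounded_multiplier m \<Longrightarrow> 0 \<le> s \<Longrightarrow> fmult m (bessel s u) = bessel s (fmult m u)"
  by (simp add: fmult_fmult mult.commute)

lemma inner_bessel: "0 \<le> s \<Longrightarrow> bessel s u \<bullet> v = u \<bullet> bessel s v"
  using inner_fmult[of "bessel_symbol s" u v] by simp

lemma rep_fourier_bessel:
  "0 \<le> s \<Longrightarrow> AE \<xi> in lborel. rep_L2 (fourier (bessel s f)) \<xi> = bessel_symbol s \<xi> * rep_L2 (fourier f) \<xi>"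
  by (simp add: rep_pmult)

lemma bessel_weight_eq:
  assumes "z = bessel_symbol s \<xi> * w"
  shows "(1 + (norm \<xi>)\<^sup>2) powr s * (cmod z)\<^sup>2 = (cmod w)\<^sup>2"
proof -
  have "((1 + (norm \<xi>)\<^sup>2) powr (- s / 2))\<^sup>2 = (1 + (norm \<xi>)\<^sup>2) powr (- s)"
    by (simp add: power2_eq_square flip: powr_add)
  moreover have "(1 + (norm \<xi>)\<^sup>2) powr s * (1 + (norm \<xi>)\<^sup>2) powr (- s) = 1"
    using one_plus_norm_sq(2)[of \<xi>] by (simp flip: powr_add)
  ultimately show ?thesis
    unfolding assms norm_mult power_mult_distrib cmod_bessel_symbol by (simp flip: mult.assoc)
qed

lemma sobolev_bessel:
  assumes "0 \<le> s"
  shows "bessel s f \<in> sobolev s" "sobolev_norm s (bessel s f) = norm f"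
proof -
  have [measurable]: "rep_L2 (fourier (bessel s f)) \<in> borel_measurable borel" by (rule borel_measurable_rep_L2)
  have eq: "AE \<xi> in lborel. (1 + (norm \<xi>)\<^sup>2) powr s * (cmod (rep_L2 (fourier (bessel s f)) \<xi>))\<^sup>2 = (cmod (rep_L2 (fourier f) \<xi>))\<^sup>2"
    using rep_fourier_bessel[OF assms, of f] by eventually_elim (rule bessel_weight_eq)
  have "integrable lborel (\<lambda>\<xi>. (cmod (rep_L2 (fourier f) \<xi>))\<^sup>2)"
    using square_integrable_rep square_integrable_def by blast
  then show "bessel s f \<in> sobolev s"
    unfolding sobolev_def using integrable_cong_AE[OF _ _ eq] by simp
  have "(LINT \<xi>|lborel. (1 + (norm \<xi>)\<^sup>2) powr s * (cmod (rep_L2 (fourier (bessel s f)) \<xi>))\<^sup>2) = (norm (fourier f))\<^sup>2"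
    unfolding power2_norm_L2 by (rule integral_cong_AE[OF _ _ eq]) measurable
  then show "sobolev_norm s (bessel s f) = norm f" by (simp add: sobolev_norm_def)
qed

text \<open>The weight is undone on the Fourier side: membership in \<open>sobolev s\<close> says
  exactly that (1 + |xi|^2)^{s/2} times the transform is square-integrable.\<close>

lemma sobolevE:
  assumes "u \<in> sobolev s" "0 \<le> s"
  obtains f where "u = bessel s f"
proof -
  define g where "g \<xi> = complex_of_real ((1 + (norm \<xi>)\<^sup>2) powr (s / 2)) * rep_L2 (fourier u) \<xi>" for \<xi>
  have [measurable]: "g \<in> borel_measurable borel" unfolding g_def by measurable
  have "(cmod (g \<xi>))\<^sup>2 = (1 + (norm \<xi>)\<^sup>2) powr s * (cmod (rep_L2 (fourier u) \<xi>))\<^sup>2" for \<xi>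
  proof -
    have "((1 + (norm \<xi>)\<^sup>2) powr (s / 2))\<^sup>2 = (1 + (norm \<xi>)\<^sup>2) powr s"
      by (simp add: power2_eq_square flip: powr_add)
    then show ?thesis unfolding g_def norm_mult power_mult_distrib by simp
  qed
  then have g: "square_integrable g"
    using assms(1) by (simp add: square_integrable_def sobolev_def)
  have "fourier u = pmult (bessel_symbol s) (abs_L2 g)"
    unfolding pmult_abs_L2[OF bounded_multiplier_bessel[OF assms(2)] g]
  proof -
    have "bessel_symbol s \<xi> * g \<xi> = rep_L2 (fourier u) \<xi>" for \<xi>
      using one_plus_norm_sq(2)[of \<xi>]
      by (simp add: bessel_symbol_def g_def flip: mult.assoc of_real_mult powr_add)
    then show "fourier u = abs_L2 (\<lambda>x. bessel_symbol s x * g x)" by simp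
  qed
  then have "u = bessel s (ifourier (abs_L2 g))" by (intro fmult_eqI) simp
  then show thesis by (rule that)
qed

lemma bessel_inject:
  assumes "0 \<le> s"
  shows "bessel s f = bessel s g \<longleftrightarrow> f = g"
proof
  assume "bessel s f = bessel s g"
  then have "bessel s (f - g) = bessel s 0" by (simp add: fmult_diff assms linear_0[OF bounded_linear.linear[OF bounded_linear_fmult]])
  then have "norm (f - g) = norm (0 :: 'a L2)" using sobolev_bessel(2)[OF assms] by metis
  then show "f = g" by simp
qed simp

section \<open>The free propagator\<close>

definition evolution_symbol :: "real \<Rightarrow> 'a::euclidean_space \<Rightarrow> complex" where
  "evolution_symbol t \<xi> = cis (t * (norm \<xi>)\<^sup>2)"

lemma bounded_multiplier_evolution [simp]: "bounded_multiplier (evolution_symbol t)"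
  unfolding evolution_symbol_def[abs_def] by (rule bounded_multiplier_cis) measurable

text \<open>The description in \<open>propagator\<close> has a unique solution because the Fourier
  transform is invertible.\<close>

lemma propagator_eq: "propagator t = fmult (evolution_symbol t)"
proof
  fix u :: "'a L2"
  show "propagator t u = fmult (evolution_symbol t) u"
    unfolding propagator_def evolution_symbol_def[symmetric] pmult_def[symmetric]
    by (rule the_equality) (auto intro: fmult_eqI)
qed

lemma propagator_propagator: "propagator s (propagator t u) = propagator (s + t) u"
  by (simp add: propagator_eq fmult_fmult) (simp add: evolution_symbol_def[abs_def] cis_mult distrib_right)

lemma propagator_0 [simp]: "propagator 0 u = u"
  by (simp add: propagator_eq evolution_symbol_def[abs_def] fmult_one)

lemma bounded_linear_propagator: "bounded_linear (propagator t)"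
  unfolding propagator_eq by (rule bounded_linear_fmult) simp

lemma inner_propagator: "propagator t u \<bullet> propagator t v = u \<bullet> v"
proof -
  have "(\<lambda>\<xi>::'a. cnj (evolution_symbol t \<xi>)) = evolution_symbol (- t)"
    by (simp add: evolution_symbol_def[abs_def] cis_cnj)
  then show ?thesis
    using inner_fmult[OF bounded_multiplier_evolution, of t u "propagator t v"] propagator_propagator[of "- t" t v]
    by (simp flip: propagator_eq)
qed

lemma norm_propagator [simp]: "norm (propagator t u) = norm u"
  by (simp add: norm_eq_sqrt_inner inner_propagator)

text \<open>The propagators are only strongly continuous in time, so the increment is split: the
  isometry absorbs the change of g, and dominated convergence of the symbols handles the fixed
  vector.\<close>

lemma continuous_on_propagator:
  assumes "continuous_on S g"
  shows "continuous_on S (\<lambda>t. propagator (c * t) (g t))"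
  unfolding continuous_on_def
proof
  fix t0 assume t0: "t0 \<in> S"
  have g: "(g \<longlongrightarrow> g t0) (at t0 within S)" using assms t0 by (simp add: continuous_on_def)
  have "((\<lambda>t. fmult (evolution_symbol (c * t)) (g t0)) \<longlongrightarrow> fmult (evolution_symbol (c * t0)) (g t0)) (at t0 within S)"
    by (rule tendsto_fmult_at[where B=1])
      (auto simp: evolution_symbol_def[abs_def] intro!: tendsto_intros)
  then have 1: "((\<lambda>t. propagator (c * t) (g t0)) \<longlongrightarrow> propagator (c * t0) (g t0)) (at t0 within S)"
    by (simp add: propagator_eq)
  have n: "((\<lambda>t. norm (g t - g t0)) \<longlongrightarrow> 0) (at t0 within S)"
    using g by (simp add: LIM_zero tendsto_norm_zero)
  have 2: "((\<lambda>t. propagator (c * t) (g t - g t0)) \<longlongrightarrow> 0) (at t0 within S)"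
    by (rule tendsto_norm_zero_cancel) (use n in simp)
  have "((\<lambda>t. propagator (c * t) (g t - g t0) + propagator (c * t) (g t0)) \<longlongrightarrow> 0 + propagator (c * t0) (g t0)) (at t0 within S)"
    by (rule tendsto_add[OF 2 1])
  then show "((\<lambda>t. propagator (c * t) (g t)) \<longlongrightarrow> propagator (c * t0) (g t0)) (at t0 within S)"
    by (simp add: linear_diff[OF bounded_linear.linear[OF bounded_linear_propagator]])
qed

section \<open>Weak derivatives and the kinetic energy\<close>

text \<open>The symbol of the derivative along b composed with J_1. Derivatives enter in this
  combination, as bounded operators.\<close>

definition deriv_symbol :: "'a::euclidean_space \<Rightarrow> 'a \<Rightarrow> complex" where
  "deriv_symbol b \<xi> = \<i> * of_real ((b \<bullet> \<xi>)) * bessel_symbol 1 \<xi>"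

lemma abs_inner_bessel_le: "b \<in> Basis \<Longrightarrow> \<bar>b \<bullet> \<xi>\<bar> * cmod (bessel_symbol 1 \<xi>) \<le> 1"
proof -
  assume "b \<in> Basis"
  then have "\<bar>b \<bullet> \<xi>\<bar> \<le> norm \<xi>" using Basis_le_norm[of b \<xi>] by (simp add: inner_commute)
  also have "\<dots> = sqrt ((norm \<xi>)\<^sup>2)" by simp
  also have "\<dots> \<le> sqrt (1 + (norm \<xi>)\<^sup>2)" by (rule real_sqrt_le_mono) simp
  finally have "\<bar>b \<bullet> \<xi>\<bar> \<le> sqrt (1 + (norm \<xi>)\<^sup>2)" .
  moreover have "cmod (bessel_symbol 1 \<xi>) = inverse (sqrt (1 + (norm \<xi>)\<^sup>2))"
    using one_plus_norm_sq(2)[of \<xi>] by (simp add: cmod_bessel_symbol powr_minus powr_half_sqrt)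
  moreover have "sqrt (1 + (norm \<xi>)\<^sup>2) * inverse (sqrt (1 + (norm \<xi>)\<^sup>2)) = 1"
    using one_plus_norm_sq(2)[of \<xi>] by simp
  ultimately show ?thesis
    using mult_right_mono[of "\<bar>b \<bullet> \<xi>\<bar>" "sqrt (1 + (norm \<xi>)\<^sup>2)" "inverse (sqrt (1 + (norm \<xi>)\<^sup>2))"] by simp
qed

lemma deriv_symbol_measurable [measurable]: "deriv_symbol b \<in> borel_measurable borel"
  unfolding deriv_symbol_def[abs_def] by measurable

lemma bounded_multiplier_deriv [simp]: "b \<in> Basis \<Longrightarrow> bounded_multiplier (deriv_symbol b)"
  by (rule bounded_multiplierI[where B=1])
    (auto simp: deriv_symbol_def norm_mult abs_inner_bessel_le)

lemma cmod_cis_diff_1_le: "cmod (cis t - 1) \<le> \<bar>t\<bar>"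
proof -
  show ?thesis using iexp_approx1[of t 0] by (simp add: cis_conv_exp)
qed

lemma tendsto_cis_quotient:
  "((\<lambda>h. (cis (h * a) - 1) / of_real h) \<longlongrightarrow> \<i> * of_real a) (at 0)"
proof -
  have "cmod ((cis (h * a) - 1) / of_real h - \<i> * of_real a) \<le> \<bar>h\<bar> * a\<^sup>2 / 2" if "h \<noteq> 0" for h
  proof -
    have "(cis (h * a) - 1) / of_real h - \<i> * of_real a = (cis (h * a) - 1 - \<i> * of_real (h * a)) / of_real h"
      using that by (simp add: field_simps)
    also have "cmod \<dots> \<le> ((h * a)\<^sup>2 / 2) / \<bar>h\<bar>"
    proof -
      have "cmod (cis (h * a) - 1 - \<i> * of_real (h * a)) \<le> (h * a)\<^sup>2 / 2"
        using iexp_approx1[of "h * a" 1] by (simp add: cis_conv_exp power2_eq_square diff_diff_eq)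
      from divide_right_mono[OF this, of "\<bar>h\<bar>"] show ?thesis by (simp add: norm_divide)
    qed
    also have "\<dots> = \<bar>h\<bar> * a\<^sup>2 / 2" using that by (simp add: power2_eq_square field_simps)
    finally show ?thesis .
  qed
  then have "\<forall>\<^sub>F h in at 0. norm ((cis (h * a) - 1) / of_real h - \<i> * of_real a) \<le> \<bar>h\<bar> * a\<^sup>2 / 2"
    by (simp add: eventually_at_filter)
  moreover have "((\<lambda>h. \<bar>h\<bar> * a\<^sup>2 / 2) \<longlongrightarrow> 0) (at 0)"
    by (auto intro!: tendsto_eq_intros)
  ultimately have "((\<lambda>h. (cis (h * a) - 1) / of_real h - \<i> * of_real a) \<longlongrightarrow> 0) (at 0)"
    by (rule Lim_null_comparison)
  then show ?thesis by (simp add: LIM_zero_iff)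
qed

text \<open>On H^1 the difference quotients converge in L^2: their symbols converge pointwise, and
  |cis t - 1| \<le> |t| bounds them by |b . xi| / (1 + |xi|^2)^{1/2}.\<close>

lemma tendsto_shift_quotient:
  assumes b: "b \<in> Basis"
  shows "((\<lambda>h. (shift (h *\<^sub>R b) (bessel 1 f) - bessel 1 f) /\<^sub>R h) \<longlongrightarrow> fmult (deriv_symbol b) f) (at 0)"
proof -
  define m where "m h \<xi> = (cis (h * (b \<bullet> \<xi>)) - 1) / of_real h * bessel_symbol 1 \<xi>" for h \<xi>
  have mm: "m h \<in> borel_measurable borel" for h unfolding m_def[abs_def] by measurable
  have mb: "cmod (m h \<xi>) \<le> 1" if "h \<noteq> 0" for h \<xi>
  proof -
    have "cmod (m h \<xi>) \<le> (\<bar>h * (b \<bullet> \<xi>)\<bar> / \<bar>h\<bar>) * cmod (bessel_symbol 1 \<xi>)"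
      unfolding m_def norm_mult norm_divide norm_of_real
      by (intro mult_right_mono divide_right_mono cmod_cis_diff_1_le) auto
    then show ?thesis using abs_inner_bessel_le[OF b, of \<xi>] that by (simp add: abs_mult)
  qed
  have lim: "((\<lambda>h. fmult (m h) f) \<longlongrightarrow> fmult (deriv_symbol b) f) (at 0)"
  proof (rule tendsto_fmult_at[where B=1])
    show "((\<lambda>h. m h x) \<longlongrightarrow> deriv_symbol b x) (at 0)" for x
      unfolding m_def deriv_symbol_def by (intro tendsto_mult tendsto_cis_quotient tendsto_const)
  qed (use mm mb in auto)
  have eq: "fmult (m h) f = (shift (h *\<^sub>R b) (bessel 1 f) - bessel 1 f) /\<^sub>R h" if "h \<noteq> 0" for h
  proof -
    have c: "bounded_multiplier (\<lambda>\<xi>. cis (h * (b \<bullet> \<xi>)))" by (rule bounded_multiplier_cis) measurable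
    have c1: "bounded_multiplier (\<lambda>\<xi>. cis (h * (b \<bullet> \<xi>)) * bessel_symbol 1 \<xi>)"
      by (intro bounded_multiplier_mult c) simp
    have c2: "bounded_multiplier (\<lambda>\<xi>. cis (h * (b \<bullet> \<xi>)) * bessel_symbol 1 \<xi> - bessel_symbol 1 \<xi>)"
      by (intro bounded_multiplier_diff c1) simp
    have "shift (h *\<^sub>R b) (bessel 1 f) - bessel 1 f = fmult (\<lambda>\<xi>. cis (h * (b \<bullet> \<xi>)) * bessel_symbol 1 \<xi> - bessel_symbol 1 \<xi>) f"
      by (simp add: shift_eq_fmult fmult_fmult[OF c] fmult_diff_mult[OF c1])
    moreover have "m h = (\<lambda>\<xi>. of_real (inverse h) * (cis (h * (b \<bullet> \<xi>)) * bessel_symbol 1 \<xi> - bessel_symbol 1 \<xi>))"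
      by (simp add: m_def fun_eq_iff field_simps)
    ultimately show ?thesis by (simp only: fmult_scaleR_mult[OF c2])
  qed
  show ?thesis
    by (rule Lim_transform_eventually[OF lim]) (simp add: eventually_at_filter eq)
qed

text \<open>The shifts x - h b run backwards because this is the direction that appears when a
  translation is moved to the other side of an inner product.\<close>

lemma test_function_lipschitz:
  assumes \<phi>: "test_function \<phi>" and b: "b \<in> Basis"
  obtains M where "0 \<le> M" "\<And>x h. \<bar>\<phi> (x - h *\<^sub>R b) - \<phi> x\<bar> \<le> M * \<bar>h\<bar>"
    "\<And>x. \<bar>frechet_derivative \<phi> (at x) b\<bar> \<le> M"
    "\<And>x. ((\<lambda>h. (\<phi> (x - h *\<^sub>R b) - \<phi> x) / h) \<longlongrightarrow> - frechet_derivative \<phi> (at x) b) (at 0)"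
proof -
  obtain M where M: "\<And>x. \<bar>frechet_derivative \<phi> (at x) b\<bar> \<le> M" "0 \<le> M"
    using test_function_bounded_support[OF test_function_deriv[OF \<phi> b]] by metis
  have C: "Ck (Suc 0) \<phi>" using \<phi> unfolding test_function_def by blast
  have D: "((\<lambda>h. \<phi> (x - h *\<^sub>R b)) has_real_derivative - frechet_derivative \<phi> (at (x - h *\<^sub>R b)) b) (at h)" for x h
  proof -
    have l: "linear (frechet_derivative \<phi> (at (x - h *\<^sub>R b)))"
      using Ck_SucD(1)[OF C] has_derivative_linear by blast
    have "((\<lambda>h. x - h *\<^sub>R b) has_derivative (\<lambda>k. - (k *\<^sub>R b))) (at h)"
      by (auto intro!: derivative_eq_intros)
    from has_derivative_compose[OF this Ck_SucD(1)[OF C]]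
    have "((\<lambda>h. \<phi> (x - h *\<^sub>R b)) has_derivative (\<lambda>k. frechet_derivative \<phi> (at (x - h *\<^sub>R b)) (- (k *\<^sub>R b)))) (at h)" .
    moreover have "(\<lambda>k. frechet_derivative \<phi> (at (x - h *\<^sub>R b)) (- (k *\<^sub>R b))) = (\<lambda>k. - frechet_derivative \<phi> (at (x - h *\<^sub>R b)) b * k)"
      using l by (simp add: linear_neg linear_cmul mult.commute)
    ultimately show ?thesis unfolding has_field_derivative_def by (simp only:)
  qed
  have "\<bar>\<phi> (x - h *\<^sub>R b) - \<phi> x\<bar> \<le> M * \<bar>h\<bar>" for x h
    using field_differentiable_bound[of UNIV "\<lambda>h. \<phi> (x - h *\<^sub>R b)" "\<lambda>h. - frechet_derivative \<phi> (at (x - h *\<^sub>R b)) b" M h 0]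
      D M(1) by auto
  moreover have "((\<lambda>h. (\<phi> (x - h *\<^sub>R b) - \<phi> x) / h) \<longlongrightarrow> - frechet_derivative \<phi> (at x) b) (at 0)" for x
    using D[of x 0] by (simp add: DERIV_def)
  ultimately show thesis using M that by blast
qed

lemma tendsto_shift_test_function:
  assumes \<phi>: "test_function \<phi>" and b: "b \<in> Basis"
  defines "\<Phi> \<equiv> abs_L2 (\<lambda>x. complex_of_real (\<phi> x))"
  shows "((\<lambda>h. (shift (- (h *\<^sub>R b)) \<Phi> - \<Phi>) /\<^sub>R h) \<longlongrightarrow> - abs_L2 (\<lambda>x. complex_of_real (frechet_derivative \<phi> (at x) b))) (at 0)"
proof -
  obtain M where M: "0 \<le> M" "\<And>x h. \<bar>\<phi> (x - h *\<^sub>R b) - \<phi> x\<bar> \<le> M * \<bar>h\<bar>"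
      "\<And>x. ((\<lambda>h. (\<phi> (x - h *\<^sub>R b) - \<phi> x) / h) \<longlongrightarrow> - frechet_derivative \<phi> (at x) b) (at 0)"
    using test_function_lipschitz[OF \<phi> b] by metis
  obtain R where R: "\<And>x. \<phi> x \<noteq> 0 \<Longrightarrow> norm x \<le> R" using test_function_bounded_support[OF \<phi>] by metis
  note sq = square_integrable_test_function[OF \<phi>]
  note sq' = square_integrable_test_function[OF test_function_deriv[OF \<phi> b]]
  have [measurable]: "(\<lambda>x. complex_of_real (\<phi> x)) \<in> borel_measurable borel"
    by (rule test_function_measurable[OF \<phi>])
  have lim: "(\<lambda>n. (shift (- (X n *\<^sub>R b)) \<Phi> - \<Phi>) /\<^sub>R X n) \<longlonglongrightarrow> - abs_L2 (\<lambda>x. complex_of_real (frechet_derivative \<phi> (at x) b))"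
    if X: "\<And>n. X n \<noteq> 0" "X \<longlonglongrightarrow> 0" for X :: "nat \<Rightarrow> real"
  proof -
    obtain K where K: "\<And>n. \<bar>X n\<bar> \<le> K"
      using convergent_imp_Bseq[of X] X(2) by (auto simp: convergent_def Bseq_def)
    define q where "q n x = complex_of_real ((\<phi> (x - X n *\<^sub>R b) - \<phi> x) / X n)" for n x
    have qm: "q n \<in> borel_measurable borel" for n
      unfolding q_def[abs_def] of_real_divide of_real_diff by measurable
    have "(\<lambda>n. abs_L2 (q n)) \<longlonglongrightarrow> abs_L2 (\<lambda>x. complex_of_real (- frechet_derivative \<phi> (at x) b))"
    proof (rule tendsto_L2_dominated(3)[where B=M and w="indicator (cball 0 (R + K))"])
      show "square_integrable (indicator (cball (0::'a) (R + K)))"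
        by (intro square_integrable_indicator emeasure_lborel_cball_finite) auto
      show "(\<lambda>x. complex_of_real (- frechet_derivative \<phi> (at x) b)) \<in> borel_measurable borel"
        using test_function_measurable[OF test_function_deriv[OF \<phi> b]] by simp
      show "AE x in lborel. cmod (q n x) \<le> M * cmod (indicator (cball 0 (R + K)) x)" for n
      proof (rule AE_I2)
        fix x
        show "cmod (q n x) \<le> M * cmod (indicator (cball 0 (R + K)) x)"
        proof (cases "norm x \<le> R + K")
          case True
          have "\<bar>\<phi> (x - X n *\<^sub>R b) - \<phi> x\<bar> / \<bar>X n\<bar> \<le> (M * \<bar>X n\<bar>) / \<bar>X n\<bar>"
            by (intro divide_right_mono M) simp
          then show ?thesis using True X(1)[of n] by (simp add: q_def norm_divide flip: of_real_diff)
        next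
          case False
          have "0 \<le> K" using K[of 0] by linarith
          then have "\<phi> x = 0" using R[of x] False by fastforce
          moreover have "norm (X n *\<^sub>R b) \<le> K" using K[of n] b by simp
          then have "norm (x - X n *\<^sub>R b) > R" using False norm_triangle_ineq2[of x "X n *\<^sub>R b"] by linarith
          then have "\<phi> (x - X n *\<^sub>R b) = 0" using R[of "x - X n *\<^sub>R b"] by fastforce
          ultimately show ?thesis using False by (simp add: q_def)
        qed
      qed
      show "AE x in lborel. (\<lambda>n. q n x) \<longlonglongrightarrow> complex_of_real (- frechet_derivative \<phi> (at x) b)"
      proof (rule AE_I2)
        fix x
        have "(\<lambda>n. (\<phi> (x - X n *\<^sub>R b) - \<phi> x) / X n) \<longlonglongrightarrow> - frechet_derivative \<phi> (at x) b"
          using M(3)[of x] X unfolding tendsto_at_iff_sequentially comp_def by auto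
        then show "(\<lambda>n. q n x) \<longlonglongrightarrow> complex_of_real (- frechet_derivative \<phi> (at x) b)"
          unfolding q_def by (rule tendsto_of_real)
      qed
    qed (use qm in auto)
    moreover have "abs_L2 (q n) = (shift (- (X n *\<^sub>R b)) \<Phi> - \<Phi>) /\<^sub>R X n" for n
    proof -
      have "shift (- (X n *\<^sub>R b)) \<Phi> - \<Phi> = abs_L2 (\<lambda>x. complex_of_real (\<phi> (x - X n *\<^sub>R b)) - complex_of_real (\<phi> x))"
        using square_integrable_shift[OF sq, of "- (X n *\<^sub>R b)"] by (simp add: \<Phi>_def shift_abs_L2 sq abs_L2_diff)
      moreover have "square_integrable (\<lambda>x. complex_of_real (\<phi> (x - X n *\<^sub>R b)) - complex_of_real (\<phi> x))"
        using square_integrable_shift[OF sq, of "- (X n *\<^sub>R b)"] by (intro square_integrable_diff sq) simp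
      ultimately show ?thesis
        by (simp add: abs_L2_scaleR q_def[abs_def] scaleR_conv_of_real field_simps)
    qed
    moreover have "abs_L2 (\<lambda>x. complex_of_real (- frechet_derivative \<phi> (at x) b)) = - abs_L2 (\<lambda>x. complex_of_real (frechet_derivative \<phi> (at x) b))"
      using abs_L2_scaleR[OF sq', of "- 1"] by simp
    ultimately show ?thesis by simp
  qed
  show ?thesis
    unfolding tendsto_at_iff_sequentially comp_def using lim by auto
qed

lemma cscale_L2_one: "cscale_L2 1 u = u"
  using cscale_L2_of_real[of 1 u] by simp

lemma cinner_abs_L2_right:
  "square_integrable f \<Longrightarrow> cinner u (abs_L2 f) = (LINT x|lborel. rep_L2 u x * cnj (f x))"
  unfolding cinner_def using rep_abs_L2[of f]
  by (intro integral_cong_AE borel_measurable_times borel_measurable_cnj) (auto simp: square_integrableD)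

lemma integral_test_function:
  "test_function \<phi> \<Longrightarrow> (LINT x|lborel. \<phi> x *\<^sub>R rep_L2 u x) = cinner u (abs_L2 (\<lambda>x. of_real (\<phi> x)))"
  by (simp add: cinner_abs_L2_right square_integrable_test_function scaleR_conv_of_real mult.commute)

lemma cinner_diff_left: "cinner (u - v) w = cinner u w - cinner v w"
  by (simp add: cinner_eq inner_diff_left complex_eq_iff)

text \<open>Moving the difference quotient from u to the test function and passing to the limit
  shows that the multiplier is a weak derivative. The fundamental lemma shows that it is the only
  one, as the description operator requires.\<close>

lemma weak_deriv_bessel:
  assumes b: "b \<in> Basis"
  shows "weak_deriv b (bessel 1 f) = fmult (deriv_symbol b) f"
  unfolding weak_deriv_def
proof (rule the_equality)
  let ?u = "bessel 1 f"
  have eq: "(LINT x|lborel. frechet_derivative \<phi> (at x) b *\<^sub>R rep_L2 ?u x) = - (LINT x|lborel. \<phi> x *\<^sub>R rep_L2 (fmult (deriv_symbol b) f) x)"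
    if \<phi>: "test_function \<phi>" for \<phi>
  proof -
    define \<Phi> where "\<Phi> = abs_L2 (\<lambda>x. complex_of_real (\<phi> x))"
    define \<Phi>' where "\<Phi>' = abs_L2 (\<lambda>x. complex_of_real (frechet_derivative \<phi> (at x) b))"
    \<comment> \<open>The real inner product is used with a multiple c of the test function; c = 1
      and c = i give the two parts of the complex identity.\<close>
    have *: "?u \<bullet> cscale_L2 c \<Phi>' = - (fmult (deriv_symbol b) f \<bullet> cscale_L2 c \<Phi>)" for c
    proof -
      have "((\<lambda>h. ((shift (h *\<^sub>R b) ?u - ?u) /\<^sub>R h) \<bullet> cscale_L2 c \<Phi>) \<longlongrightarrow> fmult (deriv_symbol b) f \<bullet> cscale_L2 c \<Phi>) (at 0)"
        by (intro tendsto_inner tendsto_const tendsto_shift_quotient b)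
      moreover have "((\<lambda>h. ?u \<bullet> cscale_L2 c ((shift (- (h *\<^sub>R b)) \<Phi> - \<Phi>) /\<^sub>R h)) \<longlongrightarrow> ?u \<bullet> cscale_L2 c (- \<Phi>')) (at 0)"
        unfolding \<Phi>_def \<Phi>'_def
        by (intro tendsto_inner tendsto_const bounded_linear.tendsto[OF bounded_linear_cscale_L2] tendsto_shift_test_function \<phi> b)
      moreover have "((shift (h *\<^sub>R b) ?u - ?u) /\<^sub>R h) \<bullet> cscale_L2 c \<Phi> = ?u \<bullet> cscale_L2 c ((shift (- (h *\<^sub>R b)) \<Phi> - \<Phi>) /\<^sub>R h)" for h
      proof -
        have "cscale_L2 c ((shift (- (h *\<^sub>R b)) \<Phi> - \<Phi>) /\<^sub>R h) = (shift (- (h *\<^sub>R b)) (cscale_L2 c \<Phi>) - cscale_L2 c \<Phi>) /\<^sub>R h"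
          by (simp add: linear_cmul[OF bounded_linear.linear[OF bounded_linear_cscale_L2]] cscale_L2_diff shift_cscale)
        then show ?thesis by (simp add: inner_diff_left inner_diff_right inner_shift)
      qed
      ultimately have "fmult (deriv_symbol b) f \<bullet> cscale_L2 c \<Phi> = ?u \<bullet> cscale_L2 c (- \<Phi>')"
        by (intro tendsto_unique[OF at_neq_bot]) auto
      also have "cscale_L2 c (- \<Phi>') = - cscale_L2 c \<Phi>'"
        by (rule linear_neg[OF bounded_linear.linear[OF bounded_linear_cscale_L2]])
      finally show ?thesis by simp
    qed
    have "cinner ?u \<Phi>' = - cinner (fmult (deriv_symbol b) f) \<Phi>"
      using *[of 1] *[of \<i>] by (simp add: cinner_eq complex_eq_iff cscale_L2_one)
    then show ?thesis
      by (simp add: integral_test_function[OF \<phi>] integral_test_function[OF test_function_deriv[OF \<phi> b]] \<Phi>_def \<Phi>'_def)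
  qed
  then show "\<forall>\<phi>. test_function \<phi> \<longrightarrow> (LINT x|lborel. frechet_derivative \<phi> (at x) b *\<^sub>R rep_L2 ?u x) = - (LINT x|lborel. \<phi> x *\<^sub>R rep_L2 (fmult (deriv_symbol b) f) x)"
    by blast
  fix v assume v: "\<forall>\<phi>. test_function \<phi> \<longrightarrow> (LINT x|lborel. frechet_derivative \<phi> (at x) b *\<^sub>R rep_L2 ?u x) = - (LINT x|lborel. \<phi> x *\<^sub>R rep_L2 v x)"
  have "v - fmult (deriv_symbol b) f = 0"
  proof (rule L2_eq_0_test_function)
    fix \<phi> :: "'a \<Rightarrow> real" assume \<phi>: "test_function \<phi>"
    have "- (LINT x|lborel. \<phi> x *\<^sub>R rep_L2 v x) = - (LINT x|lborel. \<phi> x *\<^sub>R rep_L2 (fmult (deriv_symbol b) f) x)"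
      using v \<phi> eq[OF \<phi>] by simp
    then show "cinner (v - fmult (deriv_symbol b) f) (abs_L2 (\<lambda>x. of_real (\<phi> x))) = 0"
      by (simp add: integral_test_function[OF \<phi>] cinner_diff_left)
  qed
  then show "v = fmult (deriv_symbol b) f" by simp
qed

text \<open>The form $\langle f, K f\rangle$ of this multiplier is $\|\nabla J_1 f\|_2^2$.\<close>

definition kinetic_symbol :: "'a::euclidean_space \<Rightarrow> complex" where
  "kinetic_symbol \<xi> = of_real ((norm \<xi>)\<^sup>2 / (1 + (norm \<xi>)\<^sup>2))"

lemma kinetic_symbol_eq: "kinetic_symbol \<xi> = 1 - bessel_symbol 2 \<xi>"
proof -
  have "bessel_symbol 2 \<xi> = of_real (1 / (1 + (norm \<xi>)\<^sup>2))"
    using one_plus_norm_sq(2)[of \<xi>] by (simp add: bessel_symbol_def powr_minus_divide)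
  moreover have "(norm \<xi>)\<^sup>2 / (1 + (norm \<xi>)\<^sup>2) = 1 - 1 / (1 + (norm \<xi>)\<^sup>2)"
    using one_plus_norm_sq(2)[of \<xi>] by (simp add: field_simps)
  ultimately show ?thesis by (simp add: kinetic_symbol_def)
qed

lemma bounded_multiplier_kinetic [simp]: "bounded_multiplier kinetic_symbol"
  unfolding kinetic_symbol_eq[abs_def] by (intro bounded_multiplier_diff bounded_multiplier_const) simp

lemma sum_deriv_symbol: "(\<Sum>b\<in>Basis. cnj (deriv_symbol b \<xi>) * deriv_symbol b \<xi>) = kinetic_symbol \<xi>"
proof -
  have "cnj (deriv_symbol b \<xi>) * deriv_symbol b \<xi> = of_real ((\<xi> \<bullet> b)\<^sup>2) * bessel_symbol 2 \<xi>" for b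
  proof -
    have "cnj (deriv_symbol b \<xi>) * deriv_symbol b \<xi> = of_real ((\<xi> \<bullet> b)\<^sup>2) * (bessel_symbol 1 \<xi> * bessel_symbol 1 \<xi>)"
      by (simp add: deriv_symbol_def power2_eq_square inner_commute algebra_simps)
    then show ?thesis by (simp only: bessel_symbol_mult) simp
  qed
  then have "(\<Sum>b\<in>Basis. cnj (deriv_symbol b \<xi>) * deriv_symbol b \<xi>) = of_real ((norm \<xi>)\<^sup>2) * bessel_symbol 2 \<xi>"
    unfolding power2_norm_Basis by (simp add: sum_distrib_right)
  also have "\<dots> = kinetic_symbol \<xi>"
    using one_plus_norm_sq(2)[of \<xi>] by (simp add: bessel_symbol_def kinetic_symbol_def powr_minus_divide)
  finally show ?thesis .
qed

lemma sum_norm_deriv: "(\<Sum>b\<in>Basis. (norm (fmult (deriv_symbol b) f))\<^sup>2) = f \<bullet> fmult kinetic_symbol f"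
proof -
  have "(\<Sum>b\<in>Basis. (norm (fmult (deriv_symbol b) f))\<^sup>2) = (\<Sum>b\<in>Basis. f \<bullet> fmult (\<lambda>\<xi>. cnj (deriv_symbol b \<xi>) * deriv_symbol b \<xi>) f)"
    by (intro sum.cong refl) (simp add: power2_norm_eq_inner inner_fmult fmult_fmult bounded_multiplier_cnj)
  also have "\<dots> = f \<bullet> (\<Sum>b\<in>Basis. fmult (\<lambda>\<xi>. cnj (deriv_symbol b \<xi>) * deriv_symbol b \<xi>) f)"
    by (simp add: inner_sum_right)
  also have "(\<Sum>b\<in>Basis. fmult (\<lambda>\<xi>. cnj (deriv_symbol b \<xi>) * deriv_symbol b \<xi>) f) = fmult kinetic_symbol f"
    using fmult_sum_mult[of Basis "\<lambda>b \<xi>. cnj (deriv_symbol b \<xi>) * deriv_symbol b \<xi>" f]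
    by (simp add: sum_deriv_symbol[abs_def] bounded_multiplier_mult bounded_multiplier_cnj)
  finally show ?thesis .
qed

text \<open>For psi = J_1 f this is the splitting of the squared H^1 norm into the squared L^2 norms
  of psi and of its gradient.\<close>

lemma norm_eq_kinetic: "(norm f)\<^sup>2 = (norm (bessel 1 f))\<^sup>2 + f \<bullet> fmult kinetic_symbol f"
proof -
  have "fmult kinetic_symbol f = f - bessel 2 f"
    unfolding kinetic_symbol_eq[abs_def] by (simp add: fmult_diff_mult bounded_multiplier_const fmult_one)
  moreover have "(norm (bessel 1 f))\<^sup>2 = f \<bullet> bessel 2 f"
    by (simp add: power2_norm_eq_inner inner_bessel bessel_bessel)
  ultimately show ?thesis by (simp add: inner_diff_right power2_norm_eq_inner)
qed

lemma kinetic_integral: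
  "(LINT x|lborel. (\<Sum>b\<in>Basis. (cmod (rep_L2 (weak_deriv b (bessel 1 f)) x))\<^sup>2)) = f \<bullet> fmult kinetic_symbol f"
proof -
  have "(LINT x|lborel. (\<Sum>b\<in>Basis. (cmod (rep_L2 (weak_deriv b (bessel 1 f)) x))\<^sup>2)) =
      (\<Sum>b\<in>Basis. LINT x|lborel. (cmod (rep_L2 (weak_deriv b (bessel 1 f)) x))\<^sup>2)"
    by (rule Bochner_Integration.integral_sum) (use square_integrable_rep square_integrable_def in blast)
  also have "\<dots> = (\<Sum>b\<in>Basis. (norm (fmult (deriv_symbol b) f))\<^sup>2)"
    by (intro sum.cong refl) (simp add: weak_deriv_bessel flip: power2_norm_L2)
  finally show ?thesis by (simp add: sum_norm_deriv)
qed

section \<open>Hardy's inequality\<close>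

lemma pmult_shift:
  assumes "bounded_multiplier m"
  shows "pmult m (shift k u) = shift k (pmult (\<lambda>x. m (x - k)) u)"
proof -
  have b: "bounded_multiplier (\<lambda>x. m (x - k))"
    using assms by (auto simp: bounded_multiplier_def bounded_iff)
  have "pmult m (shift k u) = abs_L2 (\<lambda>x. m x * rep_L2 u (x + k))"
    unfolding shift_def by (intro pmult_abs_L2 assms square_integrable_shift) simp
  moreover have "shift k (pmult (\<lambda>x. m (x - k)) u) = abs_L2 (\<lambda>x. m x * rep_L2 u (x + k))"
    unfolding pmult_def using shift_abs_L2[OF square_integrable_pmult[OF b square_integrable_rep], of k u] by simp
  ultimately show ?thesis by simp
qed

lemma inner_pmult_shift:
  assumes "bounded_multiplier m"
  shows "pmult m (shift k u) \<bullet> shift k u = pmult (\<lambda>x. m (x - k)) u \<bullet> u"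
  by (simp add: pmult_shift[OF assms] inner_shift shift_shift)

lemma inner_pmult_self:
  assumes "bounded_multiplier (\<lambda>x. complex_of_real (\<phi> x))"
  shows "pmult (\<lambda>x. of_real (\<phi> x)) u \<bullet> u = (LINT x|lborel. \<phi> x * (cmod (rep_L2 u x))\<^sup>2)"
proof -
  have [measurable]: "\<phi> \<in> borel_measurable borel"
    using measurable_compose[OF bounded_multiplier_measurable[OF assms] borel_measurable_Re] by simp
  show ?thesis
    unfolding inner_L2_eq cmod_power2 using rep_pmult[OF assms, of u]
    by (intro integral_cong_AE) (auto simp: inner_complex_def power2_eq_square algebra_simps)
qed

lemma integrable_mult_power2_norm:
  assumes "\<phi> \<in> borel_measurable borel" "\<And>x. \<bar>\<phi> x\<bar> \<le> B"
  shows "integrable lborel (\<lambda>x. \<phi> x * (cmod (rep_L2 u x))\<^sup>2)"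
proof (rule Bochner_Integration.integrable_bound)
  show "integrable lborel (\<lambda>x. B * (cmod (rep_L2 u x))\<^sup>2)"
    using square_integrable_rep[of u] unfolding square_integrable_def by simp
  show "AE x in lborel. norm (\<phi> x * (cmod (rep_L2 u x))\<^sup>2) \<le> norm (B * (cmod (rep_L2 u x))\<^sup>2)"
    using assms(2) by (auto simp: abs_mult intro!: mult_right_mono AE_I2 order.trans[OF assms(2) abs_ge_self])
qed (use assms in measurable)

text \<open>Translation invariance exchanges a difference quotient of phi for one of u, and the
  latter converges in L^2 for u in H^1. The hypotheses on phi are fitted to the Hardy field, whose
  components are bounded with bounded derivatives but not compactly supported.\<close>

lemma integration_by_parts_norm:
  assumes b: "b \<in> Basis" and [measurable]: "\<phi> \<in> borel_measurable borel" "\<phi>' \<in> borel_measurable borel"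
    and B: "\<And>x. \<bar>\<phi> x\<bar> \<le> B" and M: "\<And>x. \<bar>\<phi>' x\<bar> \<le> M"
    and lip: "\<And>x h. \<bar>\<phi> (x - h *\<^sub>R b) - \<phi> x\<bar> \<le> M * \<bar>h\<bar>"
    and lim: "\<And>x. ((\<lambda>h. (\<phi> (x - h *\<^sub>R b) - \<phi> x) / h) \<longlongrightarrow> - \<phi>' x) (at 0)"
  shows "pmult (\<lambda>x. of_real (\<phi>' x)) (bessel 1 f) \<bullet> bessel 1 f =
    - 2 * (pmult (\<lambda>x. of_real (\<phi> x)) (bessel 1 f) \<bullet> fmult (deriv_symbol b) f)"
proof -
  define u where "u = bessel 1 f"
  define D where "D = fmult (deriv_symbol b) f"
  define T where "T h = shift (h *\<^sub>R b) u" for h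
  define Q where "Q h = (T h - u) /\<^sub>R h" for h
  define m where "m x = complex_of_real (\<phi> x)" for x
  have m: "bounded_multiplier m" unfolding m_def[abs_def] by (rule bounded_multiplierI[where B=B]) (use B in auto)
  have ms: "bounded_multiplier (\<lambda>x. m (x - k))" for k
    using m by (auto simp: bounded_multiplier_def bounded_iff)
  have Q: "(Q \<longlongrightarrow> D) (at 0)"
    unfolding Q_def T_def u_def D_def by (rule tendsto_shift_quotient[OF b])
  have T: "(T \<longlongrightarrow> u) (at 0)"
  proof -
    have "((\<lambda>h. h *\<^sub>R Q h + u) \<longlongrightarrow> 0 *\<^sub>R D + u) (at 0)" by (intro tendsto_intros Q)
    moreover have "h *\<^sub>R Q h + u = T h" for h by (cases "h = 0") (auto simp: Q_def T_def)
    ultimately show ?thesis by simp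
  qed
  have P: "linear (pmult m)" by (rule bounded_linear.linear[OF bounded_linear_pmult[OF m]])
  have mult: "pmult m v \<bullet> w = v \<bullet> pmult m w" for v w
    using inner_pmult[OF m, of v w] by (simp add: m_def[abs_def])
  define q where "q h x = complex_of_real ((\<phi> (x - h *\<^sub>R b) - \<phi> x) / h)" for h x
  have qu: "((\<lambda>h. pmult (q h) u \<bullet> u) \<longlongrightarrow> pmult (\<lambda>x. of_real (- \<phi>' x)) u \<bullet> u) (at 0)"
  proof (intro tendsto_inner tendsto_const tendsto_pmult_at[where B=M])
    show "q h \<in> borel_measurable borel" for h unfolding q_def[abs_def] by measurable
    show "cmod (q h x) \<le> M" if "h \<noteq> 0" for h x
      using divide_right_mono[OF lip[where x=x and h=h], of "\<bar>h\<bar>"] that by (simp add: q_def norm_divide flip: of_real_diff)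
    show "((\<lambda>h. q h x) \<longlongrightarrow> of_real (- \<phi>' x)) (at 0)" for x
      unfolding q_def by (intro tendsto_of_real lim)
  qed measurable
  have PQ: "((\<lambda>h. pmult m (Q h) \<bullet> T h + pmult m u \<bullet> Q h) \<longlongrightarrow> pmult m D \<bullet> u + pmult m u \<bullet> D) (at 0)"
    by (intro tendsto_intros Q T bounded_linear.tendsto[OF bounded_linear_pmult[OF m]])
  \<comment> \<open>Discrete product rule: the change of the quadratic form between u and
    \<open>T h\<close> is split into the changes in its two slots.\<close>
  have eq: "pmult (q h) u \<bullet> u = pmult m (Q h) \<bullet> T h + pmult m u \<bullet> Q h" if "h \<noteq> 0" for h
  proof -
    have "pmult (q h) u = inverse h *\<^sub>R (pmult (\<lambda>x. m (x - h *\<^sub>R b)) u - pmult m u)"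
    proof -
      have c: "bounded_multiplier (\<lambda>x. m (x - h *\<^sub>R b) - m x)" by (intro bounded_multiplier_diff ms m)
      have "q h = (\<lambda>x. of_real (inverse h) * (m (x - h *\<^sub>R b) - m x))"
        by (simp add: q_def m_def fun_eq_iff field_simps)
      then have "pmult (q h) u = pmult (\<lambda>x. of_real (inverse h)) (pmult (\<lambda>x. m (x - h *\<^sub>R b) - m x) u)"
        by (simp add: pmult_pmult[OF bounded_multiplier_const c])
      then show ?thesis by (simp only: pmult_const cscale_L2_of_real pmult_diff_mult[OF ms m])
    qed
    then have "pmult (q h) u \<bullet> u = inverse h * (pmult m (T h) \<bullet> T h - pmult m u \<bullet> u)"
      by (simp add: T_def inner_pmult_shift[OF m] inner_diff_left)
    also have "\<dots> = pmult m (Q h) \<bullet> T h + pmult m u \<bullet> Q h"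
      by (simp add: Q_def linear_cmul[OF P] linear_diff[OF P] inner_diff_left inner_diff_right algebra_simps)
    finally show ?thesis .
  qed
  have "((\<lambda>h. pmult (q h) u \<bullet> u) \<longlongrightarrow> pmult m D \<bullet> u + pmult m u \<bullet> D) (at 0)"
    by (rule Lim_transform_eventually[OF PQ]) (simp add: eventually_at_filter eq)
  from tendsto_unique[OF at_neq_bot qu this]
  have "pmult (\<lambda>x. of_real (- \<phi>' x)) u \<bullet> u = 2 * (pmult m u \<bullet> D)"
    by (simp add: mult[of D u] inner_commute[of D])
  moreover have "pmult (\<lambda>x. of_real (- \<phi>' x)) u \<bullet> u = - (pmult (\<lambda>x. of_real (\<phi>' x)) u \<bullet> u)"
  proof -
    have "bounded_multiplier (\<lambda>x. complex_of_real (\<phi>' x))" "bounded_multiplier (\<lambda>x. complex_of_real (- \<phi>' x))"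
      using M by (auto intro!: bounded_multiplierI[where B=M])
    then show ?thesis by (simp only: inner_pmult_self) simp
  qed
  ultimately show ?thesis by (simp add: m_def[abs_def] u_def D_def)
qed

text \<open>Integrates $|u|^2$ against the divergence of the bounded field $(y - x_0) / (|y - x_0|^2 + e)$,
  which is at least $(N - 2) / (|y - x_0|^2 + e)$.\<close>

lemma hardy_regularized:
  fixes f :: "'a::euclidean_space L2" and x0 :: 'a
  assumes N: "3 \<le> DIM('a)" and e: "0 < e"
  shows "(LINT y|lborel. 1 / ((norm (y - x0))\<^sup>2 + e) * (cmod (rep_L2 (bessel 1 f) y))\<^sup>2) \<le> 4 * (f \<bullet> fmult kinetic_symbol f)"
proof -
  define u where "u = bessel 1 f"
  define r where "r y = (norm (y - x0))\<^sup>2 + e" for y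
  define X where "X b y = ((y - x0) \<bullet> b) / r y" for b y
  define X' where "X' b y = 1 / r y - 2 * ((y - x0) \<bullet> b)\<^sup>2 / (r y)\<^sup>2" for b y
  have r: "r y \<ge> e" "r y > 0" "(norm (y - x0))\<^sup>2 \<le> r y" for y using e by (auto simp: r_def add_nonneg_pos)
  have [measurable]: "r \<in> borel_measurable borel" unfolding r_def by measurable
  have [measurable]: "X b \<in> borel_measurable borel" "X' b \<in> borel_measurable borel" for b
    unfolding X_def X'_def by measurable
  have ir: "1 / r y \<le> 1 / e" for y using r[of y] e by (simp add: frac_le)
  have sqle: "((y - x0) \<bullet> b)\<^sup>2 \<le> r y" if "b \<in> Basis" for b y
  proof -
    have "((y - x0) \<bullet> b)\<^sup>2 \<le> (norm (y - x0))\<^sup>2"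
      using Basis_le_norm[OF that, of "y - x0"] by (metis abs_le_square_iff abs_norm_cancel)
    then show ?thesis using r(3)[of y] by linarith
  qed
  have Xsq: "(X b y)\<^sup>2 \<le> 1 / e" if "b \<in> Basis" for b y
  proof -
    have "(X b y)\<^sup>2 \<le> r y / (r y)\<^sup>2"
      unfolding X_def power_divide by (intro divide_right_mono sqle that) simp
    also have "\<dots> = 1 / r y" using r(2)[of y] by (simp add: power2_eq_square)
    finally show ?thesis using ir[of y] by linarith
  qed
  \<comment> \<open>Only finiteness matters for the integration by parts; 1/e + 1 follows from the
    bound on the square without taking a root.\<close>
  have XB: "\<bar>X b y\<bar> \<le> 1 / e + 1" if "b \<in> Basis" for b y
  proof (rule ccontr)
    assume "\<not> ?thesis"
    then have a: "\<bar>X b y\<bar> > 1 / e + 1" by simp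
    moreover have "1 / e > 0" using e by simp
    ultimately have "1 < \<bar>X b y\<bar>" by linarith
    then have "\<bar>X b y\<bar> * 1 < \<bar>X b y\<bar> * \<bar>X b y\<bar>" by (intro mult_strict_left_mono) auto
    then have "\<bar>X b y\<bar> < (X b y)\<^sup>2" by (simp add: power2_eq_square)
    then show False using a Xsq[OF that, of y] by linarith
  qed
  have X'M: "\<bar>X' b y\<bar> \<le> 3 / e" if "b \<in> Basis" for b y
  proof -
    have "2 * ((y - x0) \<bullet> b)\<^sup>2 / (r y)\<^sup>2 \<le> 2 * r y / (r y)\<^sup>2"
      by (intro divide_right_mono mult_left_mono sqle that) auto
    also have "\<dots> = 2 * (1 / r y)" using r(2)[of y] by (simp add: power2_eq_square)
    finally have "2 * ((y - x0) \<bullet> b)\<^sup>2 / (r y)\<^sup>2 \<le> 2 * (1 / r y)" .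
    moreover have "0 \<le> 2 * ((y - x0) \<bullet> b)\<^sup>2 / (r y)\<^sup>2" "0 < 1 / r y" using r(2)[of y] by auto
    ultimately show ?thesis using ir[of y] unfolding X'_def by linarith
  qed
  \<comment> \<open>Along the line x - h b the component is an explicit rational function of h; the
    backward direction produces the minus sign.\<close>
  have D: "((\<lambda>h. X b (x - h *\<^sub>R b)) has_real_derivative - X' b (x - h *\<^sub>R b)) (at h)" if b: "b \<in> Basis" for b x h
  proof -
    define p where "p = (x - x0) \<bullet> b"
    define q where "q = (norm (x - x0))\<^sup>2 + e"
    have num: "(x - h *\<^sub>R b - x0) \<bullet> b = p - h" for h using b by (simp add: p_def inner_diff_left)
    have den: "r (x - h *\<^sub>R b) = q - 2 * h * p + h\<^sup>2" for h
    proof -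
      have 1: "x - h *\<^sub>R b - x0 = (x - x0) - h *\<^sub>R b" by simp
      have 2: "(norm (z - h *\<^sub>R b))\<^sup>2 = (norm z)\<^sup>2 - 2 * h * (z \<bullet> b) + h\<^sup>2" for z
        unfolding power2_norm_eq_inner
        using b by (simp add: inner_diff_left inner_diff_right inner_commute power2_eq_square)
      show ?thesis unfolding r_def q_def p_def 1 2 by simp
    qed
    have pos: "q - 2 * h * p + h\<^sup>2 > 0" using r(2)[of "x - h *\<^sub>R b"] by (simp add: den)
    have "((\<lambda>h. (p - h) / (q - 2 * h * p + h\<^sup>2)) has_real_derivative
        ((- 1) * (q - 2 * h * p + h\<^sup>2) - (p - h) * (- 2 * p + 2 * h)) / ((q - 2 * h * p + h\<^sup>2) * (q - 2 * h * p + h\<^sup>2))) (at h)"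
      using pos by (auto intro!: derivative_eq_intros)
    also have "((- 1) * (q - 2 * h * p + h\<^sup>2) - (p - h) * (- 2 * p + 2 * h)) / ((q - 2 * h * p + h\<^sup>2) * (q - 2 * h * p + h\<^sup>2))
       = - X' b (x - h *\<^sub>R b)"
    proof -
      have "((- 1) * R - (p - h) * (- 2 * p + 2 * h)) / (R * R) = - (1 / R - 2 * (p - h)\<^sup>2 / R\<^sup>2)" if "R > 0" for R
        using that by (simp add: field_simps power2_eq_square)
      from this[OF pos] show ?thesis unfolding X'_def num den .
    qed
    finally show ?thesis by (simp add: X_def num den)
  qed
  have ibp: "pmult (\<lambda>y. of_real (X' b y)) u \<bullet> u = - 2 * (pmult (\<lambda>y. of_real (X b y)) u \<bullet> fmult (deriv_symbol b) f)"
    if b: "b \<in> Basis" for b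
    unfolding u_def
  proof (rule integration_by_parts_norm[OF b _ _ XB[OF b] X'M[OF b]])
    show "\<bar>X b (x - h *\<^sub>R b) - X b x\<bar> \<le> 3 / e * \<bar>h\<bar>" for x h
      using field_differentiable_bound[of UNIV "\<lambda>h. X b (x - h *\<^sub>R b)" "\<lambda>h. - X' b (x - h *\<^sub>R b)" "3 / e" h 0] D[OF b] X'M[OF b]
      by auto
    show "((\<lambda>h. (X b (x - h *\<^sub>R b) - X b x) / h) \<longlongrightarrow> - X' b x) (at 0)" for x
      using D[OF b, of x 0] by (simp add: DERIV_def)
  qed auto
  define I where "I = (LINT y|lborel. 1 / r y * (cmod (rep_L2 u y))\<^sup>2)"
  have iI: "integrable lborel (\<lambda>y. 1 / r y * (cmod (rep_L2 u y))\<^sup>2)"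
    using r ir by (intro integrable_mult_power2_norm[where B="1 / e"]) (auto simp: abs_of_pos)
  have iX': "integrable lborel (\<lambda>y. X' b y * (cmod (rep_L2 u y))\<^sup>2)" if "b \<in> Basis" for b
    using X'M[OF that] by (intro integrable_mult_power2_norm) auto
  have iX: "integrable lborel (\<lambda>y. (X b y)\<^sup>2 * (cmod (rep_L2 u y))\<^sup>2)" if "b \<in> Basis" for b
    using Xsq[OF that] by (intro integrable_mult_power2_norm[where B="1 / e"]) auto
  have bX: "bounded_multiplier (\<lambda>y. complex_of_real (X b y))" if "b \<in> Basis" for b
    by (rule bounded_multiplierI[where B="1 / e + 1"]) (use XB[OF that] in auto)
  have bX': "bounded_multiplier (\<lambda>y. complex_of_real (X' b y))" if "b \<in> Basis" for b
    by (rule bounded_multiplierI[where B="3 / e"]) (use X'M[OF that] in auto)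
  have nX: "(norm (pmult (\<lambda>y. of_real (X b y)) u))\<^sup>2 = (LINT y|lborel. (X b y)\<^sup>2 * (cmod (rep_L2 u y))\<^sup>2)" if "b \<in> Basis" for b
    unfolding pmult_def using square_integrable_pmult[OF bX[OF that] square_integrable_rep[of u]]
    by (simp add: power2_norm_abs_L2 norm_mult power_mult_distrib)
  \<comment> \<open>Here N \<ge> 3 enters: the divergence is N/r - 2 |y - x0|^2 / r^2, which is at
    least (N - 2)/r and hence at least 1/r.\<close>
  have "I \<le> (LINT y|lborel. (\<Sum>b\<in>Basis. X' b y * (cmod (rep_L2 u y))\<^sup>2))"
    unfolding I_def
  proof (rule integral_mono[OF iI])
    show "integrable lborel (\<lambda>y. \<Sum>b\<in>Basis. X' b y * (cmod (rep_L2 u y))\<^sup>2)" using iX' by auto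
    fix y
    have "(\<Sum>b\<in>Basis. X' b y) = real DIM('a) * (1 / r y) - 2 * (norm (y - x0))\<^sup>2 / (r y)\<^sup>2"
      unfolding X'_def power2_norm_Basis by (simp add: sum_subtractf sum_distrib_left sum_divide_distrib)
    moreover have "2 * (norm (y - x0))\<^sup>2 / (r y)\<^sup>2 \<le> 2 * r y / (r y)\<^sup>2"
      by (intro divide_right_mono mult_left_mono r(3)) auto
    moreover have "2 * r y / (r y)\<^sup>2 = 2 * (1 / r y)" using r(2)[of y] by (simp add: power2_eq_square)
    moreover have "3 * (1 / r y) \<le> real DIM('a) * (1 / r y)"
      using N r(2)[of y] by (intro mult_right_mono) (auto simp: less_imp_le)
    ultimately have "1 / r y \<le> (\<Sum>b\<in>Basis. X' b y)" by linarith
    then show "1 / r y * (cmod (rep_L2 u y))\<^sup>2 \<le> (\<Sum>b\<in>Basis. X' b y * (cmod (rep_L2 u y))\<^sup>2)"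
      unfolding sum_distrib_right[symmetric] by (rule mult_right_mono) simp
  qed
  also have "\<dots> = (\<Sum>b\<in>Basis. pmult (\<lambda>y. of_real (X' b y)) u \<bullet> u)"
    by (subst Bochner_Integration.integral_sum) (auto simp: iX' inner_pmult_self bX')
  \<comment> \<open>Young's inequality with the weights 1/2 and 2. The first part sums to at most
    I/2 and is absorbed, which yields the constant 4.\<close>
  also have "\<dots> \<le> (\<Sum>b\<in>Basis. (1/2) * (norm (pmult (\<lambda>y. of_real (X b y)) u))\<^sup>2 + 2 * (norm (fmult (deriv_symbol b) f))\<^sup>2)"
  proof (rule sum_mono)
    fix b :: 'a assume b: "b \<in> Basis"
    let ?v = "pmult (\<lambda>y. complex_of_real (X b y)) u" and ?w = "fmult (deriv_symbol b) f"
    have "0 \<le> (norm (?v + 2 *\<^sub>R ?w))\<^sup>2" by simp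
    also have "\<dots> = (norm ?v)\<^sup>2 + 4 * (?v \<bullet> ?w) + 4 * (norm ?w)\<^sup>2"
      by (simp add: power2_norm_eq_inner inner_add_left inner_add_right inner_commute)
    finally show "pmult (\<lambda>y. of_real (X' b y)) u \<bullet> u \<le> (1/2) * (norm ?v)\<^sup>2 + 2 * (norm ?w)\<^sup>2"
      unfolding ibp[OF b] by linarith
  qed
  also have "\<dots> = (1/2) * (\<Sum>b\<in>Basis. LINT y|lborel. (X b y)\<^sup>2 * (cmod (rep_L2 u y))\<^sup>2) + 2 * (f \<bullet> fmult kinetic_symbol f)"
    by (simp add: sum.distrib nX flip: sum_distrib_left sum_divide_distrib sum_norm_deriv)
  finally have I1: "I \<le> (1/2) * (\<Sum>b\<in>Basis. LINT y|lborel. (X b y)\<^sup>2 * (cmod (rep_L2 u y))\<^sup>2) + 2 * (f \<bullet> fmult kinetic_symbol f)" .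
  have "(\<Sum>b\<in>Basis. LINT y|lborel. (X b y)\<^sup>2 * (cmod (rep_L2 u y))\<^sup>2) = (LINT y|lborel. (\<Sum>b\<in>Basis. (X b y)\<^sup>2 * (cmod (rep_L2 u y))\<^sup>2))"
    by (rule Bochner_Integration.integral_sum[symmetric]) (rule iX)
  also have "\<dots> \<le> I"
    unfolding I_def
  proof (rule integral_mono[OF _ iI])
    show "integrable lborel (\<lambda>y. \<Sum>b\<in>Basis. (X b y)\<^sup>2 * (cmod (rep_L2 u y))\<^sup>2)" using iX by auto
    fix y
    have "(\<Sum>b\<in>Basis. (X b y)\<^sup>2) = (norm (y - x0))\<^sup>2 / (r y)\<^sup>2"
      unfolding X_def power2_norm_Basis by (simp add: power_divide sum_divide_distrib)
    also have "\<dots> \<le> r y / (r y)\<^sup>2" by (intro divide_right_mono r(3)) simp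
    also have "\<dots> = 1 / r y" using r(2)[of y] by (simp add: power2_eq_square)
    finally show "(\<Sum>b\<in>Basis. (X b y)\<^sup>2 * (cmod (rep_L2 u y))\<^sup>2) \<le> 1 / r y * (cmod (rep_L2 u y))\<^sup>2"
      unfolding sum_distrib_right[symmetric] by (rule mult_right_mono) simp
  qed
  finally have "I \<le> 4 * (f \<bullet> fmult kinetic_symbol f)" using I1 by linarith
  then show ?thesis by (simp add: I_def r_def u_def)
qed

lemma kinetic_nonneg: "0 \<le> f \<bullet> fmult kinetic_symbol f"
  unfolding sum_norm_deriv[symmetric] by (intro sum_nonneg) simp

text \<open>Fatou's lemma removes the regularisation; the point y = x is a null set.\<close>

lemma hardy:
  fixes f :: "'a::euclidean_space L2" and x :: 'a
  assumes N: "3 \<le> DIM('a)"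
  shows "(\<integral>\<^sup>+y. ennreal (1 / (norm (x - y))\<^sup>2 * (cmod (rep_L2 (bessel 1 f) y))\<^sup>2) \<partial>lborel) \<le> ennreal (4 * (f \<bullet> fmult kinetic_symbol f))"
proof -
  define g where "g n y = 1 / ((norm (y - x))\<^sup>2 + inverse (real (Suc n))) * (cmod (rep_L2 (bessel 1 f) y))\<^sup>2" for n y
  have [measurable]: "g n \<in> borel_measurable borel" for n unfolding g_def by measurable
  have "AE y in lborel. y \<noteq> x" using AE_lborel_singleton[of x] by auto
  then have "(\<integral>\<^sup>+y. ennreal (1 / (norm (x - y))\<^sup>2 * (cmod (rep_L2 (bessel 1 f) y))\<^sup>2) \<partial>lborel) =
      (\<integral>\<^sup>+y. liminf (\<lambda>n. ennreal (g n y)) \<partial>lborel)"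
  proof (intro nn_integral_cong_AE, eventually_elim)
    fix y assume "y \<noteq> x"
    then have "(\<lambda>n. g n y) \<longlonglongrightarrow> 1 / ((norm (y - x))\<^sup>2 + 0) * (cmod (rep_L2 (bessel 1 f) y))\<^sup>2"
      unfolding g_def by (intro tendsto_intros LIMSEQ_inverse_real_of_nat) auto
    then have "(\<lambda>n. ennreal (g n y)) \<longlonglongrightarrow> ennreal (1 / (norm (x - y))\<^sup>2 * (cmod (rep_L2 (bessel 1 f) y))\<^sup>2)"
      by (intro tendsto_ennrealI) (simp add: norm_minus_commute)
    then show "ennreal (1 / (norm (x - y))\<^sup>2 * (cmod (rep_L2 (bessel 1 f) y))\<^sup>2) = liminf (\<lambda>n. ennreal (g n y))"
      by (intro lim_imp_Liminf[symmetric]) simp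
  qed
  also have "\<dots> \<le> liminf (\<lambda>n. \<integral>\<^sup>+y. ennreal (g n y) \<partial>lborel)"
    by (rule nn_integral_liminf) measurable
  also have "\<dots> \<le> liminf (\<lambda>n. ennreal (4 * (f \<bullet> fmult kinetic_symbol f)))"
  proof (rule Liminf_mono, rule always_eventually, rule allI)
    fix n
    have p: "inverse (real (Suc n)) > 0" by simp
    have p': "(norm (y - x))\<^sup>2 + inverse (real (Suc n)) > 0" for y using p by (simp add: add_nonneg_pos)
    have "integrable lborel (g n)"
      unfolding g_def[abs_def]
    proof (rule integrable_mult_power2_norm[where B="1 / inverse (real (Suc n))"])
      show "\<bar>1 / ((norm (y - x))\<^sup>2 + inverse (real (Suc n)))\<bar> \<le> 1 / inverse (real (Suc n))" for y
        unfolding abs_of_pos[OF divide_pos_pos[OF zero_less_one p']]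
        by (intro divide_left_mono mult_pos_pos p p') auto
    qed measurable
    then have "(\<integral>\<^sup>+y. ennreal (g n y) \<partial>lborel) = ennreal (LINT y|lborel. g n y)"
      by (rule nn_integral_eq_integral) (simp add: g_def less_imp_le[OF p'])
    also have "\<dots> \<le> ennreal (4 * (f \<bullet> fmult kinetic_symbol f))"
      unfolding g_def by (intro ennreal_leI hardy_regularized N p)
    finally show "(\<integral>\<^sup>+y. ennreal (g n y) \<partial>lborel) \<le> ennreal (4 * (f \<bullet> fmult kinetic_symbol f))" .
  qed
  finally show ?thesis by (simp add: Liminf_const)
qed

section \<open>Riesz potentials\<close>

lemma ennreal_power2_le_imp_le:
  fixes a b :: ennreal
  assumes "a\<^sup>2 \<le> b\<^sup>2"
  shows "a \<le> b"
proof (rule ccontr)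
  assume "\<not> a \<le> b"
  then have ba: "b < a" by simp
  then obtain r where r: "b = ennreal r" "0 \<le> r" by (cases b) auto
  have "ennreal (r\<^sup>2) < a\<^sup>2"
  proof (cases a)
    case (real s)
    then have "r\<^sup>2 < s\<^sup>2" using ba r by (intro power_strict_mono) (auto simp: ennreal_less_iff)
    then show ?thesis using real by (simp add: ennreal_power ennreal_less_iff)
  qed (simp add: power2_eq_square ennreal_top_mult)
  then show False using assms r by (simp add: ennreal_power not_le[symmetric])
qed

lemma Cauchy_Schwarz_double_nn_integral:
  fixes S T :: "'a::euclidean_space \<Rightarrow> 'a \<Rightarrow> real"
  assumes [measurable]: "(\<lambda>(x, y). S x y) \<in> borel_measurable (borel \<Otimes>\<^sub>M borel)" "(\<lambda>(x, y). T x y) \<in> borel_measurable (borel \<Otimes>\<^sub>M borel)"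
    and nn: "\<And>x y. 0 \<le> S x y" "\<And>x y. 0 \<le> T x y" "0 \<le> A" "0 \<le> B"
    and S: "(\<integral>\<^sup>+x. \<integral>\<^sup>+y. ennreal ((S x y)\<^sup>2) \<partial>lborel \<partial>lborel) \<le> ennreal (A\<^sup>2)"
    and T: "(\<integral>\<^sup>+x. \<integral>\<^sup>+y. ennreal ((T x y)\<^sup>2) \<partial>lborel \<partial>lborel) \<le> ennreal (B\<^sup>2)"
  shows "(\<integral>\<^sup>+x. \<integral>\<^sup>+y. ennreal (S x y * T x y) \<partial>lborel \<partial>lborel) \<le> ennreal (A * B)"
proof -
  let ?M = "lborel \<Otimes>\<^sub>M lborel :: ('a \<times> 'a) measure"
  have e: "(\<integral>\<^sup>+x. \<integral>\<^sup>+y. ennreal (h x y) \<partial>lborel \<partial>lborel) = (\<integral>\<^sup>+p. ennreal (h (fst p) (snd p)) \<partial>?M)"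
    if [measurable]: "(\<lambda>(x, y). h x y) \<in> borel_measurable (borel \<Otimes>\<^sub>M borel)" for h :: "'a \<Rightarrow> 'a \<Rightarrow> real"
    by (subst lborel.nn_integral_fst[symmetric]) auto
  have "(\<integral>\<^sup>+p. ennreal (S (fst p) (snd p) * T (fst p) (snd p)) \<partial>?M)\<^sup>2
      = (\<integral>\<^sup>+p. ennreal (S (fst p) (snd p)) * ennreal (T (fst p) (snd p)) \<partial>?M)\<^sup>2"
    using nn by (simp add: ennreal_mult)
  also have "\<dots> \<le> (\<integral>\<^sup>+p. (ennreal (S (fst p) (snd p)))\<^sup>2 \<partial>?M) * (\<integral>\<^sup>+p. (ennreal (T (fst p) (snd p)))\<^sup>2 \<partial>?M)"
    by (rule Cauchy_Schwarz_nn_integral) measurable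
  also have "\<dots> = (\<integral>\<^sup>+x. \<integral>\<^sup>+y. ennreal ((S x y)\<^sup>2) \<partial>lborel \<partial>lborel) * (\<integral>\<^sup>+x. \<integral>\<^sup>+y. ennreal ((T x y)\<^sup>2) \<partial>lborel \<partial>lborel)"
    using nn by (simp add: e ennreal_power)
  also have "\<dots> \<le> ennreal (A\<^sup>2) * ennreal (B\<^sup>2)" by (intro mult_mono S T) auto
  also have "\<dots> = (ennreal (A * B))\<^sup>2"
    using nn by (simp add: ennreal_power power_mult_distrib flip: ennreal_mult)
  finally have "(\<integral>\<^sup>+p. ennreal (S (fst p) (snd p) * T (fst p) (snd p)) \<partial>?M) \<le> ennreal (A * B)"
    by (rule ennreal_power2_le_imp_le)
  then show ?thesis by (simp add: e)
qed

text \<open>The Riesz kernel. On the diagonal \<open>powr\<close> gives 0 instead of infinity, which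
  affects a null set.\<close>

definition riesz :: "real \<Rightarrow> 'a::euclidean_space \<Rightarrow> 'a \<Rightarrow> real" where
  "riesz \<gamma> x y = norm (x - y) powr (- \<gamma>)"

lemma riesz_nonneg [simp]: "0 \<le> riesz \<gamma> x y" by (simp add: riesz_def)

lemma riesz_commute: "riesz \<gamma> x y = riesz \<gamma> y x" by (simp add: riesz_def norm_minus_commute)

lemma riesz_measurable [measurable]:
  "f \<in> borel_measurable M \<Longrightarrow> g \<in> borel_measurable M \<Longrightarrow> (\<lambda>x. riesz \<gamma> (f x) (g x)) \<in> borel_measurable M"
  unfolding riesz_def by measurable

lemma riesz_half: "(riesz (\<gamma> / 2) x y)\<^sup>2 = riesz \<gamma> x y"
  by (simp add: riesz_def power2_eq_square flip: powr_add)

context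
  fixes \<gamma> :: real
  assumes \<gamma>: "0 < \<gamma>" "\<gamma> < 2" and N: "3 \<le> DIM('a::euclidean_space)"
begin

text \<open>The kernel is split at distance rho: inside it is at most rho^{2-gamma} |x-y|^{-2}, to
  which Hardy's inequality applies, outside at most rho^{-gamma}. The first coefficient tends to 0
  with rho because gamma < 2. The radius stays free: the energy bound takes it small, the
  multilinear estimates take rho = 1.\<close>

lemma nn_integral_riesz:
  fixes f :: "'a L2"
  assumes \<rho>: "0 < \<rho>"
  shows "(\<integral>\<^sup>+y. ennreal (riesz \<gamma> x y * (cmod (rep_L2 (bessel 1 f) y))\<^sup>2) \<partial>lborel)
    \<le> ennreal (4 * \<rho> powr (2 - \<gamma>) * (f \<bullet> fmult kinetic_symbol f) + \<rho> powr (- \<gamma>) * (norm (bessel 1 f))\<^sup>2)"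
proof -
  let ?u = "rep_L2 (bessel 1 f)"
  have le: "riesz \<gamma> x y \<le> \<rho> powr (2 - \<gamma>) * (1 / (norm (x - y))\<^sup>2) + \<rho> powr (- \<gamma>)" for y
  proof -
    define d where "d = norm (x - y)"
    have d: "d \<ge> 0" by (simp add: d_def)
    consider "d = 0" | "d \<ge> \<rho>" | "0 < d" "d < \<rho>" using d by linarith
    then have "d powr (- \<gamma>) \<le> \<rho> powr (2 - \<gamma>) * (1 / d\<^sup>2) + \<rho> powr (- \<gamma>)"
    proof cases
      case 2
      then have "d powr (- \<gamma>) \<le> \<rho> powr (- \<gamma>)" using \<rho> \<gamma> by (intro powr_mono2') auto
      then show ?thesis by (simp add: add_increasing)
    next
      case 3
      have "d powr (- \<gamma>) = d powr (2 - \<gamma>) * d powr (- 2)" by (simp flip: powr_add)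
      also have "d powr (- 2) = 1 / d\<^sup>2" using 3 by (simp add: powr_minus_divide)
      also have "d powr (2 - \<gamma>) * (1 / d\<^sup>2) \<le> \<rho> powr (2 - \<gamma>) * (1 / d\<^sup>2)"
        using 3 \<gamma> by (intro mult_right_mono powr_mono2) auto
      finally show ?thesis by (simp add: add_increasing2)
    qed auto
    then show ?thesis by (simp add: riesz_def d_def)
  qed
  have "(\<integral>\<^sup>+y. ennreal (riesz \<gamma> x y * (cmod (?u y))\<^sup>2) \<partial>lborel) \<le>
      (\<integral>\<^sup>+y. ennreal (\<rho> powr (2 - \<gamma>)) * ennreal (1 / (norm (x - y))\<^sup>2 * (cmod (?u y))\<^sup>2) + ennreal (\<rho> powr (- \<gamma>)) * ennreal ((cmod (?u y))\<^sup>2) \<partial>lborel)"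
  proof (rule nn_integral_mono)
    fix y
    have "riesz \<gamma> x y * (cmod (?u y))\<^sup>2 \<le> (\<rho> powr (2 - \<gamma>) * (1 / (norm (x - y))\<^sup>2) + \<rho> powr (- \<gamma>)) * (cmod (?u y))\<^sup>2"
      by (intro mult_right_mono le) simp
    also have "\<dots> = \<rho> powr (2 - \<gamma>) * (1 / (norm (x - y))\<^sup>2 * (cmod (?u y))\<^sup>2) + \<rho> powr (- \<gamma>) * (cmod (?u y))\<^sup>2"
      by (simp add: distrib_right)
    finally show "ennreal (riesz \<gamma> x y * (cmod (?u y))\<^sup>2) \<le> ennreal (\<rho> powr (2 - \<gamma>)) * ennreal (1 / (norm (x - y))\<^sup>2 * (cmod (?u y))\<^sup>2) + ennreal (\<rho> powr (- \<gamma>)) * ennreal ((cmod (?u y))\<^sup>2)"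
      by (simp add: ennreal_leI flip: ennreal_mult ennreal_plus)
  qed
  also have "\<dots> = ennreal (\<rho> powr (2 - \<gamma>)) * (\<integral>\<^sup>+y. ennreal (1 / (norm (x - y))\<^sup>2 * (cmod (?u y))\<^sup>2) \<partial>lborel) + ennreal (\<rho> powr (- \<gamma>)) * ennreal ((norm (bessel 1 f))\<^sup>2)"
    by (subst nn_integral_add) (auto simp: nn_integral_cmult nn_integral_rep_L2)
  also have "\<dots> \<le> ennreal (\<rho> powr (2 - \<gamma>)) * ennreal (4 * (f \<bullet> fmult kinetic_symbol f)) + ennreal (\<rho> powr (- \<gamma>)) * ennreal ((norm (bessel 1 f))\<^sup>2)"
    by (intro add_mono mult_left_mono hardy N) auto
  also have "\<dots> = ennreal (\<rho> powr (2 - \<gamma>) * (4 * (f \<bullet> fmult kinetic_symbol f)) + \<rho> powr (- \<gamma>) * (norm (bessel 1 f))\<^sup>2)"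
    using kinetic_nonneg[of f] by (simp flip: ennreal_mult ennreal_plus)
  finally show ?thesis by (simp add: mult_ac)
qed

lemma nn_integral_riesz_le:
  fixes f :: "'a L2"
  shows "(\<integral>\<^sup>+y. ennreal (riesz \<gamma> x y * (cmod (rep_L2 (bessel 1 f) y))\<^sup>2) \<partial>lborel) \<le> ennreal (4 * (norm f)\<^sup>2)"
proof -
  have le: "4 * 1 powr (2 - \<gamma>) * (f \<bullet> fmult kinetic_symbol f) + 1 powr (- \<gamma>) * (norm (bessel 1 f))\<^sup>2 \<le> 4 * (norm f)\<^sup>2"
    using norm_eq_kinetic[of f] by simp
  show ?thesis by (rule order.trans[OF nn_integral_riesz[OF zero_less_one] ennreal_leI[OF le]])
qed

text \<open>Half of the kernel with an H^1 factor at one point and an L^2 factor at the other: the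
  blocks into which Cauchy-Schwarz splits the quartic form.\<close>

lemma nn_integral_riesz_pair:
  fixes f :: "'a L2"
  shows "(\<integral>\<^sup>+x. \<integral>\<^sup>+y. ennreal ((riesz (\<gamma> / 2) x y * cmod (rep_L2 (bessel 1 f) y) * cmod (rep_L2 p x))\<^sup>2) \<partial>lborel \<partial>lborel)
      \<le> ennreal ((2 * norm f * norm p)\<^sup>2)"
    and "(\<integral>\<^sup>+x. \<integral>\<^sup>+y. ennreal ((riesz (\<gamma> / 2) x y * cmod (rep_L2 (bessel 1 f) x) * cmod (rep_L2 p y))\<^sup>2) \<partial>lborel \<partial>lborel)
      \<le> ennreal ((2 * norm f * norm p)\<^sup>2)"
proof -
  show 1: "(\<integral>\<^sup>+x. \<integral>\<^sup>+y. ennreal ((riesz (\<gamma> / 2) x y * cmod (rep_L2 (bessel 1 f) y) * cmod (rep_L2 p x))\<^sup>2) \<partial>lborel \<partial>lborel)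
      \<le> ennreal ((2 * norm f * norm p)\<^sup>2)" for p
  proof -
    have "(\<integral>\<^sup>+x. \<integral>\<^sup>+y. ennreal ((riesz (\<gamma> / 2) x y * cmod (rep_L2 (bessel 1 f) y) * cmod (rep_L2 p x))\<^sup>2) \<partial>lborel \<partial>lborel)
        = (\<integral>\<^sup>+x. (\<integral>\<^sup>+y. ennreal (riesz \<gamma> x y * (cmod (rep_L2 (bessel 1 f) y))\<^sup>2) \<partial>lborel) * ennreal ((cmod (rep_L2 p x))\<^sup>2) \<partial>lborel)"
      by (simp add: power_mult_distrib riesz_half ennreal_mult nn_integral_multc)
    also have "\<dots> \<le> (\<integral>\<^sup>+x. ennreal (4 * (norm f)\<^sup>2) * ennreal ((cmod (rep_L2 p x))\<^sup>2) \<partial>lborel)"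
      by (intro nn_integral_mono mult_right_mono nn_integral_riesz_le) simp
    also have "\<dots> = ennreal ((2 * norm f * norm p)\<^sup>2)"
      by (subst nn_integral_cmult) (auto simp: nn_integral_rep_L2 power_mult_distrib simp flip: ennreal_mult)
    finally show ?thesis .
  qed
  have "(\<integral>\<^sup>+x. \<integral>\<^sup>+y. ennreal ((riesz (\<gamma> / 2) x y * cmod (rep_L2 (bessel 1 f) x) * cmod (rep_L2 p y))\<^sup>2) \<partial>lborel \<partial>lborel)
     = (\<integral>\<^sup>+y. \<integral>\<^sup>+x. ennreal ((riesz (\<gamma> / 2) x y * cmod (rep_L2 (bessel 1 f) x) * cmod (rep_L2 p y))\<^sup>2) \<partial>lborel \<partial>lborel)"
    by (rule lborel_pair.Fubini'[symmetric]) measurable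
  also have "\<dots> = (\<integral>\<^sup>+x. \<integral>\<^sup>+y. ennreal ((riesz (\<gamma> / 2) x y * cmod (rep_L2 (bessel 1 f) y) * cmod (rep_L2 p x))\<^sup>2) \<partial>lborel \<partial>lborel)"
    by (subst riesz_commute) simp
  finally show "(\<integral>\<^sup>+x. \<integral>\<^sup>+y. ennreal ((riesz (\<gamma> / 2) x y * cmod (rep_L2 (bessel 1 f) x) * cmod (rep_L2 p y))\<^sup>2) \<partial>lborel \<partial>lborel)
      \<le> ennreal ((2 * norm f * norm p)\<^sup>2)" using 1 by simp
qed

definition quartic :: "'a L2 \<Rightarrow> 'a L2 \<Rightarrow> 'a L2 \<Rightarrow> 'a L2 \<Rightarrow> ennreal" where
  "quartic u v w z = (\<integral>\<^sup>+x. \<integral>\<^sup>+y. ennreal (riesz \<gamma> x y * (cmod (rep_L2 u y) * cmod (rep_L2 v y) * cmod (rep_L2 w x) * cmod (rep_L2 z x))) \<partial>lborel \<partial>lborel)"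

text \<open>Each half kernel receives one H^1 argument together with an L^2 argument at the other
  point. The three placements are those that occur when the Sobolev weight falls on the third,
  second or first factor; the last place belongs to the dual function.\<close>

lemma quartic_le:
  fixes f g p q :: "'a L2"
  shows "quartic (bessel 1 f) (bessel 1 g) p q \<le> ennreal (4 * norm f * norm g * norm p * norm q)"
    and "quartic (bessel 1 f) p (bessel 1 g) q \<le> ennreal (4 * norm f * norm g * norm p * norm q)"
    and "quartic p (bessel 1 f) (bessel 1 g) q \<le> ennreal (4 * norm f * norm g * norm p * norm q)"
proof -
  have split: "riesz \<gamma> x y * (a * b * c * d) = (riesz (\<gamma> / 2) x y * a * d) * (riesz (\<gamma> / 2) x y * b * c)" for x y :: 'a and a b c d
    by (simp add: riesz_half[of \<gamma>, symmetric] power2_eq_square mult_ac)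
  have split2: "riesz \<gamma> x y * (a * b * c * d) = (riesz (\<gamma> / 2) x y * a * d) * (riesz (\<gamma> / 2) x y * c * b)" for x y :: 'a and a b c d
    by (simp add: riesz_half[of \<gamma>, symmetric] power2_eq_square mult_ac)
  have e: "4 * norm f * norm g * norm p * norm q = (2 * norm f * norm q) * (2 * norm g * norm p)" for f g p q :: "'a L2"
    by simp
  show "quartic (bessel 1 f) (bessel 1 g) p q \<le> ennreal (4 * norm f * norm g * norm p * norm q)"
    unfolding quartic_def split e
    by (rule Cauchy_Schwarz_double_nn_integral) (auto intro!: nn_integral_riesz_pair)
  show 2: "quartic (bessel 1 f) p (bessel 1 g) q \<le> ennreal (4 * norm f * norm g * norm p * norm q)" for f p g
    unfolding quartic_def split2 e
    by (rule Cauchy_Schwarz_double_nn_integral) (auto intro!: nn_integral_riesz_pair)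
  have "quartic p (bessel 1 f) (bessel 1 g) q = quartic (bessel 1 f) p (bessel 1 g) q"
    by (simp add: quartic_def mult_ac)
  then show "quartic p (bessel 1 f) (bessel 1 g) q \<le> ennreal (4 * norm f * norm g * norm p * norm q)"
    using 2 by simp
qed

end

section \<open>The polarised Hartree nonlinearity\<close>

definition riesz_conv :: "real \<Rightarrow> 'a::euclidean_space L2 \<Rightarrow> 'a L2 \<Rightarrow> 'a \<Rightarrow> complex" where
  "riesz_conv \<gamma> u v x = (LINT y|lborel. of_real (riesz \<gamma> x y) * (rep_L2 u y * cnj (rep_L2 v y)))"

text \<open>The cubic term with three independent arguments, conjugate-linear in the second, so that
  differences and Sobolev weights can be treated one factor at a time.\<close>

definition trilinear :: "real \<Rightarrow> 'a::euclidean_space L2 \<Rightarrow> 'a L2 \<Rightarrow> 'a L2 \<Rightarrow> 'a L2" where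
  "trilinear \<gamma> u v w = pmult (riesz_conv \<gamma> u v) w"

lemma riesz_conv_measurable [measurable]: "riesz_conv \<gamma> u v \<in> borel_measurable borel"
  unfolding riesz_conv_def[abs_def] by measurable

lemma riesz_conv_self: "riesz_conv \<gamma> u u x = of_real (hartree_potential \<gamma> u x)"
proof -
  have "riesz_conv \<gamma> u u x = (LINT y|lborel. of_real (norm (x - y) powr - \<gamma> * (cmod (rep_L2 u y))\<^sup>2))"
    unfolding riesz_conv_def riesz_def by (intro Bochner_Integration.integral_cong) (simp_all only: of_real_mult complex_norm_square)
  then show ?thesis unfolding hartree_potential_def by (simp only: integral_complex_of_real)
qed

context
  fixes \<gamma> :: real
  assumes \<gamma>: "0 < \<gamma>" "\<gamma> < 2" and N: "3 \<le> DIM('a::euclidean_space)"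
begin

lemma nn_integral_riesz_mult_le:
  fixes f g :: "'a L2"
  shows "(\<integral>\<^sup>+y. ennreal (riesz \<gamma> x y * (cmod (rep_L2 (bessel 1 f) y) * cmod (rep_L2 (bessel 1 g) y))) \<partial>lborel) \<le> ennreal (4 * norm f * norm g)"
proof -
  let ?F = "\<lambda>f y. ennreal (riesz (\<gamma> / 2) x y * cmod (rep_L2 (bessel 1 f) y))"
  have sq: "(\<integral>\<^sup>+y. (?F f y)\<^sup>2 \<partial>lborel) \<le> ennreal (4 * (norm f)\<^sup>2)" for f :: "'a L2"
    using nn_integral_riesz_le[OF \<gamma> N, of x f] by (simp add: ennreal_power power_mult_distrib riesz_half)
  have "(\<integral>\<^sup>+y. ennreal (riesz \<gamma> x y * (cmod (rep_L2 (bessel 1 f) y) * cmod (rep_L2 (bessel 1 g) y))) \<partial>lborel) = (\<integral>\<^sup>+y. ?F f y * ?F g y \<partial>lborel)"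
    by (simp add: riesz_half[of \<gamma>, symmetric] power2_eq_square mult_ac flip: ennreal_mult)
  moreover have "(\<integral>\<^sup>+y. ?F f y * ?F g y \<partial>lborel)\<^sup>2 \<le> (ennreal (4 * norm f * norm g))\<^sup>2"
  proof -
    have "(\<integral>\<^sup>+y. ?F f y * ?F g y \<partial>lborel)\<^sup>2 \<le> (\<integral>\<^sup>+y. (?F f y)\<^sup>2 \<partial>lborel) * (\<integral>\<^sup>+y. (?F g y)\<^sup>2 \<partial>lborel)"
      by (rule Cauchy_Schwarz_nn_integral) measurable
    also have "\<dots> \<le> ennreal (4 * (norm f)\<^sup>2) * ennreal (4 * (norm g)\<^sup>2)" by (intro mult_mono sq) auto
    also have "\<dots> = (ennreal (4 * norm f * norm g))\<^sup>2"
      by (simp add: ennreal_power power_mult_distrib flip: ennreal_mult)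
    finally show ?thesis .
  qed
  ultimately show ?thesis by (simp add: ennreal_power2_le_imp_le)
qed

lemma integrable_riesz_conv:
  fixes f g :: "'a L2"
  shows "integrable lborel (\<lambda>y. of_real (riesz \<gamma> x y) * (rep_L2 (bessel 1 f) y * cnj (rep_L2 (bessel 1 g) y)))"
proof (rule integrableI_bounded)
  have "(\<integral>\<^sup>+y. ennreal (norm (of_real (riesz \<gamma> x y) * (rep_L2 (bessel 1 f) y * cnj (rep_L2 (bessel 1 g) y)))) \<partial>lborel) \<le> ennreal (4 * norm f * norm g)"
    using nn_integral_riesz_mult_le[of x f g] by (simp add: norm_mult)
  then show "(\<integral>\<^sup>+y. ennreal (norm (of_real (riesz \<gamma> x y) * (rep_L2 (bessel 1 f) y * cnj (rep_L2 (bessel 1 g) y)))) \<partial>lborel) < \<infinity>"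
    using order.strict_trans1 ennreal_less_top by fastforce
qed measurable

text \<open>Hardy's inequality is uniform in the centre x, so the potential of H^1 functions acts on
  L^2 as a bounded multiplier.\<close>

lemma cmod_riesz_conv_le:
  fixes f g :: "'a L2"
  shows "cmod (riesz_conv \<gamma> (bessel 1 f) (bessel 1 g) x) \<le> 4 * norm f * norm g"
proof -
  have "ennreal (cmod (riesz_conv \<gamma> (bessel 1 f) (bessel 1 g) x)) \<le> (\<integral>\<^sup>+y. ennreal (norm (of_real (riesz \<gamma> x y) * (rep_L2 (bessel 1 f) y * cnj (rep_L2 (bessel 1 g) y)))) \<partial>lborel)"
    unfolding riesz_conv_def by (rule integral_norm_bound_ennreal[OF integrable_riesz_conv])
  also have "\<dots> \<le> ennreal (4 * norm f * norm g)"
    using nn_integral_riesz_mult_le[of x f g] by (simp add: norm_mult)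
  finally show ?thesis by simp
qed

lemma bounded_multiplier_riesz_conv:
  fixes f g :: "'a L2"
  shows "bounded_multiplier (riesz_conv \<gamma> (bessel 1 f) (bessel 1 g))"
  by (rule bounded_multiplierI) (auto intro: cmod_riesz_conv_le)

lemma riesz_conv_diff_left:
  fixes f f' g :: "'a L2"
  shows "riesz_conv \<gamma> (bessel 1 f - bessel 1 f') (bessel 1 g) x = riesz_conv \<gamma> (bessel 1 f) (bessel 1 g) x - riesz_conv \<gamma> (bessel 1 f') (bessel 1 g) x"
  unfolding riesz_conv_def Bochner_Integration.integral_diff[OF integrable_riesz_conv integrable_riesz_conv, symmetric]
  using rep_L2_diff[of "bessel 1 f" "bessel 1 f'"] by (intro integral_cong_AE) (auto simp: left_diff_distrib right_diff_distrib)

lemma riesz_conv_diff_right: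
  fixes f g g' :: "'a L2"
  shows "riesz_conv \<gamma> (bessel 1 f) (bessel 1 g - bessel 1 g') x = riesz_conv \<gamma> (bessel 1 f) (bessel 1 g) x - riesz_conv \<gamma> (bessel 1 f) (bessel 1 g') x"
  unfolding riesz_conv_def Bochner_Integration.integral_diff[OF integrable_riesz_conv integrable_riesz_conv, symmetric]
  using rep_L2_diff[of "bessel 1 g" "bessel 1 g'"] by (intro integral_cong_AE) (auto simp: left_diff_distrib right_diff_distrib)

lemma integrable_trilinear:
  fixes f g h q :: "'a L2"
  shows "integrable (lborel \<Otimes>\<^sub>M lborel) (\<lambda>(x, y). of_real (riesz \<gamma> x y) * (rep_L2 (bessel 1 f) y * cnj (rep_L2 (bessel 1 g) y) * rep_L2 p x * cnj (rep_L2 q x)))"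
proof (rule integrableI_bounded)
  have "(\<integral>\<^sup>+z. ennreal (norm (case z of (x, y) \<Rightarrow> of_real (riesz \<gamma> x y) * (rep_L2 (bessel 1 f) y * cnj (rep_L2 (bessel 1 g) y) * rep_L2 p x * cnj (rep_L2 q x)))) \<partial>(lborel \<Otimes>\<^sub>M lborel))
      = quartic \<gamma> (bessel 1 f) (bessel 1 g) p q"
    unfolding quartic_def[OF \<gamma> N] by (subst lborel.nn_integral_fst[symmetric]) (auto simp: norm_mult mult_ac)
  then show "(\<integral>\<^sup>+z. ennreal (norm (case z of (x, y) \<Rightarrow> of_real (riesz \<gamma> x y) * (rep_L2 (bessel 1 f) y * cnj (rep_L2 (bessel 1 g) y) * rep_L2 p x * cnj (rep_L2 q x)))) \<partial>(lborel \<Otimes>\<^sub>M lborel)) < \<infinity>"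
    using quartic_le(1)[OF \<gamma> N, of f g p q] order.strict_trans1 ennreal_less_top by fastforce
qed measurable

lemma cinner_trilinear:
  fixes f g p q :: "'a L2"
  shows "cinner (trilinear \<gamma> (bessel 1 f) (bessel 1 g) p) q =
    (LINT x|lborel. LINT y|lborel. of_real (riesz \<gamma> x y) * (rep_L2 (bessel 1 f) y * cnj (rep_L2 (bessel 1 g) y) * rep_L2 p x * cnj (rep_L2 q x)))"
proof -
  have "cinner (trilinear \<gamma> (bessel 1 f) (bessel 1 g) p) q = (LINT x|lborel. riesz_conv \<gamma> (bessel 1 f) (bessel 1 g) x * rep_L2 p x * cnj (rep_L2 q x))"
    unfolding cinner_def trilinear_def using rep_pmult[OF bounded_multiplier_riesz_conv[of f g], of p]
    by (intro integral_cong_AE) auto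
  also have "\<dots> = (LINT x|lborel. LINT y|lborel. of_real (riesz \<gamma> x y) * (rep_L2 (bessel 1 f) y * cnj (rep_L2 (bessel 1 g) y) * rep_L2 p x * cnj (rep_L2 q x)))"
    unfolding riesz_conv_def by (simp add: mult.assoc flip: integral_mult_left_zero)
  finally show ?thesis .
qed

end

lemma nonlinearity_eq:
  fixes f :: "'a::euclidean_space L2"
  assumes "0 < \<gamma>" "\<gamma> < 2" "0 < \<gamma>'" "\<gamma>' < 2" "3 \<le> DIM('a)"
  shows "nonlinearity \<gamma> \<gamma>' (bessel 1 f) = trilinear \<gamma> (bessel 1 f) (bessel 1 f) (bessel 1 f) - trilinear \<gamma>' (bessel 1 f) (bessel 1 f) (bessel 1 f)"
  unfolding nonlinearity_def trilinear_def pmult_def riesz_conv_self[symmetric]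
  using square_integrable_pmult[OF bounded_multiplier_riesz_conv[OF assms(1,2,5)] square_integrable_rep]
    square_integrable_pmult[OF bounded_multiplier_riesz_conv[OF assms(3,4,5)] square_integrable_rep]
  by (simp add: abs_L2_diff)

section \<open>The quartic form in frequency space\<close>

lemma norm_integral_le_nn_integral:
  fixes f :: "'a \<Rightarrow> 'b::{banach, second_countable_topology}"
  shows "ennreal (norm (integral\<^sup>L M f)) \<le> (\<integral>\<^sup>+x. ennreal (norm (f x)) \<partial>M)"
  by (cases "integrable M f") (auto simp: integral_norm_bound_ennreal not_integrable_integral_eq)

lemma integrable_rep_mult: "integrable lborel (\<lambda>y. rep_L2 u y * cnj (rep_L2 v y))"
  by (rule integrable_cinner)

text \<open>Parseval after a modulation: the transform of u conj(v) is, up to normalisation, the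
  correlation of the two transforms.\<close>

lemma modulation_cinner:
  "(LINT y|lborel. rep_L2 u y * cnj (rep_L2 v y) * cis (- (k \<bullet> y))) =
    (LINT \<eta>|lborel. rep_L2 (fourier u) \<eta> * cnj (rep_L2 (fourier v) (\<eta> - k)))"
proof -
  have b: "bounded_multiplier (\<lambda>x. cis (k \<bullet> x))" by (rule bounded_multiplier_cis) measurable
  have "(LINT y|lborel. rep_L2 u y * cnj (rep_L2 v y) * cis (- (k \<bullet> y))) = cinner u (pmult (\<lambda>x. cis (k \<bullet> x)) v)"
    unfolding cinner_def
  proof (rule integral_cong_AE)
    show "AE y in lborel. rep_L2 u y * cnj (rep_L2 v y) * cis (- (k \<bullet> y)) = rep_L2 u y * cnj (rep_L2 (pmult (\<lambda>x. cis (k \<bullet> x)) v) y)"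
      using rep_pmult[OF b, of v] by eventually_elim (simp add: cis_cnj)
  qed measurable
  also have "\<dots> = cinner (fourier u) (shift (- k) (fourier v))"
    by (subst cinner_fourier[symmetric]) (simp only: fourier_modulation)
  also have "\<dots> = (LINT \<eta>|lborel. rep_L2 (fourier u) \<eta> * cnj (rep_L2 (fourier v) (\<eta> - k)))"
    unfolding cinner_def using rep_shift[of "- k" "fourier v"]
    by (intro integral_cong_AE) auto
  finally show ?thesis .
qed

text \<open>A correlation instead of a convolution, because one factor of each product is
  conjugated. Values in \<open>ennreal\<close> make it meaningful for arbitrary nonnegative
  measurable functions.\<close>

definition pair_freq :: "('a::euclidean_space \<Rightarrow> ennreal) \<Rightarrow> ('a \<Rightarrow> ennreal) \<Rightarrow> 'a \<Rightarrow> ennreal" where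
  "pair_freq F G k = (\<integral>\<^sup>+\<eta>. F \<eta> * G (\<eta> + k) \<partial>lborel)"

text \<open>The Gaussian kernel $e^{-\sigma^2 |x - y|^2 / 2}$ has a positive Fourier transform, so its quartic form is
  bounded by this expression in the moduli of the Fourier transforms.\<close>

definition quartic_freq :: "real \<Rightarrow> ('a::euclidean_space \<Rightarrow> ennreal) \<Rightarrow> ('a \<Rightarrow> ennreal) \<Rightarrow> ('a \<Rightarrow> ennreal) \<Rightarrow> ('a \<Rightarrow> ennreal) \<Rightarrow> ennreal" where
  "quartic_freq \<sigma> F1 F2 F3 F4 = (\<integral>\<^sup>+\<zeta>. ennreal (gauss \<zeta>) * (pair_freq F1 F2 (- (\<sigma> *\<^sub>R \<zeta>)) * pair_freq F3 F4 (\<sigma> *\<^sub>R \<zeta>)) \<partial>lborel)"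

definition fourier_modulus :: "'a::euclidean_space L2 \<Rightarrow> 'a \<Rightarrow> ennreal" where
  "fourier_modulus u \<eta> = ennreal (cmod (rep_L2 (fourier u) \<eta>))"

lemma fourier_modulus_measurable [measurable]: "fourier_modulus u \<in> borel_measurable borel"
  unfolding fourier_modulus_def[abs_def] by measurable

lemma pair_freq_measurable [measurable]:
  assumes [measurable]: "F \<in> borel_measurable borel" "G \<in> borel_measurable borel" "h \<in> borel_measurable M"
  shows "(\<lambda>x. pair_freq F G (h x)) \<in> borel_measurable M"
proof -
  have "pair_freq F G \<in> borel_measurable borel" unfolding pair_freq_def[abs_def] by measurable
  then show ?thesis by measurable
qed

text \<open>The Gaussian is a superposition of characters, which decouples x and y; each of the two
  products then contributes a correlation, and the two frequency shifts are opposite.\<close>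

lemma gauss_identity:
  fixes u v w z :: "'a::euclidean_space L2" and \<sigma> :: real
  defines "a \<equiv> \<lambda>\<zeta>. LINT \<eta>|lborel. rep_L2 (fourier u) \<eta> * cnj (rep_L2 (fourier v) (\<eta> - \<sigma> *\<^sub>R \<zeta>))"
    and "b \<equiv> \<lambda>\<zeta>. LINT \<eta>|lborel. rep_L2 (fourier w) \<eta> * cnj (rep_L2 (fourier z) (\<eta> + \<sigma> *\<^sub>R \<zeta>))"
  shows "(LINT x|lborel. LINT y|lborel. of_real (exp (- (norm (\<sigma> *\<^sub>R (x - y)))\<^sup>2 / 2)) * (rep_L2 u y * cnj (rep_L2 v y) * rep_L2 w x * cnj (rep_L2 z x)))
      = (LINT \<zeta>|lborel. of_real (gauss \<zeta>) * (a \<zeta> * b \<zeta>))"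
    and "integrable lborel (\<lambda>\<zeta>. of_real (gauss \<zeta>) * (a \<zeta> * b \<zeta>))"
proof -
  define P where "P y = rep_L2 u y * cnj (rep_L2 v y)" for y
  define R where "R x = rep_L2 w x * cnj (rep_L2 z x)" for x
  have P: "integrable lborel P" and R: "integrable lborel R"
    unfolding P_def[abs_def] R_def[abs_def] by (rule integrable_rep_mult)+
  have [measurable]: "P \<in> borel_measurable borel" "R \<in> borel_measurable borel"
    unfolding P_def[abs_def] R_def[abs_def] by measurable
  have gi: "integrable lborel (\<lambda>\<zeta>::'a. complex_of_real (gauss \<zeta>))"
    using integrable_gauss[where 'a='a] by simp
  have a: "a \<zeta> = (LINT y|lborel. P y * cis (- ((\<sigma> *\<^sub>R \<zeta>) \<bullet> y)))" for \<zeta>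
    unfolding a_def P_def by (rule modulation_cinner[symmetric])
  have b: "b \<zeta> = (LINT x|lborel. R x * cis ((\<sigma> *\<^sub>R \<zeta>) \<bullet> x))" for \<zeta>
    unfolding b_def R_def using modulation_cinner[of w z "- (\<sigma> *\<^sub>R \<zeta>)"] by simp
  have [measurable]: "a \<in> borel_measurable borel" unfolding a_def by measurable
  have [measurable]: "b \<in> borel_measurable borel" unfolding b_def by measurable
  have abd: "cmod (a \<zeta>) \<le> (LINT y|lborel. cmod (P y))" for \<zeta>
    unfolding a using integral_norm_bound[of lborel "\<lambda>y. P y * cis (- ((\<sigma> *\<^sub>R \<zeta>) \<bullet> y))"] by (simp add: norm_mult)
  have bbd: "cmod (b \<zeta>) \<le> (LINT y|lborel. cmod (R y))" for \<zeta>
    unfolding b using integral_norm_bound[of lborel "\<lambda>y. R y * cis ((\<sigma> *\<^sub>R \<zeta>) \<bullet> y)"] by (simp add: norm_mult)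
  have ga: "integrable lborel (\<lambda>\<zeta>. of_real (gauss \<zeta>) * a \<zeta>)"
    by (rule Bochner_Integration.integrable_bound[OF integrable_mult_left[OF gi, of "of_real (LINT y|lborel. cmod (P y))"]])
      (auto simp: norm_mult intro!: mult_left_mono order.trans[OF abd])
  show "integrable lborel (\<lambda>\<zeta>. of_real (gauss \<zeta>) * (a \<zeta> * b \<zeta>))"
    unfolding mult.assoc[symmetric]
    by (rule Bochner_Integration.integrable_bound[OF integrable_mult_left[OF ga, of "of_real (LINT y|lborel. cmod (R y))"]])
      (auto simp: norm_mult intro!: mult_left_mono order.trans[OF bbd])
  have "(LINT x|lborel. LINT y|lborel. of_real (exp (- (norm (\<sigma> *\<^sub>R (x - y)))\<^sup>2 / 2)) * (rep_L2 u y * cnj (rep_L2 v y) * rep_L2 w x * cnj (rep_L2 z x)))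
     = (LINT x|lborel. R x * (LINT y|lborel. P y * (LINT \<zeta>|lborel. of_real (gauss \<zeta>) * cis (\<zeta> \<bullet> (\<sigma> *\<^sub>R (x - y))))))"
  proof -
    have "of_real (exp (- (norm (\<sigma> *\<^sub>R (x - y)))\<^sup>2 / 2)) * (rep_L2 u y * cnj (rep_L2 v y) * rep_L2 w x * cnj (rep_L2 z x))
       = R x * (P y * (LINT \<zeta>|lborel. of_real (gauss \<zeta>) * cis (\<zeta> \<bullet> (\<sigma> *\<^sub>R (x - y)))))" for x y
      using integral_cis_gauss(2)[of "\<sigma> *\<^sub>R (x - y)"] by (simp add: P_def R_def mult_ac)
    then show ?thesis by (simp only:) simp
  qed
  also have "\<dots> = (LINT x|lborel. R x * (LINT \<zeta>|lborel. of_real (gauss \<zeta>) * (LINT y|lborel. P y * cis (\<zeta> \<bullet> (\<sigma> *\<^sub>R (x - y))))))"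
    by (subst Fubini_product_kernel[OF P gi, of "\<lambda>y \<zeta>. cis (\<zeta> \<bullet> (\<sigma> *\<^sub>R (_ - y)))" 1]) auto
  also have "\<dots> = (LINT x|lborel. R x * (LINT \<zeta>|lborel. (of_real (gauss \<zeta>) * a \<zeta>) * cis ((\<sigma> *\<^sub>R \<zeta>) \<bullet> x)))"
  proof -
    have "cis (\<zeta> \<bullet> (\<sigma> *\<^sub>R (x - y))) = cis (- ((\<sigma> *\<^sub>R \<zeta>) \<bullet> y)) * cis ((\<sigma> *\<^sub>R \<zeta>) \<bullet> x)" for \<zeta> x y :: 'a
      by (simp add: cis_mult inner_diff_right algebra_simps)
    then have "(LINT y|lborel. P y * cis (\<zeta> \<bullet> (\<sigma> *\<^sub>R (x - y)))) = a \<zeta> * cis ((\<sigma> *\<^sub>R \<zeta>) \<bullet> x)" for \<zeta> x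
      by (simp add: a mult.assoc[symmetric])
    then show ?thesis by (simp add: mult.assoc)
  qed
  also have "\<dots> = (LINT \<zeta>|lborel. (of_real (gauss \<zeta>) * a \<zeta>) * (LINT x|lborel. R x * cis ((\<sigma> *\<^sub>R \<zeta>) \<bullet> x)))"
    by (rule Fubini_product_kernel[OF R ga, of _ 1]) auto
  finally show "(LINT x|lborel. LINT y|lborel. of_real (exp (- (norm (\<sigma> *\<^sub>R (x - y)))\<^sup>2 / 2)) * (rep_L2 u y * cnj (rep_L2 v y) * rep_L2 w x * cnj (rep_L2 z x)))
      = (LINT \<zeta>|lborel. of_real (gauss \<zeta>) * (a \<zeta> * b \<zeta>))"
    by (simp add: b mult.assoc)
qed

lemma gauss_quartic_le:
  fixes u v w z :: "'a::euclidean_space L2"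
  shows "ennreal (cmod (LINT x|lborel. LINT y|lborel. of_real (exp (- (norm (\<sigma> *\<^sub>R (x - y)))\<^sup>2 / 2)) * (rep_L2 u y * cnj (rep_L2 v y) * rep_L2 w x * cnj (rep_L2 z x))))
     \<le> quartic_freq \<sigma> (fourier_modulus u) (fourier_modulus v) (fourier_modulus w) (fourier_modulus z)"
proof -
  have pf: "ennreal (cmod (LINT \<eta>|lborel. rep_L2 (fourier u) \<eta> * cnj (rep_L2 (fourier v) (\<eta> + k)))) \<le> pair_freq (fourier_modulus u) (fourier_modulus v) k"
    for u v :: "'a L2" and k
    unfolding pair_freq_def fourier_modulus_def
    using norm_integral_le_nn_integral[of lborel "\<lambda>\<eta>. rep_L2 (fourier u) \<eta> * cnj (rep_L2 (fourier v) (\<eta> + k))"]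
    by (simp add: norm_mult ennreal_mult)
  show ?thesis
    unfolding gauss_identity(1) quartic_freq_def
    by (rule order.trans[OF norm_integral_le_nn_integral])
      (auto simp: norm_mult ennreal_mult intro!: nn_integral_mono mult_mono pf pf[of _ _ "- _", simplified])
qed

text \<open>The function whose transform is the modulus of that of u. It commutes with J_s and
  preserves the L^2 norm, hence every Sobolev norm, so estimates by norms survive the
  replacement.\<close>

definition modulus_rearrangement :: "'a::euclidean_space L2 \<Rightarrow> 'a L2" where
  "modulus_rearrangement u = ifourier (abs_L2 (\<lambda>\<eta>. of_real (cmod (rep_L2 (fourier u) \<eta>))))"

lemma square_integrable_cmod: "square_integrable f \<Longrightarrow> square_integrable (\<lambda>x. complex_of_real (cmod (f x)))"
  unfolding square_integrable_def by auto

lemma rep_fourier_modulus_rearrangement: "AE \<eta> in lborel. rep_L2 (fourier (modulus_rearrangement u)) \<eta> = of_real (cmod (rep_L2 (fourier u) \<eta>))"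
  unfolding modulus_rearrangement_def fourier_ifourier by (rule rep_abs_L2) (simp add: square_integrable_cmod)

lemma norm_modulus_rearrangement [simp]: "norm (modulus_rearrangement u) = norm u"
proof -
  have "(norm (modulus_rearrangement u))\<^sup>2 = (norm (fourier u))\<^sup>2"
    unfolding modulus_rearrangement_def norm_ifourier power2_norm_L2[of "fourier u"]
    by (subst power2_norm_abs_L2) (auto simp: square_integrable_cmod)
  then show ?thesis by simp
qed

lemma modulus_rearrangement_bessel:
  assumes "0 \<le> s"
  shows "modulus_rearrangement (bessel s f) = bessel s (modulus_rearrangement f)"
proof (rule fmult_eqI, rule L2_eqI)
  show "AE x in lborel. rep_L2 (fourier (modulus_rearrangement (bessel s f))) x = rep_L2 (pmult (bessel_symbol s) (fourier (modulus_rearrangement f))) x"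
    using rep_fourier_modulus_rearrangement[of "bessel s f"] rep_fourier_modulus_rearrangement[of f] rep_fourier_bessel[OF assms, of f]
      rep_pmult[OF bounded_multiplier_bessel[OF assms], of "fourier (modulus_rearrangement f)"]
  proof eventually_elim
    case (elim x)
    have "complex_of_real (cmod (bessel_symbol s x)) = bessel_symbol s x" by (simp add: bessel_symbol_def)
    with elim show ?case by (simp add: norm_mult)
  qed
qed

text \<open>For nonnegative transforms the frequency form equals the Gaussian form of the functions
  themselves. Applied to the rearranged functions this returns to physical space, where absolute
  values are taken once more.\<close>

lemma quartic_freq_le_gauss:
  fixes u v w z :: "'a::euclidean_space L2"
  shows "quartic_freq \<sigma> (fourier_modulus u) (fourier_modulus v) (fourier_modulus w) (fourier_modulus z) \<le>
    (\<integral>\<^sup>+x. \<integral>\<^sup>+y. ennreal (exp (- (norm (\<sigma> *\<^sub>R (x - y)))\<^sup>2 / 2) * (cmod (rep_L2 (modulus_rearrangement u) y) * cmod (rep_L2 (modulus_rearrangement v) y) * cmod (rep_L2 (modulus_rearrangement w) x) * cmod (rep_L2 (modulus_rearrangement z) x))) \<partial>lborel \<partial>lborel)"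
proof -
  define A where "A u v k = (LINT \<eta>|lborel. cmod (rep_L2 (fourier u) \<eta>) * cmod (rep_L2 (fourier v) (\<eta> + k)))" for u v :: "'a L2" and k
  have int: "integrable lborel (\<lambda>\<eta>. cmod (rep_L2 (fourier u) \<eta>) * cmod (rep_L2 (fourier v) (\<eta> + k)))" for u v :: "'a L2" and k
    using integrable_norm[OF square_integrable_mult[OF square_integrable_rep square_integrable_shift[OF square_integrable_rep]], of "fourier u" "fourier v" k]
    by (simp add: norm_mult)
  have A0: "0 \<le> A u v k" for u v k unfolding A_def by simp
  have pA: "pair_freq (fourier_modulus u) (fourier_modulus v) k = ennreal (A u v k)" for u v :: "'a L2" and k
    unfolding pair_freq_def fourier_modulus_def A_def
    using nn_integral_eq_integral[OF int, of u v k] by (simp add: ennreal_mult)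
  have mA: "(LINT \<eta>|lborel. rep_L2 (fourier (modulus_rearrangement u)) \<eta> * cnj (rep_L2 (fourier (modulus_rearrangement v)) (\<eta> + k))) = of_real (A u v k)" for u v :: "'a L2" and k
  proof -
    have "(LINT \<eta>|lborel. rep_L2 (fourier (modulus_rearrangement u)) \<eta> * cnj (rep_L2 (fourier (modulus_rearrangement v)) (\<eta> + k)))
       = (LINT \<eta>|lborel. of_real (cmod (rep_L2 (fourier u) \<eta>) * cmod (rep_L2 (fourier v) (\<eta> + k))))"
      using rep_fourier_modulus_rearrangement[of u] AE_lborel_translate[OF rep_fourier_modulus_rearrangement[of v], of k]
      by (intro integral_cong_AE) auto
    then show ?thesis unfolding A_def by (simp only: integral_complex_of_real)
  qed
  let ?g = "\<lambda>\<zeta>. gauss \<zeta> * (A u v (- (\<sigma> *\<^sub>R \<zeta>)) * A w z (\<sigma> *\<^sub>R \<zeta>))"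
  note gi = gauss_identity[where \<sigma>=\<sigma> and u="modulus_rearrangement u" and v="modulus_rearrangement v" and w="modulus_rearrangement w" and z="modulus_rearrangement z", unfolded mA mA[of _ _ "- _", simplified]]
  have gI: "integrable lborel ?g"
    using integrable_Re[OF gi(2)] by simp
  have "quartic_freq \<sigma> (fourier_modulus u) (fourier_modulus v) (fourier_modulus w) (fourier_modulus z) = (\<integral>\<^sup>+\<zeta>. ennreal (?g \<zeta>) \<partial>lborel)"
    unfolding quartic_freq_def pA by (simp add: ennreal_mult A0)
  also have "\<dots> = ennreal (LINT \<zeta>|lborel. ?g \<zeta>)"
    by (rule nn_integral_eq_integral[OF gI]) (simp add: A0)
  also have "(LINT \<zeta>|lborel. ?g \<zeta>) \<le> cmod (LINT \<zeta>|lborel. of_real (gauss \<zeta>) * (of_real (A u v (- (\<sigma> *\<^sub>R \<zeta>))) * of_real (A w z (\<sigma> *\<^sub>R \<zeta>))))"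
    by (simp flip: of_real_mult)
  also have "ennreal \<dots> \<le> (\<integral>\<^sup>+x. ennreal (cmod (LINT y|lborel. of_real (exp (- (norm (\<sigma> *\<^sub>R (x - y)))\<^sup>2 / 2)) * (rep_L2 (modulus_rearrangement u) y * cnj (rep_L2 (modulus_rearrangement v) y) * rep_L2 (modulus_rearrangement w) x * cnj (rep_L2 (modulus_rearrangement z) x)))) \<partial>lborel)"
    unfolding gi(1)[symmetric] by (rule norm_integral_le_nn_integral)
  also have "\<dots> \<le> (\<integral>\<^sup>+x. \<integral>\<^sup>+y. ennreal (exp (- (norm (\<sigma> *\<^sub>R (x - y)))\<^sup>2 / 2) * (cmod (rep_L2 (modulus_rearrangement u) y) * cmod (rep_L2 (modulus_rearrangement v) y) * cmod (rep_L2 (modulus_rearrangement w) x) * cmod (rep_L2 (modulus_rearrangement z) x))) \<partial>lborel \<partial>lborel)"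
    by (intro nn_integral_mono order.trans[OF norm_integral_le_nn_integral]) (simp add: norm_mult)
  finally show ?thesis using ennreal_leI by blast
qed

text \<open>Writes $|x|^{-\gamma}$ as a superposition of the Gaussians $e^{-\tau |x|^2}$.\<close>

definition riesz_weight :: "real \<Rightarrow> real \<Rightarrow> real" where
  "riesz_weight \<gamma> \<tau> = indicator {0..} \<tau> * \<tau> powr (\<gamma> / 2 - 1)"

lemma riesz_weight_nonneg [simp]: "0 \<le> riesz_weight \<gamma> \<tau>" by (simp add: riesz_weight_def)

lemma riesz_weight_measurable [measurable]: "riesz_weight \<gamma> \<in> borel_measurable borel"
  unfolding riesz_weight_def[abs_def] by measurable

text \<open>Euler's integral for the Gamma function after the substitution of d^2 tau for the
  variable.\<close>

lemma nn_integral_riesz_weight: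
  assumes \<gamma>: "0 < \<gamma>" and d: "0 < d"
  shows "(\<integral>\<^sup>+\<tau>. ennreal (riesz_weight \<gamma> \<tau> * exp (- \<tau> * d\<^sup>2)) \<partial>lborel) = ennreal (Gamma (\<gamma> / 2) * d powr (- \<gamma>))"
proof -
  let ?h = "\<lambda>t. riesz_weight \<gamma> t * exp (- t)"
  have "((\<lambda>t. t powr (\<gamma> / 2 - 1) / exp t) has_integral Gamma (\<gamma> / 2)) {0..}"
    by (rule Gamma_integral_real) (use \<gamma> in simp)
  then have "((\<lambda>t. if t \<in> {0..} then t powr (\<gamma> / 2 - 1) / exp t else 0) has_integral Gamma (\<gamma> / 2)) UNIV"
    by (simp only: has_integral_restrict_UNIV)
  also have "(\<lambda>t. if t \<in> {0..} then t powr (\<gamma> / 2 - 1) / exp t else 0) = ?h"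
    by (auto simp: fun_eq_iff riesz_weight_def exp_minus field_simps)
  finally have "(\<integral>\<^sup>+t. ennreal (?h t) \<partial>lborel) = ennreal (Gamma (\<gamma> / 2))"
    by (intro nn_integral_has_integral_lborel) auto
  moreover have "(\<integral>\<^sup>+t. ennreal (?h t) \<partial>lborel) = ennreal (d\<^sup>2) * (\<integral>\<^sup>+t. ennreal (?h (0 + d\<^sup>2 * t)) \<partial>lborel)"
    using d nn_integral_real_affine[of "\<lambda>t. ennreal (?h t)" "d\<^sup>2" 0] by simp
  moreover have hs: "?h (0 + d\<^sup>2 * t) = d powr (\<gamma> - 2) * (riesz_weight \<gamma> t * exp (- t * d\<^sup>2))" for t
  proof (cases "0 \<le> t")
    case True
    have "d\<^sup>2 powr (\<gamma> / 2 - 1) = d powr (\<gamma> - 2)"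
      using powr_powr[of d 2 "\<gamma> / 2 - 1"] d by (simp add: algebra_simps)
    moreover have "(d\<^sup>2 * t) powr (\<gamma> / 2 - 1) = d\<^sup>2 powr (\<gamma> / 2 - 1) * t powr (\<gamma> / 2 - 1)"
      using True d by (simp add: powr_mult)
    ultimately show ?thesis using True d by (simp add: riesz_weight_def mult.commute)
  next
    case False
    then have "\<not> 0 \<le> d\<^sup>2 * t" using d by (simp add: zero_le_mult_iff not_le)
    with False show ?thesis by (simp add: riesz_weight_def)
  qed
  moreover have "(\<integral>\<^sup>+t. ennreal (?h (0 + d\<^sup>2 * t)) \<partial>lborel) = ennreal (d powr (\<gamma> - 2)) * (\<integral>\<^sup>+t. ennreal (riesz_weight \<gamma> t * exp (- t * d\<^sup>2)) \<partial>lborel)"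
    unfolding hs by (subst nn_integral_cmult[symmetric]) (auto simp flip: ennreal_mult)
  ultimately have "ennreal (Gamma (\<gamma> / 2)) = ennreal (d\<^sup>2) * (ennreal (d powr (\<gamma> - 2)) * (\<integral>\<^sup>+t. ennreal (riesz_weight \<gamma> t * exp (- t * d\<^sup>2)) \<partial>lborel))"
    by simp
  also have "\<dots> = ennreal (d powr \<gamma>) * (\<integral>\<^sup>+t. ennreal (riesz_weight \<gamma> t * exp (- t * d\<^sup>2)) \<partial>lborel)"
  proof -
    have "d\<^sup>2 * d powr (\<gamma> - 2) = d powr 2 * d powr (\<gamma> - 2)" using d by simp
    also have "\<dots> = d powr \<gamma>" by (simp flip: powr_add)
    finally show ?thesis by (simp add: mult.assoc[symmetric] flip: ennreal_mult)
  qed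
  finally have "ennreal (d powr (- \<gamma>)) * ennreal (Gamma (\<gamma> / 2)) = (ennreal (d powr (- \<gamma>)) * ennreal (d powr \<gamma>)) * (\<integral>\<^sup>+t. ennreal (riesz_weight \<gamma> t * exp (- t * d\<^sup>2)) \<partial>lborel)"
    by (simp add: mult.assoc)
  moreover have "ennreal (d powr (- \<gamma>)) * ennreal (d powr \<gamma>) = 1"
    using d by (simp flip: ennreal_mult powr_add)
  moreover have "ennreal (Gamma (\<gamma> / 2) * d powr (- \<gamma>)) = ennreal (Gamma (\<gamma> / 2)) * ennreal (d powr (- \<gamma>))"
    using \<gamma> by (intro ennreal_mult less_imp_le[OF Gamma_real_pos]) auto
  ultimately show ?thesis by (simp add: mult.commute)
qed

text \<open>The value sigma = sqrt (2 tau) turns exp (- sigma^2 |x-y|^2 / 2) into exp (- tau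
  |x-y|^2). Integrated against \<open>riesz_weight\<close>, the form bounds Gamma (gamma / 2) times
  the modulus of the Riesz form.\<close>

definition quartic_plus :: "real \<Rightarrow> ('a::euclidean_space \<Rightarrow> ennreal) \<Rightarrow> ('a \<Rightarrow> ennreal) \<Rightarrow> ('a \<Rightarrow> ennreal) \<Rightarrow> ('a \<Rightarrow> ennreal) \<Rightarrow> ennreal" where
  "quartic_plus \<gamma> F1 F2 F3 F4 = (\<integral>\<^sup>+\<tau>. ennreal (riesz_weight \<gamma> \<tau>) * quartic_freq (sqrt (2 * \<tau>)) F1 F2 F3 F4 \<partial>lborel)"

lemma norm_scaleR_sqrt: "0 \<le> \<tau> \<Longrightarrow> (norm (sqrt (2 * \<tau>) *\<^sub>R x))\<^sup>2 / 2 = \<tau> * (norm x)\<^sup>2"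
  by (simp add: power_mult_distrib)

text \<open>For negative tau both sides vanish with the weight, so the identity can be used under
  integrals over the whole line.\<close>

lemma exp_sqrt_weight:
  "riesz_weight \<gamma> \<tau> * exp (- (norm (sqrt (2 * \<tau>) *\<^sub>R x))\<^sup>2 / 2) = riesz_weight \<gamma> \<tau> * exp (- \<tau> * (norm x)\<^sup>2)"
proof (cases "0 \<le> \<tau>")
  case True
  then show ?thesis using norm_scaleR_sqrt[OF True, of x] by simp
qed (simp add: riesz_weight_def)

text \<open>Tonelli brings the tau integral inside, where it produces the Riesz kernel off the
  diagonal.\<close>

lemma nn_integral_weight_double:
  fixes D :: "'a::euclidean_space \<Rightarrow> 'a \<Rightarrow> real"
  assumes \<gamma>: "0 < \<gamma>" and [measurable]: "(\<lambda>(x, y). D x y) \<in> borel_measurable (borel \<Otimes>\<^sub>M borel)" and D: "\<And>x y. 0 \<le> D x y"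
  shows "(\<integral>\<^sup>+\<tau>. ennreal (riesz_weight \<gamma> \<tau>) * (\<integral>\<^sup>+x. \<integral>\<^sup>+y. ennreal (exp (- (norm (sqrt (2 * \<tau>) *\<^sub>R (x - y)))\<^sup>2 / 2) * D x y) \<partial>lborel \<partial>lborel) \<partial>lborel)
    = ennreal (Gamma (\<gamma> / 2)) * (\<integral>\<^sup>+x. \<integral>\<^sup>+y. ennreal (riesz \<gamma> x y * D x y) \<partial>lborel \<partial>lborel)"
proof -
  have G: "0 < Gamma (\<gamma> / 2)" using \<gamma> by (intro Gamma_real_pos) simp
  have "(\<integral>\<^sup>+\<tau>. ennreal (riesz_weight \<gamma> \<tau>) * (\<integral>\<^sup>+x. \<integral>\<^sup>+y. ennreal (exp (- (norm (sqrt (2 * \<tau>) *\<^sub>R (x - y)))\<^sup>2 / 2) * D x y) \<partial>lborel \<partial>lborel) \<partial>lborel)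
     = (\<integral>\<^sup>+\<tau>. \<integral>\<^sup>+x. \<integral>\<^sup>+y. ennreal (riesz_weight \<gamma> \<tau> * exp (- \<tau> * (norm (x - y))\<^sup>2)) * ennreal (D x y) \<partial>lborel \<partial>lborel \<partial>lborel)"
  proof (intro nn_integral_cong)
    fix \<tau> :: real
    have *: "ennreal (riesz_weight \<gamma> \<tau> * exp (- \<tau> * (norm (x - y))\<^sup>2)) * ennreal (D x y) = ennreal (riesz_weight \<gamma> \<tau>) * ennreal (exp (- (norm (sqrt (2 * \<tau>) *\<^sub>R (x - y)))\<^sup>2 / 2) * D x y)" for x y
      unfolding exp_sqrt_weight[symmetric] by (simp add: D mult.assoc flip: ennreal_mult)
    show "ennreal (riesz_weight \<gamma> \<tau>) * (\<integral>\<^sup>+x. \<integral>\<^sup>+y. ennreal (exp (- (norm (sqrt (2 * \<tau>) *\<^sub>R (x - y)))\<^sup>2 / 2) * D x y) \<partial>lborel \<partial>lborel)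
      = (\<integral>\<^sup>+x. \<integral>\<^sup>+y. ennreal (riesz_weight \<gamma> \<tau> * exp (- \<tau> * (norm (x - y))\<^sup>2)) * ennreal (D x y) \<partial>lborel \<partial>lborel)"
      unfolding * by (subst nn_integral_cmult[symmetric], measurable, intro nn_integral_cong nn_integral_cmult[symmetric]) measurable
  qed
  also have "\<dots> = (\<integral>\<^sup>+x. \<integral>\<^sup>+\<tau>. \<integral>\<^sup>+y. ennreal (riesz_weight \<gamma> \<tau> * exp (- \<tau> * (norm (x - y))\<^sup>2)) * ennreal (D x y) \<partial>lborel \<partial>lborel \<partial>lborel)"
    by (rule lborel_pair.Fubini') measurable
  also have "\<dots> = (\<integral>\<^sup>+x. \<integral>\<^sup>+y. \<integral>\<^sup>+\<tau>. ennreal (riesz_weight \<gamma> \<tau> * exp (- \<tau> * (norm (x - y))\<^sup>2)) * ennreal (D x y) \<partial>lborel \<partial>lborel \<partial>lborel)"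
    by (intro nn_integral_cong lborel_pair.Fubini') measurable
  also have "\<dots> = (\<integral>\<^sup>+x. \<integral>\<^sup>+y. ennreal (Gamma (\<gamma> / 2)) * ennreal (riesz \<gamma> x y * D x y) \<partial>lborel \<partial>lborel)"
  proof (rule nn_integral_cong, rule nn_integral_cong_AE)
    fix x :: 'a
    have "AE y in lborel. y \<noteq> x" using AE_lborel_singleton[of x] by auto
    then show "AE y in lborel. (\<integral>\<^sup>+\<tau>. ennreal (riesz_weight \<gamma> \<tau> * exp (- \<tau> * (norm (x - y))\<^sup>2)) * ennreal (D x y) \<partial>lborel) = ennreal (Gamma (\<gamma> / 2)) * ennreal (riesz \<gamma> x y * D x y)"
    proof eventually_elim
      fix y assume "y \<noteq> x"
      then have "0 < norm (x - y)" by simp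
      then show "(\<integral>\<^sup>+\<tau>. ennreal (riesz_weight \<gamma> \<tau> * exp (- \<tau> * (norm (x - y))\<^sup>2)) * ennreal (D x y) \<partial>lborel) = ennreal (Gamma (\<gamma> / 2)) * ennreal (riesz \<gamma> x y * D x y)"
        by (subst nn_integral_multc, measurable, subst nn_integral_riesz_weight[OF \<gamma>])
          (use G D in \<open>simp_all add: riesz_def mult.assoc flip: ennreal_mult\<close>)
    qed
  qed
  also have "\<dots> = ennreal (Gamma (\<gamma> / 2)) * (\<integral>\<^sup>+x. \<integral>\<^sup>+y. ennreal (riesz \<gamma> x y * D x y) \<partial>lborel \<partial>lborel)"
    by (simp add: nn_integral_cmult)
  finally show ?thesis .
qed

lemma pair_freq_mono_AE:
  assumes "AE \<eta> in lborel. F \<eta> \<le> F' \<eta>" "AE \<eta> in lborel. G \<eta> \<le> G' \<eta>"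
  shows "pair_freq F G k \<le> pair_freq F' G' k"
  unfolding pair_freq_def using assms(1) AE_lborel_translate[OF assms(2), of k]
  by (intro nn_integral_mono_AE, eventually_elim) (rule mult_mono, auto)

lemma quartic_plus_mono_AE:
  assumes "AE \<eta> in lborel. F1 \<eta> \<le> G1 \<eta>" "AE \<eta> in lborel. F2 \<eta> \<le> G2 \<eta>"
    "AE \<eta> in lborel. F3 \<eta> \<le> G3 \<eta>" "AE \<eta> in lborel. F4 \<eta> \<le> G4 \<eta>"
  shows "quartic_plus \<gamma> F1 F2 F3 F4 \<le> quartic_plus \<gamma> G1 G2 G3 G4"
  unfolding quartic_plus_def quartic_freq_def
  by (intro nn_integral_mono mult_left_mono mult_mono pair_freq_mono_AE assms) auto

lemma pair_freq_mult:
  assumes [measurable]: "F \<in> borel_measurable borel" "G \<in> borel_measurable borel" "F' \<in> borel_measurable borel" "G' \<in> borel_measurable borel"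
  shows "pair_freq F G k * pair_freq F' G' l = (\<integral>\<^sup>+\<eta>. \<integral>\<^sup>+\<xi>. F \<eta> * G (\<eta> + k) * (F' \<xi> * G' (\<xi> + l)) \<partial>lborel \<partial>lborel)"
  unfolding pair_freq_def by (simp add: nn_integral_cmult nn_integral_multc)

text \<open>A quasi-subadditive weight on the last factor can be moved to any of the other three because all
  integrands are nonnegative.\<close>

lemma quartic_plus_weight:
  fixes W :: "'a::euclidean_space \<Rightarrow> ennreal"
  assumes [measurable]: "F1 \<in> borel_measurable borel" "F2 \<in> borel_measurable borel" "F3 \<in> borel_measurable borel" "H \<in> borel_measurable borel" "W \<in> borel_measurable borel"
    and W: "\<And>\<xi> \<eta> k. W (\<xi> + k) \<le> C * (W \<xi> + W \<eta> + W (\<eta> - k))"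
  shows "quartic_plus \<gamma> F1 F2 F3 (\<lambda>\<xi>. W \<xi> * H \<xi>) \<le>
    C * (quartic_plus \<gamma> (\<lambda>\<xi>. W \<xi> * F1 \<xi>) F2 F3 H + quartic_plus \<gamma> F1 (\<lambda>\<xi>. W \<xi> * F2 \<xi>) F3 H + quartic_plus \<gamma> F1 F2 (\<lambda>\<xi>. W \<xi> * F3 \<xi>) H)"
proof -
  have 1: "pair_freq F1 F2 (- k) * pair_freq F3 (\<lambda>\<xi>. W \<xi> * H \<xi>) k \<le> C * (pair_freq (\<lambda>\<xi>. W \<xi> * F1 \<xi>) F2 (- k) * pair_freq F3 H k
     + pair_freq F1 (\<lambda>\<xi>. W \<xi> * F2 \<xi>) (- k) * pair_freq F3 H k + pair_freq F1 F2 (- k) * pair_freq (\<lambda>\<xi>. W \<xi> * F3 \<xi>) H k)" for k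
  proof -
    have "pair_freq F1 F2 (- k) * pair_freq F3 (\<lambda>\<xi>. W \<xi> * H \<xi>) k
      = (\<integral>\<^sup>+\<eta>. \<integral>\<^sup>+\<xi>. W (\<xi> + k) * (F1 \<eta> * F2 (\<eta> - k) * F3 \<xi> * H (\<xi> + k)) \<partial>lborel \<partial>lborel)"
      by (subst pair_freq_mult) (auto simp: mult_ac)
    \<comment> \<open>The output frequency xi + k equals xi + eta - (eta - k), a combination of the
      three input frequencies; this is where the hypothesis on W acts.\<close>
    also have "\<dots> \<le> (\<integral>\<^sup>+\<eta>. \<integral>\<^sup>+\<xi>. C * (W \<xi> + W \<eta> + W (\<eta> - k)) * (F1 \<eta> * F2 (\<eta> - k) * F3 \<xi> * H (\<xi> + k)) \<partial>lborel \<partial>lborel)"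
      by (intro nn_integral_mono mult_right_mono W) simp
    also have "\<dots> = (\<integral>\<^sup>+\<eta>. \<integral>\<^sup>+\<xi>. C * (((W \<eta> * F1 \<eta>) * F2 (\<eta> + - k) * (F3 \<xi> * H (\<xi> + k)) + F1 \<eta> * (W (\<eta> + - k) * F2 (\<eta> + - k)) * (F3 \<xi> * H (\<xi> + k))) + F1 \<eta> * F2 (\<eta> + - k) * ((W \<xi> * F3 \<xi>) * H (\<xi> + k))) \<partial>lborel \<partial>lborel)"
      by (intro nn_integral_cong) (simp add: distrib_left distrib_right mult_ac add_ac)
    also have "\<dots> = C * (pair_freq (\<lambda>\<xi>. W \<xi> * F1 \<xi>) F2 (- k) * pair_freq F3 H k
     + pair_freq F1 (\<lambda>\<xi>. W \<xi> * F2 \<xi>) (- k) * pair_freq F3 H k + pair_freq F1 F2 (- k) * pair_freq (\<lambda>\<xi>. W \<xi> * F3 \<xi>) H k)"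
      by (simp add: pair_freq_mult nn_integral_cmult nn_integral_add)
    finally show ?thesis .
  qed
  have "quartic_plus \<gamma> F1 F2 F3 (\<lambda>\<xi>. W \<xi> * H \<xi>) \<le> (\<integral>\<^sup>+\<tau>. ennreal (riesz_weight \<gamma> \<tau>) * (\<integral>\<^sup>+\<zeta>. ennreal (gauss (\<zeta>::'a)) * (C * (pair_freq (\<lambda>\<xi>. W \<xi> * F1 \<xi>) F2 (- (sqrt (2 * \<tau>) *\<^sub>R \<zeta>)) * pair_freq F3 H (sqrt (2 * \<tau>) *\<^sub>R \<zeta>)
     + pair_freq F1 (\<lambda>\<xi>. W \<xi> * F2 \<xi>) (- (sqrt (2 * \<tau>) *\<^sub>R \<zeta>)) * pair_freq F3 H (sqrt (2 * \<tau>) *\<^sub>R \<zeta>) + pair_freq F1 F2 (- (sqrt (2 * \<tau>) *\<^sub>R \<zeta>)) * pair_freq (\<lambda>\<xi>. W \<xi> * F3 \<xi>) H (sqrt (2 * \<tau>) *\<^sub>R \<zeta>))) \<partial>lborel) \<partial>lborel)"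
    unfolding quartic_plus_def quartic_freq_def by (intro nn_integral_mono mult_left_mono 1) auto
  also have "\<dots> = C * (quartic_plus \<gamma> (\<lambda>\<xi>. W \<xi> * F1 \<xi>) F2 F3 H + quartic_plus \<gamma> F1 (\<lambda>\<xi>. W \<xi> * F2 \<xi>) F3 H + quartic_plus \<gamma> F1 F2 (\<lambda>\<xi>. W \<xi> * F3 \<xi>) H)"
    unfolding quartic_plus_def quartic_freq_def
    by (simp add: distrib_left nn_integral_add nn_integral_cmult mult.left_commute[of _ C])
  finally show ?thesis .
qed

context
  fixes \<gamma> :: real
  assumes \<gamma>: "0 < \<gamma>" "\<gamma> < 2" and N: "3 \<le> DIM('a::euclidean_space)"
begin

text \<open>The way back: integrating the bound for Gaussians over tau restores the Riesz kernel,
  and the quartic form of the rearranged functions falls under Hardy's inequality.\<close>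

lemma quartic_plus_le_quartic:
  fixes u v w z :: "'a L2"
  shows "quartic_plus \<gamma> (fourier_modulus u) (fourier_modulus v) (fourier_modulus w) (fourier_modulus z) \<le> ennreal (Gamma (\<gamma> / 2)) * quartic \<gamma> (modulus_rearrangement u) (modulus_rearrangement v) (modulus_rearrangement w) (modulus_rearrangement z)"
proof -
  have "quartic_plus \<gamma> (fourier_modulus u) (fourier_modulus v) (fourier_modulus w) (fourier_modulus z) \<le>
     (\<integral>\<^sup>+\<tau>. ennreal (riesz_weight \<gamma> \<tau>) * (\<integral>\<^sup>+x. \<integral>\<^sup>+y. ennreal (exp (- (norm (sqrt (2 * \<tau>) *\<^sub>R (x - y)))\<^sup>2 / 2) * (cmod (rep_L2 (modulus_rearrangement u) y) * cmod (rep_L2 (modulus_rearrangement v) y) * cmod (rep_L2 (modulus_rearrangement w) x) * cmod (rep_L2 (modulus_rearrangement z) x))) \<partial>lborel \<partial>lborel) \<partial>lborel)"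
    unfolding quartic_plus_def by (intro nn_integral_mono mult_left_mono quartic_freq_le_gauss) auto
  also have "\<dots> = ennreal (Gamma (\<gamma> / 2)) * quartic \<gamma> (modulus_rearrangement u) (modulus_rearrangement v) (modulus_rearrangement w) (modulus_rearrangement z)"
    unfolding quartic_def[OF \<gamma> N] by (rule nn_integral_weight_double) (auto simp: \<gamma>)
  finally show ?thesis .
qed

text \<open>With two H^1 factors the Riesz form converges absolutely, so Fubini exposes it as a
  superposition of Gaussian forms, and each of these is bounded in frequency separately.\<close>

lemma cinner_trilinear_le_quartic_plus:
  fixes f g p q :: "'a L2"
  shows "ennreal (Gamma (\<gamma> / 2) * cmod (cinner (trilinear \<gamma> (bessel 1 f) (bessel 1 g) p) q)) \<le> quartic_plus \<gamma> (fourier_modulus (bessel 1 f)) (fourier_modulus (bessel 1 g)) (fourier_modulus p) (fourier_modulus q)"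
proof -
  define Z where "Z x y = rep_L2 (bessel 1 f) y * cnj (rep_L2 (bessel 1 g) y) * rep_L2 p x * cnj (rep_L2 q x)" for x y
  have Zm [measurable]: "(\<lambda>(x, y). Z x y) \<in> borel_measurable (borel \<Otimes>\<^sub>M borel)" unfolding Z_def by measurable
  have G: "0 < Gamma (\<gamma> / 2)" using \<gamma> by (intro Gamma_real_pos) simp
  let ?e = "\<lambda>\<tau> x y. exp (- (norm (sqrt (2 * \<tau>) *\<^sub>R (x - y :: 'a)))\<^sup>2 / 2)"
  have fin: "(\<integral>\<^sup>+\<tau>. ennreal (riesz_weight \<gamma> \<tau>) * (\<integral>\<^sup>+x. \<integral>\<^sup>+y. ennreal (?e \<tau> x y * cmod (Z x y)) \<partial>lborel \<partial>lborel) \<partial>lborel) < \<infinity>"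
  proof -
    have "(\<integral>\<^sup>+x. \<integral>\<^sup>+y. ennreal (riesz \<gamma> x y * cmod (Z x y)) \<partial>lborel \<partial>lborel) = quartic \<gamma> (bessel 1 f) (bessel 1 g) p q"
      unfolding quartic_def[OF \<gamma> N] Z_def by (simp add: norm_mult)
    also have "\<dots> < \<infinity>" using quartic_le(1)[OF \<gamma> N, of f g p q] order.strict_trans1 ennreal_less_top by fastforce
    finally show ?thesis
      by (subst nn_integral_weight_double) (auto simp: \<gamma> ennreal_mult_less_top)
  qed
  interpret P: pair_sigma_finite "lborel :: real measure" "lborel \<Otimes>\<^sub>M lborel :: ('a \<times> 'a) measure"
    by (simp add: pair_sigma_finite_def sigma_finite_lborel lborel_prod)
  have sf: "sigma_finite_measure (lborel \<Otimes>\<^sub>M lborel :: ('a \<times> 'a) measure)"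
    by (simp add: lborel_prod sigma_finite_lborel)
  define F where "F \<tau> s = complex_of_real (riesz_weight \<gamma> \<tau>) * (of_real (?e \<tau> (fst s) (snd s)) * Z (fst s) (snd s))" for \<tau> s
  have [measurable]: "(\<lambda>(\<tau>, s). F \<tau> s) \<in> borel_measurable (borel \<Otimes>\<^sub>M (borel \<Otimes>\<^sub>M borel))"
    unfolding F_def by measurable
  have I: "integrable (lborel \<Otimes>\<^sub>M (lborel \<Otimes>\<^sub>M lborel)) (\<lambda>(\<tau>, s). F \<tau> s)"
  proof (rule integrableI_bounded)
    have "(\<integral>\<^sup>+r. ennreal (norm (case r of (\<tau>, s) \<Rightarrow> F \<tau> s)) \<partial>(lborel \<Otimes>\<^sub>M (lborel \<Otimes>\<^sub>M lborel))) = (\<integral>\<^sup>+\<tau>. \<integral>\<^sup>+s. ennreal (norm (F \<tau> s)) \<partial>(lborel \<Otimes>\<^sub>M lborel) \<partial>lborel)"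
      by (subst sigma_finite_measure.nn_integral_fst[OF sf, symmetric]) auto
    also have "\<dots> = (\<integral>\<^sup>+\<tau>. ennreal (riesz_weight \<gamma> \<tau>) * (\<integral>\<^sup>+x. \<integral>\<^sup>+y. ennreal (?e \<tau> x y * cmod (Z x y)) \<partial>lborel \<partial>lborel) \<partial>lborel)"
    proof (rule nn_integral_cong)
      fix \<tau> :: real
      have "(\<integral>\<^sup>+s. ennreal (norm (F \<tau> s)) \<partial>(lborel \<Otimes>\<^sub>M lborel)) = (\<integral>\<^sup>+s. ennreal (riesz_weight \<gamma> \<tau>) * ennreal (?e \<tau> (fst s) (snd s) * cmod (Z (fst s) (snd s))) \<partial>(lborel \<Otimes>\<^sub>M lborel))"
        by (intro nn_integral_cong) (simp add: F_def norm_mult flip: ennreal_mult)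
      also have "\<dots> = ennreal (riesz_weight \<gamma> \<tau>) * (\<integral>\<^sup>+s. ennreal (?e \<tau> (fst s) (snd s) * cmod (Z (fst s) (snd s))) \<partial>(lborel \<Otimes>\<^sub>M lborel))"
        by (rule nn_integral_cmult) measurable
      also have "(\<integral>\<^sup>+s. ennreal (?e \<tau> (fst s) (snd s) * cmod (Z (fst s) (snd s))) \<partial>(lborel \<Otimes>\<^sub>M lborel)) = (\<integral>\<^sup>+x. \<integral>\<^sup>+y. ennreal (?e \<tau> x y * cmod (Z x y)) \<partial>lborel \<partial>lborel)"
        by (subst lborel.nn_integral_fst[symmetric]) auto
      finally show "(\<integral>\<^sup>+s. ennreal (norm (F \<tau> s)) \<partial>(lborel \<Otimes>\<^sub>M lborel)) = ennreal (riesz_weight \<gamma> \<tau>) * (\<integral>\<^sup>+x. \<integral>\<^sup>+y. ennreal (?e \<tau> x y * cmod (Z x y)) \<partial>lborel \<partial>lborel)" .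
    qed
    finally show "(\<integral>\<^sup>+r. ennreal (norm (case r of (\<tau>, s) \<Rightarrow> F \<tau> s)) \<partial>(lborel \<Otimes>\<^sub>M (lborel \<Otimes>\<^sub>M lborel))) < \<infinity>" using fin by simp
  qed auto
  have "(LINT s|(lborel \<Otimes>\<^sub>M lborel). LINT \<tau>|lborel. F \<tau> s) = (LINT \<tau>|lborel. LINT s|(lborel \<Otimes>\<^sub>M lborel). F \<tau> s)"
    by (rule P.Fubini_integral[OF I])
  moreover have "(LINT s|(lborel \<Otimes>\<^sub>M lborel). LINT \<tau>|lborel. F \<tau> s) = of_real (Gamma (\<gamma> / 2)) * cinner (trilinear \<gamma> (bessel 1 f) (bessel 1 g) p) q"
  proof -
    have "(LINT s|(lborel \<Otimes>\<^sub>M lborel). LINT \<tau>|lborel. F \<tau> s) = (LINT x|lborel. LINT y|lborel. LINT \<tau>|lborel. F \<tau> (x, y))"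
      using lborel_pair.integral_fst'[OF P.integrable_snd[OF I]] by simp
    also have "\<dots> = (LINT x|lborel. LINT y|lborel. of_real (Gamma (\<gamma> / 2)) * (of_real (riesz \<gamma> x y) * Z x y))"
    proof (rule Bochner_Integration.integral_cong[OF refl], rule integral_cong_AE)
      fix x :: 'a
      have "AE y in lborel. y \<noteq> x" using AE_lborel_singleton[of x] by auto
      then show "AE y in lborel. (LINT \<tau>|lborel. F \<tau> (x, y)) = of_real (Gamma (\<gamma> / 2)) * (of_real (riesz \<gamma> x y) * Z x y)"
      proof eventually_elim
        fix y assume "y \<noteq> x"
        then have d: "0 < norm (x - y)" by simp
        have "(LINT \<tau>|lborel. F \<tau> (x, y)) = (LINT \<tau>|lborel. of_real (riesz_weight \<gamma> \<tau> * exp (- \<tau> * (norm (x - y))\<^sup>2)) * Z x y)"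
          unfolding F_def exp_sqrt_weight[symmetric] fst_conv snd_conv of_real_mult mult.assoc ..
        also have "\<dots> = of_real (LINT \<tau>|lborel. riesz_weight \<gamma> \<tau> * exp (- \<tau> * (norm (x - y))\<^sup>2)) * Z x y"
          unfolding integral_mult_left_zero integral_complex_of_real ..
        also have "(LINT \<tau>|lborel. riesz_weight \<gamma> \<tau> * exp (- \<tau> * (norm (x - y))\<^sup>2)) = Gamma (\<gamma> / 2) * norm (x - y) powr (- \<gamma>)"
          using nn_integral_riesz_weight[OF \<gamma>(1) d] G by (intro integral_eq_nn_integral[THEN trans]) auto
        finally show "(LINT \<tau>|lborel. F \<tau> (x, y)) = of_real (Gamma (\<gamma> / 2)) * (of_real (riesz \<gamma> x y) * Z x y)"
          by (simp add: riesz_def)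
      qed
    qed measurable
    finally show ?thesis unfolding cinner_trilinear[OF \<gamma> N] Z_def by simp
  qed
  moreover have "ennreal (cmod (LINT \<tau>|lborel. LINT s|(lborel \<Otimes>\<^sub>M lborel). F \<tau> s)) \<le> quartic_plus \<gamma> (fourier_modulus (bessel 1 f)) (fourier_modulus (bessel 1 g)) (fourier_modulus p) (fourier_modulus q)"
    unfolding quartic_plus_def
  proof (rule order.trans[OF norm_integral_le_nn_integral], rule nn_integral_mono)
    fix \<tau> :: real
    have eZ: "integrable (lborel \<Otimes>\<^sub>M lborel) (\<lambda>(x, y). complex_of_real (?e \<tau> x y) * Z x y)"
    proof -
      have "integrable (lborel \<Otimes>\<^sub>M lborel) (\<lambda>(x, y). (rep_L2 p x * cnj (rep_L2 q x)) * (rep_L2 (bessel 1 f) y * cnj (rep_L2 (bessel 1 g) y)) * complex_of_real (?e \<tau> x y))"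
        by (rule integrable_product_kernel[OF integrable_rep_mult integrable_rep_mult, where B=1]) auto
      then show ?thesis by (simp add: Z_def mult_ac)
    qed
    have "(LINT s|(lborel \<Otimes>\<^sub>M lborel). F \<tau> s) = of_real (riesz_weight \<gamma> \<tau>) * (LINT x|lborel. LINT y|lborel. of_real (?e \<tau> x y) * Z x y)"
      using lborel_pair.integral_fst'[OF eZ] by (simp add: F_def case_prod_beta')
    then have "ennreal (norm (LINT s|(lborel \<Otimes>\<^sub>M lborel). F \<tau> s)) = ennreal (riesz_weight \<gamma> \<tau>) * ennreal (cmod (LINT x|lborel. LINT y|lborel. of_real (?e \<tau> x y) * Z x y))"
      by (simp add: norm_mult flip: ennreal_mult)
    also have "\<dots> \<le> ennreal (riesz_weight \<gamma> \<tau>) * quartic_freq (sqrt (2 * \<tau>)) (fourier_modulus (bessel 1 f)) (fourier_modulus (bessel 1 g)) (fourier_modulus p) (fourier_modulus q)"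
      unfolding Z_def by (intro mult_left_mono gauss_quartic_le) simp
    finally show "ennreal (norm (LINT s|(lborel \<Otimes>\<^sub>M lborel). F \<tau> s)) \<le> ennreal (riesz_weight \<gamma> \<tau>) * quartic_freq (sqrt (2 * \<tau>)) (fourier_modulus (bessel 1 f)) (fourier_modulus (bessel 1 g)) (fourier_modulus p) (fourier_modulus q)" .
  qed
  moreover have "Gamma (\<gamma> / 2) * cmod (cinner (trilinear \<gamma> (bessel 1 f) (bessel 1 g) p) q) = cmod (of_real (Gamma (\<gamma> / 2)) * cinner (trilinear \<gamma> (bessel 1 f) (bessel 1 g) p) q)"
    using G by (simp add: norm_mult)
  ultimately show ?thesis by simp
qed

end

section \<open>Tame estimates\<close>

text \<open>Since xi + k = xi + eta - (eta - k), its norm is at most 3 times the largest of the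
  three norms. Squaring gives the 9, and the largest weight is bounded by the sum.\<close>

lemma japanese_bracket_le:
  fixes \<xi> \<eta> k :: "'a::real_normed_vector"
  assumes "0 \<le> s"
  shows "(1 + (norm (\<xi> + k))\<^sup>2) powr (s / 2) \<le> 9 powr (s / 2) *
    ((1 + (norm \<xi>)\<^sup>2) powr (s / 2) + (1 + (norm \<eta>)\<^sup>2) powr (s / 2) + (1 + (norm (\<eta> - k))\<^sup>2) powr (s / 2))"
proof -
  define a b c where "a = norm \<xi>" and "b = norm \<eta>" and "c = norm (\<eta> - k)"
  define m where "m = max a (max b c)"
  have "norm (\<xi> + k) = norm (\<xi> + \<eta> - (\<eta> - k))" by simp
  also have "\<dots> \<le> a + b + c"
    unfolding a_def b_def c_def by (meson add_right_mono norm_triangle_ineq norm_triangle_ineq4 order.trans)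
  also have "\<dots> \<le> 3 * m" by (simp add: m_def)
  finally have "(norm (\<xi> + k))\<^sup>2 \<le> (3 * m)\<^sup>2" by (rule power_mono) simp
  then have "1 + (norm (\<xi> + k))\<^sup>2 \<le> 9 * (1 + m\<^sup>2)" by (simp add: power_mult_distrib)
  then have "(1 + (norm (\<xi> + k))\<^sup>2) powr (s / 2) \<le> (9 * (1 + m\<^sup>2)) powr (s / 2)"
    using assms by (intro powr_mono2) auto
  also have "\<dots> = 9 powr (s / 2) * (1 + m\<^sup>2) powr (s / 2)" by (rule powr_mult)
  also have "(1 + m\<^sup>2) powr (s / 2) \<le> (1 + a\<^sup>2) powr (s / 2) + (1 + b\<^sup>2) powr (s / 2) + (1 + c\<^sup>2) powr (s / 2)"
    unfolding m_def by (auto simp: max_def add_nonneg_nonneg)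
  finally show ?thesis by (simp add: a_def b_def c_def)
qed

definition bracket :: "real \<Rightarrow> 'a::euclidean_space \<Rightarrow> real" where
  "bracket s \<xi> = (1 + (norm \<xi>)\<^sup>2) powr (s / 2)"

lemma bracket_measurable [measurable]: "bracket s \<in> borel_measurable borel"
  unfolding bracket_def[abs_def] by measurable

lemma bracket_nonneg [simp]: "0 \<le> bracket s \<xi>" by (simp add: bracket_def)

lemma bracket_bessel_symbol: "complex_of_real (bracket s \<xi>) * bessel_symbol s \<xi> = 1"
  using one_plus_norm_sq(2)[of \<xi>] by (simp add: bracket_def bessel_symbol_def flip: of_real_mult powr_add)

lemma bracket_fourier_modulus_bessel:
  assumes "0 \<le> s"
  shows "AE \<xi> in lborel. ennreal (bracket s \<xi>) * fourier_modulus (bessel s f) \<xi> = fourier_modulus f \<xi>"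
  using rep_fourier_bessel[OF assms, of f]
proof eventually_elim
  case (elim \<xi>)
  have "bracket s \<xi> * cmod (bessel_symbol s \<xi>) = 1"
    using arg_cong[OF bracket_bessel_symbol[of s \<xi>], of cmod] by (simp add: norm_mult)
  then show ?case using elim by (simp add: fourier_modulus_def norm_mult mult.assoc[symmetric] flip: ennreal_mult)
qed

context
  fixes \<gamma> :: real
  assumes \<gamma>: "0 < \<gamma>" "\<gamma> < 2" and N: "3 \<le> DIM('a::euclidean_space)"
begin

text \<open>The factor that takes the weight loses its potential J_s and remains in L^2, measured by
  \<open>norm f\<close>, the H^s norm of J_s f. The other two keep one derivative for Hardy's
  inequality and are measured in H^1. This makes the estimate linear in the highest norm.\<close>

lemma quartic_plus_bracket_le:
  fixes f g h q :: "'a L2"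
  assumes s: "1 \<le> s"
  shows "quartic_plus \<gamma> (fourier_modulus (bessel s f)) (fourier_modulus (bessel s g)) (fourier_modulus (bessel s h)) (\<lambda>\<xi>. ennreal (bracket s \<xi>) * fourier_modulus q \<xi>) \<le>
     ennreal (9 powr (s / 2) * (Gamma (\<gamma> / 2) * (4 *
       (norm f * norm (bessel (s - 1) g) * norm (bessel (s - 1) h) + norm (bessel (s - 1) f) * norm g * norm (bessel (s - 1) h)
        + norm (bessel (s - 1) f) * norm (bessel (s - 1) g) * norm h) * norm q)))"
proof -
  have s0: "0 \<le> s" using s by simp
  define J where "J f = bessel (s - 1) f" for f :: "'a L2"
  have b1: "bessel s f = bessel 1 (J f)" for f using s by (simp add: J_def bessel_bessel)
  have m1: "modulus_rearrangement (bessel s f) = bessel 1 (modulus_rearrangement (J f))" for f by (simp add: b1 modulus_rearrangement_bessel)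
  have G: "0 \<le> Gamma (\<gamma> / 2)" using \<gamma> by (intro less_imp_le Gamma_real_pos) simp
  let ?W = "\<lambda>f \<xi>. ennreal (bracket s \<xi>) * fourier_modulus (bessel s f) \<xi>"
  have W: "AE \<xi> in lborel. ?W f \<xi> \<le> fourier_modulus f \<xi>" for f
    using bracket_fourier_modulus_bessel[OF s0, of f] by eventually_elim simp
  have refl: "AE \<xi> in lborel. fourier_modulus f \<xi> \<le> fourier_modulus f \<xi>" for f :: "'a L2" by simp
  have t1: "quartic_plus \<gamma> (?W f) (fourier_modulus (bessel s g)) (fourier_modulus (bessel s h)) (fourier_modulus q) \<le> ennreal (Gamma (\<gamma> / 2) * (4 * norm f * norm (J g) * norm (J h) * norm q))"
  proof -
    have "quartic_plus \<gamma> (?W f) (fourier_modulus (bessel s g)) (fourier_modulus (bessel s h)) (fourier_modulus q) \<le> quartic_plus \<gamma> (fourier_modulus f) (fourier_modulus (bessel s g)) (fourier_modulus (bessel s h)) (fourier_modulus q)"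
      by (rule quartic_plus_mono_AE[OF W refl refl refl])
    also have "\<dots> \<le> ennreal (Gamma (\<gamma> / 2)) * quartic \<gamma> (modulus_rearrangement f) (bessel 1 (modulus_rearrangement (J g))) (bessel 1 (modulus_rearrangement (J h))) (modulus_rearrangement q)"
      using quartic_plus_le_quartic[OF \<gamma> N, of f "bessel s g" "bessel s h" q] by (simp only: m1)
    also have "\<dots> \<le> ennreal (Gamma (\<gamma> / 2)) * ennreal (4 * norm (J g) * norm (J h) * norm f * norm q)"
      using quartic_le(3)[OF \<gamma> N, of "modulus_rearrangement f" "modulus_rearrangement (J g)" "modulus_rearrangement (J h)" "modulus_rearrangement q"] by (intro mult_left_mono) auto
    finally show ?thesis using G by (simp add: mult_ac flip: ennreal_mult)
  qed
  have t2: "quartic_plus \<gamma> (fourier_modulus (bessel s f)) (?W g) (fourier_modulus (bessel s h)) (fourier_modulus q) \<le> ennreal (Gamma (\<gamma> / 2) * (4 * norm (J f) * norm g * norm (J h) * norm q))"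
  proof -
    have "quartic_plus \<gamma> (fourier_modulus (bessel s f)) (?W g) (fourier_modulus (bessel s h)) (fourier_modulus q) \<le> quartic_plus \<gamma> (fourier_modulus (bessel s f)) (fourier_modulus g) (fourier_modulus (bessel s h)) (fourier_modulus q)"
      by (rule quartic_plus_mono_AE[OF refl W refl refl])
    also have "\<dots> \<le> ennreal (Gamma (\<gamma> / 2)) * quartic \<gamma> (bessel 1 (modulus_rearrangement (J f))) (modulus_rearrangement g) (bessel 1 (modulus_rearrangement (J h))) (modulus_rearrangement q)"
      using quartic_plus_le_quartic[OF \<gamma> N, of "bessel s f" g "bessel s h" q] by (simp only: m1)
    also have "\<dots> \<le> ennreal (Gamma (\<gamma> / 2)) * ennreal (4 * norm (J f) * norm (J h) * norm g * norm q)"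
      using quartic_le(2)[OF \<gamma> N, of "modulus_rearrangement (J f)" "modulus_rearrangement g" "modulus_rearrangement (J h)" "modulus_rearrangement q"] by (intro mult_left_mono) auto
    finally show ?thesis using G by (simp add: mult_ac flip: ennreal_mult)
  qed
  have t3: "quartic_plus \<gamma> (fourier_modulus (bessel s f)) (fourier_modulus (bessel s g)) (?W h) (fourier_modulus q) \<le> ennreal (Gamma (\<gamma> / 2) * (4 * norm (J f) * norm (J g) * norm h * norm q))"
  proof -
    have "quartic_plus \<gamma> (fourier_modulus (bessel s f)) (fourier_modulus (bessel s g)) (?W h) (fourier_modulus q) \<le> quartic_plus \<gamma> (fourier_modulus (bessel s f)) (fourier_modulus (bessel s g)) (fourier_modulus h) (fourier_modulus q)"
      by (rule quartic_plus_mono_AE[OF refl refl W refl])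
    also have "\<dots> \<le> ennreal (Gamma (\<gamma> / 2)) * quartic \<gamma> (bessel 1 (modulus_rearrangement (J f))) (bessel 1 (modulus_rearrangement (J g))) (modulus_rearrangement h) (modulus_rearrangement q)"
      using quartic_plus_le_quartic[OF \<gamma> N, of "bessel s f" "bessel s g" h q] by (simp only: m1)
    also have "\<dots> \<le> ennreal (Gamma (\<gamma> / 2)) * ennreal (4 * norm (J f) * norm (J g) * norm h * norm q)"
      using quartic_le(1)[OF \<gamma> N, of "modulus_rearrangement (J f)" "modulus_rearrangement (J g)" "modulus_rearrangement h" "modulus_rearrangement q"] by (intro mult_left_mono) auto
    finally show ?thesis using G by (simp add: mult_ac flip: ennreal_mult)
  qed
  have "quartic_plus \<gamma> (fourier_modulus (bessel s f)) (fourier_modulus (bessel s g)) (fourier_modulus (bessel s h)) (\<lambda>\<xi>. ennreal (bracket s \<xi>) * fourier_modulus q \<xi>) \<le>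
    ennreal (9 powr (s / 2)) * (quartic_plus \<gamma> (?W f) (fourier_modulus (bessel s g)) (fourier_modulus (bessel s h)) (fourier_modulus q)
      + quartic_plus \<gamma> (fourier_modulus (bessel s f)) (?W g) (fourier_modulus (bessel s h)) (fourier_modulus q) + quartic_plus \<gamma> (fourier_modulus (bessel s f)) (fourier_modulus (bessel s g)) (?W h) (fourier_modulus q))"
  proof (rule quartic_plus_weight)
    fix \<xi> \<eta> k :: 'a
    show "ennreal (bracket s (\<xi> + k)) \<le> ennreal (9 powr (s / 2)) * (ennreal (bracket s \<xi>) + ennreal (bracket s \<eta>) + ennreal (bracket s (\<eta> - k)))"
      using japanese_bracket_le[OF s0, of \<xi> k \<eta>] by (simp add: bracket_def ennreal_leI flip: ennreal_mult ennreal_plus)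
  qed measurable
  also have "\<dots> \<le> ennreal (9 powr (s / 2)) * (ennreal (Gamma (\<gamma> / 2) * (4 * norm f * norm (J g) * norm (J h) * norm q))
      + ennreal (Gamma (\<gamma> / 2) * (4 * norm (J f) * norm g * norm (J h) * norm q)) + ennreal (Gamma (\<gamma> / 2) * (4 * norm (J f) * norm (J g) * norm h * norm q)))"
    by (intro mult_left_mono add_mono t1 t2 t3) simp
  also have "\<dots> = ennreal (9 powr (s / 2) * (Gamma (\<gamma> / 2) * (4 * norm f * norm (J g) * norm (J h) * norm q)
      + Gamma (\<gamma> / 2) * (4 * norm (J f) * norm g * norm (J h) * norm q) + Gamma (\<gamma> / 2) * (4 * norm (J f) * norm (J g) * norm h * norm q)))"
    using G by (simp flip: ennreal_mult ennreal_plus)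
  also have "\<dots> = ennreal (9 powr (s / 2) * (Gamma (\<gamma> / 2) * (4 * (norm f * norm (J g) * norm (J h) + norm (J f) * norm g * norm (J h) + norm (J f) * norm (J g) * norm h) * norm q)))"
    by (simp add: algebra_simps)
  finally show ?thesis by (simp add: J_def)
qed

text \<open>Duality with a truncated weight: testing the product against I_R^2 times itself bounds
  the square of the truncated H^s norm by B times that norm, which is finite by truncation and may
  be cancelled. Fatou's lemma then removes R.\<close>

lemma trilinear_sobolev:
  fixes f g h :: "'a L2"
  assumes s: "1 \<le> s"
  shows "\<exists>n. bessel s n = trilinear \<gamma> (bessel s f) (bessel s g) (bessel s h) \<and>
    norm n \<le> 4 * 9 powr (s / 2) * (norm f * norm (bessel (s - 1) g) * norm (bessel (s - 1) h)
      + norm (bessel (s - 1) f) * norm g * norm (bessel (s - 1) h) + norm (bessel (s - 1) f) * norm (bessel (s - 1) g) * norm h)"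
proof -
  have s0: "0 \<le> s" using s by simp
  define B where "B = 4 * 9 powr (s / 2) * (norm f * norm (bessel (s - 1) g) * norm (bessel (s - 1) h)
      + norm (bessel (s - 1) f) * norm g * norm (bessel (s - 1) h) + norm (bessel (s - 1) f) * norm (bessel (s - 1) g) * norm h)"
  have B0: "0 \<le> B" by (simp add: B_def)
  have b1: "bessel s f = bessel 1 (bessel (s - 1) f)" for f :: "'a L2" using s by (simp add: bessel_bessel)
  have G: "0 < Gamma (\<gamma> / 2)" using \<gamma> by (intro Gamma_real_pos) simp
  define n0 where "n0 = trilinear \<gamma> (bessel s f) (bessel s g) (bessel s h)"
  define r where "r = rep_L2 (fourier n0)"
  have [measurable]: "r \<in> borel_measurable borel" unfolding r_def by measurable
  define W :: "'a \<Rightarrow> real" where "W = bracket s"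
  have [measurable]: "W \<in> borel_measurable borel" unfolding W_def by measurable
  have W0: "0 \<le> W \<xi>" for \<xi> by (simp add: W_def)
  define I :: "real \<Rightarrow> 'a \<Rightarrow> complex" where "I R \<xi> = complex_of_real (indicator (cball 0 R) \<xi> * W \<xi>)" for R \<xi>
  have [measurable]: "I R \<in> borel_measurable borel" for R
  proof -
    have [measurable]: "(\<lambda>\<xi>. indicator (cball 0 R) \<xi> * W \<xi>) \<in> borel_measurable borel"
      by (intro borel_measurable_times borel_measurable_indicator) auto
    show ?thesis unfolding I_def[abs_def] by measurable
  qed
  have Ib: "bounded_multiplier (I R)" for R
  proof (rule bounded_multiplierI[where B="(1 + R\<^sup>2) powr (s / 2)"])
    fix \<xi> :: 'a
    show "cmod (I R \<xi>) \<le> (1 + R\<^sup>2) powr (s / 2)"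
    proof (cases "norm \<xi> \<le> R")
      case True
      then have "(norm \<xi>)\<^sup>2 \<le> R\<^sup>2" by (intro power_mono) auto
      then show ?thesis using True s0 by (simp add: I_def W_def bracket_def powr_mono2 add_nonneg_nonneg)
    qed (simp add: I_def)
  qed measurable
  have le: "norm (pmult (I R) (fourier n0)) \<le> B" for R
  proof -
    \<comment> \<open>One truncated weight gives q, two give z. Hence the squared norm of q is the
      pairing of n0 with z, while the transform of z is at most \<open>bracket s\<close> times that
      of q in modulus.\<close>
    define q where "q = fmult (I R) n0"
    define z where "z = fmult (\<lambda>\<xi>. I R \<xi> * I R \<xi>) n0"
    have "(norm q)\<^sup>2 = n0 \<bullet> z"
    proof -
      have "(\<lambda>\<xi>. cnj (I R \<xi>) * I R \<xi>) = (\<lambda>\<xi>. I R \<xi> * I R \<xi>)" by (simp add: I_def)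
      then show ?thesis
        using inner_fmult[OF Ib, of R n0 q] by (simp add: power2_norm_eq_inner q_def z_def fmult_fmult Ib bounded_multiplier_cnj)
    qed
    also have "\<dots> \<le> cmod (cinner n0 z)" by (simp add: complex_Re_le_cmod flip: Re_cinner)
    finally have "ennreal (Gamma (\<gamma> / 2) * (norm q)\<^sup>2) \<le> ennreal (Gamma (\<gamma> / 2) * cmod (cinner n0 z))"
      using G by (intro ennreal_leI mult_left_mono) auto
    also have "\<dots> \<le> quartic_plus \<gamma> (fourier_modulus (bessel s f)) (fourier_modulus (bessel s g)) (fourier_modulus (bessel s h)) (fourier_modulus z)"
      unfolding n0_def b1 by (rule cinner_trilinear_le_quartic_plus[OF \<gamma> N])
    also have "\<dots> \<le> quartic_plus \<gamma> (fourier_modulus (bessel s f)) (fourier_modulus (bessel s g)) (fourier_modulus (bessel s h)) (\<lambda>\<xi>. ennreal (bracket s \<xi>) * fourier_modulus q \<xi>)"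
    proof (rule quartic_plus_mono_AE)
      show "AE \<xi> in lborel. fourier_modulus z \<xi> \<le> ennreal (bracket s \<xi>) * fourier_modulus q \<xi>"
        using rep_pmult[OF bounded_multiplier_mult[OF Ib Ib], of R R "fourier n0"] rep_pmult[OF Ib, of R "fourier n0"]
      proof eventually_elim
        case (elim \<xi>)
        have "cmod (I R \<xi>) \<le> bracket s \<xi>" by (auto simp: I_def W_def norm_mult split: split_indicator)
        then have "cmod (I R \<xi>) * (cmod (I R \<xi>) * cmod (rep_L2 (fourier n0) \<xi>)) \<le> bracket s \<xi> * (cmod (I R \<xi>) * cmod (rep_L2 (fourier n0) \<xi>))"
          by (rule mult_right_mono) simp
        then show ?case using elim
          by (simp add: fourier_modulus_def z_def q_def norm_mult mult.assoc ennreal_leI flip: ennreal_mult)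
      qed
    qed auto
    also have "\<dots> \<le> ennreal (Gamma (\<gamma> / 2) * (B * norm q))"
    proof -
      have "9 powr (s / 2) * (Gamma (\<gamma> / 2) * (4 * X * norm q)) = Gamma (\<gamma> / 2) * ((4 * 9 powr (s / 2) * X) * norm q)" for X
        by (simp only: mult_ac)
      from quartic_plus_bracket_le[OF s, of f g h q, unfolded this] show ?thesis by (simp only: B_def)
    qed
    finally have "Gamma (\<gamma> / 2) * (norm q)\<^sup>2 \<le> Gamma (\<gamma> / 2) * (B * norm q)"
      using G B0 by simp
    then have "norm q * norm q \<le> B * norm q" using G by (simp add: power2_eq_square)
    then have "norm q \<le> B" using B0 by (cases "norm q = 0") auto
    then show ?thesis by (simp add: q_def fmult_def)
  qed
  have fin: "(\<integral>\<^sup>+\<xi>. ennreal ((cmod (of_real (W \<xi>) * r \<xi>))\<^sup>2) \<partial>lborel) \<le> ennreal (B\<^sup>2)"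
  proof -
    have "(\<integral>\<^sup>+\<xi>. ennreal ((cmod (of_real (W \<xi>) * r \<xi>))\<^sup>2) \<partial>lborel) = (\<integral>\<^sup>+\<xi>. liminf (\<lambda>n. ennreal ((cmod (I (real n) \<xi> * r \<xi>))\<^sup>2)) \<partial>lborel)"
    proof (rule nn_integral_cong)
      fix \<xi> :: 'a
      have "\<forall>\<^sub>F n in sequentially. norm \<xi> \<le> real n" by (rule eventually_sequentiallyI[of "nat \<lceil>norm \<xi>\<rceil>"]) linarith
      then have "\<forall>\<^sub>F n in sequentially. ennreal ((cmod (I (real n) \<xi> * r \<xi>))\<^sup>2) = ennreal ((cmod (of_real (W \<xi>) * r \<xi>))\<^sup>2)"
        by eventually_elim (simp add: I_def)
      from lim_imp_Liminf[OF _ tendsto_eventually[OF this]]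
      show "ennreal ((cmod (of_real (W \<xi>) * r \<xi>))\<^sup>2) = liminf (\<lambda>n. ennreal ((cmod (I (real n) \<xi> * r \<xi>))\<^sup>2))" by simp
    qed
    also have "\<dots> \<le> liminf (\<lambda>n. \<integral>\<^sup>+\<xi>. ennreal ((cmod (I (real n) \<xi> * r \<xi>))\<^sup>2) \<partial>lborel)"
      by (rule nn_integral_liminf) measurable
    also have "\<dots> \<le> liminf (\<lambda>n. ennreal (B\<^sup>2))"
    proof (rule Liminf_mono, rule always_eventually, rule allI)
      fix n
      have "(\<integral>\<^sup>+\<xi>. ennreal ((cmod (I (real n) \<xi> * r \<xi>))\<^sup>2) \<partial>lborel) = ennreal ((norm (pmult (I (real n)) (fourier n0)))\<^sup>2)"
        unfolding r_def pmult_def by (rule nn_integral_abs_L2) (intro square_integrable_pmult Ib square_integrable_rep)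
      also have "\<dots> \<le> ennreal (B\<^sup>2)" by (intro ennreal_leI power_mono le) simp
      finally show "(\<integral>\<^sup>+\<xi>. ennreal ((cmod (I (real n) \<xi> * r \<xi>))\<^sup>2) \<partial>lborel) \<le> ennreal (B\<^sup>2)" .
    qed
    finally show ?thesis by (simp add: Liminf_const)
  qed
  have sq: "square_integrable (\<lambda>\<xi>. of_real (W \<xi>) * r \<xi>)"
    by (rule square_integrableI) (use fin order.strict_trans1 ennreal_less_top in \<open>auto intro: order.strict_trans1[OF fin]\<close>)
  define n where "n = ifourier (abs_L2 (\<lambda>\<xi>. of_real (W \<xi>) * r \<xi>))"
  have "norm n \<le> B"
  proof (rule power2_le_imp_le[OF _ B0])
    have "ennreal ((norm n)\<^sup>2) \<le> ennreal (B\<^sup>2)" using fin by (simp only: n_def norm_ifourier nn_integral_abs_L2[OF sq])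
    then show "(norm n)\<^sup>2 \<le> B\<^sup>2" by simp
  qed
  moreover have "bessel s n = n0"
  proof -
    have "(\<lambda>\<xi>. bessel_symbol s \<xi> * (of_real (W \<xi>) * r \<xi>)) = r"
    proof
      fix \<xi>
      have "bessel_symbol s \<xi> * (of_real (W \<xi>) * r \<xi>) = (of_real (bracket s \<xi>) * bessel_symbol s \<xi>) * r \<xi>"
        by (simp add: W_def)
      then show "bessel_symbol s \<xi> * (of_real (W \<xi>) * r \<xi>) = r \<xi>" by (simp only: bracket_bessel_symbol mult_1_left)
    qed
    then have "fourier n0 = pmult (bessel_symbol s) (fourier n)"
      unfolding n_def fourier_ifourier pmult_abs_L2[OF bounded_multiplier_bessel[OF s0] sq] by (simp add: r_def)
    then show ?thesis by (rule fmult_eqI[symmetric])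
  qed
  ultimately show ?thesis unfolding n0_def B_def by blast
qed

end

text \<open>Here g0 is a limit that may differ from the value of g at t0, in contrast to
  \<open>continuous_on_propagator\<close>: the lemma is applied to difference quotients.\<close>

lemma tendsto_propagator_mult:
  assumes g: "(g \<longlongrightarrow> g0) (at t0 within S)"
  shows "((\<lambda>t. propagator (c * t) (g t)) \<longlongrightarrow> propagator (c * t0) g0) (at t0 within S)"
proof -
  have 1: "((\<lambda>t. propagator (c * t) g0) \<longlongrightarrow> propagator (c * t0) g0) (at t0 within S)"
  proof (rule tendsto_within_subset[OF _ subset_UNIV])
    show "((\<lambda>t. propagator (c * t) g0) \<longlongrightarrow> propagator (c * t0) g0) (at t0)"
      using continuous_on_propagator[OF continuous_on_const, of UNIV c g0]
      by (simp add: continuous_on_eq_continuous_at isCont_def)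
  qed
  have n: "((\<lambda>t. norm (g t - g0)) \<longlongrightarrow> 0) (at t0 within S)"
    using g by (simp add: LIM_zero tendsto_norm_zero)
  have 2: "((\<lambda>t. propagator (c * t) (g t - g0)) \<longlongrightarrow> 0) (at t0 within S)"
    by (rule tendsto_norm_zero_cancel) (use n in simp)
  have "((\<lambda>t. propagator (c * t) (g t - g0) + propagator (c * t) g0) \<longlongrightarrow> 0 + propagator (c * t0) g0) (at t0 within S)"
    by (rule tendsto_add[OF 2 1])
  then show ?thesis
    by (simp add: linear_diff[OF bounded_linear.linear[OF bounded_linear_propagator]])
qed

lemma cscale_L2_minus: "cscale_L2 (- c) u = - cscale_L2 c u"
proof -
  have "cscale_L2 (- c) u = cscale_L2 (of_real (- 1)) (cscale_L2 c u)" by (simp add: cscale_L2_cscale)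
  then show ?thesis by (simp only: cscale_L2_of_real) simp
qed

text \<open>The trilinear map conjugated by J_s. The value exists because triple products of H^s
  functions stay in H^s and is unique because J_s is injective; estimates in H^s become estimates in
  L^2.\<close>

definition trilinear_lift :: "real \<Rightarrow> real \<Rightarrow> 'a::euclidean_space L2 \<Rightarrow> 'a L2 \<Rightarrow> 'a L2 \<Rightarrow> 'a L2" where
  "trilinear_lift s \<gamma> f g h = (THE n. bessel s n = trilinear \<gamma> (bessel s f) (bessel s g) (bessel s h))"

context
  fixes \<gamma> s :: real
  assumes \<gamma>: "0 < \<gamma>" "\<gamma> < 2" and N: "3 \<le> DIM('a::euclidean_space)" and s: "1 \<le> s"
begin

lemma bessel_split: "bessel s (f :: 'a L2) = bessel 1 (bessel (s - 1) f)"
  using s by (simp add: bessel_bessel)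

lemma trilinear_lift_ex1: "\<exists>!n. bessel s n = trilinear \<gamma> (bessel s f) (bessel s g) (bessel s (h :: 'a L2))"
proof -
  obtain n where n: "bessel s n = trilinear \<gamma> (bessel s f) (bessel s g) (bessel s h)" using trilinear_sobolev[OF \<gamma> N s] by blast
  show ?thesis
  proof (rule ex1I[of _ n], rule n)
    fix n' assume "bessel s n' = trilinear \<gamma> (bessel s f) (bessel s g) (bessel s h)"
    then have "bessel s n' = bessel s n" unfolding n .
    then show "n' = n" using s by (simp add: bessel_inject)
  qed
qed

lemma bessel_trilinear_lift: "bessel s (trilinear_lift s \<gamma> f g h) = trilinear \<gamma> (bessel s f) (bessel s g) (bessel s (h :: 'a L2))"
  unfolding trilinear_lift_def by (rule theI'[OF trilinear_lift_ex1])

lemma trilinear_lift_eqI: "bessel s n = trilinear \<gamma> (bessel s f) (bessel s g) (bessel s (h :: 'a L2)) \<Longrightarrow> trilinear_lift s \<gamma> f g h = n"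
  unfolding trilinear_lift_def by (rule the1_equality[OF trilinear_lift_ex1])

lemma norm_trilinear_lift_tame:
  "norm (trilinear_lift s \<gamma> f g (h :: 'a L2)) \<le> 4 * 9 powr (s / 2) * (norm f * norm (bessel (s - 1) g) * norm (bessel (s - 1) h)
      + norm (bessel (s - 1) f) * norm g * norm (bessel (s - 1) h) + norm (bessel (s - 1) f) * norm (bessel (s - 1) g) * norm h)"
  using trilinear_sobolev[OF \<gamma> N s, of f g h] trilinear_lift_eqI[of _ f g h] by metis

lemma norm_trilinear_lift: "norm (trilinear_lift s \<gamma> f g (h :: 'a L2)) \<le> 12 * 9 powr (s / 2) * norm f * norm g * norm h"
proof -
  have J: "norm (bessel (s - 1) f) \<le> norm f" for f :: "'a L2" using s by (intro norm_bessel_le) simp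
  have "norm f * norm (bessel (s - 1) g) * norm (bessel (s - 1) h)
      + norm (bessel (s - 1) f) * norm g * norm (bessel (s - 1) h) + norm (bessel (s - 1) f) * norm (bessel (s - 1) g) * norm h
      \<le> norm f * norm g * norm h + norm f * norm g * norm h + norm f * norm g * norm h"
    by (intro add_mono mult_mono J) auto
  then have "4 * 9 powr (s / 2) * (norm f * norm (bessel (s - 1) g) * norm (bessel (s - 1) h)
      + norm (bessel (s - 1) f) * norm g * norm (bessel (s - 1) h) + norm (bessel (s - 1) f) * norm (bessel (s - 1) g) * norm h)
      \<le> 4 * 9 powr (s / 2) * (norm f * norm g * norm h + norm f * norm g * norm h + norm f * norm g * norm h)"
    by (intro mult_left_mono) auto
  also have "\<dots> = 12 * 9 powr (s / 2) * norm f * norm g * norm h" by (simp add: algebra_simps)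
  finally show ?thesis using norm_trilinear_lift_tame order.trans by blast
qed

lemma trilinear_lift_diff:
  fixes f g h k :: "'a L2"
  shows "trilinear_lift s \<gamma> (f - k) g h = trilinear_lift s \<gamma> f g h - trilinear_lift s \<gamma> k g h"
    and "trilinear_lift s \<gamma> f (g - k) h = trilinear_lift s \<gamma> f g h - trilinear_lift s \<gamma> f k h"
    and "trilinear_lift s \<gamma> f g (h - k) = trilinear_lift s \<gamma> f g h - trilinear_lift s \<gamma> f g k"
proof -
  have s0: "bounded_multiplier (bessel_symbol s :: 'a \<Rightarrow> complex)" using s by simp
  have bm: "bounded_multiplier (riesz_conv \<gamma> (bessel s f) (bessel s g))" for f g :: "'a L2"
    unfolding bessel_split by (rule bounded_multiplier_riesz_conv[OF \<gamma> N])
  show "trilinear_lift s \<gamma> (f - k) g h = trilinear_lift s \<gamma> f g h - trilinear_lift s \<gamma> k g h"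
  proof (rule trilinear_lift_eqI)
    have "riesz_conv \<gamma> (bessel s f - bessel s k) (bessel s g) = (\<lambda>x. riesz_conv \<gamma> (bessel s f) (bessel s g) x - riesz_conv \<gamma> (bessel s k) (bessel s g) x)"
      unfolding bessel_split by (intro ext riesz_conv_diff_left[OF \<gamma> N])
    then show "bessel s (trilinear_lift s \<gamma> f g h - trilinear_lift s \<gamma> k g h) = trilinear \<gamma> (bessel s (f - k)) (bessel s g) (bessel s h)"
      by (simp add: fmult_diff[OF s0] bessel_trilinear_lift) (simp add: trilinear_def pmult_diff_mult bm)
  qed
  show "trilinear_lift s \<gamma> f (g - k) h = trilinear_lift s \<gamma> f g h - trilinear_lift s \<gamma> f k h"
  proof (rule trilinear_lift_eqI)
    have "riesz_conv \<gamma> (bessel s f) (bessel s g - bessel s k) = (\<lambda>x. riesz_conv \<gamma> (bessel s f) (bessel s g) x - riesz_conv \<gamma> (bessel s f) (bessel s k) x)"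
      unfolding bessel_split by (intro ext riesz_conv_diff_right[OF \<gamma> N])
    then show "bessel s (trilinear_lift s \<gamma> f g h - trilinear_lift s \<gamma> f k h) = trilinear \<gamma> (bessel s f) (bessel s (g - k)) (bessel s h)"
      by (simp add: fmult_diff[OF s0] bessel_trilinear_lift) (simp add: trilinear_def pmult_diff_mult bm)
  qed
  show "trilinear_lift s \<gamma> f g (h - k) = trilinear_lift s \<gamma> f g h - trilinear_lift s \<gamma> f g k"
    by (rule trilinear_lift_eqI) (simp add: fmult_diff[OF s0] bessel_trilinear_lift trilinear_def
        linear_diff[OF bounded_linear.linear[OF bounded_linear_pmult[OF bm]]])
qed

lemma trilinear_lift_telescope:
  fixes f g h f' g' h' :: "'a L2"
  shows "trilinear_lift s \<gamma> f g h - trilinear_lift s \<gamma> f' g' h' =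
    trilinear_lift s \<gamma> (f - f') g h + trilinear_lift s \<gamma> f' (g - g') h + trilinear_lift s \<gamma> f' g' (h - h')"
  by (simp add: trilinear_lift_diff)

lemma tendsto_trilinear_lift:
  fixes f g h :: "'b \<Rightarrow> 'a L2"
  assumes f: "(f \<longlongrightarrow> f0) F" and g: "(g \<longlongrightarrow> g0) F" and h: "(h \<longlongrightarrow> h0) F"
  shows "((\<lambda>x. trilinear_lift s \<gamma> (f x) (g x) (h x)) \<longlongrightarrow> trilinear_lift s \<gamma> f0 g0 h0) F"
proof -
  define K where "K = 12 * 9 powr (s / 2)"
  have "((\<lambda>x. trilinear_lift s \<gamma> (f x) (g x) (h x) - trilinear_lift s \<gamma> f0 g0 h0) \<longlongrightarrow> 0) F"
  proof (rule Lim_null_comparison)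
    show "\<forall>\<^sub>F x in F. norm (trilinear_lift s \<gamma> (f x) (g x) (h x) - trilinear_lift s \<gamma> f0 g0 h0) \<le>
        K * norm (f x - f0) * norm (g x) * norm (h x) + K * norm f0 * norm (g x - g0) * norm (h x) + K * norm f0 * norm g0 * norm (h x - h0)"
      unfolding trilinear_lift_telescope K_def
      by (intro always_eventually allI norm_triangle_le add_mono order.trans[OF norm_triangle_ineq] norm_trilinear_lift)
    have "((\<lambda>x. K * norm (f x - f0) * norm (g x) * norm (h x) + K * norm f0 * norm (g x - g0) * norm (h x) + K * norm f0 * norm g0 * norm (h x - h0))
      \<longlongrightarrow> K * norm (f0 - f0) * norm g0 * norm h0 + K * norm f0 * norm (g0 - g0) * norm h0 + K * norm f0 * norm g0 * norm (h0 - h0)) F"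
      by (intro tendsto_intros f g h)
    then show "((\<lambda>x. K * norm (f x - f0) * norm (g x) * norm (h x) + K * norm f0 * norm (g x - g0) * norm (h x) + K * norm f0 * norm g0 * norm (h x - h0)) \<longlongrightarrow> 0) F"
      by simp
  qed
  then show ?thesis by (simp add: LIM_zero_iff)
qed

end

definition nonlinear_lift :: "real \<Rightarrow> real \<Rightarrow> real \<Rightarrow> 'a::euclidean_space L2 \<Rightarrow> 'a L2" where
  "nonlinear_lift \<gamma>1 \<gamma>2 s f = trilinear_lift s \<gamma>1 f f f - trilinear_lift s \<gamma>2 f f f"

section \<open>The interaction energy and its increments\<close>

lemma riesz_div: "a / norm (x - y) powr \<gamma> = riesz \<gamma> x y * a"
  by (simp add: riesz_def powr_minus_divide)

context
  fixes \<gamma> :: real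
  assumes \<gamma>: "0 < \<gamma>" "\<gamma> < 2" and N: "3 \<le> DIM('a::euclidean_space)"
begin

lemma inner_trilinear_eq:
  fixes f g :: "'a L2"
  shows "trilinear \<gamma> (bessel 1 f) (bessel 1 f) (bessel 1 g) \<bullet> bessel 1 g =
    (LINT x|lborel. LINT y|lborel. riesz \<gamma> x y * ((cmod (rep_L2 (bessel 1 f) y))\<^sup>2 * (cmod (rep_L2 (bessel 1 g) x))\<^sup>2))"
    and "integrable (lborel \<Otimes>\<^sub>M lborel) (\<lambda>(x, y). riesz \<gamma> x y * ((cmod (rep_L2 (bessel 1 f) y))\<^sup>2 * (cmod (rep_L2 (bessel 1 g) x))\<^sup>2))"
proof -
  have e: "of_real (riesz \<gamma> x y) * (rep_L2 (bessel 1 f) y * cnj (rep_L2 (bessel 1 f) y) * rep_L2 (bessel 1 g) x * cnj (rep_L2 (bessel 1 g) x)) =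
     complex_of_real (riesz \<gamma> x y * ((cmod (rep_L2 (bessel 1 f) y))\<^sup>2 * (cmod (rep_L2 (bessel 1 g) x))\<^sup>2))" for x y
    unfolding of_real_mult complex_norm_square by (simp only: mult.assoc)
  have "cinner (trilinear \<gamma> (bessel 1 f) (bessel 1 f) (bessel 1 g)) (bessel 1 g) =
    of_real (LINT x|lborel. LINT y|lborel. riesz \<gamma> x y * ((cmod (rep_L2 (bessel 1 f) y))\<^sup>2 * (cmod (rep_L2 (bessel 1 g) x))\<^sup>2))"
    unfolding cinner_trilinear[OF \<gamma> N] e integral_complex_of_real ..
  then show "trilinear \<gamma> (bessel 1 f) (bessel 1 f) (bessel 1 g) \<bullet> bessel 1 g =
    (LINT x|lborel. LINT y|lborel. riesz \<gamma> x y * ((cmod (rep_L2 (bessel 1 f) y))\<^sup>2 * (cmod (rep_L2 (bessel 1 g) x))\<^sup>2))"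
    unfolding Re_cinner[symmetric] by (simp only: Re_complex_of_real)
  have "integrable (lborel \<Otimes>\<^sub>M lborel) (\<lambda>(x, y). complex_of_real (riesz \<gamma> x y * ((cmod (rep_L2 (bessel 1 f) y))\<^sup>2 * (cmod (rep_L2 (bessel 1 g) x))\<^sup>2)))"
    using integrable_trilinear[OF \<gamma> N, of f f "bessel 1 g" "bessel 1 g"] unfolding e .
  from integrable_Re[OF this] show "integrable (lborel \<Otimes>\<^sub>M lborel) (\<lambda>(x, y). riesz \<gamma> x y * ((cmod (rep_L2 (bessel 1 f) y))\<^sup>2 * (cmod (rep_L2 (bessel 1 g) x))\<^sup>2))"
    by (simp only: case_prod_beta' Re_complex_of_real)
qed

text \<open>Both sides are the same double integral, because the kernel is symmetric.\<close>

lemma inner_trilinear_swap: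
  fixes f g :: "'a L2"
  shows "trilinear \<gamma> (bessel 1 f) (bessel 1 f) (bessel 1 g) \<bullet> bessel 1 g = trilinear \<gamma> (bessel 1 g) (bessel 1 g) (bessel 1 f) \<bullet> bessel 1 f"
  unfolding inner_trilinear_eq(1) using lborel_pair.Fubini_integral[OF inner_trilinear_eq(2)[of f g]]
  by (simp add: mult_ac riesz_commute[of \<gamma>])

lemma trilinear_self_adjoint:
  fixes f :: "'a L2"
  shows "trilinear \<gamma> (bessel 1 f) (bessel 1 f) u \<bullet> v = u \<bullet> trilinear \<gamma> (bessel 1 f) (bessel 1 f) v"
proof -
  have "(\<lambda>x. cnj (riesz_conv \<gamma> (bessel 1 f) (bessel 1 f) x)) = riesz_conv \<gamma> (bessel 1 f) (bessel 1 f)" by (simp add: riesz_conv_self fun_eq_iff)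
  then show ?thesis
    unfolding trilinear_def using inner_pmult[OF bounded_multiplier_riesz_conv[OF \<gamma> N, of f f], of u v] by simp
qed

text \<open>The potential is real, so multiplication by it is symmetric and commutes with i. This is
  why the nonlinearity does not change the mass.\<close>

lemma inner_trilinear_ii:
  fixes f :: "'a L2"
  shows "trilinear \<gamma> (bessel 1 f) (bessel 1 f) u \<bullet> cscale_L2 \<i> u = 0"
proof -
  have c: "pmult (riesz_conv \<gamma> (bessel 1 f) (bessel 1 f)) (cscale_L2 \<i> u) = cscale_L2 \<i> (pmult (riesz_conv \<gamma> (bessel 1 f) (bessel 1 f)) u)"
    unfolding pmult_const[symmetric] by (simp add: pmult_pmult bounded_multiplier_const bounded_multiplier_riesz_conv[OF \<gamma> N] mult.commute)
  have "trilinear \<gamma> (bessel 1 f) (bessel 1 f) u \<bullet> cscale_L2 \<i> u = u \<bullet> cscale_L2 \<i> (trilinear \<gamma> (bessel 1 f) (bessel 1 f) u)"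
    unfolding trilinear_self_adjoint by (simp add: trilinear_def c)
  also have "\<dots> = - (cscale_L2 \<i> u \<bullet> trilinear \<gamma> (bessel 1 f) (bessel 1 f) u)"
    by (simp add: inner_cscale_L2[of \<i>] cscale_L2_minus)
  finally show ?thesis by (simp add: inner_commute)
qed

lemma potential_energy_eq:
  fixes f :: "'a L2"
  shows "(LINT x|lborel. LINT y|lborel. (cmod (rep_L2 (bessel 1 f) x))\<^sup>2 * (cmod (rep_L2 (bessel 1 f) y))\<^sup>2 / norm (x - y) powr \<gamma>) =
    trilinear \<gamma> (bessel 1 f) (bessel 1 f) (bessel 1 f) \<bullet> bessel 1 f"
  unfolding inner_trilinear_eq(1) riesz_div by (intro Bochner_Integration.integral_cong refl) simp

text \<open>With V_f the potential of J_1 f, the form V_f + V_g applied to the sum and the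
  difference of J_1 g and J_1 f leaves P g - P f, since the mixed terms cancel by
  \<open>inner_trilinear_swap\<close>. The difference is written under J_2 because the time
  quotients of J_2 f are the ones that converge.\<close>

lemma potential_diff:
  fixes f g :: "'a L2"
  defines "P \<equiv> \<lambda>f. trilinear \<gamma> (bessel 1 f) (bessel 1 f) (bessel 1 f) \<bullet> bessel 1 f"
  shows "P g - P f = (trilinear_lift 1 \<gamma> f f f + trilinear_lift 1 \<gamma> f f g + trilinear_lift 1 \<gamma> g g f + trilinear_lift 1 \<gamma> g g g) \<bullet> (bessel 2 g - bessel 2 f)"
proof -
  let ?b = "bessel 1 g" and ?a = "bessel 1 f"
  have e: "x \<bullet> (bessel 2 g - bessel 2 f) = bessel 1 x \<bullet> (?b - ?a)" for x :: "'a L2"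
    by (simp add: inner_bessel inner_diff_right bessel_bessel)
  show ?thesis
    unfolding e P_def using inner_trilinear_swap[of f g] trilinear_self_adjoint[of f ?a ?b] trilinear_self_adjoint[of g ?a ?b]
    by (simp add: fmult_add bessel_trilinear_lift[OF \<gamma> N] inner_add_left inner_add_right inner_diff_left inner_diff_right inner_commute)
qed

end

lemma energy_bessel:
  fixes f :: "'a::euclidean_space L2"
  assumes "0 < \<gamma>1" "\<gamma>1 < 2" "0 < \<gamma>2" "\<gamma>2 < 2" "3 \<le> DIM('a)"
  shows "energy \<gamma>1 \<gamma>2 (bessel 1 f) = 1/2 * (f \<bullet> fmult kinetic_symbol f)
    + 1/4 * (trilinear \<gamma>2 (bessel 1 f) (bessel 1 f) (bessel 1 f) \<bullet> bessel 1 f)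
    - 1/4 * (trilinear \<gamma>1 (bessel 1 f) (bessel 1 f) (bessel 1 f) \<bullet> bessel 1 f)"
  unfolding energy_def kinetic_integral potential_energy_eq[OF assms(1,2,5)] potential_energy_eq[OF assms(3,4,5)] ..

text \<open>J_2 compensates the generator: the quotients of the phases have modulus at most |xi|^2,
  and |xi|^2 / (1 + |xi|^2) \<le> 1 is the uniform bound for dominated convergence.\<close>

lemma tendsto_evolution_quotient:
  fixes y :: "'a::euclidean_space L2"
  shows "((\<lambda>t'. (bessel 2 (propagator t' y) - bessel 2 (propagator t y)) /\<^sub>R (t' - t)) \<longlongrightarrow> cscale_L2 \<i> (fmult kinetic_symbol (propagator t y))) (at t within S)"
proof -
  define m where "m t' \<xi> = (evolution_symbol t' \<xi> - evolution_symbol t \<xi>) / of_real (t' - t) * bessel_symbol 2 \<xi>" for t' and \<xi> :: 'a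
  have ev: "evolution_symbol t' \<xi> - evolution_symbol t \<xi> = evolution_symbol t \<xi> * (cis ((t' - t) * (norm \<xi>)\<^sup>2) - 1)" for t' and \<xi> :: 'a
    by (simp add: evolution_symbol_def right_diff_distrib cis_mult left_diff_distrib)
  have bs: "bessel_symbol 2 \<xi> = of_real (1 / (1 + (norm \<xi>)\<^sup>2))" for \<xi> :: 'a
    using one_plus_norm_sq(2)[of \<xi>] by (simp add: bessel_symbol_def powr_minus_divide)
  have lim: "((\<lambda>t'. fmult (m t') y) \<longlongrightarrow> fmult (\<lambda>\<xi>. \<i> * kinetic_symbol \<xi> * evolution_symbol t \<xi>) y) (at t within S)"
  proof (rule tendsto_fmult_at[where B=1])
    have [measurable]: "evolution_symbol t \<in> borel_measurable (borel :: 'a measure)" for t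
      by (rule bounded_multiplier_measurable) simp
    have [measurable]: "kinetic_symbol \<in> borel_measurable (borel :: 'a measure)"
      by (rule bounded_multiplier_measurable) simp
    show "m t' \<in> borel_measurable borel" for t' unfolding m_def[abs_def] by measurable
    show "(\<lambda>\<xi>. \<i> * kinetic_symbol \<xi> * evolution_symbol t \<xi>) \<in> borel_measurable (borel :: 'a measure)" by measurable
    show "cmod (m t' \<xi>) \<le> 1" if "t' \<noteq> t" for t' \<xi>
    proof -
      have "cmod (m t' \<xi>) \<le> (\<bar>(t' - t) * (norm \<xi>)\<^sup>2\<bar> / \<bar>t' - t\<bar>) * cmod (bessel_symbol 2 \<xi>)"
        unfolding m_def ev norm_mult norm_divide norm_of_real
        by (intro mult_right_mono divide_right_mono) (auto simp: evolution_symbol_def cmod_cis_diff_1_le)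
      also have "\<dots> = (norm \<xi>)\<^sup>2 / (1 + (norm \<xi>)\<^sup>2)"
        using that one_plus_norm_sq(2)[of \<xi>] by (simp add: bs norm_divide abs_mult del: of_real_add)
      also have "\<dots> \<le> 1" using one_plus_norm_sq(2)[of \<xi>] by simp
      finally show ?thesis .
    qed
    show "((\<lambda>t'. m t' \<xi>) \<longlongrightarrow> \<i> * kinetic_symbol \<xi> * evolution_symbol t \<xi>) (at t within S)" for \<xi>
    proof -
      have "((\<lambda>h. evolution_symbol t \<xi> * ((cis (h * (norm \<xi>)\<^sup>2) - 1) / of_real h) * bessel_symbol 2 \<xi>) \<longlongrightarrow> evolution_symbol t \<xi> * (\<i> * of_real ((norm \<xi>)\<^sup>2)) * bessel_symbol 2 \<xi>) (at 0)"
        by (intro tendsto_mult tendsto_const tendsto_cis_quotient)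
      then have "((\<lambda>h. m (t + h) \<xi>) \<longlongrightarrow> \<i> * kinetic_symbol \<xi> * evolution_symbol t \<xi>) (at 0)"
        by (simp add: m_def ev kinetic_symbol_def bs mult_ac)
      then show ?thesis by (rule tendsto_within_subset[OF LIM_offset_zero_cancel subset_UNIV])
    qed
  qed
  have eq: "fmult (m t') y = (bessel 2 (propagator t' y) - bessel 2 (propagator t y)) /\<^sub>R (t' - t)" for t'
  proof -
    have d: "bounded_multiplier (\<lambda>\<xi>::'a. evolution_symbol t' \<xi> - evolution_symbol t \<xi>)" by (intro bounded_multiplier_diff) auto
    have "m t' = (\<lambda>\<xi>. of_real (inverse (t' - t)) * (bessel_symbol 2 \<xi> * (evolution_symbol t' \<xi> - evolution_symbol t \<xi>)))"
      by (simp add: m_def fun_eq_iff field_simps)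
    then have "fmult (m t') y = inverse (t' - t) *\<^sub>R fmult (\<lambda>\<xi>. bessel_symbol 2 \<xi> * (evolution_symbol t' \<xi> - evolution_symbol t \<xi>)) y"
      by (simp only: fmult_scaleR_mult[OF bounded_multiplier_mult[OF bounded_multiplier_bessel d], of 2] simp_thms zero_le_numeral)
    also have "fmult (\<lambda>\<xi>. bessel_symbol 2 \<xi> * (evolution_symbol t' \<xi> - evolution_symbol t \<xi>)) y = bessel 2 (propagator t' y - propagator t y)"
      by (simp add: propagator_eq fmult_diff_mult flip: fmult_fmult[OF bounded_multiplier_bessel d])
    finally show ?thesis by (simp add: fmult_diff)
  qed
  have "cscale_L2 \<i> (fmult kinetic_symbol (propagator t y)) = fmult (\<lambda>\<xi>. \<i> * kinetic_symbol \<xi> * evolution_symbol t \<xi>) y"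
    unfolding fmult_const[symmetric] propagator_eq
    by (simp add: fmult_fmult bounded_multiplier_const bounded_multiplier_mult mult.assoc)
  then show ?thesis using lim unfolding eq by simp
qed

section \<open>Conservation laws\<close>

text \<open>The derivative as a limit of quotients, the form to which time-dependent operators can
  be applied.\<close>

lemma has_vector_derivative_quotient:
  assumes "(f has_vector_derivative D) (at t within S)"
  shows "((\<lambda>y. (f y - f t) /\<^sub>R (y - t)) \<longlongrightarrow> D) (at t within S)"
proof -
  have "((\<lambda>y. norm ((f y - f t - (y - t) *\<^sub>R D) /\<^sub>R norm (y - t))) \<longlongrightarrow> 0) (at t within S)"
    using assms tendsto_norm_zero unfolding has_vector_derivative_def has_derivative_within
    by (fastforce simp: diff_diff_eq divide_inverse_commute)
  moreover have "\<forall>\<^sub>F y in at t within S. norm ((f y - f t - (y - t) *\<^sub>R D) /\<^sub>R norm (y - t)) = norm ((f y - f t) /\<^sub>R (y - t) - D)"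
    unfolding eventually_at_filter
  proof (rule always_eventually, intro allI impI)
    fix y assume "y \<noteq> t"
    then have "(f y - f t) /\<^sub>R (y - t) - D = (f y - f t - (y - t) *\<^sub>R D) /\<^sub>R (y - t)"
      by (simp add: scaleR_diff_right)
    then show "norm ((f y - f t - (y - t) *\<^sub>R D) /\<^sub>R norm (y - t)) = norm ((f y - f t) /\<^sub>R (y - t) - D)" by simp
  qed
  ultimately have "((\<lambda>y. norm ((f y - f t) /\<^sub>R (y - t) - D)) \<longlongrightarrow> 0) (at t within S)"
    by (rule Lim_transform_eventually)
  then show ?thesis by (simp add: tendsto_norm_zero_iff LIM_zero_iff)
qed

text \<open>The equation in the interaction picture for $f = J_s^{-1} \psi$: an ordinary differential equation in
  $L^2$ whose right-hand side is locally Lipschitz.\<close>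

definition hartree_flow :: "real \<Rightarrow> real \<Rightarrow> real \<Rightarrow> real \<Rightarrow> (real \<Rightarrow> 'a::euclidean_space L2) \<Rightarrow> bool" where
  "hartree_flow \<gamma>1 \<gamma>2 s T f \<longleftrightarrow> (\<forall>t\<in>{0..T}. ((\<lambda>t. propagator (- t) (f t)) has_vector_derivative
     - cscale_L2 \<i> (propagator (- t) (nonlinear_lift \<gamma>1 \<gamma>2 s (f t)))) (at t within {0..T}))"

text \<open>The radius $\rho$ at which Hardy's inequality lets the kinetic energy absorb the focusing term:
  $4 \rho^{2 - \gamma_1} m^2 \le 1$.\<close>

definition energy_radius :: "real \<Rightarrow> real \<Rightarrow> real" where
  "energy_radius \<gamma>1 m = (1 / (4 * (1 + m\<^sup>2))) powr (1 / (2 - \<gamma>1))"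

text \<open>The summand $1$ makes the bound positive for all arguments, also those not attained by any solution.\<close>

definition sobolev_bound :: "real \<Rightarrow> real \<Rightarrow> real \<Rightarrow> real" where
  "sobolev_bound \<gamma>1 e m = sqrt \<bar>m\<^sup>2 + 4 * e + energy_radius \<gamma>1 m powr (- \<gamma>1) * m ^ 4\<bar> + 1"

lemma propagator_commute_bessel: "0 \<le> s \<Longrightarrow> propagator t (bessel s f) = bessel s (propagator t f)"
  unfolding propagator_eq by (rule fmult_bessel_commute) auto

lemma propagator_cscale: "propagator t (cscale_L2 c f) = cscale_L2 c (propagator t f)"
  unfolding propagator_eq by (rule fmult_cscale) simp

lemma inner_i_self [simp]: "u \<bullet> cscale_L2 \<i> u = 0" "cscale_L2 \<i> u \<bullet> u = 0"
proof -
  have "u \<bullet> cscale_L2 \<i> u = - (cscale_L2 \<i> u \<bullet> u)" by (simp add: inner_cscale_L2[of \<i>] cscale_L2_minus)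
  then show "u \<bullet> cscale_L2 \<i> u = 0" "cscale_L2 \<i> u \<bullet> u = 0" by (simp_all add: inner_commute)
qed

lemma inner_i_left: "cscale_L2 \<i> u \<bullet> v = - (u \<bullet> cscale_L2 \<i> v)"
  by (simp add: inner_cscale_L2[of \<i>] cscale_L2_minus)

lemma inner_kinetic: "fmult kinetic_symbol u \<bullet> v = u \<bullet> fmult kinetic_symbol v"
proof -
  have "(\<lambda>x::'a. cnj (kinetic_symbol x)) = kinetic_symbol" by (simp add: kinetic_symbol_def fun_eq_iff)
  then show ?thesis using inner_fmult[OF bounded_multiplier_kinetic, of u v] by simp
qed

lemma constant_of_zero_derivative:
  fixes \<phi> :: "real \<Rightarrow> real"
  assumes "\<And>t. t \<in> {0..T} \<Longrightarrow> (\<phi> has_real_derivative 0) (at t within {0..T})" and t: "t \<in> {0..T}"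
  shows "\<phi> t = \<phi> 0"
proof -
  obtain c where "\<And>x. x \<in> {0..T} \<Longrightarrow> \<phi> x = c"
    using has_field_derivative_zero_constant[of "{0..T}" \<phi>] assms(1) by auto
  then show ?thesis using t by auto
qed

context
  fixes \<gamma>1 \<gamma>2 :: real
  assumes \<gamma>1: "0 < \<gamma>1" "\<gamma>1 < 2" and \<gamma>2: "0 < \<gamma>2" "\<gamma>2 < 2" and N: "3 \<le> DIM('a::euclidean_space)"
begin

lemma nonlinearity_bessel:
  fixes f :: "'a L2"
  assumes s: "1 \<le> s"
  shows "nonlinearity \<gamma>1 \<gamma>2 (bessel s f) = bessel s (nonlinear_lift \<gamma>1 \<gamma>2 s f)"
proof -
  have "bessel s (nonlinear_lift \<gamma>1 \<gamma>2 s f) = trilinear \<gamma>1 (bessel s f) (bessel s f) (bessel s f) - trilinear \<gamma>2 (bessel s f) (bessel s f) (bessel s f)"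
    using s by (simp add: nonlinear_lift_def fmult_diff bessel_trilinear_lift[OF \<gamma>1 N s] bessel_trilinear_lift[OF \<gamma>2 N s])
  then show ?thesis
    using nonlinearity_eq[OF \<gamma>1 \<gamma>2 N, of "bessel (s - 1) f"] bessel_split[OF \<gamma>1 N s, of f] by simp
qed

text \<open>The pulled-back nonlinearities for different s are compatible, so J_{s-1} maps a flow
  for H^s to one for H^1, to which the conservation laws apply.\<close>

lemma nonlinear_lift_bessel_lower:
  fixes f :: "'a L2"
  assumes s: "1 \<le> s"
  shows "nonlinear_lift \<gamma>1 \<gamma>2 1 (bessel (s - 1) f) = bessel (s - 1) (nonlinear_lift \<gamma>1 \<gamma>2 s f)"
proof -
  have "bessel 1 (nonlinear_lift \<gamma>1 \<gamma>2 1 (bessel (s - 1) f)) = bessel 1 (bessel (s - 1) (nonlinear_lift \<gamma>1 \<gamma>2 s f))"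
    unfolding nonlinearity_bessel[OF order.refl, symmetric] bessel_split[OF \<gamma>1 N s, symmetric] by (rule nonlinearity_bessel[OF s])
  then show ?thesis by (simp add: bessel_inject)
qed

lemma tendsto_nonlinear_lift:
  assumes "1 \<le> s" "(f \<longlongrightarrow> (f0 :: 'a L2)) F"
  shows "((\<lambda>x. nonlinear_lift \<gamma>1 \<gamma>2 s (f x)) \<longlongrightarrow> nonlinear_lift \<gamma>1 \<gamma>2 s f0) F"
  unfolding nonlinear_lift_def by (intro tendsto_diff tendsto_trilinear_lift[OF \<gamma>1 N] tendsto_trilinear_lift[OF \<gamma>2 N] assms)

text \<open>The factor 24 counts two kernels, three positions of the weight and the constant 4 from
  Hardy's inequality.\<close>

lemma norm_nonlinear_lift_tame:
  fixes f :: "'a L2"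
  assumes s: "1 \<le> s"
  shows "norm (nonlinear_lift \<gamma>1 \<gamma>2 s f) \<le> 24 * 9 powr (s / 2) * (norm (bessel (s - 1) f))\<^sup>2 * norm f"
proof -
  have "norm (nonlinear_lift \<gamma>1 \<gamma>2 s f) \<le> norm (trilinear_lift s \<gamma>1 f f f) + norm (trilinear_lift s \<gamma>2 f f f)"
    unfolding nonlinear_lift_def by (rule norm_triangle_ineq4)
  also have "\<dots> \<le> 12 * 9 powr (s / 2) * (norm (bessel (s - 1) f))\<^sup>2 * norm f + 12 * 9 powr (s / 2) * (norm (bessel (s - 1) f))\<^sup>2 * norm f"
    using norm_trilinear_lift_tame[OF \<gamma>1 N s, of f f f] norm_trilinear_lift_tame[OF \<gamma>2 N s, of f f f]
    by (intro add_mono) (simp_all add: power2_eq_square algebra_simps)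
  finally show ?thesis by (simp add: algebra_simps)
qed

text \<open>Telescoping replaces one argument at a time; 72 counts two kernels, three increments and
  the constant 12 of \<open>norm_trilinear_lift\<close>.\<close>

lemma nonlinear_lift_lipschitz:
  fixes f g :: "'a L2"
  assumes s: "1 \<le> s" and R: "norm f \<le> R" "norm g \<le> R"
  shows "norm (nonlinear_lift \<gamma>1 \<gamma>2 s f - nonlinear_lift \<gamma>1 \<gamma>2 s g) \<le> 72 * 9 powr (s / 2) * R\<^sup>2 * norm (f - g)"
proof -
  have R0: "0 \<le> R" using R(1) norm_ge_zero order.trans by blast
  have 1: "norm (trilinear_lift s \<gamma> f f f - trilinear_lift s \<gamma> g g g) \<le> 36 * 9 powr (s / 2) * R\<^sup>2 * norm (f - g)"
    if \<gamma>: "0 < \<gamma>" "\<gamma> < 2" for \<gamma>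
  proof -
    define k where "k = 12 * 9 powr (s / 2)"
    have k: "k \<ge> 0" by (simp add: k_def)
    note b = norm_trilinear_lift[OF \<gamma> N s, folded k_def]
    have "norm (trilinear_lift s \<gamma> f f f - trilinear_lift s \<gamma> g g g) \<le> norm (trilinear_lift s \<gamma> (f - g) f f) + norm (trilinear_lift s \<gamma> g (f - g) f) + norm (trilinear_lift s \<gamma> g g (f - g))"
      unfolding trilinear_lift_telescope[OF \<gamma> N s] by (intro norm_triangle_le add_mono norm_triangle_ineq order.refl)
    also have "\<dots> \<le> k * norm (f - g) * norm f * norm f + k * norm g * norm (f - g) * norm f + k * norm g * norm g * norm (f - g)"
      by (intro add_mono b)
    also have "\<dots> \<le> k * norm (f - g) * R * R + k * R * norm (f - g) * R + k * R * R * norm (f - g)"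
      using k R R0 by (intro add_mono mult_mono) auto
    also have "\<dots> = 36 * 9 powr (s / 2) * R\<^sup>2 * norm (f - g)" by (simp add: k_def power2_eq_square)
    finally show ?thesis .
  qed
  have "nonlinear_lift \<gamma>1 \<gamma>2 s f - nonlinear_lift \<gamma>1 \<gamma>2 s g = (trilinear_lift s \<gamma>1 f f f - trilinear_lift s \<gamma>1 g g g) - (trilinear_lift s \<gamma>2 f f f - trilinear_lift s \<gamma>2 g g g)"
    by (simp add: nonlinear_lift_def)
  then have "norm (nonlinear_lift \<gamma>1 \<gamma>2 s f - nonlinear_lift \<gamma>1 \<gamma>2 s g) \<le> norm (trilinear_lift s \<gamma>1 f f f - trilinear_lift s \<gamma>1 g g g) + norm (trilinear_lift s \<gamma>2 f f f - trilinear_lift s \<gamma>2 g g g)"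
    by (simp only: norm_triangle_ineq4)
  then show ?thesis using 1[OF \<gamma>1] 1[OF \<gamma>2] by simp
qed

lemma hartree_flow_continuous:
  fixes f :: "real \<Rightarrow> 'a L2"
  assumes "hartree_flow \<gamma>1 \<gamma>2 s T f"
  shows "continuous_on {0..T} f"
proof -
  have "continuous_on {0..T} (\<lambda>t. propagator (- t) (f t))"
    using assms unfolding hartree_flow_def
    by (auto simp: continuous_on_eq_continuous_within intro: has_vector_derivative_continuous)
  from continuous_on_propagator[OF this, of 1] show ?thesis by (simp add: propagator_propagator)
qed

text \<open>In the interaction picture the free evolution has disappeared, so the squared norm is
  differentiable and the nonlinearity alone contributes; its contribution vanishes because the
  potentials are real.\<close>

lemma mass_conservation:
  fixes f :: "real \<Rightarrow> 'a L2"
  assumes f: "hartree_flow \<gamma>1 \<gamma>2 1 T f" and t: "t \<in> {0..T}"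
  shows "norm (bessel 1 (f t)) = norm (bessel 1 (f 0))"
proof -
  define v where "v t = bessel 1 (propagator (- t) (f t))" for t
  have "((\<lambda>t. v t \<bullet> v t) has_real_derivative 0) (at t within {0..T})" if t: "t \<in> {0..T}" for t
  proof -
    define D where "D = bessel 1 (- cscale_L2 \<i> (propagator (- t) (nonlinear_lift \<gamma>1 \<gamma>2 1 (f t))))"
    have "(v has_vector_derivative D) (at t within {0..T})"
      unfolding v_def D_def using f t unfolding hartree_flow_def
      by (intro bounded_linear.has_vector_derivative[OF bounded_linear_fmult]) auto
    from bounded_bilinear.has_vector_derivative[OF bounded_bilinear_inner this this]
    have "((\<lambda>t. v t \<bullet> v t) has_vector_derivative v t \<bullet> D + D \<bullet> v t) (at t within {0..T})" .
    moreover have "D \<bullet> v t = 0"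
    proof -
      have "D = - propagator (- t) (cscale_L2 \<i> (nonlinearity \<gamma>1 \<gamma>2 (bessel 1 (f t))))"
        by (simp add: D_def nonlinearity_bessel linear_neg[OF bounded_linear.linear[OF bounded_linear_fmult]] fmult_cscale
            propagator_cscale propagator_commute_bessel)
      moreover have "v t = propagator (- t) (bessel 1 (f t))" by (simp add: v_def propagator_commute_bessel)
      ultimately have "D \<bullet> v t = nonlinearity \<gamma>1 \<gamma>2 (bessel 1 (f t)) \<bullet> cscale_L2 \<i> (bessel 1 (f t))"
        by (simp add: inner_propagator inner_i_left)
      then show ?thesis
        by (simp add: nonlinearity_eq[OF \<gamma>1 \<gamma>2 N] inner_diff_left inner_trilinear_ii[OF \<gamma>1 N] inner_trilinear_ii[OF \<gamma>2 N])
    qed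
    ultimately show ?thesis by (simp add: has_real_derivative_iff_has_vector_derivative inner_commute)
  qed
  from constant_of_zero_derivative[OF this t] have "v t \<bullet> v t = v 0 \<bullet> v 0" .
  then show ?thesis by (simp add: v_def norm_eq_sqrt_inner inner_propagator flip: propagator_commute_bessel)
qed

text \<open>The curve $f$ itself need not be differentiable; $J_2$ compensates the two derivatives lost to the Laplacian,
  and pairing with it suffices for the energy.\<close>

lemma flow_bessel2_derivative:
  fixes f :: "real \<Rightarrow> 'a L2"
  assumes f: "hartree_flow \<gamma>1 \<gamma>2 1 T f" and t: "t \<in> {0..T}"
  shows "((\<lambda>t'. (bessel 2 (f t') - bessel 2 (f t)) /\<^sub>R (t' - t)) \<longlongrightarrow>
      cscale_L2 \<i> (fmult kinetic_symbol (f t)) - cscale_L2 \<i> (bessel 2 (nonlinear_lift \<gamma>1 \<gamma>2 1 (f t)))) (at t within {0..T})"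
proof -
  define g where "g t = propagator (- t) (f t)" for t
  have fg: "f t = propagator t (g t)" for t by (simp add: g_def propagator_propagator)
  define D where "D = - cscale_L2 \<i> (propagator (- t) (nonlinear_lift \<gamma>1 \<gamma>2 1 (f t)))"
  have "(g has_vector_derivative D) (at t within {0..T})"
    using f t unfolding hartree_flow_def g_def D_def by auto
  from tendsto_propagator_mult[OF has_vector_derivative_quotient[OF this], of 1]
  have 1: "((\<lambda>t'. bessel 2 (propagator t' ((g t' - g t) /\<^sub>R (t' - t)))) \<longlongrightarrow> bessel 2 (propagator t D)) (at t within {0..T})"
    by (intro bounded_linear.tendsto[OF bounded_linear_fmult]) simp_all
  have 2: "((\<lambda>t'. (bessel 2 (propagator t' (g t)) - bessel 2 (propagator t (g t))) /\<^sub>R (t' - t)) \<longlongrightarrow> cscale_L2 \<i> (fmult kinetic_symbol (f t))) (at t within {0..T})"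
    using tendsto_evolution_quotient[where y="g t" and t=t and S="{0..T}"] by (simp add: fg)
  have D: "bessel 2 (propagator t D) = - cscale_L2 \<i> (bessel 2 (nonlinear_lift \<gamma>1 \<gamma>2 1 (f t)))"
    by (simp add: D_def linear_neg[OF bounded_linear.linear[OF bounded_linear_propagator]] propagator_cscale propagator_propagator
        linear_neg[OF bounded_linear.linear[OF bounded_linear_fmult]] fmult_cscale)
  \<comment> \<open>Product rule for U(t) g(t): the first term moves g under U(t'), the second moves
    U with g fixed.\<close>
  have e: "bessel 2 (propagator t' ((g t' - g t) /\<^sub>R (t' - t))) + (bessel 2 (propagator t' (g t)) - bessel 2 (propagator t (g t))) /\<^sub>R (t' - t)
      = (bessel 2 (f t') - bessel 2 (f t)) /\<^sub>R (t' - t)" for t'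
    by (simp add: fg linear_cmul[OF bounded_linear.linear[OF bounded_linear_propagator]] linear_diff[OF bounded_linear.linear[OF bounded_linear_propagator]]
        fmult_scaleR fmult_diff flip: scaleR_add_right)
  from tendsto_add[OF 1 2] show ?thesis unfolding e D by simp
qed

text \<open>The energy is differentiable although f need not be: the kinetic form is evaluated on
  the differentiable curve U(-t) f, and the quartic forms have exact increments. Both derivatives
  are, up to sign, the pairing of the nonlinearity with i times the kinetic term, and they
  cancel.\<close>

lemma energy_conservation:
  fixes f :: "real \<Rightarrow> 'a L2"
  assumes f: "hartree_flow \<gamma>1 \<gamma>2 1 T f" and t: "t \<in> {0..T}"
  shows "energy \<gamma>1 \<gamma>2 (bessel 1 (f t)) = energy \<gamma>1 \<gamma>2 (bessel 1 (f 0))"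
proof -
  define K where "K t = f t \<bullet> fmult kinetic_symbol (f t)" for t
  define P where "P \<gamma> t = trilinear \<gamma> (bessel 1 (f t)) (bessel 1 (f t)) (bessel 1 (f t)) \<bullet> bessel 1 (f t)" for \<gamma> t
  have "((\<lambda>t. 1/2 * K t + 1/4 * P \<gamma>2 t - 1/4 * P \<gamma>1 t) has_real_derivative 0) (at t within {0..T})" if t: "t \<in> {0..T}" for t
  proof -
    define n where "n = nonlinear_lift \<gamma>1 \<gamma>2 1 (f t)"
    define w where "w = cscale_L2 \<i> (fmult kinetic_symbol (f t)) - cscale_L2 \<i> (bessel 2 n)"
    have dK: "(K has_real_derivative - 2 * (cscale_L2 \<i> n \<bullet> fmult kinetic_symbol (f t))) (at t within {0..T})"
    proof -
      define g where "g t = propagator (- t) (f t)" for t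
      define D where "D = - cscale_L2 \<i> (propagator (- t) n)"
      have g: "(g has_vector_derivative D) (at t within {0..T})"
        using f t unfolding hartree_flow_def g_def D_def n_def by auto
      have Bg: "((\<lambda>t. fmult kinetic_symbol (g t)) has_vector_derivative fmult kinetic_symbol D) (at t within {0..T})"
        by (intro bounded_linear.has_vector_derivative[OF bounded_linear_fmult] g) simp
      have c: "fmult kinetic_symbol (propagator r u) = propagator r (fmult kinetic_symbol u)" for r and u :: "'a L2"
        unfolding propagator_eq by (simp add: fmult_fmult mult.commute)
      have "K = (\<lambda>t. g t \<bullet> fmult kinetic_symbol (g t))"
        by (simp add: fun_eq_iff K_def g_def c inner_propagator)
      moreover have "g t \<bullet> fmult kinetic_symbol D + D \<bullet> fmult kinetic_symbol (g t) = - 2 * (cscale_L2 \<i> n \<bullet> fmult kinetic_symbol (f t))"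
      proof -
        have "g t \<bullet> fmult kinetic_symbol D = D \<bullet> fmult kinetic_symbol (g t)"
          using inner_kinetic[of "g t" D] by (metis inner_commute)
        moreover have "D \<bullet> fmult kinetic_symbol (g t) = - (cscale_L2 \<i> n \<bullet> fmult kinetic_symbol (f t))"
          by (simp add: D_def g_def c inner_propagator flip: propagator_cscale)
        ultimately show ?thesis by simp
      qed
      ultimately show ?thesis
        using bounded_bilinear.has_vector_derivative[OF bounded_bilinear_inner g Bg]
        by (simp add: has_real_derivative_iff_has_vector_derivative)
    qed
    have ft: "(f \<longlongrightarrow> f t) (at t within {0..T})"
      using hartree_flow_continuous[OF f] t by (simp add: continuous_on_def)
    have dP: "(P \<gamma> has_real_derivative 4 * (trilinear_lift 1 \<gamma> (f t) (f t) (f t) \<bullet> w)) (at t within {0..T})"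
      if \<gamma>: "0 < \<gamma>" "\<gamma> < 2" for \<gamma>
    proof -
      \<comment> \<open>At equal arguments the four terms coincide; the resulting factor 4 matches
        the coefficient 1/4 in the energy.\<close>
      let ?G = "\<lambda>a b. trilinear_lift 1 \<gamma> a a a + trilinear_lift 1 \<gamma> a a b + trilinear_lift 1 \<gamma> b b a + trilinear_lift 1 \<gamma> b b b"
      have "((\<lambda>t'. ?G (f t) (f t') \<bullet> ((bessel 2 (f t') - bessel 2 (f t)) /\<^sub>R (t' - t))) \<longlongrightarrow> ?G (f t) (f t) \<bullet> w) (at t within {0..T})"
        unfolding w_def n_def
        by (intro tendsto_inner tendsto_add tendsto_trilinear_lift[OF \<gamma> N order.refl] tendsto_const ft flow_bessel2_derivative[OF f t])
      moreover have "?G (f t) (f t') \<bullet> ((bessel 2 (f t') - bessel 2 (f t)) /\<^sub>R (t' - t)) = (P \<gamma> t' - P \<gamma> t) / (t' - t)" for t'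
        unfolding P_def potential_diff[OF \<gamma> N, of "f t'" "f t"] by (simp add: divide_inverse)
      moreover have "?G (f t) (f t) \<bullet> w = 4 * (trilinear_lift 1 \<gamma> (f t) (f t) (f t) \<bullet> w)" by (simp add: inner_add_left)
      ultimately show ?thesis by (simp add: has_field_derivative_iff)
    qed
    have "((\<lambda>t. 1/2 * K t + 1/4 * P \<gamma>2 t - 1/4 * P \<gamma>1 t) has_real_derivative
      1/2 * (- 2 * (cscale_L2 \<i> n \<bullet> fmult kinetic_symbol (f t))) + 1/4 * (4 * (trilinear_lift 1 \<gamma>2 (f t) (f t) (f t) \<bullet> w))
        - 1/4 * (4 * (trilinear_lift 1 \<gamma>1 (f t) (f t) (f t) \<bullet> w))) (at t within {0..T})"
      by (intro DERIV_diff DERIV_add DERIV_cmult dK dP[OF \<gamma>1] dP[OF \<gamma>2])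
    also have "1/2 * (- 2 * (cscale_L2 \<i> n \<bullet> fmult kinetic_symbol (f t))) + 1/4 * (4 * (trilinear_lift 1 \<gamma>2 (f t) (f t) (f t) \<bullet> w))
        - 1/4 * (4 * (trilinear_lift 1 \<gamma>1 (f t) (f t) (f t) \<bullet> w)) = - (cscale_L2 \<i> n \<bullet> fmult kinetic_symbol (f t)) - n \<bullet> w"
      by (simp add: n_def nonlinear_lift_def inner_diff_left)
    \<comment> \<open>The summand of w with J_2 n contributes the pairing of J_1 n with i J_1 n,
      which is 0.\<close>
    also have "\<dots> = 0"
    proof -
      have "n \<bullet> cscale_L2 \<i> (bessel 2 n) = bessel 1 n \<bullet> cscale_L2 \<i> (bessel 1 n)"
        using inner_bessel[of 1 n "cscale_L2 \<i> (bessel 1 n)"] by (simp add: bessel_bessel fmult_cscale)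
      then have "n \<bullet> w = n \<bullet> cscale_L2 \<i> (fmult kinetic_symbol (f t))" by (simp add: w_def inner_diff_right)
      then show ?thesis by (simp add: inner_i_left)
    qed
    finally show ?thesis .
  qed
  from constant_of_zero_derivative[OF this t] show ?thesis
    by (simp add: energy_bessel[OF \<gamma>1 \<gamma>2 N] K_def P_def)
qed

text \<open>The defocusing term is nonnegative and dropped. The bound B of the focusing potential
  satisfies B m^2 \<le> K + rho^{-gamma1} m^4; a quarter of this is subtracted from K/2, so that K
  \<le> 4 e + rho^{-gamma1} m^4 remains.\<close>

lemma norm_le_sobolev_bound:
  fixes f :: "'a L2"
  shows "norm f \<le> sobolev_bound \<gamma>1 (energy \<gamma>1 \<gamma>2 (bessel 1 f)) (norm (bessel 1 f))"
proof -
  define m where "m = norm (bessel 1 f)"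
  define K where "K = f \<bullet> fmult kinetic_symbol f"
  define e where "e = energy \<gamma>1 \<gamma>2 (bessel 1 f)"
  define \<rho> where "\<rho> = energy_radius \<gamma>1 m"
  have K: "K \<ge> 0" unfolding K_def by (rule kinetic_nonneg)
  have p: "1 / (4 * (1 + m\<^sup>2)) > 0" by (simp add: add_pos_nonneg)
  have \<rho>: "\<rho> > 0" "\<rho> powr (2 - \<gamma>1) = 1 / (4 * (1 + m\<^sup>2))"
    using p \<gamma>1 by (auto simp: \<rho>_def energy_radius_def powr_powr)
  define B where "B = 4 * \<rho> powr (2 - \<gamma>1) * K + \<rho> powr (- \<gamma>1) * m\<^sup>2"
  have B0: "B \<ge> 0" using K by (simp add: B_def)
  have hb: "cmod (riesz_conv \<gamma>1 (bessel 1 f) (bessel 1 f) x) \<le> B" for x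
  proof -
    have "ennreal (cmod (riesz_conv \<gamma>1 (bessel 1 f) (bessel 1 f) x)) \<le> (\<integral>\<^sup>+y. ennreal (riesz \<gamma>1 x y * (cmod (rep_L2 (bessel 1 f) y))\<^sup>2) \<partial>lborel)"
      unfolding riesz_conv_def by (rule order.trans[OF norm_integral_le_nn_integral]) (simp add: norm_mult power2_eq_square)
    also have "\<dots> \<le> ennreal B"
      unfolding B_def K_def m_def by (rule nn_integral_riesz[OF \<gamma>1 N \<rho>(1)])
    finally show ?thesis using B0 by simp
  qed
  have P1: "trilinear \<gamma>1 (bessel 1 f) (bessel 1 f) (bessel 1 f) \<bullet> bessel 1 f \<le> B * m\<^sup>2"
  proof -
    have "trilinear \<gamma>1 (bessel 1 f) (bessel 1 f) (bessel 1 f) \<bullet> bessel 1 f \<le> norm (trilinear \<gamma>1 (bessel 1 f) (bessel 1 f) (bessel 1 f)) * norm (bessel 1 f)"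
      by (rule norm_cauchy_schwarz)
    also have "\<dots> \<le> (B * norm (bessel 1 f)) * norm (bessel 1 f)"
      unfolding trilinear_def by (intro mult_right_mono norm_pmult_le bounded_multiplier_riesz_conv[OF \<gamma>1 N] hb) simp
    finally show ?thesis by (simp add: m_def power2_eq_square)
  qed
  have P2: "0 \<le> trilinear \<gamma>2 (bessel 1 f) (bessel 1 f) (bessel 1 f) \<bullet> bessel 1 f"
    unfolding inner_trilinear_eq(1)[OF \<gamma>2 N] by (intro Bochner_Integration.integral_nonneg) simp
  have "e \<ge> 1/2 * K - 1/4 * (B * m\<^sup>2)"
    unfolding e_def energy_bessel[OF \<gamma>1 \<gamma>2 N] K_def[symmetric] using P1 P2 by linarith
  moreover have "B * m\<^sup>2 \<le> K + \<rho> powr (- \<gamma>1) * m ^ 4"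
  proof -
    have "B * m\<^sup>2 = K * (m\<^sup>2 / (1 + m\<^sup>2)) + \<rho> powr (- \<gamma>1) * m ^ 4"
    proof -
      have "4 * \<rho> powr (2 - \<gamma>1) = 1 / (1 + m\<^sup>2)" unfolding \<rho>(2) by (simp only: times_divide_eq_right mult_divide_mult_cancel_left_if) simp
      then show ?thesis by (simp add: B_def distrib_right power2_eq_square power4_eq_xxxx)
    qed
    moreover have "m\<^sup>2 / (1 + m\<^sup>2) \<le> 1" by (simp add: add_pos_nonneg)
    then have "K * (m\<^sup>2 / (1 + m\<^sup>2)) \<le> K" using mult_left_le[OF _ K] by blast
    ultimately show ?thesis by linarith
  qed
  ultimately have "K \<le> 4 * e + \<rho> powr (- \<gamma>1) * m ^ 4" by linarith
  moreover have "(norm f)\<^sup>2 = m\<^sup>2 + K" unfolding m_def K_def by (rule norm_eq_kinetic)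
  ultimately have "(norm f)\<^sup>2 \<le> \<bar>m\<^sup>2 + 4 * e + \<rho> powr (- \<gamma>1) * m ^ 4\<bar>" by linarith
  then have "norm f \<le> sqrt \<bar>m\<^sup>2 + 4 * e + \<rho> powr (- \<gamma>1) * m ^ 4\<bar>" by (rule real_le_rsqrt)
  then show ?thesis by (simp add: sobolev_bound_def \<rho>_def m_def e_def)
qed

lemma hartree_flow_bound:
  fixes f :: "real \<Rightarrow> 'a L2"
  assumes "hartree_flow \<gamma>1 \<gamma>2 1 T f" "t \<in> {0..T}"
  shows "norm (f t) \<le> sobolev_bound \<gamma>1 (energy \<gamma>1 \<gamma>2 (bessel 1 (f 0))) (norm (bessel 1 (f 0)))"
  using norm_le_sobolev_bound[of "f t"] by (simp only: mass_conservation[OF assms] energy_conservation[OF assms])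

end

section \<open>Global existence\<close>

text \<open>The weight $e^{-\kappa t}$ makes the integral operator a contraction on the whole interval.\<close>

lemma picard_global:
  fixes \<Phi> :: "real \<Rightarrow> 'b::banach \<Rightarrow> 'b"
  assumes T: "0 \<le> T" and L: "0 \<le> L"
    and lip: "\<And>t x y. norm (\<Phi> t x - \<Phi> t y) \<le> L * norm (x - y)"
    and cont: "\<And>g. continuous_on {0..T} g \<Longrightarrow> continuous_on {0..T} (\<lambda>t. \<Phi> t (g t))"
  shows "\<exists>g. g 0 = x0 \<and> (\<forall>t\<in>{0..T}. (g has_vector_derivative \<Phi> t (g t)) (at t within {0..T}))"
proof -
  \<comment> \<open>Large enough for the contraction factor L / kappa to be at most 1/2, and
    positive even if L = 0.\<close>
  define \<kappa> where "\<kappa> = 2 * L + 1"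
  have \<kappa>: "0 < \<kappa>" "L / \<kappa> \<le> 1/2" using L by (auto simp: \<kappa>_def field_simps)
  \<comment> \<open>The unknown h is the damped curve exp (- kappa t) g(t), so the plain supremum
    norm of h is the weighted norm of g.\<close>
  define lift :: "(real \<Rightarrow>\<^sub>C 'b) \<Rightarrow> real \<Rightarrow> 'b" where "lift h r = exp (\<kappa> * r) *\<^sub>R h r" for h r
  define I where "I h t = x0 + integral {0..t} (\<lambda>r. \<Phi> r (lift h r))" for h t
  define F where "F h t = exp (- \<kappa> * t) *\<^sub>R I h t" for h t
  have c: "continuous_on {0..T} (\<lambda>r. \<Phi> r (lift h r))" for h
    unfolding lift_def by (intro cont continuous_intros continuous_on_apply_bcontfun)
  have int: "(\<lambda>r. \<Phi> r (lift h r)) integrable_on {0..t}" if "t \<in> {0..T}" for h t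
    using that by (intro integrable_continuous_real continuous_on_subset[OF c]) auto
  have dI: "(I h has_vector_derivative \<Phi> t (lift h t)) (at t within {0..T})" if "t \<in> {0..T}" for h t
    unfolding I_def using has_vector_derivative_add[OF has_vector_derivative_const integral_has_vector_derivative[OF c that]] by simp
  have cF: "continuous_on (cbox 0 T) (F h)" for h
  proof -
    have "continuous_on {0..T} (I h)"
      using dI has_vector_derivative_continuous unfolding continuous_on_eq_continuous_within by blast
    then show ?thesis unfolding F_def cbox_interval by (intro continuous_intros)
  qed
  \<comment> \<open>The fixed point is sought in the complete type of bounded continuous functions
    on the whole line; clamping the argument extends curves from the interval to it.\<close>
  have "\<exists>k :: real \<Rightarrow>\<^sub>C 'b. \<forall>t. k t = F h (clamp 0 T t)" for h
    using continuous_on_cbox_bcontfunE[OF cF[of h]] by metis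
  then obtain A :: "(real \<Rightarrow>\<^sub>C 'b) \<Rightarrow> (real \<Rightarrow>\<^sub>C 'b)" where A: "\<And>h t. A h t = F h (clamp 0 T t)"
    by metis
  have bound: "norm (F h t - F k t) \<le> 1/2 * dist h k" if t: "t \<in> {0..T}" for h k t
  proof -
    have e: "((\<lambda>r. exp (\<kappa> * r)) has_integral exp (\<kappa> * t) / \<kappa> - exp (\<kappa> * 0) / \<kappa>) {0..t}"
      using t \<kappa> by (intro fundamental_theorem_of_calculus)
        (auto intro!: derivative_eq_intros simp flip: has_real_derivative_iff_has_vector_derivative)
    have eI: "((\<lambda>r. L * dist h k * exp (\<kappa> * r)) has_integral L * dist h k * (exp (\<kappa> * t) / \<kappa> - exp (\<kappa> * 0) / \<kappa>)) {0..t}"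
      by (intro has_integral_mult_right e)
    have "norm (I h t - I k t) = norm (integral {0..t} (\<lambda>r. \<Phi> r (lift h r) - \<Phi> r (lift k r)))"
      using t by (simp add: I_def Henstock_Kurzweil_Integration.integral_diff int)
    also have "\<dots> \<le> integral {0..t} (\<lambda>r. L * dist h k * exp (\<kappa> * r))"
    proof (rule Henstock_Kurzweil_Integration.integral_norm_bound_integral)
      show "(\<lambda>r. \<Phi> r (lift h r) - \<Phi> r (lift k r)) integrable_on {0..t}"
        using t by (intro Henstock_Kurzweil_Integration.integrable_diff int)
      show "(\<lambda>r. L * dist h k * exp (\<kappa> * r)) integrable_on {0..t}" using eI by blast
      show "norm (\<Phi> r (lift h r) - \<Phi> r (lift k r)) \<le> L * dist h k * exp (\<kappa> * r)" for r
      proof -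
        have "norm (lift h r - lift k r) = exp (\<kappa> * r) * dist (h r) (k r)"
          by (simp add: lift_def dist_norm flip: scaleR_diff_right)
        also have "\<dots> \<le> exp (\<kappa> * r) * dist h k" by (intro mult_left_mono dist_bounded) simp
        finally have "L * norm (lift h r - lift k r) \<le> L * (exp (\<kappa> * r) * dist h k)"
          using L by (rule mult_left_mono)
        then show ?thesis using lip[of r "lift h r" "lift k r"] by (simp add: mult_ac)
      qed
    qed
    also have "\<dots> = L * dist h k * (exp (\<kappa> * t) / \<kappa> - exp (\<kappa> * 0) / \<kappa>)" using eI by blast
    also have "\<dots> \<le> L * dist h k * (exp (\<kappa> * t) / \<kappa>)"
      using L \<kappa> by (intro mult_left_mono) auto
    finally have "norm (I h t - I k t) \<le> L * dist h k * (exp (\<kappa> * t) / \<kappa>)" .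
    then have "exp (- \<kappa> * t) * norm (I h t - I k t) \<le> exp (- \<kappa> * t) * (L * dist h k * (exp (\<kappa> * t) / \<kappa>))"
      by (rule mult_left_mono) simp
    also have "\<dots> = L / \<kappa> * dist h k" by (simp add: exp_minus)
    also have "\<dots> \<le> 1/2 * dist h k" using \<kappa>(2) by (rule mult_right_mono) simp
    finally show ?thesis by (simp add: F_def flip: scaleR_diff_right)
  qed
  have cl: "clamp 0 T t \<in> {0..T}" for t
    using clamp_in_interval[of 0 T t] T by simp
  have "dist (A h) (A k) \<le> 1/2 * dist h k" for h k
    by (rule dist_bound) (unfold A dist_norm[of "F _ _"], rule bound[OF cl])
  then have "\<exists>!h. A h = h" by (intro banach_fix_type[of "1/2"]) auto
  then obtain h where h: "A h = h" by auto
  have u: "lift h t = I h t" if t: "t \<in> {0..T}" for t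
  proof -
    have "h t = F h t" using A[of h t] clamp_cancel_cbox[of t 0 T] t by (simp add: h)
    then show ?thesis by (simp add: lift_def F_def flip: exp_add)
  qed
  have "(I h has_vector_derivative \<Phi> t (I h t)) (at t within {0..T})" if t: "t \<in> {0..T}" for t
    using dI[OF t, of h] u[OF t] by simp
  moreover have "I h 0 = x0" by (simp add: I_def)
  ultimately show ?thesis by blast
qed

section \<open>Radial truncation\<close>

definition radial_truncation :: "real \<Rightarrow> 'b::real_normed_vector \<Rightarrow> 'b" where
  "radial_truncation R x = (R / max R (norm x)) *\<^sub>R x"

lemma radial_truncation_id: "0 < R \<Longrightarrow> norm x \<le> R \<Longrightarrow> radial_truncation R x = x"
  by (simp add: radial_truncation_def max_absorb1)

lemma norm_radial_truncation: "0 < R \<Longrightarrow> norm (radial_truncation R x) \<le> R"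
  by (auto simp: radial_truncation_def max_def)

text \<open>The change of the scaling factor is split off and controlled by the difference of the
  norms. Each of the two pieces costs one times the distance, which gives the constant 2 in any
  normed space.\<close>

lemma radial_truncation_lipschitz:
  assumes R: "0 < R"
  shows "norm (radial_truncation R x - radial_truncation R y) \<le> 2 * norm (x - y)"
proof -
  define a where "a = max R (norm x)"
  define b where "b = max R (norm y)"
  have a: "R \<le> a" "0 < a" and b: "norm y \<le> b" "0 < b" using R by (auto simp: a_def b_def)
  have "\<bar>R / a - R / b\<bar> * norm y = \<bar>b - a\<bar> * ((R / a) * (norm y / b))"
    using a b R by (simp add: divide_simps abs_mult abs_divide flip: right_diff_distrib)
  also have "\<dots> \<le> \<bar>b - a\<bar> * (1 * 1)"
    using a b R by (intro mult_left_mono mult_mono) auto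
  also have "\<dots> \<le> \<bar>norm x - norm y\<bar>" by (auto simp: a_def b_def max_def)
  also have "\<dots> \<le> norm (x - y)" by (rule norm_triangle_ineq3)
  finally have 1: "\<bar>R / a - R / b\<bar> * norm y \<le> norm (x - y)" .
  have "radial_truncation R x - radial_truncation R y = (R / a) *\<^sub>R (x - y) + (R / a - R / b) *\<^sub>R y"
    by (simp add: radial_truncation_def a_def b_def algebra_simps)
  then have "norm (radial_truncation R x - radial_truncation R y) \<le> norm ((R / a) *\<^sub>R (x - y)) + norm ((R / a - R / b) *\<^sub>R y)"
    by (simp only: norm_triangle_ineq)
  also have "\<dots> = R / a * norm (x - y) + \<bar>R / a - R / b\<bar> * norm y" using R a by simp
  also have "R / a * norm (x - y) \<le> 1 * norm (x - y)" using R a by (intro mult_right_mono) auto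
  finally show ?thesis using 1 by linarith
qed

lemma continuous_on_radial_truncation:
  assumes "0 < R" "continuous_on S f"
  shows "continuous_on S (\<lambda>t. radial_truncation R (f t))"
  unfolding radial_truncation_def using assms by (intro continuous_intros) auto

context
  fixes \<gamma>1 \<gamma>2 :: real
  assumes \<gamma>1: "0 < \<gamma>1" "\<gamma>1 < 2" and \<gamma>2: "0 < \<gamma>2" "\<gamma>2 < 2" and N: "3 \<le> DIM('a::euclidean_space)"
begin

lemma hartree_flow_lower:
  fixes f :: "real \<Rightarrow> 'a L2"
  assumes s: "1 \<le> s" and f: "hartree_flow \<gamma>1 \<gamma>2 s T f"
  shows "hartree_flow \<gamma>1 \<gamma>2 1 T (\<lambda>t. bessel (s - 1) (f t))"
  unfolding hartree_flow_def
proof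
  fix t assume t: "t \<in> {0..T}"
  have "((\<lambda>t. bessel (s - 1) (propagator (- t) (f t))) has_vector_derivative
      bessel (s - 1) (- cscale_L2 \<i> (propagator (- t) (nonlinear_lift \<gamma>1 \<gamma>2 s (f t))))) (at t within {0..T})"
    using f t s unfolding hartree_flow_def
    by (intro bounded_linear.has_vector_derivative[OF bounded_linear_fmult]) auto
  then show "((\<lambda>t. propagator (- t) (bessel (s - 1) (f t))) has_vector_derivative
      - cscale_L2 \<i> (propagator (- t) (nonlinear_lift \<gamma>1 \<gamma>2 1 (bessel (s - 1) (f t))))) (at t within {0..T})"
    using s by (simp add: propagator_commute_bessel nonlinear_lift_bessel_lower[OF \<gamma>1 \<gamma>2 N s] fmult_cscale
        linear_neg[OF bounded_linear.linear[OF bounded_linear_fmult]])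
qed

text \<open>T is fixed first, so the cut-off radius may depend on it. The a priori bound holds for
  true flows, not for the truncated equation; a first time of reaching the radius avoids the
  circularity.\<close>

lemma hartree_flow_exists:
  fixes f0 :: "'a L2"
  assumes s: "1 \<le> s" and T: "0 \<le> T"
  shows "\<exists>f. hartree_flow \<gamma>1 \<gamma>2 s T f \<and> f 0 = f0"
proof -
  define M where "M = sobolev_bound \<gamma>1 (energy \<gamma>1 \<gamma>2 (bessel s f0)) (norm (bessel s f0))"
  define K where "K = 24 * 9 powr (s / 2) * M\<^sup>2"
  \<comment> \<open>One more than the Gronwall bound on {0..T}, so that reaching R is a
    contradiction.\<close>
  define R where "R = norm f0 * exp (K * T) + 1"
  have K: "0 \<le> K" by (simp add: K_def)
  have R: "0 < R" by (simp add: R_def add_nonneg_pos)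
  define \<Phi> :: "real \<Rightarrow> 'a L2 \<Rightarrow> 'a L2"
    where "\<Phi> t g = - cscale_L2 \<i> (propagator (- t) (nonlinear_lift \<gamma>1 \<gamma>2 s (radial_truncation R (propagator t g))))" for t g
  define L where "L = 72 * 9 powr (s / 2) * R\<^sup>2 * 2"
  have "\<exists>g. g 0 = f0 \<and> (\<forall>t\<in>{0..T}. (g has_vector_derivative \<Phi> t (g t)) (at t within {0..T}))"
  proof (rule picard_global[OF T, of L])
    show "0 \<le> L" by (simp add: L_def)
    show "norm (\<Phi> t x - \<Phi> t y) \<le> L * norm (x - y)" for t x y
    proof -
      let ?r = "\<lambda>x. radial_truncation R (propagator t x)"
      have "\<Phi> t x - \<Phi> t y = - cscale_L2 \<i> (propagator (- t) (nonlinear_lift \<gamma>1 \<gamma>2 s (?r x) - nonlinear_lift \<gamma>1 \<gamma>2 s (?r y)))"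
        by (simp add: \<Phi>_def cscale_L2_diff linear_diff[OF bounded_linear.linear[OF bounded_linear_propagator]])
      then have "norm (\<Phi> t x - \<Phi> t y) = norm (nonlinear_lift \<gamma>1 \<gamma>2 s (?r x) - nonlinear_lift \<gamma>1 \<gamma>2 s (?r y))" by simp
      also have "\<dots> \<le> 72 * 9 powr (s / 2) * R\<^sup>2 * norm (?r x - ?r y)"
        by (intro nonlinear_lift_lipschitz[OF \<gamma>1 \<gamma>2 N s] norm_radial_truncation R)
      also have "\<dots> \<le> 72 * 9 powr (s / 2) * R\<^sup>2 * (2 * norm (propagator t x - propagator t y))"
        by (intro mult_left_mono radial_truncation_lipschitz R) simp
      also have "norm (propagator t x - propagator t y) = norm (x - y)"
        by (simp flip: linear_diff[OF bounded_linear.linear[OF bounded_linear_propagator]])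
      finally show ?thesis by (simp add: L_def)
    qed
    show "continuous_on {0..T} (\<lambda>t. \<Phi> t (g t))" if g: "continuous_on {0..T} g" for g
    proof -
      have "continuous_on {0..T} (\<lambda>t. nonlinear_lift \<gamma>1 \<gamma>2 s (radial_truncation R (propagator (1 * t) (g t))))"
        using continuous_on_radial_truncation[OF R continuous_on_propagator[OF g, of 1]]
        unfolding continuous_on_def by (intro ballI tendsto_nonlinear_lift[OF \<gamma>1 \<gamma>2 N s]) auto
      from continuous_on_propagator[OF this, of "-1"]
      show ?thesis unfolding \<Phi>_def
        by (intro continuous_on_minus bounded_linear.continuous_on[OF bounded_linear_cscale_L2]) simp
    qed
  qed
  then obtain g where g0: "g 0 = f0"
    and g: "\<And>t. t \<in> {0..T} \<Longrightarrow> (g has_vector_derivative \<Phi> t (g t)) (at t within {0..T})" by blast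
  define f where "f t = propagator t (g t)" for t
  have gf: "propagator (- t) (f t) = g t" and nf: "norm (f t) = norm (g t)" for t
    by (simp_all add: f_def propagator_propagator)
  have f0: "f 0 = f0" by (simp add: f_def g0)
  have flow: "hartree_flow \<gamma>1 \<gamma>2 s T' f" if T': "T' \<le> T" and b: "\<And>t. t \<in> {0..T'} \<Longrightarrow> norm (f t) \<le> R" for T'
    unfolding hartree_flow_def gf
  proof
    fix t assume t: "t \<in> {0..T'}"
    then have "(g has_vector_derivative \<Phi> t (g t)) (at t within {0..T'})"
      using T' by (intro has_vector_derivative_within_subset[OF g]) auto
    then show "(g has_vector_derivative - cscale_L2 \<i> (propagator (- t) (nonlinear_lift \<gamma>1 \<gamma>2 s (f t)))) (at t within {0..T'})"
      using radial_truncation_id[OF R b[OF t]] by (simp add: \<Phi>_def flip: f_def)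
  qed
  have cg: "continuous_on {0..T} g"
    using g has_vector_derivative_continuous unfolding continuous_on_eq_continuous_within by blast
  have bound: "norm (f t) < R" if t: "t \<in> {0..T}" for t
  proof (rule ccontr)
    assume nb: "\<not> norm (f t) < R"
    \<comment> \<open>Compactness gives a first time t1 at which the radius is reached; before it
      the equation is the original one.\<close>
    define S where "S = {t \<in> {0..T}. R \<le> norm (g t)}"
    have "closed S" unfolding S_def
      by (intro continuous_on_closed_Collect_le continuous_on_const continuous_on_norm cg closed_atLeastAtMost)
    moreover have "bounded S" by (rule bounded_subset[of "{0..T}"]) (auto simp: S_def)
    ultimately have "compact S" by (simp add: compact_eq_bounded_closed)
    moreover have "t \<in> S" using t nb by (simp add: S_def nf)
    ultimately obtain t1 where t1: "t1 \<in> S" and first: "\<And>t. t \<in> S \<Longrightarrow> t1 \<le> t"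
      using compact_attains_inf[of S] by blast
    have t1T: "0 \<le> t1" "t1 \<le> T" "R \<le> norm (g t1)" using t1 by (auto simp: S_def)
    have small: "norm (f r) \<le> R" if "0 \<le> r" "r < t1" for r
      using first[of r] that t1T by (fastforce simp: S_def nf)
    \<comment> \<open>Gronwall's argument in monotone form. Derivatives are taken at interior times
      r < t1, where the H^1 bound M comes from the true flow on {0..r}.\<close>
    define \<phi> where "\<phi> r = exp (- (2 * K) * r) * (g r \<bullet> g r)" for r
    have "\<phi> t1 \<le> \<phi> 0"
    proof (rule DERIV_nonpos_imp_decreasing_open[OF t1T(1)])
      show "continuous_on {0..t1} \<phi>" unfolding \<phi>_def
        using t1T by (intro continuous_intros continuous_on_subset[OF cg]) auto
      fix r assume r: "0 < r" "r < t1"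
      have fl: "hartree_flow \<gamma>1 \<gamma>2 s r f" using r t1T by (intro flow small) auto
      have "norm (bessel (s - 1) (f r)) \<le> M"
        using hartree_flow_bound[OF \<gamma>1 \<gamma>2 N hartree_flow_lower[OF s fl], of r] r
        by (simp add: M_def f0 flip: bessel_split[OF \<gamma>1 N s])
      then have "norm (nonlinear_lift \<gamma>1 \<gamma>2 s (f r)) \<le> K * norm (f r)" unfolding K_def
        by (intro order.trans[OF norm_nonlinear_lift_tame[OF \<gamma>1 \<gamma>2 N s]] mult_right_mono mult_left_mono power_mono) auto
      then have n: "norm (\<Phi> r (g r)) \<le> K * norm (g r)"
        using radial_truncation_id[OF R small[of r]] r by (simp add: \<Phi>_def nf flip: f_def)
      have "(g has_vector_derivative \<Phi> r (g r)) (at r)"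
        using g[of r] r t1T at_within_Icc_at[of 0 r T] by simp
      from bounded_bilinear.has_vector_derivative[OF bounded_bilinear_inner this this]
      have d: "((\<lambda>r. g r \<bullet> g r) has_real_derivative 2 * (g r \<bullet> \<Phi> r (g r))) (at r)"
        by (simp add: has_real_derivative_iff_has_vector_derivative inner_commute)
      have "(\<phi> has_real_derivative exp (- (2 * K) * r) * (2 * (g r \<bullet> \<Phi> r (g r)) - 2 * K * (g r \<bullet> g r))) (at r)"
        unfolding \<phi>_def
        using DERIV_mult[OF DERIV_fun_exp[OF DERIV_cmult_Id[of "- (2 * K)"]] d] by (simp add: algebra_simps)
      moreover have "2 * (g r \<bullet> \<Phi> r (g r)) - 2 * K * (g r \<bullet> g r) \<le> 0" if "g r \<bullet> \<Phi> r (g r) \<le> K * (g r \<bullet> g r)" using that by simp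
      moreover have "g r \<bullet> \<Phi> r (g r) \<le> K * (g r \<bullet> g r)"
      proof -
        have "g r \<bullet> \<Phi> r (g r) \<le> norm (g r) * norm (\<Phi> r (g r))" by (rule norm_cauchy_schwarz)
        also have "\<dots> \<le> norm (g r) * (K * norm (g r))" by (intro mult_left_mono n) simp
        finally show ?thesis by (simp add: power2_norm_eq_inner[symmetric] power2_eq_square mult_ac)
      qed
      ultimately show "\<exists>y. DERIV \<phi> r :> y \<and> y \<le> 0"
        using mult_nonneg_nonpos[OF exp_ge_zero] by blast
    qed
    then have "exp (- (2 * K) * t1) * (norm (g t1))\<^sup>2 \<le> (norm f0)\<^sup>2"
      by (simp add: \<phi>_def g0 power2_norm_eq_inner)
    then have "exp (2 * K * t1) * (exp (- (2 * K) * t1) * (norm (g t1))\<^sup>2) \<le> exp (2 * K * t1) * (norm f0)\<^sup>2"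
      by (rule mult_left_mono) simp
    then have "(norm (g t1))\<^sup>2 \<le> (norm f0 * exp (K * t1))\<^sup>2"
      by (simp add: power_mult_distrib exp_minus mult_ac flip: exp_of_nat_mult)
    then have "norm (g t1) \<le> norm f0 * exp (K * t1)" by (rule power2_le_imp_le) simp
    also have "\<dots> \<le> norm f0 * exp (K * T)" using K t1T by (intro mult_left_mono) (auto intro: mult_left_mono)
    finally show False using t1T(3) by (simp add: R_def)
  qed
  then have "hartree_flow \<gamma>1 \<gamma>2 s T f" by (intro flow) (auto intro: less_imp_le)
  then show ?thesis using f0 by blast
qed

section \<open>From the flow to Duhamel's formula and back\<close>

lemma solution_on_hartree_flow:
  fixes f :: "real \<Rightarrow> 'a L2"
  assumes s: "1 \<le> s" and f: "hartree_flow \<gamma>1 \<gamma>2 s T f"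
  shows "solution_on s \<gamma>1 \<gamma>2 (bessel s (f 0)) {0..T} (\<lambda>t. bessel s (f t))"
  unfolding solution_on_def
proof (intro conjI ballI)
  fix t assume t: "t \<in> {0..T}"
  have s0: "0 \<le> s" using s by simp
  show "bessel s (f t) \<in> sobolev s" using s0 by (rule sobolev_bessel)
  have "((\<lambda>t'. norm (f t' - f t)) \<longlongrightarrow> 0) (at t within {0..T})"
    using hartree_flow_continuous[OF \<gamma>1 \<gamma>2 N f] t by (simp add: continuous_on_def tendsto_norm_zero_iff LIM_zero_iff)
  then show "((\<lambda>t'. sobolev_norm s (bessel s (f t') - bessel s (f t))) \<longlongrightarrow> 0) (at t within {0..T})"
    using s0 by (simp add: sobolev_bessel flip: fmult_diff)
  \<comment> \<open>Applying i J_s U(t) to the integrated flow equation gives Duhamel's formula for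
    J_s f: the factor - i in the integrand cancels, and U(t) U(-r) = U(t - r).\<close>
  define \<Lambda> :: "'a L2 \<Rightarrow> 'a L2" where "\<Lambda> u = cscale_L2 \<i> (bessel s (propagator t u))" for u
  have bl: "bounded_linear \<Lambda>" unfolding \<Lambda>_def
    using s0 by (intro bounded_linear_compose[OF bounded_linear_cscale_L2] bounded_linear_compose[OF bounded_linear_fmult]
        bounded_linear_propagator) simp
  have "((\<lambda>r. - cscale_L2 \<i> (propagator (- r) (nonlinear_lift \<gamma>1 \<gamma>2 s (f r)))) has_integral propagator (- t) (f t) - propagator (- 0) (f 0)) {0..t}"
  proof (rule fundamental_theorem_of_calculus)
    show "((\<lambda>r. propagator (- r) (f r)) has_vector_derivative - cscale_L2 \<i> (propagator (- r) (nonlinear_lift \<gamma>1 \<gamma>2 s (f r)))) (at r within {0..t})"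
      if "r \<in> {0..t}" for r
      using f that t unfolding hartree_flow_def
      by (intro has_vector_derivative_within_subset[where S="{0..T}" and T="{0..t}", rotated]) auto
  qed (use t in auto)
  from has_integral_linear[OF this bl]
  have "((\<lambda>r. \<Lambda> (- cscale_L2 \<i> (propagator (- r) (nonlinear_lift \<gamma>1 \<gamma>2 s (f r))))) has_integral \<Lambda> (propagator (- t) (f t) - f 0)) {0..t}"
    by (simp add: o_def)
  moreover have "\<Lambda> (- cscale_L2 \<i> (propagator (- r) (nonlinear_lift \<gamma>1 \<gamma>2 s (f r)))) = propagator (t - r) (nonlinearity \<gamma>1 \<gamma>2 (bessel s (f r)))" for r
    using s0 by (simp add: \<Lambda>_def nonlinearity_bessel[OF \<gamma>1 \<gamma>2 N s] propagator_commute_bessel propagator_cscale fmult_cscale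
        linear_neg[OF bounded_linear.linear[OF bounded_linear_propagator]]
        linear_neg[OF bounded_linear.linear[OF bounded_linear_fmult]]
        linear_neg[OF bounded_linear.linear[OF bounded_linear_cscale_L2]]
        cscale_L2_cscale cscale_L2_minus cscale_L2_one propagator_propagator)
  moreover have "\<Lambda> (propagator (- t) (f t) - f 0) = cscale_L2 \<i> (bessel s (f t) - propagator t (bessel s (f 0)))"
    using s0 by (simp add: \<Lambda>_def propagator_commute_bessel fmult_diff propagator_propagator
        linear_diff[OF bounded_linear.linear[OF bounded_linear_propagator]])
  ultimately have i: "((\<lambda>r. propagator (t - r) (nonlinearity \<gamma>1 \<gamma>2 (bessel s (f r)))) has_integral
      cscale_L2 \<i> (bessel s (f t) - propagator t (bessel s (f 0)))) {0..t}"
    by simp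
  then show "(\<lambda>r. propagator (t - r) (nonlinearity \<gamma>1 \<gamma>2 (bessel s (f r)))) integrable_on {0..t}" by blast
  show "bessel s (f t) = propagator t (bessel s (f 0))
      - cscale_L2 \<i> (integral {0..t} (\<lambda>r. propagator (t - r) (nonlinearity \<gamma>1 \<gamma>2 (bessel s (f r)))))"
    unfolding integral_unique[OF i] by (simp add: cscale_L2_cscale cscale_L2_minus cscale_L2_one)
qed

text \<open>Once J_1 is divided out, the integrand of Duhamel's formula is continuous in the
  interaction picture, so the integral is differentiable and the formula turns back into the
  differential equation. The flow is produced at the level s = 1, where the H^1 bound is
  proved.\<close>

lemma hartree_flow_of_solution:
  fixes \<psi> :: "real \<Rightarrow> 'a L2"
  assumes s: "1 \<le> s" and \<psi>: "solution_on s \<gamma>1 \<gamma>2 \<psi>0 J \<psi>" and J: "{0..T} \<subseteq> J" and T: "0 \<le> T"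
  shows "\<exists>f. hartree_flow \<gamma>1 \<gamma>2 1 T f \<and> (\<forall>t\<in>{0..T}. \<psi> t = bessel 1 (f t)) \<and> \<psi> 0 = \<psi>0"
proof -
  have s0: "0 \<le> s" using s by simp
  have "\<forall>t\<in>J. \<exists>h. \<psi> t = bessel s h"
    using \<psi> s0 unfolding solution_on_def by (metis sobolevE)
  then obtain h where h: "\<And>t. t \<in> J \<Longrightarrow> \<psi> t = bessel s (h t)" by metis
  define f where "f t = bessel (s - 1) (h t)" for t
  have \<psi>f: "\<psi> t = bessel 1 (f t)" if "t \<in> {0..T}" for t
    using h[of t] that J by (auto simp: f_def bessel_split[OF \<gamma>1 N s])
  have "continuous_on {0..T} h" unfolding continuous_on_def
  proof
    fix t assume t: "t \<in> {0..T}"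
    have "((\<lambda>t'. sobolev_norm s (\<psi> t' - \<psi> t)) \<longlongrightarrow> 0) (at t within {0..T})"
      using \<psi> t J unfolding solution_on_def by (blast intro: tendsto_within_subset)
    moreover have "\<forall>\<^sub>F t' in at t within {0..T}. sobolev_norm s (\<psi> t' - \<psi> t) = norm (h t' - h t)"
      unfolding eventually_at_filter using t J s0
      by (intro always_eventually) (auto simp: h subset_iff sobolev_bessel simp flip: fmult_diff)
    ultimately have "((\<lambda>t'. norm (h t' - h t)) \<longlongrightarrow> 0) (at t within {0..T})"
      by (rule Lim_transform_eventually)
    then show "(h \<longlongrightarrow> h t) (at t within {0..T})" by (simp add: tendsto_norm_zero_iff LIM_zero_iff)
  qed
  then have cf: "continuous_on {0..T} f"
    unfolding f_def using s by (intro bounded_linear.continuous_on[OF bounded_linear_fmult]) auto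
  define G where "G r = propagator (- r) (nonlinear_lift \<gamma>1 \<gamma>2 1 (f r))" for r
  have cG: "continuous_on {0..T} G"
  proof -
    have "continuous_on {0..T} (\<lambda>r. nonlinear_lift \<gamma>1 \<gamma>2 1 (f r))"
      using cf unfolding continuous_on_def by (auto intro: tendsto_nonlinear_lift[OF \<gamma>1 \<gamma>2 N order.refl])
    from continuous_on_propagator[OF this, of "-1"] show ?thesis by (simp add: G_def)
  qed
  have duhamel: "bessel 1 (f t) = propagator t \<psi>0 - bessel 1 (propagator t (cscale_L2 \<i> (integral {0..t} G)))" if t: "t \<in> {0..T}" for t
  proof -
    have bl: "bounded_linear (\<lambda>u::'a L2. bessel 1 (propagator t u))"
      by (intro bounded_linear_compose[OF bounded_linear_fmult] bounded_linear_propagator) simp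
    have "integral {0..t} (\<lambda>r. propagator (t - r) (nonlinearity \<gamma>1 \<gamma>2 (\<psi> r))) = integral {0..t} ((\<lambda>u. bessel 1 (propagator t u)) \<circ> G)"
    proof (rule Henstock_Kurzweil_Integration.integral_cong)
      fix r assume "r \<in> {0..t}"
      then have "\<psi> r = bessel 1 (f r)" using t by (intro \<psi>f) auto
      then show "propagator (t - r) (nonlinearity \<gamma>1 \<gamma>2 (\<psi> r)) = ((\<lambda>u. bessel 1 (propagator t u)) \<circ> G) r"
        by (simp add: G_def nonlinearity_bessel[OF \<gamma>1 \<gamma>2 N] propagator_commute_bessel propagator_propagator)
    qed
    also have "\<dots> = bessel 1 (propagator t (integral {0..t} G))"
      using t by (intro integral_linear[OF _ bl] integrable_continuous_real continuous_on_subset[OF cG]) auto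
    finally have "integral {0..t} (\<lambda>r. propagator (t - r) (nonlinearity \<gamma>1 \<gamma>2 (\<psi> r))) = bessel 1 (propagator t (integral {0..t} G))" .
    moreover have "\<psi> t = propagator t \<psi>0 - cscale_L2 \<i> (integral {0..t} (\<lambda>r. propagator (t - r) (nonlinearity \<gamma>1 \<gamma>2 (\<psi> r))))"
      using \<psi> t J unfolding solution_on_def by blast
    ultimately show ?thesis using \<psi>f[OF t] by (simp add: propagator_cscale fmult_cscale)
  qed
  \<comment> \<open>The initial condition is Duhamel's formula at time 0.\<close>
  have \<psi>0: "\<psi>0 = bessel 1 (f 0)"
    using duhamel[of 0] T by (simp add: linear_0[OF bounded_linear.linear[OF bounded_linear_cscale_L2]]
        linear_0[OF bounded_linear.linear[OF bounded_linear_fmult]])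
  have g: "propagator (- t) (f t) = f 0 - cscale_L2 \<i> (integral {0..t} G)" if t: "t \<in> {0..T}" for t
  proof -
    have "bessel 1 (f t) = bessel 1 (propagator t (f 0 - cscale_L2 \<i> (integral {0..t} G)))"
      using duhamel[OF t] by (simp add: \<psi>0 propagator_commute_bessel fmult_diff
          linear_diff[OF bounded_linear.linear[OF bounded_linear_propagator]])
    then have "f t = propagator t (f 0 - cscale_L2 \<i> (integral {0..t} G))" by (simp add: bessel_inject)
    then show ?thesis by (simp add: propagator_propagator)
  qed
  have "hartree_flow \<gamma>1 \<gamma>2 1 T f" unfolding hartree_flow_def
  proof
    fix t assume t: "t \<in> {0..T}"
    have "((\<lambda>t. f 0 - cscale_L2 \<i> (integral {0..t} G)) has_vector_derivative 0 - cscale_L2 \<i> (G t)) (at t within {0..T})"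
      by (intro has_vector_derivative_diff has_vector_derivative_const bounded_linear.has_vector_derivative[OF bounded_linear_cscale_L2]
          integral_has_vector_derivative[OF cG t])
    then have "((\<lambda>t. propagator (- t) (f t)) has_vector_derivative 0 - cscale_L2 \<i> (G t)) (at t within {0..T})"
      by (rule has_vector_derivative_transform[OF t g, rotated])
    then show "((\<lambda>t. propagator (- t) (f t)) has_vector_derivative - cscale_L2 \<i> (propagator (- t) (nonlinear_lift \<gamma>1 \<gamma>2 1 (f t)))) (at t within {0..T})"
      by (simp add: G_def)
  qed
  then show ?thesis using \<psi>f \<psi>0 T by auto
qed

end

theorem theorem1p7:
  fixes \<gamma>1 \<gamma>2 :: real
  assumes "3 \<le> CARD('n::finite)"
    and "0 < \<gamma>2" and "\<gamma>2 < \<gamma>1" and "\<gamma>1 < 2"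
  shows "\<exists>C0 :: real \<Rightarrow> real \<Rightarrow> real.
    (\<forall>e m. 0 < C0 e m) \<and>
    (\<forall>s\<ge>1. \<forall>\<psi>0 \<in> (sobolev s :: (real ^ 'n) L2 set).
      max_existence_time s \<gamma>1 \<gamma>2 \<psi>0 = \<infinity> \<and>
      (\<forall>\<psi>. maximal_solution s \<gamma>1 \<gamma>2 \<psi>0 \<psi> \<longrightarrow>
        (\<forall>t\<ge>0. sobolev_norm 1 (\<psi> t) \<le> C0 (energy \<gamma>1 \<gamma>2 \<psi>0) (norm \<psi>0))))"
proof (intro exI[of _ "sobolev_bound \<gamma>1"] conjI allI impI ballI)
  have \<gamma>1: "0 < \<gamma>1" "\<gamma>1 < 2" and \<gamma>2: "0 < \<gamma>2" "\<gamma>2 < 2" using assms by auto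
  have N: "3 \<le> DIM(real ^ 'n)" using assms(1) by simp
  show "0 < sobolev_bound \<gamma>1 e m" for e m
    by (simp add: sobolev_bound_def add_nonneg_pos)
  fix s :: real and \<psi>0 :: "(real ^ 'n) L2"
  assume s: "1 \<le> s" and \<psi>0: "\<psi>0 \<in> sobolev s"
  obtain f0 where f0: "\<psi>0 = bessel s f0" using sobolevE[OF \<psi>0] s by auto
  have T: "ereal T \<le> max_existence_time s \<gamma>1 \<gamma>2 \<psi>0" if T: "0 < T" for T
  proof -
    obtain f where "hartree_flow \<gamma>1 \<gamma>2 s T f" "f 0 = f0"
      using hartree_flow_exists[OF \<gamma>1 \<gamma>2 N s, of T f0] T by auto
    then have "solution_on s \<gamma>1 \<gamma>2 \<psi>0 {0..T} (\<lambda>t. bessel s (f t))"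
      using solution_on_hartree_flow[OF \<gamma>1 \<gamma>2 N s, of T f] by (simp add: f0)
    then show ?thesis unfolding max_existence_time_def using T by (intro Sup_upper) auto
  qed
  show inf: "max_existence_time s \<gamma>1 \<gamma>2 \<psi>0 = \<infinity>"
  proof (rule ereal_top)
    \<comment> \<open>The time \<open>max B 1\<close> is positive and at least the arbitrary real
      B.\<close>
    show "ereal B \<le> max_existence_time s \<gamma>1 \<gamma>2 \<psi>0" for B
      using T[of "max B 1"] by (rule order.trans[rotated]) auto
  qed
  fix \<psi> and t :: real
  assume "maximal_solution s \<gamma>1 \<gamma>2 \<psi>0 \<psi>" and t: "0 \<le> t"
  \<comment> \<open>The maximal interval is the half line, so the solution can be restricted to
    {0..t} for the given t.\<close>
  then have "solution_on s \<gamma>1 \<gamma>2 \<psi>0 {t. 0 \<le> t} \<psi>" by (simp add: maximal_solution_def inf)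
  then obtain f where f: "hartree_flow \<gamma>1 \<gamma>2 1 t f" "\<And>r. r \<in> {0..t} \<Longrightarrow> \<psi> r = bessel 1 (f r)" "\<psi> 0 = \<psi>0"
    using hartree_flow_of_solution[OF \<gamma>1 \<gamma>2 N s _ _ t, of \<psi>0 "{t. 0 \<le> t}" \<psi>] by (fastforce simp: subset_iff)
  then have "norm (f t) \<le> sobolev_bound \<gamma>1 (energy \<gamma>1 \<gamma>2 \<psi>0) (norm \<psi>0)"
    using hartree_flow_bound[OF \<gamma>1 \<gamma>2 N f(1), of t] f(2)[of 0] t by simp
  then show "sobolev_norm 1 (\<psi> t) \<le> sobolev_bound \<gamma>1 (energy \<gamma>1 \<gamma>2 \<psi>0) (norm \<psi>0)"
    using f(2)[of t] t by (simp add: sobolev_bessel)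
qed

end
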